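(* There is a dense set of real-valued limit-periodic sequences $V$ (dense in the space of all limit-periodic sequences on $\mathbb{Z}$ with the $\ell^\infty$ metric) such that for all $p>0$ and all values of the coupling constant $\lambda>0$, the discrete Schrödinger operator $\Delta+\lambda V$ on $\ell^2(\mathbb{Z})$ satisfies $\beta^-_{\delta_0}(p)=0$.
   Context: A sequence $V:\mathbb{Z}\to\mathbb{R}$ is limit-periodic if it is a limit in $\ell^\infty(\mathbb{Z})$ of periodic sequences. $\Delta$ is the discrete Laplacian, $(\Delta u)(n)=u(n+1)+u(n-1)$, and $V$ acts by multiplication. With $(|X|^pu)(n)=|n|^pu(n)$, $H=\Delta+\lambda V$ and $\psi(t)=e^{-itH}\psi$, $\beta^-_\psi(p)=\liminf_{t\to\infty}\frac{\log\langle\psi(t),|X|^p\psi(t)\rangle}{p\log t}$; here $\psi=\delta_0$ is the standard basis vector at $0$. *)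

theory Defs
  imports "HOL-Analysis.Analysis" "HOL-Real_Asymp.Real_Asymp"
begin

section \<open>The Hilbert space of square-summable sequences\<close>

typedef ell2 = "{u :: int \<Rightarrow> complex. (\<lambda>n. (cmod (u n))\<^sup>2) summable_on UNIV}"
  morphisms apply_ell2 Abs_ell2
  by (rule exI[of _ "\<lambda>_. 0"]) simp

setup_lifting type_definition_ell2

declare [[coercion apply_ell2]]

lemma ell2_eqI: "(\<And>n. apply_ell2 u n = apply_ell2 v n) \<Longrightarrow> u = v"
  by transfer auto

lemma square_summable_add:
  fixes u v :: "int \<Rightarrow> complex"
  assumes "(\<lambda>n. (cmod (u n))\<^sup>2) summable_on UNIV" "(\<lambda>n. (cmod (v n))\<^sup>2) summable_on UNIV"
  shows "(\<lambda>n. (cmod (u n + v n))\<^sup>2) summable_on UNIV"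
proof (rule summable_on_comparison_test)
  show "(\<lambda>n. 2 * ((cmod (u n))\<^sup>2 + (cmod (v n))\<^sup>2)) summable_on UNIV"
    by (intro summable_on_cmult_right summable_on_add assms)
  fix n
  have "(cmod (u n + v n))\<^sup>2 \<le> (cmod (u n) + cmod (v n))\<^sup>2"
    by (intro power_mono norm_triangle_ineq) auto
  also have "\<dots> \<le> 2 * ((cmod (u n))\<^sup>2 + (cmod (v n))\<^sup>2)"
    using sum_squares_bound[of "cmod (u n)" "cmod (v n)"] by (simp add: power2_sum)
  finally show "(cmod (u n + v n))\<^sup>2 \<le> 2 * ((cmod (u n))\<^sup>2 + (cmod (v n))\<^sup>2)" .
qed auto

lemma square_summable_mult:
  fixes u :: "int \<Rightarrow> complex"
  assumes u: "(\<lambda>n. (cmod (u n))\<^sup>2) summable_on UNIV" and c: "\<And>n. cmod (c n) \<le> C"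
  shows "(\<lambda>n. (cmod (c n * u n))\<^sup>2) summable_on UNIV"
proof (rule summable_on_comparison_test)
  show "(\<lambda>n. C\<^sup>2 * (cmod (u n))\<^sup>2) summable_on UNIV"
    by (intro summable_on_cmult_right u)
  fix n
  show "(cmod (c n * u n))\<^sup>2 \<le> C\<^sup>2 * (cmod (u n))\<^sup>2"
    using c[of n] by (simp add: norm_mult power_mult_distrib mult_right_mono power_mono)
qed auto

lemma ell2_summable: "(\<lambda>n. (cmod (apply_ell2 u n))\<^sup>2) summable_on UNIV"
  by transfer simp

instantiation ell2 :: real_vector
begin

lift_definition zero_ell2 :: ell2 is "\<lambda>_. 0" by simp

lift_definition plus_ell2 :: "ell2 \<Rightarrow> ell2 \<Rightarrow> ell2" is "\<lambda>u v n. u n + v n"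
  by (auto intro: square_summable_add)

lift_definition uminus_ell2 :: "ell2 \<Rightarrow> ell2" is "\<lambda>u n. - u n" by simp

lift_definition minus_ell2 :: "ell2 \<Rightarrow> ell2 \<Rightarrow> ell2" is "\<lambda>u v n. u n - v n"
  using square_summable_add[where v = "\<lambda>n. - v n" for v] by auto

lift_definition scaleR_ell2 :: "real \<Rightarrow> ell2 \<Rightarrow> ell2" is "\<lambda>r u n. r *\<^sub>R u n"
  by (auto simp: power_mult_distrib intro!: summable_on_cmult_right)

instance
  by standard (transfer; auto simp: algebra_simps)+

end

lemma apply_ell2_simps [simp]:
  "apply_ell2 0 n = 0"
  "apply_ell2 (u + v) n = apply_ell2 u n + apply_ell2 v n"
  "apply_ell2 (- u) n = - apply_ell2 u n"
  "apply_ell2 (u - v) n = apply_ell2 u n - apply_ell2 v n"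
  "apply_ell2 (r *\<^sub>R u) n = r *\<^sub>R apply_ell2 u n"
  by (transfer, simp)+

lemma ell2_inner_summable: "(\<lambda>n. apply_ell2 u n \<bullet> apply_ell2 v n) summable_on UNIV"
proof -
  have "(\<lambda>n. (cmod (apply_ell2 (u + v) n))\<^sup>2 + - (cmod (apply_ell2 u n))\<^sup>2
          + - (cmod (apply_ell2 v n))\<^sup>2) summable_on UNIV"
    by (intro summable_on_add summable_on_uminus[THEN iffD2] ell2_summable)
  then have "(\<lambda>n. (1/2) * ((cmod (apply_ell2 (u + v) n))\<^sup>2 + - (cmod (apply_ell2 u n))\<^sup>2
          + - (cmod (apply_ell2 v n))\<^sup>2)) summable_on UNIV"
    by (rule summable_on_cmult_right)
  then show ?thesis
    by (rule summable_on_cong[THEN iffD1, rotated])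
       (simp add: power2_norm_eq_inner inner_add inner_commute)
qed

text \<open>The real inner product is the real part of the usual Hermitian one; it induces the
  usual \<open>\<ell>\<^sup>2\<close> norm.\<close>

instantiation ell2 :: real_inner
begin

definition inner_ell2 :: "ell2 \<Rightarrow> ell2 \<Rightarrow> real" where
  "inner_ell2 u v = (\<Sum>\<^sub>\<infinity>n. apply_ell2 u n \<bullet> apply_ell2 v n)"

definition norm_ell2 :: "ell2 \<Rightarrow> real" where
  "norm_ell2 u = sqrt (\<Sum>\<^sub>\<infinity>n. (cmod (apply_ell2 u n))\<^sup>2)"

definition sgn_ell2 :: "ell2 \<Rightarrow> ell2" where "sgn_ell2 u = u /\<^sub>R norm u"

definition dist_ell2 :: "ell2 \<Rightarrow> ell2 \<Rightarrow> real" where "dist_ell2 u v = norm (u - v)"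

definition uniformity_ell2 :: "(ell2 \<times> ell2) filter" where
  "uniformity_ell2 = (INF e\<in>{0 <..}. principal {(x, y). dist x y < e})"

definition open_ell2 :: "ell2 set \<Rightarrow> bool" where
  "open_ell2 S = (\<forall>x\<in>S. \<forall>\<^sub>F (x', y) in uniformity. x' = x \<longrightarrow> y \<in> S)"

instance
proof
  fix x y z :: ell2 and r :: real
  show "x \<bullet> y = y \<bullet> x" by (simp add: inner_ell2_def inner_commute)
  show "(x + y) \<bullet> z = x \<bullet> z + y \<bullet> z"
    by (simp add: inner_ell2_def inner_add_left infsum_add ell2_inner_summable)
  show "r *\<^sub>R x \<bullet> y = r * (x \<bullet> y)"
    by (simp add: inner_ell2_def infsum_cmult_right ell2_inner_summable)
  show "0 \<le> x \<bullet> x" by (simp add: inner_ell2_def infsum_nonneg)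
  show "x \<bullet> x = 0 \<longleftrightarrow> x = 0"
  proof
    assume "x \<bullet> x = 0"
    then have "apply_ell2 x n \<bullet> apply_ell2 x n = 0" for n
      by (intro nonneg_infsum_le_0D[OF _ ell2_inner_summable[of x x]]) (auto simp: inner_ell2_def)
    then show "x = 0" by (auto intro!: ell2_eqI)
  qed (simp add: inner_ell2_def)
  show "norm x = sqrt (x \<bullet> x)" by (simp add: norm_ell2_def inner_ell2_def power2_norm_eq_inner)
qed (rule sgn_ell2_def dist_ell2_def uniformity_ell2_def open_ell2_def)+

end

lemma norm_ell2_power2: "(norm u)\<^sup>2 = (\<Sum>\<^sub>\<infinity>n. (cmod (apply_ell2 u n))\<^sup>2)"
  by (simp add: norm_ell2_def infsum_nonneg)

lemma sum_le_norm_ell2: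
  "finite F \<Longrightarrow> (\<Sum>n\<in>F. (cmod (apply_ell2 u n))\<^sup>2) \<le> (norm u)\<^sup>2"
  unfolding norm_ell2_power2 by (intro finite_sum_le_infsum ell2_summable) auto

lemma cmod_le_norm_ell2: "cmod (apply_ell2 u n) \<le> norm u"
proof (rule power2_le_imp_le)
  show "(cmod (apply_ell2 u n))\<^sup>2 \<le> (norm u)\<^sup>2"
    using sum_le_norm_ell2[of "{n}" u] by simp
qed simp

lemma norm_ell2_le:
  assumes "\<And>F. finite F \<Longrightarrow> (\<Sum>n\<in>F. (cmod (apply_ell2 u n))\<^sup>2) \<le> B\<^sup>2" "0 \<le> B"
  shows "norm u \<le> B"
proof (rule power2_le_imp_le)
  show "(norm u)\<^sup>2 \<le> B\<^sup>2"
    unfolding norm_ell2_power2 by (intro infsum_le_finite_sums ell2_summable assms)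
qed fact

text \<open>Completeness makes every absolutely convergent series of bounded operators converge.\<close>

instance ell2 :: banach
proof
  fix X :: "nat \<Rightarrow> ell2"
  assume X: "Cauchy X"
  have "Cauchy (\<lambda>m. apply_ell2 (X m) n)" for n
  proof (rule metric_CauchyI)
    fix e :: real assume "e > 0"
    then obtain M where M: "\<forall>m\<ge>M. \<forall>k\<ge>M. dist (X m) (X k) < e"
      using metric_CauchyD[OF X] by blast
    have "dist (apply_ell2 (X m) n) (apply_ell2 (X k) n) \<le> dist (X m) (X k)" for m k
      using cmod_le_norm_ell2[of "X m - X k" n] by (simp add: dist_norm)
    with M show "\<exists>M. \<forall>m\<ge>M. \<forall>k\<ge>M. dist (apply_ell2 (X m) n) (apply_ell2 (X k) n) < e"
      by (meson le_less_trans)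
  qed
  then have "\<forall>n. \<exists>l. (\<lambda>m. apply_ell2 (X m) n) \<longlonglongrightarrow> l"
    by (simp add: Cauchy_convergent_iff convergent_def)
  then obtain u where u: "\<And>n. (\<lambda>m. apply_ell2 (X m) n) \<longlonglongrightarrow> u n"
    by metis
  have tail: "(\<Sum>n\<in>F. (cmod (apply_ell2 (X m) n - u n))\<^sup>2) \<le> e\<^sup>2"
    if M: "\<forall>m\<ge>M. \<forall>k\<ge>M. dist (X m) (X k) < e" and "M \<le> m" "finite F" for e m M F
  proof (rule tendsto_upperbound)
    show "(\<lambda>k. \<Sum>n\<in>F. (cmod (apply_ell2 (X m) n - apply_ell2 (X k) n))\<^sup>2)
            \<longlonglongrightarrow> (\<Sum>n\<in>F. (cmod (apply_ell2 (X m) n - u n))\<^sup>2)"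
      by (intro tendsto_intros u)
    show "\<forall>\<^sub>F k in sequentially. (\<Sum>n\<in>F. (cmod (apply_ell2 (X m) n - apply_ell2 (X k) n))\<^sup>2) \<le> e\<^sup>2"
      using eventually_ge_at_top[of M]
    proof eventually_elim
      case (elim k)
      have "(\<Sum>n\<in>F. (cmod (apply_ell2 (X m - X k) n))\<^sup>2) \<le> (norm (X m - X k))\<^sup>2"
        by (rule sum_le_norm_ell2) fact
      also have "\<dots> \<le> e\<^sup>2"
        using M elim \<open>M \<le> m\<close> by (intro power_mono) (auto simp: dist_norm less_imp_le)
      finally show ?case by simp
    qed
  qed simp
  obtain M1 where M1: "\<forall>m\<ge>M1. \<forall>k\<ge>M1. dist (X m) (X k) < 1"
    using metric_CauchyD[OF X zero_less_one] by blast
  have "(\<lambda>n. (cmod (apply_ell2 (X M1) n - u n))\<^sup>2) summable_on UNIV"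
  proof (rule nonneg_bdd_above_summable_on)
    show "bdd_above (sum (\<lambda>n. (cmod (apply_ell2 (X M1) n - u n))\<^sup>2) ` {F. F \<subseteq> UNIV \<and> finite F})"
      using tail[OF M1 order_refl] by (intro bdd_aboveI[of _ "1\<^sup>2"]) blast
  qed simp
  then have "(\<lambda>n. (cmod (apply_ell2 (X M1) n + - (apply_ell2 (X M1) n - u n)))\<^sup>2) summable_on UNIV"
    by (intro square_summable_add ell2_summable) (simp only: norm_minus_cancel)
  then have "(\<lambda>n. (cmod (u n))\<^sup>2) summable_on UNIV" by simp
  then have U: "apply_ell2 (Abs_ell2 u) = u" by (intro Abs_ell2_inverse) simp
  have "X \<longlonglongrightarrow> Abs_ell2 u"
  proof (rule metric_LIMSEQ_I)
    fix e :: real assume e: "e > 0"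
    then obtain M where M: "\<forall>m\<ge>M. \<forall>k\<ge>M. dist (X m) (X k) < e / 2"
      using metric_CauchyD[OF X half_gt_zero[OF e]] by blast
    have "norm (X m - Abs_ell2 u) \<le> e / 2" if "m \<ge> M" for m
    proof (rule norm_ell2_le)
      fix F :: "int set" assume "finite F"
      from tail[OF M that this]
      show "(\<Sum>n\<in>F. (cmod (apply_ell2 (X m - Abs_ell2 u) n))\<^sup>2) \<le> (e / 2)\<^sup>2"
        by (simp only: apply_ell2_simps U)
    qed (use e in simp)
    moreover have "e / 2 < e" using e by simp
    ultimately show "\<exists>M. \<forall>m\<ge>M. dist (X m) (Abs_ell2 u) < e"
      unfolding dist_norm by (meson le_less_trans)
  qed
  then show "convergent X" by (auto simp: convergent_def)
qed

lemma square_summable_delta: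
  "(\<lambda>n. (cmod (if n = m then 1 else 0))\<^sup>2) summable_on (UNIV :: int set)"
proof -
  have "(\<lambda>n. (cmod (if n = m then 1 else 0))\<^sup>2) summable_on {m}" by simp
  then show ?thesis
    by (rule summable_on_cong_neutral[THEN iffD1, rotated -1]) auto
qed

lift_definition ell2_delta :: "int \<Rightarrow> ell2" is "\<lambda>m n. if n = m then 1 else 0"
  by (simp only: mem_Collect_eq square_summable_delta)

section \<open>Bounded operators\<close>

lift_definition ell2_shift :: "int \<Rightarrow> ell2 \<Rightarrow> ell2" is "\<lambda>k u n. u (n + k)"
  using summable_on_reindex_bij_betw[OF bij_plus_right, of "\<lambda>n. (cmod (u n))\<^sup>2" for u] by auto

lemma norm_ell2_shift: "norm (ell2_shift k u) = norm u"
  unfolding norm_ell2_def ell2_shift.rep_eq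
  using infsum_reindex_bij_betw[of "\<lambda>n. n + k" UNIV UNIV "\<lambda>n. (cmod (apply_ell2 u n))\<^sup>2"]
  by (simp add: bij_plus_right)

lift_definition laplacian :: "ell2 \<Rightarrow>\<^sub>L ell2" is "\<lambda>u. ell2_shift 1 u + ell2_shift (-1) u"
proof (rule bounded_linear_intro[where K = 2])
  fix x y :: ell2 and r :: real
  show "ell2_shift 1 (x + y) + ell2_shift (-1) (x + y)
    = ell2_shift 1 x + ell2_shift (-1) x + (ell2_shift 1 y + ell2_shift (-1) y)"
    by (rule ell2_eqI) (simp add: ell2_shift.rep_eq)
  show "ell2_shift 1 (r *\<^sub>R x) + ell2_shift (-1) (r *\<^sub>R x)
    = r *\<^sub>R (ell2_shift 1 x + ell2_shift (-1) x)"
    by (rule ell2_eqI) (simp add: ell2_shift.rep_eq algebra_simps)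
  show "norm (ell2_shift 1 x + ell2_shift (-1) x) \<le> norm x * 2"
    using norm_triangle_ineq[of "ell2_shift 1 x" "ell2_shift (-1) x"] by (simp add: norm_ell2_shift)
qed

setup_lifting type_definition_bcontfun

lift_definition ell2_mult :: "(int \<Rightarrow>\<^sub>C complex) \<Rightarrow> ell2 \<Rightarrow> ell2" is "\<lambda>f u n. f n * u n"
  by (auto simp: bcontfun_def bounded_iff intro: square_summable_mult)

lemma norm_ell2_mult: "norm (ell2_mult f u) \<le> norm u * norm f"
proof (rule norm_ell2_le)
  fix F :: "int set" assume F: "finite F"
  have "(\<Sum>n\<in>F. (cmod (apply_ell2 (ell2_mult f u) n))\<^sup>2)
      \<le> (\<Sum>n\<in>F. (norm f)\<^sup>2 * (cmod (apply_ell2 u n))\<^sup>2)"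
    by (intro sum_mono)
       (auto simp: ell2_mult.rep_eq norm_mult power_mult_distrib norm_bounded
             intro!: mult_right_mono power_mono)
  also have "\<dots> \<le> (norm f)\<^sup>2 * (norm u)\<^sup>2"
    using sum_le_norm_ell2[OF F, of u] by (simp add: sum_distrib_left[symmetric] mult_left_mono)
  finally show "(\<Sum>n\<in>F. (cmod (apply_ell2 (ell2_mult f u) n))\<^sup>2) \<le> (norm u * norm f)\<^sup>2"
    by (simp add: power_mult_distrib mult.commute)
qed simp

lift_definition mult_op :: "(int \<Rightarrow>\<^sub>C complex) \<Rightarrow> ell2 \<Rightarrow>\<^sub>L ell2" is ell2_mult
  by (rule bounded_linear_intro[OF _ _ norm_ell2_mult])
     (auto intro!: ell2_eqI simp: ell2_mult.rep_eq algebra_simps)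

text \<open>On the discrete space \<open>\<int>\<close>, the type \<open>int \<Rightarrow>\<^sub>C real\<close> of bounded continuous functions is
  \<open>\<ell>\<^sup>\<infinity>(\<int>)\<close> with the supremum metric.\<close>

lift_definition complexify :: "(int \<Rightarrow>\<^sub>C real) \<Rightarrow> (int \<Rightarrow>\<^sub>C complex)" is "\<lambda>V n. complex_of_real (V n)"
  by (auto simp: bcontfun_def bounded_iff)

definition schrodinger :: "real \<Rightarrow> (int \<Rightarrow>\<^sub>C real) \<Rightarrow> ell2 \<Rightarrow>\<^sub>L ell2" where
  "schrodinger c V = laplacian + c *\<^sub>R mult_op (complexify V)"

lemma apply_schrodinger:
  "apply_ell2 (blinfun_apply (schrodinger c V) u) n
    = apply_ell2 u (n + 1) + apply_ell2 u (n - 1)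
      + complex_of_real (c * apply_bcontfun V n) * apply_ell2 u n"
  by (simp add: schrodinger_def laplacian.rep_eq mult_op.rep_eq ell2_shift.rep_eq ell2_mult.rep_eq
    complexify.rep_eq blinfun.add_left blinfun.scaleR_left scaleR_conv_of_real)

definition cscale_op :: "complex \<Rightarrow> ell2 \<Rightarrow>\<^sub>L ell2" where
  "cscale_op c = mult_op (const_bcontfun c)"

lemma apply_cscale_op [simp]:
  "apply_ell2 (blinfun_apply (cscale_op c) u) n = c * apply_ell2 u n"
  by (simp add: cscale_op_def mult_op.rep_eq ell2_mult.rep_eq const_bcontfun.rep_eq)

text \<open>The exponential of a bounded operator; \<open>ell2 \<Rightarrow>\<^sub>L ell2\<close> is not an instance of the class for
  which the library's \<open>exp\<close> is defined.\<close>

definition exp_op :: "(ell2 \<Rightarrow>\<^sub>L ell2) \<Rightarrow> (ell2 \<Rightarrow>\<^sub>L ell2)" where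
  "exp_op A = (\<Sum>k. ((\<lambda>B. A o\<^sub>L B) ^^ k) id_blinfun /\<^sub>R fact k)"

lemma norm_compose_power_le:
  fixes A :: "ell2 \<Rightarrow>\<^sub>L ell2"
  shows "norm (((\<lambda>B. A o\<^sub>L B) ^^ k) id_blinfun) \<le> norm A ^ k"
proof (induction k)
  case 0
  show ?case by (simp add: norm_blinfun_id_le)
next
  case (Suc k)
  then show ?case
    using norm_blinfun_compose[of A "((\<lambda>B. A o\<^sub>L B) ^^ k) id_blinfun"]
    by simp (meson mult_left_mono norm_ge_zero order_trans)
qed

lemma summable_exp_op:
  fixes A :: "ell2 \<Rightarrow>\<^sub>L ell2"
  shows "summable (\<lambda>k. ((\<lambda>B. A o\<^sub>L B) ^^ k) id_blinfun /\<^sub>R fact k)"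
proof (rule summable_comparison_test)
  show "summable (\<lambda>k. norm A ^ k /\<^sub>R fact k)"
    using summable_exp_generic[of "norm A"] by simp
  show "\<exists>N. \<forall>k\<ge>N. norm (((\<lambda>B. A o\<^sub>L B) ^^ k) id_blinfun /\<^sub>R fact k) \<le> norm A ^ k /\<^sub>R fact k"
    by (auto simp: norm_compose_power_le intro!: mult_left_mono)
qed

definition evolution :: "(ell2 \<Rightarrow>\<^sub>L ell2) \<Rightarrow> real \<Rightarrow> ell2 \<Rightarrow> ell2" where
  "evolution H t \<psi> = blinfun_apply (exp_op (cscale_op (- \<i> * complex_of_real t) o\<^sub>L H)) \<psi>"

section \<open>Moments and transport exponents\<close>

text \<open>The quadratic form \<open>\<langle>\<psi>, |X|\<^sup>p \<psi>\<rangle>\<close>. It is meaningful only where the series converges (an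
  unsummable \<open>infsum\<close> is \<open>0\<close>); lemma \<open>summable_position_moment\<close> below shows that this is
  always so for \<open>\<psi> = e\<^sup>-\<^sup>i\<^sup>t\<^sup>H\<delta>\<^sub>0\<close>.\<close>

definition position_moment :: "real \<Rightarrow> ell2 \<Rightarrow> real" where
  "position_moment p \<psi> = (\<Sum>\<^sub>\<infinity>n. \<bar>real_of_int n\<bar> powr p * (cmod (apply_ell2 \<psi> n))\<^sup>2)"

lemma evolution_delta_support:
  fixes A :: "ell2 \<Rightarrow>\<^sub>L ell2"
  assumes A: "A = cscale_op z o\<^sub>L schrodinger c V" and "k < nat \<bar>n\<bar>"
  shows "apply_ell2 (blinfun_apply (((\<lambda>B. A o\<^sub>L B) ^^ k) id_blinfun) (ell2_delta 0)) n = 0"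
  using assms(2)
proof (induction k arbitrary: n)
  case 0
  then show ?case by (simp add: ell2_delta.rep_eq)
next
  case (Suc k)
  then have "k < nat \<bar>n\<bar>" "k < nat \<bar>n + 1\<bar>" "k < nat \<bar>n - 1\<bar>" by linarith+
  then show ?case by (simp add: A apply_schrodinger Suc.IH[unfolded A])
qed

lemma evolution_delta_decay:
  "\<exists>C. \<forall>n. cmod (apply_ell2 (evolution (schrodinger c V) t (ell2_delta 0)) n) \<le> C * exp (- \<bar>real_of_int n\<bar>)"
proof -
  define A where "A = cscale_op (- \<i> * complex_of_real t) o\<^sub>L schrodinger c V"
  define P where "P k = ((\<lambda>B. A o\<^sub>L B) ^^ k) id_blinfun" for k
  define \<delta> where "\<delta> = ell2_delta 0"
  define a where "a n k = apply_ell2 (blinfun_apply (P k /\<^sub>R fact k) \<delta>) n" for n k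
  define b where "b k = norm \<delta> * ((norm A * exp 1) ^ k /\<^sub>R fact k)" for k
  have b: "summable b"
    unfolding b_def by (intro summable_mult summable_exp_generic)
  have ev: "bounded_linear (\<lambda>B::ell2 \<Rightarrow>\<^sub>L ell2. apply_ell2 (blinfun_apply B \<delta>) n)" for n
  proof (rule bounded_linear_compose[OF _ blinfun.bounded_linear_left])
    show "bounded_linear (\<lambda>u. apply_ell2 u n)"
      by (rule bounded_linear_intro[where K = 1]) (auto simp: cmod_le_norm_ell2)
  qed
  have le: "cmod (a n k) \<le> exp (- \<bar>real_of_int n\<bar>) * b k" for n k
  proof (cases "k < nat \<bar>n\<bar>")
    case True
    then show ?thesis
      using evolution_delta_support[OF A_def True]
      by (simp add: a_def P_def \<delta>_def b_def blinfun.scaleR_left)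
  next
    case False
    have "cmod (a n k) \<le> norm (blinfun_apply (P k) \<delta>) / fact k"
      using cmod_le_norm_ell2[of "blinfun_apply (P k) \<delta>" n]
      by (simp add: a_def blinfun.scaleR_left divide_simps)
    also have "\<dots> \<le> norm A ^ k * norm \<delta> / fact k"
      using norm_blinfun[of "P k" \<delta>] norm_compose_power_le[of k A, folded P_def]
      by (intro divide_right_mono) (meson mult_right_mono norm_ge_zero order_trans, simp)
    also have "\<dots> \<le> (exp (real k - \<bar>real_of_int n\<bar>)) * (norm A ^ k * norm \<delta> / fact k)"
    proof -
      have "1 \<le> exp (real k - \<bar>real_of_int n\<bar>)" using False by simp
      then show ?thesis
        by (metis (no_types, lifting) mult_right_mono mult_1 divide_nonneg_nonneg fact_ge_zero
            mult_nonneg_nonneg norm_ge_zero zero_le_power)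
    qed
    also have "\<dots> = exp (- \<bar>real_of_int n\<bar>) * b k"
      by (simp add: b_def exp_diff exp_minus power_mult_distrib exp_of_nat_mult[symmetric] field_simps)
    finally show ?thesis .
  qed
  have "cmod (apply_ell2 (evolution (schrodinger c V) t \<delta>) n)
      \<le> suminf b * exp (- \<bar>real_of_int n\<bar>)" for n
  proof -
    have sum_b: "summable (\<lambda>k. exp (- \<bar>real_of_int n\<bar>) * b k)"
      by (intro summable_mult b)
    have "apply_ell2 (evolution (schrodinger c V) t \<delta>) n = (\<Sum>k. a n k)"
      unfolding evolution_def exp_op_def a_def P_def A_def[symmetric]
      by (rule bounded_linear.suminf[OF ev summable_exp_op])
    moreover have "summable (\<lambda>k. cmod (a n k))"
      by (rule summable_comparison_test'[OF sum_b]) (simp add: le)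
    ultimately have "cmod (apply_ell2 (evolution (schrodinger c V) t \<delta>) n) \<le> (\<Sum>k. cmod (a n k))"
      by (simp add: summable_norm)
    also have "\<dots> \<le> (\<Sum>k. exp (- \<bar>real_of_int n\<bar>) * b k)"
      by (intro suminf_le le sum_b) fact
    finally show ?thesis by (subst (asm) suminf_mult[OF b]) (simp only: mult.commute)
  qed
  then show ?thesis unfolding \<delta>_def by blast
qed

lemma summable_position_moment:
  assumes "p > 0"
  shows "(\<lambda>n. \<bar>real_of_int n\<bar> powr p *
     (cmod (apply_ell2 (evolution (schrodinger c V) t (ell2_delta 0)) n))\<^sup>2) summable_on UNIV"
proof -
  obtain C where C: "\<And>n. cmod (apply_ell2 (evolution (schrodinger c V) t (ell2_delta 0)) n)
      \<le> C * exp (- \<bar>real_of_int n\<bar>)"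
    using evolution_delta_decay by blast
  define g where "g n = C\<^sup>2 * (\<bar>real_of_int n\<bar> powr p * exp (- 2 * \<bar>real_of_int n\<bar>))" for n :: int
  have "summable (\<lambda>n::nat. real n powr p * exp (- 2 * real n))"
  proof (rule summable_comparison_test_bigo)
    show "summable (\<lambda>n. norm (exp (- 1 :: real) ^ n))" by (simp add: summable_geometric)
    show "(\<lambda>n::nat. real n powr p * exp (- 2 * real n)) \<in> O(\<lambda>n. exp (- 1 :: real) ^ n)"
      using assms by real_asymp
  qed
  then have nat: "(\<lambda>n::nat. real n powr p * exp (- 2 * real n)) summable_on UNIV"
    by (intro norm_summable_imp_summable_on) simp
  have "g summable_on (range int \<union> range (\<lambda>n. - int n))"
  proof (rule summable_on_union)
    show "g summable_on range int"
      unfolding g_def by (intro summable_on_cmult_right, subst summable_on_reindex)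
        (use nat in \<open>auto simp: o_def\<close>)
    show "g summable_on range (\<lambda>n. - int n)"
      unfolding g_def by (intro summable_on_cmult_right, subst summable_on_reindex)
        (use nat in \<open>auto simp: o_def inj_on_def\<close>)
  qed
  moreover have "range int \<union> range (\<lambda>n. - int n) = UNIV"
    by (auto simp: image_iff) (metis int_cases2)
  ultimately have g: "g summable_on UNIV" by simp
  show ?thesis
  proof (rule summable_on_comparison_test[OF g])
    fix n :: int
    have "(cmod (apply_ell2 (evolution (schrodinger c V) t (ell2_delta 0)) n))\<^sup>2
        \<le> (C * exp (- \<bar>real_of_int n\<bar>))\<^sup>2"
      by (intro power_mono C) simp
    also have "\<dots> = C\<^sup>2 * exp (- 2 * \<bar>real_of_int n\<bar>)"
      by (simp add: power_mult_distrib exp_double[symmetric])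
    finally show "\<bar>real_of_int n\<bar> powr p *
        (cmod (apply_ell2 (evolution (schrodinger c V) t (ell2_delta 0)) n))\<^sup>2 \<le> g n"
      unfolding g_def by (metis (no_types, lifting) mult.left_commute mult_left_mono powr_ge_zero)
  qed simp
qed

definition transport_exponent_minus :: "(ell2 \<Rightarrow>\<^sub>L ell2) \<Rightarrow> ell2 \<Rightarrow> real \<Rightarrow> ereal" where
  "transport_exponent_minus H \<psi> p =
     Liminf at_top (\<lambda>t::real. ereal (ln (position_moment p (evolution H t \<psi>)) / (p * ln t)))"

section \<open>Limit-periodic sequences\<close>

definition periodic_seq :: "(int \<Rightarrow>\<^sub>C real) \<Rightarrow> bool" where
  "periodic_seq V \<longleftrightarrow> (\<exists>q::int. q > 0 \<and> (\<forall>n. apply_bcontfun V (n + q) = apply_bcontfun V n))"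

definition limit_periodic :: "(int \<Rightarrow>\<^sub>C real) \<Rightarrow> bool" where
  "limit_periodic V \<longleftrightarrow> (\<exists>W :: nat \<Rightarrow> (int \<Rightarrow>\<^sub>C real). (\<forall>k. periodic_seq (W k)) \<and> W \<longlonglongrightarrow> V)"

end

theory Submission
  imports Defs "HOL-Analysis.Analysis" "HOL-Real_Asymp.Real_Asymp"
begin

text \<open>Near a periodic potential one adds, stage by stage, ever smaller periodic perturbations of two kinds.

  \<^item> For the upper bound on the exponent, gaps are opened at all energies of the (compact) spectral
  range by finitely many periodic perturbations, and these are installed on long consecutive blocks
  around the origin: whatever the energy, the particle must cross a gapped zone, so up to one
  huge time \<open>t\<close> it stays within \<open>t\<^bsup>1/k\<^esup>\<close>.

  \<^item> For the lower bound it suffices that \<open>e\<^bsup>-itH\<^esup>\<delta>\<^sub>0\<close> does not come back to within \<open>t\<^bsup>-\<epsilon>\<^esup>\<close>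
  of a multiple of \<open>\<delta>\<^sub>0\<close>. Wells with slightly different energies are planted at hierarchically
  growing distances; a function of \<open>H\<close> turns \<open>\<delta>\<^sub>0\<close> into states living forever in the \<open>i\<close>-th family of
  wells. Shifting the potential by \<open>x\<^sub>i\<close> on that family rotates the phase of such a state at its own
  speed, whereas a return forces all phases to agree. Hence for each time only a fraction
  \<open>O(t\<^bsup>-\<epsilon>N\<^esup>)\<close> of the parameters \<open>(x\<^sub>1,\<dots>,x\<^sub>N)\<close> returns, which is summable over a fine net of
  times and couplings once \<open>\<epsilon>N \<ge> 5\<close>. The parameters of one stage are fixed after those of the next
  have been introduced, so that the times between two consecutive thresholds involve only two blocks
  of free parameters.\<close>

section \<open>Unitary evolutions\<close>

text \<open>Confinement along one sequence of times only makes the lower limit at most 0. It could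
  still be negative: at a time of almost perfect return to the origin the moment is nearly 0. So
  return must be excluded at all large times and for all couplings at once, and the bad fraction of
  parameters has to beat the size of a net of times near \<open>s\<close> and couplings, about
  \<open>s\<^sup>3\<close>, by a summable factor. The time from which a block of parameters takes
  effect depends on the potentials to which it is added, so it comes late; until then the previous
  block must do the work under a perturbation not yet known. Hence all counting is uniform in a
  small perturbation \<open>Z\<close>, and the double count \<open>ex_good_choice\<close> fixes one
  block while keeping most values of the next. True eigenvectors are avoided: the forms live on
  infinite sets, where maxima need not be attained, and the potential changes again at every later
  stage. Near maximizers of the form and polynomials in \<open>H\<close> take their place; their
  estimates are stable under small perturbations.\<close>

typedef bop = "UNIV :: (ell2 \<Rightarrow>\<^sub>L ell2) set" morphisms of_bop to_bop by simp

setup_lifting type_definition_bop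

lemma norm_ell2_delta [simp]: "norm (ell2_delta m) = 1"
proof -
  have "(\<Sum>\<^sub>\<infinity>n. (cmod (apply_ell2 (ell2_delta m) n))\<^sup>2) = (\<Sum>\<^sub>\<infinity>n\<in>{m}. 1)"
    by (rule infsum_cong_neutral) (auto simp: ell2_delta.rep_eq)
  then show ?thesis by (simp add: norm_ell2_def)
qed

instantiation bop :: real_vector
begin
lift_definition zero_bop :: bop is 0 .
lift_definition plus_bop :: "bop \<Rightarrow> bop \<Rightarrow> bop" is "(+)" .
lift_definition minus_bop :: "bop \<Rightarrow> bop \<Rightarrow> bop" is "(-)" .
lift_definition uminus_bop :: "bop \<Rightarrow> bop" is uminus .
lift_definition scaleR_bop :: "real \<Rightarrow> bop \<Rightarrow> bop" is scaleR .
instance by standard (transfer; simp add: algebra_simps)+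
end

text \<open>With composition as product the bounded operators form a unital Banach algebra; on this
  copy of the type \<open>exp\<close> and its derivative rules are available, and
  \<open>exp_op_eq\<close> carries them back to \<open>exp_op\<close>.\<close>

instantiation bop :: real_normed_algebra_1
begin
lift_definition one_bop :: bop is id_blinfun .
lift_definition times_bop :: "bop \<Rightarrow> bop \<Rightarrow> bop" is "(o\<^sub>L)" .
lift_definition norm_bop :: "bop \<Rightarrow> real" is norm .
definition dist_bop :: "bop \<Rightarrow> bop \<Rightarrow> real" where "dist_bop x y = norm (x - y)"
definition sgn_bop :: "bop \<Rightarrow> bop" where "sgn_bop x = x /\<^sub>R norm x"
definition uniformity_bop :: "(bop \<times> bop) filter" where
  "uniformity_bop = (INF e\<in>{0 <..}. principal {(x, y). dist x y < e})"
definition open_bop :: "bop set \<Rightarrow> bool" where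
  "open_bop S = (\<forall>x\<in>S. \<forall>\<^sub>F (x', y) in uniformity. x' = x \<longrightarrow> y \<in> S)"
instance
proof
  have *: "norm (id_blinfun :: ell2 \<Rightarrow>\<^sub>L ell2) = 1"
  proof (rule antisym[OF norm_blinfun_id_le])
    show "1 \<le> norm (id_blinfun :: ell2 \<Rightarrow>\<^sub>L ell2)"
      using norm_blinfun[of "id_blinfun :: ell2 \<Rightarrow>\<^sub>L ell2" "ell2_delta 0"] by simp
  qed
  fix a b c :: bop and r s :: real
  show "norm (1::bop) = 1" by (simp add: norm_bop.rep_eq one_bop.rep_eq *)
  show "norm (a * b) \<le> norm a * norm b" by transfer (rule norm_blinfun_compose)
  show "norm (a + b) \<le> norm a + norm b" by transfer (rule norm_triangle_ineq)
  show "norm (r *\<^sub>R a) = \<bar>r\<bar> * norm a" by transfer simp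
  show "(norm a = 0) = (a = 0)" by transfer simp
  show "(0::bop) \<noteq> 1" using * by transfer auto
  show "(a + b) * c = a * c + b * c" "a * (b + c) = a * b + a * c" "a * b * c = a * (b * c)"
    by (transfer; auto simp: blinfun.bilinear_simps intro!: blinfun_eqI)+
  show "1 * a = a" "a * 1 = a"
    by (transfer; auto intro!: blinfun_eqI)+
  show "r *\<^sub>R a * b = r *\<^sub>R (a * b)" "a * r *\<^sub>R b = r *\<^sub>R (a * b)"
    by (transfer; auto simp: blinfun.bilinear_simps intro!: blinfun_eqI)+
qed (rule sgn_bop_def dist_bop_def uniformity_bop_def open_bop_def)+
end

instance bop :: banach
proof
  fix X :: "nat \<Rightarrow> bop" assume X: "Cauchy X"
  have d: "dist x y = dist (of_bop x) (of_bop y)" for x y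
    by (simp add: dist_bop_def dist_norm norm_bop.rep_eq minus_bop.rep_eq)
  have "Cauchy (\<lambda>n. of_bop (X n))" using X by (simp add: Cauchy_def d)
  then obtain L where "(\<lambda>n. of_bop (X n)) \<longlonglongrightarrow> L"
    using Cauchy_convergent_iff convergent_def by blast
  then have "X \<longlonglongrightarrow> to_bop L" by (simp add: tendsto_iff d to_bop_inverse)
  then show "convergent X" by (auto simp: convergent_def)
qed

lemma bounded_linear_of_bop: "bounded_linear of_bop"
  by (rule bounded_linear_intro[where K = 1])
     (simp_all add: plus_bop.rep_eq scaleR_bop.rep_eq norm_bop.rep_eq)

lemma to_bop_power: "of_bop (to_bop A ^ k) = ((\<lambda>B. A o\<^sub>L B) ^^ k) id_blinfun"
  by (induction k) (simp_all add: one_bop.rep_eq times_bop.rep_eq to_bop_inverse)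

lemma exp_op_eq: "exp_op A = of_bop (exp (to_bop A))"
proof -
  have "of_bop (exp (to_bop A)) = (\<Sum>k. of_bop (to_bop A ^ k /\<^sub>R fact k))"
    unfolding exp_def by (rule bounded_linear.suminf[OF bounded_linear_of_bop summable_exp_generic])
  then show ?thesis by (simp add: exp_op_def scaleR_bop.rep_eq to_bop_power)
qed

section \<open>Complex scalars and symmetric operators\<close>

lemma mult_op_apply [simp]:
  "apply_ell2 (mult_op f u) n = apply_bcontfun f n * apply_ell2 u n"
  by (simp add: mult_op.rep_eq ell2_mult.rep_eq)

lemma norm_cscale_op: "norm (cscale_op z u) = cmod z * norm u"
  by (simp add: norm_ell2_def norm_mult power_mult_distrib infsum_cmult_right' real_sqrt_mult)

lemma cscale_op_cscale_op: "cscale_op z (cscale_op w u) = cscale_op (z * w) u"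
  by (rule ell2_eqI) simp

lemma cscale_op_1 [simp]: "cscale_op 1 u = u"
  by (rule ell2_eqI) simp

lemma cscale_op_real: "cscale_op (of_real r) u = r *\<^sub>R u"
  by (rule ell2_eqI) (simp add: scaleR_conv_of_real)

lemma cscale_op_add: "cscale_op (z + w) u = cscale_op z u + cscale_op w u"
  by (rule ell2_eqI) (simp add: algebra_simps)

lemma inner_cscale_ii: "cscale_op \<i> u \<bullet> v = - (u \<bullet> cscale_op \<i> v)"
  by (simp add: inner_ell2_def infsum_uminus[symmetric] inner_complex_def algebra_simps)

text \<open>Operators are only real linear here and the inner product is the real part of the
  Hermitian one. Symmetry for the real form together with commutation with \<open>\<i>\<close>
  amounts to complex linearity and symmetry for the Hermitian form.\<close>

definition hermitian_op :: "(ell2 \<Rightarrow>\<^sub>L ell2) \<Rightarrow> bool" where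
  "hermitian_op H \<longleftrightarrow> (\<forall>u v. blinfun_apply H u \<bullet> v = u \<bullet> blinfun_apply H v)
     \<and> (\<forall>u. blinfun_apply H (cscale_op \<i> u) = cscale_op \<i> (blinfun_apply H u))"

lemma hermitian_op_sym: "hermitian_op H \<Longrightarrow> blinfun_apply H u \<bullet> v = u \<bullet> blinfun_apply H v"
  by (simp add: hermitian_op_def)

lemma commute_cscale_op:
  assumes "\<And>u. blinfun_apply T (cscale_op \<i> u) = cscale_op \<i> (blinfun_apply T u)"
  shows "blinfun_apply T (cscale_op z u) = cscale_op z (blinfun_apply T u)"
proof -
  have *: "cscale_op z v = Re z *\<^sub>R v + Im z *\<^sub>R cscale_op \<i> v" for v
    by (rule ell2_eqI) (simp add: complex_eq_iff)
  show ?thesis by (simp add: * blinfun.bilinear_simps assms)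
qed

lemma hermitian_op_cscale:
  "hermitian_op H \<Longrightarrow> blinfun_apply H (cscale_op z u) = cscale_op z (blinfun_apply H u)"
  by (rule commute_cscale_op) (simp add: hermitian_op_def)

section \<open>The unitary group and Duhamel's estimate\<close>

lemma evolution_eq:
  "evolution H t u = blinfun_apply (of_bop (exp (t *\<^sub>R to_bop (cscale_op (- \<i>) o\<^sub>L H)))) u"
proof -
  have "to_bop (cscale_op (- \<i> * of_real t) o\<^sub>L H) = t *\<^sub>R to_bop (cscale_op (- \<i>) o\<^sub>L H)"
    by (simp add: of_bop_inject[symmetric] scaleR_bop.rep_eq to_bop_inverse)
       (auto intro!: blinfun_eqI ell2_eqI simp: blinfun.scaleR_left scaleR_conv_of_real algebra_simps)
  then show ?thesis by (simp add: evolution_def exp_op_eq)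
qed

lemma evolution_0 [simp]: "evolution H 0 u = u"
  by (simp add: evolution_eq one_bop.rep_eq)

lemma evolution_plus: "evolution H (s + t) u = evolution H s (evolution H t u)"
  by (simp add: evolution_eq scaleR_left_distrib exp_add_commuting times_bop.rep_eq)

lemma evolution_inverse [simp]: "evolution H (- t) (evolution H t u) = u" "evolution H t (evolution H (- t) u) = u"
  by (simp_all add: evolution_plus[symmetric])

lemma bounded_linear_evolution: "bounded_linear (evolution H t)"
  unfolding evolution_eq[abs_def] by (rule blinfun.bounded_linear_right)

lemmas evolution_linear = bounded_linear.linear[OF bounded_linear_evolution]

lemma has_vector_derivative_evolution:
  "((\<lambda>t. evolution H t u) has_vector_derivative
     - cscale_op \<i> (blinfun_apply H (evolution H t u))) (at t within S)"
proof -
  define X where "X = to_bop (cscale_op (- \<i>) o\<^sub>L H)"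
  have "bounded_linear (\<lambda>B. blinfun_apply (of_bop B) u)"
    by (rule bounded_linear_compose[OF blinfun.bounded_linear_left bounded_linear_of_bop])
  from bounded_linear.has_vector_derivative[OF this has_vector_derivative_at_within[OF exp_scaleR_has_vector_derivative_left[of X t]]]
  have "((\<lambda>t. evolution H t u) has_vector_derivative blinfun_apply (of_bop (X * exp (t *\<^sub>R X))) u) (at t within S)"
    by (simp add: evolution_eq X_def)
  moreover have "blinfun_apply (of_bop (X * exp (t *\<^sub>R X))) u
      = - cscale_op \<i> (blinfun_apply H (evolution H t u))"
    by (rule ell2_eqI) (simp add: evolution_eq X_def times_bop.rep_eq to_bop_inverse)
  ultimately show ?thesis by simp
qed

text \<open>The squared norm has derivative twice the inner product of \<open>- \<i> H w\<close>
  with \<open>w\<close>, which is 0: \<open>H\<close> is symmetric and multiplication by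
  \<open>\<i>\<close> is skew.\<close>

lemma norm_evolution:
  assumes H: "hermitian_op H" shows "norm (evolution H t u) = norm u"
proof -
  have z: "cscale_op \<i> (blinfun_apply H w) \<bullet> w = 0" for w
    using hermitian_op_sym[OF H, of w "cscale_op \<i> w"] hermitian_op_cscale[OF H, of \<i> w]
      inner_cscale_ii[of "blinfun_apply H w" w] inner_commute[of w "cscale_op \<i> (blinfun_apply H w)"]
    by simp
  have "((\<lambda>t. evolution H t u \<bullet> evolution H t u) has_vector_derivative 0) (at t)" for t
  proof -
    have "((\<lambda>t. evolution H t u \<bullet> evolution H t u) has_derivative
       (\<lambda>h. evolution H t u \<bullet> (h *\<^sub>R - cscale_op \<i> (blinfun_apply H (evolution H t u)))
          + (h *\<^sub>R - cscale_op \<i> (blinfun_apply H (evolution H t u))) \<bullet> evolution H t u)) (at t)"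
      by (rule has_derivative_inner) (use has_vector_derivative_evolution in \<open>auto simp: has_vector_derivative_def\<close>)
    then show ?thesis by (simp add: has_vector_derivative_def z inner_commute[of "evolution H t u"])
  qed
  then have "evolution H t u \<bullet> evolution H t u = evolution H 0 u \<bullet> evolution H 0 u"
    using has_vector_derivative_zero_constant[of UNIV "\<lambda>t. evolution H t u \<bullet> evolution H t u"]
    by (metis (mono_tags, lifting) UNIV_I convex_UNIV)
  then show ?thesis by (simp add: norm_eq_sqrt_inner)
qed

text \<open>Every comparison of two evolutions goes through this estimate. Pulled back by the group
  at time \<open>- s\<close>, an approximate solution has derivative equal to the pulled back defect
  \<open>r s\<close>, and the group preserves norms.\<close>

lemma duhamel:
  assumes H: "hermitian_op H" and t: "0 \<le> t"
    and d: "\<And>s. 0 \<le> s \<Longrightarrow> s \<le> t \<Longrightarrow> (\<phi> has_vector_derivative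
        - cscale_op \<i> (blinfun_apply H (\<phi> s)) + r s) (at s within {0..t})"
    and r: "\<And>s. 0 \<le> s \<Longrightarrow> s \<le> t \<Longrightarrow> norm (r s) \<le> e"
  shows "norm (\<phi> t - evolution H t (\<phi> 0)) \<le> t * e"
proof -
  define X where "X = to_bop (cscale_op (- \<i>) o\<^sub>L H)"
  define g where "g s = evolution H (- s) (\<phi> s)" for s
  have g: "(g has_vector_derivative evolution H (- s) (r s)) (at s within {0..t})" if s: "0 \<le> s" "s \<le> t" for s
  proof -
    have e1: "((\<lambda>s. exp (s *\<^sub>R - X)) has_vector_derivative exp (s *\<^sub>R - X) * - X) (at s within {0..t})"
      by (rule exp_scaleR_has_vector_derivative_right)
    have e2: "((\<lambda>s. of_bop (exp (s *\<^sub>R - X))) has_vector_derivative of_bop (exp (s *\<^sub>R - X) * - X)) (at s within {0..t})"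
      by (rule bounded_linear.has_vector_derivative[OF bounded_linear_of_bop e1])
    have "((\<lambda>s. blinfun_apply (of_bop (exp (s *\<^sub>R - X))) (\<phi> s)) has_vector_derivative
       blinfun_apply (of_bop (exp (s *\<^sub>R - X))) (- cscale_op \<i> (blinfun_apply H (\<phi> s)) + r s)
        + blinfun_apply (of_bop (exp (s *\<^sub>R - X) * - X)) (\<phi> s)) (at s within {0..t})"
      by (rule bounded_bilinear.has_vector_derivative[OF bounded_bilinear_blinfun_apply e2 d[OF s]])
    moreover have "blinfun_apply (of_bop (exp (s *\<^sub>R - X) * - X)) v
        = blinfun_apply (of_bop (exp (s *\<^sub>R - X))) (cscale_op \<i> (blinfun_apply H v))" for v
    proof -
      have "blinfun_apply (of_bop (- X)) v = cscale_op \<i> (blinfun_apply H v)"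
        by (rule ell2_eqI) (simp add: X_def uminus_bop.rep_eq to_bop_inverse blinfun.minus_left)
      then show ?thesis unfolding times_bop.rep_eq blinfun_apply_blinfun_compose by (rule arg_cong)
    qed
    ultimately show ?thesis
      by (simp add: g_def[abs_def] evolution_eq X_def[symmetric] blinfun.bilinear_simps)
  qed
  have "norm (g t - g 0) \<le> e * norm (t - 0)"
  proof (rule differentiable_bound[where S = "{0..t}" and f' = "\<lambda>s h. h *\<^sub>R evolution H (- s) (r s)"])
    show "(g has_derivative (\<lambda>h. h *\<^sub>R evolution H (- s) (r s))) (at s within {0..t})" if "s \<in> {0..t}" for s
      using g[of s] that by (auto simp: has_vector_derivative_def)
    show "onorm (\<lambda>h. h *\<^sub>R evolution H (- s) (r s)) \<le> e" if "s \<in> {0..t}" for s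
    proof (rule onorm_le)
      fix h :: real
      show "norm (h *\<^sub>R evolution H (- s) (r s)) \<le> e * norm h"
        using r[of s] that by (simp add: norm_evolution[OF H] mult.commute[of "\<bar>h\<bar>"] mult_right_mono)
    qed
  qed (use t in auto)
  moreover have "norm (g t - g 0) = norm (\<phi> t - evolution H t (\<phi> 0))"
  proof -
    have "evolution H t (g t - g 0) = \<phi> t - evolution H t (\<phi> 0)"
      by (simp add: g_def linear_diff[OF evolution_linear])
    then show ?thesis using norm_evolution[OF H, of t "g t - g 0"] by simp
  qed
  ultimately show ?thesis using t by (simp add: mult.commute)
qed

text \<open>Both sides solve the same initial value problem, so \<open>duhamel\<close> with defect 0
  settles \<open>0 \<le> t\<close>; negative times follow by inverting the group.\<close>

lemma commute_evolution:
  assumes H: "hermitian_op H"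
    and T: "\<And>u. blinfun_apply T (cscale_op \<i> u) = cscale_op \<i> (blinfun_apply T u)"
    "\<And>u. blinfun_apply T (blinfun_apply H u) = blinfun_apply H (blinfun_apply T u)"
  shows "blinfun_apply T (evolution H t u) = evolution H t (blinfun_apply T u)"
proof -
  have *: "blinfun_apply T (evolution H t u) = evolution H t (blinfun_apply T u)" if "0 \<le> t" for t u
  proof -
    have "norm (blinfun_apply T (evolution H t u) - evolution H t (blinfun_apply T (evolution H 0 u))) \<le> t * 0"
    proof (rule duhamel[OF H that, where r = "\<lambda>_. 0" and \<phi> = "\<lambda>s. blinfun_apply T (evolution H s u)"])
      fix s
      show "((\<lambda>s. blinfun_apply T (evolution H s u)) has_vector_derivative
          - cscale_op \<i> (blinfun_apply H (blinfun_apply T (evolution H s u))) + 0) (at s within {0..t})"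
        using bounded_linear.has_vector_derivative[OF blinfun.bounded_linear_right has_vector_derivative_evolution, of T H u s "{0..t}"]
        by (simp add: blinfun.bilinear_simps T)
    qed simp
    then show ?thesis by simp
  qed
  show ?thesis
  proof (cases "0 \<le> t")
    case False
    then have "blinfun_apply T (evolution H (- t) (evolution H t u)) = evolution H (- t) (blinfun_apply T (evolution H t u))"
      by (intro *) simp
    then have "evolution H t (blinfun_apply T u) = evolution H t (evolution H (- t) (blinfun_apply T (evolution H t u)))" by simp
    then show ?thesis by simp
  qed (rule *)
qed

section \<open>Finite propagation speed\<close>

lemma norm_ell2_mono:
  assumes "\<And>n. cmod (apply_ell2 u n) \<le> cmod (apply_ell2 v n)" shows "norm u \<le> norm v"
proof (rule norm_ell2_le)
  fix F :: "int set" assume "finite F"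
  have "(\<Sum>n\<in>F. (cmod (apply_ell2 u n))\<^sup>2) \<le> (\<Sum>n\<in>F. (cmod (apply_ell2 v n))\<^sup>2)"
    by (intro sum_mono power_mono assms) auto
  also have "\<dots> \<le> (norm v)\<^sup>2" by (rule sum_le_norm_ell2) fact
  finally show "(\<Sum>n\<in>F. (cmod (apply_ell2 u n))\<^sup>2) \<le> (norm v)\<^sup>2" .
qed simp

lemma norm_mult_op_le:
  assumes "\<And>n. cmod (apply_bcontfun f n) \<le> C" "0 \<le> C"
  shows "norm (mult_op f u) \<le> C * norm u"
proof -
  have "norm (mult_op f u) \<le> norm (C *\<^sub>R u)"
    by (rule norm_ell2_mono) (simp add: norm_mult assms mult_right_mono)
  then show ?thesis using assms(2) by simp
qed

text \<open>The value 0 for unbounded functions is a mere default: a bound is supplied wherever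
  \<open>bfun_apply\<close> is used.\<close>

lift_definition bfun :: "(int \<Rightarrow> 'a::real_normed_vector) \<Rightarrow> (int \<Rightarrow>\<^sub>C 'a)" is
  "\<lambda>f. if bounded (range f) then f else (\<lambda>_. 0)"
  by (auto simp: bcontfun_def)

lemma bfun_apply: "(\<And>n. norm (f n) \<le> C) \<Longrightarrow> apply_bcontfun (bfun f) n = f n"
  by (subst bfun.rep_eq) (auto simp: bounded_iff)

lemma norm_bcontfun_le: "(\<And>n. norm (apply_bcontfun f n) \<le> C) \<Longrightarrow> norm f \<le> C"
  using norm_bound by blast

definition proj_op :: "int set \<Rightarrow> ell2 \<Rightarrow>\<^sub>L ell2" where
  "proj_op S = mult_op (bfun (\<lambda>n. if n \<in> S then 1 else 0))"

lemma proj_op_apply [simp]: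
  "apply_ell2 (proj_op S u) n = (if n \<in> S then apply_ell2 u n else 0)"
proof -
  have "norm (if n \<in> S then 1 else 0 :: complex) \<le> 1" for n by simp
  from bfun_apply[OF this] show ?thesis by (simp add: proj_op_def)
qed

lemma norm_proj_op_le: "norm (proj_op S u) \<le> norm u"
  by (rule norm_ell2_mono) simp

lemma norm_proj_op_mono: "S \<subseteq> T \<Longrightarrow> norm (proj_op S u) \<le> norm (proj_op T u)"
  by (rule norm_ell2_mono) auto

lemma proj_op_commute: "proj_op S (cscale_op z u) = cscale_op z (proj_op S u)"
  by (rule ell2_eqI) simp

definition local_op :: "(ell2 \<Rightarrow>\<^sub>L ell2) \<Rightarrow> bool" where
  "local_op H \<longleftrightarrow> (\<forall>u n. (\<forall>m. \<bar>m - n\<bar> \<le> 1 \<longrightarrow> apply_ell2 u m = 0) \<longrightarrow> apply_ell2 (blinfun_apply H u) n = 0)"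

lemma local_op_schrodinger: "local_op (schrodinger c V)"
  by (auto simp: local_op_def apply_schrodinger)

lemma ell2_shift_inner: "ell2_shift 1 u \<bullet> v = u \<bullet> ell2_shift (-1) v"
  unfolding inner_ell2_def ell2_shift.rep_eq
  using infsum_reindex_bij_betw[of "\<lambda>n. n + 1" UNIV UNIV "\<lambda>n. apply_ell2 u n \<bullet> apply_ell2 v (n + - 1)"]
  by (simp add: bij_plus_right)

lemma hermitian_schrodinger: "hermitian_op (schrodinger c V)"
  unfolding hermitian_op_def
proof (intro conjI allI)
  fix u v :: ell2
  have 1: "blinfun_apply laplacian u \<bullet> v = u \<bullet> blinfun_apply laplacian v"
    using ell2_shift_inner[of u v] ell2_shift_inner[of v u]
    by (simp add: laplacian.rep_eq inner_add inner_commute)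
  have 2: "mult_op (complexify V) u \<bullet> v = u \<bullet> mult_op (complexify V) v"
    by (simp add: inner_ell2_def complexify.rep_eq inner_complex_def algebra_simps)
  show "schrodinger c V u \<bullet> v = u \<bullet> schrodinger c V v"
    by (simp add: schrodinger_def blinfun.bilinear_simps inner_add 1 2)
  show "schrodinger c V (cscale_op \<i> u) = cscale_op \<i> (schrodinger c V u)"
    by (rule ell2_eqI) (simp add: apply_schrodinger algebra_simps)
qed

lemma apply_schrodinger_diff:
  "schrodinger c V u - schrodinger c W u = c *\<^sub>R mult_op (complexify (V - W)) u"
  by (rule ell2_eqI) (simp add: apply_schrodinger complexify.rep_eq minus_bcontfun.rep_eq scaleR_conv_of_real algebra_simps)

lemma norm_mult_complexify: "norm (mult_op (complexify V) u) \<le> norm V * norm u"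
proof (rule norm_mult_op_le)
  show "cmod (apply_bcontfun (complexify V) n) \<le> norm V" for n
    using norm_bounded[of V n] by (simp add: complexify.rep_eq)
qed simp

lemma norm_schrodinger_diff:
  "norm (schrodinger c V u - schrodinger c W u) \<le> \<bar>c\<bar> * norm (V - W) * norm u"
  unfolding apply_schrodinger_diff using norm_mult_complexify[of "V - W" u]
  by (simp add: mult.assoc mult_left_mono)

lemma norm_laplacian_le: "norm (blinfun_apply laplacian u) \<le> 2 * norm u"
  using norm_triangle_ineq[of "ell2_shift 1 u" "ell2_shift (-1) u"] by (simp add: laplacian.rep_eq norm_ell2_shift)

lemma norm_schrodinger_le: "norm (schrodinger c V) \<le> 2 + \<bar>c\<bar> * norm V"
proof (rule norm_blinfun_bound)
  fix u
  have "norm (schrodinger c V u) \<le> norm (blinfun_apply laplacian u) + norm (c *\<^sub>R mult_op (complexify V) u)"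
    using norm_triangle_ineq[of "blinfun_apply laplacian u" "c *\<^sub>R mult_op (complexify V) u"]
    by (simp only: schrodinger_def blinfun.bilinear_simps)
  also have "\<dots> \<le> 2 * norm u + \<bar>c\<bar> * (norm V * norm u)"
    using norm_laplacian_le[of u] norm_mult_complexify[of V u] by (auto intro!: add_mono mult_left_mono)
  finally show "norm (schrodinger c V u) \<le> (2 + \<bar>c\<bar> * norm V) * norm u" by (simp add: algebra_simps)
qed simp

lemma hermitian_shift:
  assumes "hermitian_op H" shows "hermitian_op (H - E *\<^sub>R id_blinfun)"
  unfolding hermitian_op_def
proof (intro conjI allI)
  fix u v
  show "blinfun_apply (H - E *\<^sub>R id_blinfun) u \<bullet> v = u \<bullet> blinfun_apply (H - E *\<^sub>R id_blinfun) v"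
    using hermitian_op_sym[OF assms, of u v] by (simp add: blinfun.bilinear_simps inner_diff)
  have "cscale_op \<i> (E *\<^sub>R u) = E *\<^sub>R cscale_op \<i> u"
    by (simp add: blinfun.bilinear_simps)
  then show "blinfun_apply (H - E *\<^sub>R id_blinfun) (cscale_op \<i> u)
      = cscale_op \<i> (blinfun_apply (H - E *\<^sub>R id_blinfun) u)"
    using hermitian_op_cscale[OF assms, of "\<i>" u] by (simp add: blinfun.bilinear_simps)
qed

lemma evolution_unique:
  assumes H: "hermitian_op H" and t: "0 \<le> t"
    and d: "\<And>s. (\<phi> has_vector_derivative - cscale_op \<i> (blinfun_apply H (\<phi> s))) (at s within {0..t})"
  shows "\<phi> t = evolution H t (\<phi> 0)"
  using duhamel[OF H t, of \<phi> "\<lambda>_. 0" 0] d by simp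

lemma cis_has_vector_derivative:
  "((\<lambda>s. cis (E * s)) has_vector_derivative \<i> * of_real E * cis (E * s)) (at s within S)"
proof -
  have "((\<lambda>s. exp (s *\<^sub>R (\<i> * of_real E))) has_vector_derivative (\<i> * of_real E) * exp (s *\<^sub>R (\<i> * of_real E))) (at s within S)"
    by (rule has_vector_derivative_at_within[OF exp_scaleR_has_vector_derivative_left])
  moreover have "exp (s *\<^sub>R (\<i> * of_real E)) = cis (E * s)" for s
    by (simp add: cis_conv_exp scaleR_conv_of_real mult_ac)
  ultimately show ?thesis by simp
qed

lemma bounded_bilinear_cscale_op: "bounded_bilinear (\<lambda>z. blinfun_apply (cscale_op z))"
proof
  show "\<exists>K. \<forall>z u. norm (cscale_op z u) \<le> norm z * norm u * K"
    by (rule exI[of _ 1]) (simp add: norm_cscale_op)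
qed (auto intro!: ell2_eqI simp: blinfun.bilinear_simps cscale_op_add scaleR_conv_of_real)

lemma evolution_shift:
  assumes H: "hermitian_op H" and t: "0 \<le> t"
  shows "evolution (H - E *\<^sub>R id_blinfun) t u = cscale_op (cis (E * t)) (evolution H t u)"
proof -
  have "cscale_op (cis (E * t)) (evolution H t u)
     = evolution (H - E *\<^sub>R id_blinfun) t (cscale_op (cis (E * 0)) (evolution H 0 u))"
  proof (rule evolution_unique[OF hermitian_shift[OF H] t])
    fix s
    have *: "cscale_op w (- cscale_op \<i> v) + cscale_op (\<i> * of_real E * w) v'
       = - cscale_op \<i> (cscale_op w v - E *\<^sub>R cscale_op w v')" for w v v'
      by (rule ell2_eqI) (simp add: algebra_simps scaleR_conv_of_real blinfun.bilinear_simps)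
    show "((\<lambda>s. cscale_op (cis (E * s)) (evolution H s u)) has_vector_derivative
       - cscale_op \<i> (blinfun_apply (H - E *\<^sub>R id_blinfun) (cscale_op (cis (E * s)) (evolution H s u))))
       (at s within {0..t})"
      unfolding blinfun.bilinear_simps blinfun_apply_id_blinfun hermitian_op_cscale[OF H] *[symmetric, unfolded blinfun.bilinear_simps]
      by (rule bounded_bilinear.has_vector_derivative[OF bounded_bilinear_cscale_op cis_has_vector_derivative has_vector_derivative_evolution, unfolded blinfun.bilinear_simps])
  qed
  then show ?thesis by simp
qed

lemma local_op_power:
  assumes H: "local_op H" and "\<And>m. \<bar>m - n\<bar> \<le> int k \<Longrightarrow> apply_ell2 u m = 0"
  shows "apply_ell2 (blinfun_apply (of_bop (to_bop (cscale_op z o\<^sub>L H) ^ k)) u) n = 0"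
  using assms(2)
proof (induction k arbitrary: n)
  case 0
  then show ?case by (simp add: one_bop.rep_eq)
next
  case (Suc k)
  have "apply_ell2 (blinfun_apply (of_bop (to_bop (cscale_op z o\<^sub>L H) ^ k)) u) m = 0" if "\<bar>m - n\<bar> \<le> 1" for m
    by (rule Suc.IH) (use that Suc.prems in auto)
  then show ?case using H by (simp add: times_bop.rep_eq to_bop_inverse local_op_def)
qed

text \<open>Exponential off-diagonal decay of the propagator: the first \<open>r\<close> terms of its power series have
  range at most \<open>r\<close>.\<close>

lemma finite_range:
  assumes H: "local_op H" and K: "norm H \<le> K" and t: "0 \<le> t"
    and S: "\<And>n m. n \<in> S \<Longrightarrow> \<bar>m - n\<bar> \<le> int r \<Longrightarrow> apply_ell2 u m = 0"
  shows "norm (proj_op S (evolution H t u)) \<le> exp (exp 1 * t * K - real r) * norm u"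
proof -
  define Y where "Y = to_bop (cscale_op (- \<i>) o\<^sub>L H)"
  define a where "a k = proj_op S (blinfun_apply (of_bop ((t *\<^sub>R Y) ^ k /\<^sub>R fact k)) u)" for k
  define b where "b k = (exp (- real r) * norm u) * ((exp 1 * t * K) ^ k /\<^sub>R fact k)" for k
  have K0: "0 \<le> K" using K norm_ge_zero order_trans by blast
  have nY: "norm Y \<le> K"
  proof -
    have "norm (cscale_op (- \<i>) o\<^sub>L H) \<le> K"
      by (rule norm_blinfun_bound[OF K0])
         (simp add: norm_cscale_op, meson K mult_right_mono norm_blinfun norm_ge_zero order_trans)
    then show ?thesis by (simp add: Y_def norm_bop.rep_eq to_bop_inverse)
  qed
  have bl: "bounded_linear (\<lambda>B. proj_op S (blinfun_apply (of_bop B) u))"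
    by (intro bounded_linear_compose[OF blinfun.bounded_linear_right] bounded_linear_compose[OF blinfun.bounded_linear_left bounded_linear_of_bop])
  have eq: "proj_op S (evolution H t u) = (\<Sum>k. a k)"
    unfolding evolution_eq Y_def[symmetric] exp_def a_def
    by (rule bounded_linear.suminf[OF bl summable_exp_generic])
  have sb: "summable b" unfolding b_def by (intro summable_mult summable_exp_generic)
  have le: "norm (a k) \<le> b k" for k
  proof (cases "k \<le> r")
    case True
    have "a k = 0"
    proof (rule ell2_eqI)
      fix n
      show "apply_ell2 (a k) n = apply_ell2 0 n"
        using local_op_power[OF H, of n k u "- \<i>"] S[of n] True
        by (auto simp: a_def Y_def scaleR_power scaleR_bop.rep_eq blinfun.bilinear_simps)
    qed
    then show ?thesis using t K0 by (simp add: b_def)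
  next
    case False
    have "norm (a k) \<le> norm (of_bop ((t *\<^sub>R Y) ^ k /\<^sub>R fact k)) * norm u"
      unfolding a_def by (rule order_trans[OF norm_proj_op_le norm_blinfun])
    also have "norm (of_bop ((t *\<^sub>R Y) ^ k /\<^sub>R fact k)) \<le> (t * K) ^ k / fact k"
    proof -
      have "norm ((t *\<^sub>R Y) ^ k) \<le> (t * K) ^ k"
        by (rule order_trans[OF norm_power_ineq]) (use t nY in \<open>auto intro!: power_mono mult_left_mono\<close>)
      then show ?thesis unfolding norm_bop.rep_eq[symmetric] by (simp add: divide_simps)
    qed
    \<comment> \<open>The factor inserted is at least 1 because \<open>k > r\<close>. It turns the
      tail of the exponential series into \<open>exp (- r)\<close> times the full series for
      \<open>exp 1 * t * K\<close>.\<close>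
    also have "(t * K) ^ k / fact k * norm u \<le> exp (real k - real r) * ((t * K) ^ k / fact k * norm u)"
      using mult_right_mono[of 1 "exp (real k - real r)" "(t * K) ^ k / fact k * norm u"] False t K0 by simp
    also have "\<dots> = b k"
      by (simp add: b_def exp_diff exp_minus power_mult_distrib exp_of_nat_mult[symmetric] field_simps)
    finally show ?thesis by (simp add: mult_right_mono)
  qed
  have sa: "summable (\<lambda>k. norm (a k))" by (rule summable_comparison_test'[OF sb]) (simp add: le)
  have "norm (\<Sum>k. a k) \<le> (\<Sum>k. norm (a k))" by (rule summable_norm[OF sa])
  also have "\<dots> \<le> (\<Sum>k. b k)" by (intro suminf_le le sa sb)
  also have "\<dots> = (exp (- real r) * norm u) * exp (exp 1 * t * K)"
    using suminf_mult[OF summable_exp_generic[of "exp 1 * t * K"], of "exp (- real r) * norm u"]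
    by (simp add: b_def exp_def[symmetric, THEN fun_cong] exp_def)
  finally show ?thesis by (simp add: eq exp_diff exp_minus field_simps)
qed

section \<open>Top of the spectrum on a window\<close>

definition supp_in :: "int set \<Rightarrow> ell2 \<Rightarrow> bool" where
  "supp_in S u \<longleftrightarrow> (\<forall>n. n \<notin> S \<longrightarrow> apply_ell2 u n = 0)"

definition real_ell2 :: "ell2 \<Rightarrow> bool" where
  "real_ell2 u \<longleftrightarrow> (\<forall>n. Im (apply_ell2 u n) = 0)"

abbreviation form :: "(ell2 \<Rightarrow>\<^sub>L ell2) \<Rightarrow> ell2 \<Rightarrow> real" where
  "form H u \<equiv> blinfun_apply H u \<bullet> u"

lemma inner_ell2_delta: "u \<bullet> ell2_delta n = Re (apply_ell2 u n)"
proof -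
  have "u \<bullet> ell2_delta n = (\<Sum>\<^sub>\<infinity>m\<in>{n}. apply_ell2 u m \<bullet> apply_ell2 (ell2_delta n) m)"
    unfolding inner_ell2_def by (rule infsum_cong_neutral) (auto simp: ell2_delta.rep_eq)
  then show ?thesis by (simp add: ell2_delta.rep_eq inner_complex_def)
qed

lemma inner_finite_supp: "finite S \<Longrightarrow> supp_in S u \<Longrightarrow> u \<bullet> v = (\<Sum>n\<in>S. apply_ell2 u n \<bullet> apply_ell2 v n)"
proof -
  assume S: "finite S" "supp_in S u"
  have "u \<bullet> v = (\<Sum>\<^sub>\<infinity>n\<in>S. apply_ell2 u n \<bullet> apply_ell2 v n)"
    unfolding inner_ell2_def by (rule infsum_cong_neutral) (use S in \<open>auto simp: supp_in_def\<close>)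
  then show ?thesis using S by simp
qed

lemma norm_finite_supp: "finite S \<Longrightarrow> supp_in S u \<Longrightarrow> (norm u)\<^sup>2 = (\<Sum>n\<in>S. (cmod (apply_ell2 u n))\<^sup>2)"
  by (simp add: power2_norm_eq_inner inner_finite_supp)

lemma norm_blinfun_le: "norm H \<le> K \<Longrightarrow> norm (blinfun_apply H u) \<le> K * norm u"
  by (meson mult_right_mono norm_blinfun norm_ge_zero order_trans)

lemma abs_form_le: "norm H \<le> K \<Longrightarrow> \<bar>form H u\<bar> \<le> K * (norm u)\<^sup>2"
proof -
  assume K: "norm H \<le> K"
  have "\<bar>form H u\<bar> \<le> norm (blinfun_apply H u) * norm u" by (rule Cauchy_Schwarz_ineq2)
  also have "\<dots> \<le> (K * norm u) * norm u"
    by (intro mult_right_mono norm_blinfun_le K) simp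
  finally show ?thesis by (simp add: power2_eq_square mult.assoc)
qed

lift_definition ell2_abs :: "ell2 \<Rightarrow> ell2" is "\<lambda>u n. of_real (cmod (u n))" by simp

lemma norm_ell2_abs: "norm (ell2_abs u) = norm u"
  by (simp add: norm_ell2_def ell2_abs.rep_eq)

text \<open>Replacing \<open>u\<close> by \<open>\<bar>u\<bar>\<close> can only raise the energy, as the off-diagonal entries are nonnegative.\<close>

lemma form_ell2_abs: "form (schrodinger c V) u \<le> form (schrodinger c V) (ell2_abs u)"
  unfolding inner_ell2_def
proof (rule infsum_mono[OF ell2_inner_summable ell2_inner_summable])
  fix n
  define x where "x m = apply_ell2 u m" for m
  have le: "x m \<bullet> x n \<le> cmod (x m) * cmod (x n)" for m by (rule norm_cauchy_schwarz)
  have "apply_ell2 (schrodinger c V u) n \<bullet> apply_ell2 u n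
     = x (n + 1) \<bullet> x n + x (n - 1) \<bullet> x n + c * apply_bcontfun V n * (cmod (x n))\<^sup>2"
    by (simp add: apply_schrodinger x_def inner_add_left power2_norm_eq_inner inner_complex_def algebra_simps)
  also have "\<dots> \<le> cmod (x (n + 1)) * cmod (x n) + cmod (x (n - 1)) * cmod (x n) + c * apply_bcontfun V n * (cmod (x n))\<^sup>2"
    by (intro add_mono le order_refl)
  also have "\<dots> = apply_ell2 (schrodinger c V (ell2_abs u)) n \<bullet> apply_ell2 (ell2_abs u) n"
    by (simp add: apply_schrodinger ell2_abs.rep_eq x_def inner_complex_def power2_eq_square algebra_simps)
  finally show "apply_ell2 (schrodinger c V u) n \<bullet> apply_ell2 u n
    \<le> apply_ell2 (schrodinger c V (ell2_abs u)) n \<bullet> apply_ell2 (ell2_abs u) n" .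
qed

definition nonneg_ell2 :: "ell2 \<Rightarrow> bool" where
  "nonneg_ell2 u \<longleftrightarrow> (\<forall>n. apply_ell2 u n = of_real (cmod (apply_ell2 u n)))"

lemma nonneg_ell2_abs: "nonneg_ell2 (ell2_abs u)"
  by (simp add: nonneg_ell2_def ell2_abs.rep_eq)

lemma nonneg_real_ell2: "nonneg_ell2 u \<Longrightarrow> real_ell2 u"
  unfolding nonneg_ell2_def real_ell2_def by (metis Im_complex_of_real)

lemma nonneg_Re: "nonneg_ell2 u \<Longrightarrow> 0 \<le> Re (apply_ell2 u n)"
  unfolding nonneg_ell2_def by (metis Re_complex_of_real norm_ge_zero)

text \<open>The supremum of the form over unit vectors supported in \<open>S\<close> need not be
  attained when \<open>S\<close> is infinite, so near maximizers stand in for the ground state. They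
  can be taken nonnegative because of \<open>form_ell2_abs\<close>, like a Perron-Frobenius
  eigenvector.\<close>

definition is_top :: "(ell2 \<Rightarrow>\<^sub>L ell2) \<Rightarrow> int set \<Rightarrow> real \<Rightarrow> bool" where
  "is_top H S E \<longleftrightarrow> (\<forall>u. supp_in S u \<longrightarrow> form H u \<le> E * (norm u)\<^sup>2) \<and>
     (\<forall>\<tau>>0. \<exists>u. supp_in S u \<and> norm u = 1 \<and> nonneg_ell2 u \<and> E - \<tau> < form H u)"

lemma is_top_le: "is_top H S E \<Longrightarrow> supp_in S u \<Longrightarrow> form H u \<le> E * (norm u)\<^sup>2"
  by (simp add: is_top_def)

lemma is_top_near:
  assumes "is_top H S E" "0 < \<tau>"
  obtains u where "supp_in S u" "norm u = 1" "nonneg_ell2 u" "E - \<tau> < form H u"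
  using assms unfolding is_top_def by blast

lemma supp_in_scaleR: "supp_in S u \<Longrightarrow> supp_in S (r *\<^sub>R u)"
  by (simp add: supp_in_def)

lemma form_scaleR: "form H (r *\<^sub>R u) = r\<^sup>2 * form H u"
  by (simp add: blinfun.bilinear_simps power2_eq_square)

lemma ex_is_top:
  assumes S: "S \<noteq> {}" and K: "norm (schrodinger c V) \<le> K"
  shows "\<exists>E. is_top (schrodinger c V) S E \<and> \<bar>E\<bar> \<le> K"
proof -
  define H where "H = schrodinger c V"
  define X where "X = form H ` {u. supp_in S u \<and> norm u = 1}"
  obtain n where "n \<in> S" using S by blast
  then have "supp_in S (ell2_delta n)" by (auto simp: supp_in_def ell2_delta.rep_eq)
  then have X: "X \<noteq> {}" unfolding X_def using norm_ell2_delta by blast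
  have bnd: "\<bar>x\<bar> \<le> K" if "x \<in> X" for x
  proof -
    obtain u where "x = form H u" "norm u = 1" using \<open>x \<in> X\<close> by (auto simp: X_def)
    then show ?thesis using abs_form_le[OF K[folded H_def], of u] by simp
  qed
  have bdd: "bdd_above X" using bnd by (intro bdd_aboveI[of _ K]) (auto simp: abs_le_iff)
  define E where "E = Sup X"
  have "is_top H S E"
    unfolding is_top_def
  proof (intro conjI allI impI)
    fix u assume u: "supp_in S u"
    show "form H u \<le> E * (norm u)\<^sup>2"
    proof (cases "u = 0")
      case False
      have "form H ((1 / norm u) *\<^sub>R u) \<in> X"
        unfolding X_def using u False by (intro imageI) (simp add: supp_in_scaleR)
      then have "form H ((1 / norm u) *\<^sub>R u) \<le> E" unfolding E_def by (rule cSup_upper[OF _ bdd])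
      then show ?thesis using False by (simp only: form_scaleR) (simp add: power_divide field_simps)
    qed simp
  next
    fix \<tau> :: real assume "0 < \<tau>"
    then have "E - \<tau> < Sup X" by (simp add: E_def)
    then obtain u where u: "supp_in S u" "norm u = 1" "E - \<tau> < form H u"
      using less_cSup_iff[OF X bdd] by (auto simp: X_def)
    have "supp_in S (ell2_abs u)" using u(1) by (simp add: supp_in_def ell2_abs.rep_eq)
    then show "\<exists>u. supp_in S u \<and> norm u = 1 \<and> nonneg_ell2 u \<and> E - \<tau> < form H u"
      using u form_ell2_abs[of c V u] nonneg_ell2_abs[of u] norm_ell2_abs[of u]
      by (intro exI[of _ "ell2_abs u"]) (simp add: H_def)
  qed
  moreover have "\<bar>E\<bar> \<le> K"
  proof -
    obtain x where "x \<in> X" using X by blast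
    then have "- K \<le> E" using bnd[of x] cSup_upper[OF _ bdd, of x] by (simp add: E_def abs_le_iff)
    moreover have "E \<le> K" unfolding E_def using bnd by (intro cSup_least X) (auto simp: abs_le_iff)
    ultimately show ?thesis by (simp add: abs_le_iff)
  qed
  ultimately show ?thesis unfolding H_def by blast
qed

lemma supp_in_add: "supp_in S u \<Longrightarrow> supp_in S v \<Longrightarrow> supp_in S (u + v)"
  by (simp add: supp_in_def)

lemma supp_in_diff: "supp_in S u \<Longrightarrow> supp_in S v \<Longrightarrow> supp_in S (u - v)"
  by (simp add: supp_in_def)

lemma supp_in_mono: "supp_in S u \<Longrightarrow> S \<subseteq> T \<Longrightarrow> supp_in T u"
  by (auto simp: supp_in_def)

lemma supp_in_delta: "n \<in> S \<Longrightarrow> supp_in S (ell2_delta n)"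
  by (auto simp: supp_in_def ell2_delta.rep_eq)

text \<open>A near maximizer of the energy among vectors supported in \<open>S\<close> is an approximate eigenvector,
  tested against vectors supported in \<open>S\<close>: Cauchy-Schwarz for the semidefinite form \<open>E - H\<close>.\<close>

lemma near_top_residual:
  assumes H: "hermitian_op H" "norm H \<le> K" and E: "\<And>u. supp_in S u \<Longrightarrow> form H u \<le> E * (norm u)\<^sup>2" "\<bar>E\<bar> \<le> K"
    and u: "supp_in S u" "norm u = 1" "E - \<tau> \<le> form H u" and w: "supp_in S w"
  shows "\<bar>E * (u \<bullet> w) - blinfun_apply H u \<bullet> w\<bar> \<le> sqrt (2 * K * \<tau>) * norm w"
proof (cases "w = 0 \<or> K = 0")
  case True
  then show ?thesis
  proof
    assume "K = 0"
    moreover from this have "E = 0" "H = 0" using E(2) H(2) by auto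
    ultimately show ?thesis by simp
  qed simp
next
  case False
  define \<beta> where "\<beta> = E * (u \<bullet> w) - blinfun_apply H u \<bullet> w"
  define B where "B = 2 * K * (norm w)\<^sup>2"
  have K: "0 < K" using False E(2) by linarith
  have B: "0 < B" using False K by (simp add: B_def)
  have bw: "E * (norm w)\<^sup>2 - form H w \<le> B"
    using abs_form_le[OF H(2), of w] mult_right_mono[of E K "(norm w)\<^sup>2"] E(2) by (simp add: B_def abs_le_iff)
  \<comment> \<open>The multiple of \<open>w\<close> that minimizes
    \<open>\<tau> + 2 * s * \<beta> + s\<^sup>2 * B\<close>, an upper bound for a nonnegative
    quantity.\<close>
  define s where "s = - \<beta> / B"
  have sym: "blinfun_apply H w \<bullet> u = blinfun_apply H u \<bullet> w" using hermitian_op_sym[OF H(1), of w u] by (simp add: inner_commute)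
  have nn: "(norm (u + s *\<^sub>R w))\<^sup>2 = (norm u)\<^sup>2 + 2 * s * (u \<bullet> w) + s\<^sup>2 * (norm w)\<^sup>2"
    unfolding power2_norm_eq_inner by (simp add: inner_add inner_commute[of w u] power2_eq_square algebra_simps)
  have ff: "form H (u + s *\<^sub>R w) = form H u + 2 * s * (blinfun_apply H u \<bullet> w) + s\<^sup>2 * form H w"
    by (simp add: blinfun.bilinear_simps inner_add sym power2_eq_square algebra_simps)
  have "0 \<le> E * (norm (u + s *\<^sub>R w))\<^sup>2 - form H (u + s *\<^sub>R w)"
    using E(1)[OF supp_in_add[OF u(1) supp_in_scaleR[OF w]]] by simp
  also have "\<dots> = (E * (norm u)\<^sup>2 - form H u) + 2 * s * \<beta> + s\<^sup>2 * (E * (norm w)\<^sup>2 - form H w)"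
    unfolding nn ff \<beta>_def by (simp add: algebra_simps)
  also have "\<dots> \<le> \<tau> + 2 * s * \<beta> + s\<^sup>2 * B"
    using u(2,3) mult_left_mono[OF bw, of "s\<^sup>2"] by simp
  also have "\<dots> = \<tau> - \<beta>\<^sup>2 / B" using B by (simp add: s_def power2_eq_square field_simps)
  finally have "\<beta>\<^sup>2 \<le> \<tau> * B" using B by (simp add: field_simps)
  then have "sqrt (\<beta>\<^sup>2) \<le> sqrt (2 * K * \<tau> * (norm w)\<^sup>2)" unfolding B_def by (intro real_sqrt_le_mono) (simp add: mult_ac)
  then show ?thesis by (simp add: \<beta>_def real_sqrt_mult)
qed

text \<open>A Harnack inequality. The approximate eigenvalue equation, tested at a site of
  \<open>S\<close>, bounds the sum of the two neighbours by the site itself; as all values are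
  nonnegative, each neighbour is bounded. Iteration with \<open>growth_chain\<close> shows that a
  near maximizer cannot drop faster than exponentially.\<close>

lemma near_top_residual_site:
  assumes H: "norm (schrodinger c V) \<le> K" and E: "is_top (schrodinger c V) S E" "\<bar>E\<bar> \<le> K" and cV: "\<bar>c * apply_bcontfun V n\<bar> \<le> K"
    and u: "supp_in S u" "norm u = 1" "nonneg_ell2 u" "E - \<tau> \<le> form (schrodinger c V) u" and n: "n \<in> S"
  shows "Re (apply_ell2 u (n + 1)) + Re (apply_ell2 u (n - 1)) \<le> 2 * K * Re (apply_ell2 u n) + sqrt (2 * K * \<tau>)"
proof -
  have "\<bar>E * (u \<bullet> ell2_delta n) - schrodinger c V u \<bullet> ell2_delta n\<bar> \<le> sqrt (2 * K * \<tau>) * norm (ell2_delta n)"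
    by (rule near_top_residual[OF hermitian_schrodinger H is_top_le[OF E(1)] E(2) u(1,2,4) supp_in_delta[OF n]])
  then have "Re (apply_ell2 u (n + 1)) + Re (apply_ell2 u (n - 1)) + c * apply_bcontfun V n * Re (apply_ell2 u n)
      \<le> E * Re (apply_ell2 u n) + sqrt (2 * K * \<tau>)"
    by (simp add: inner_ell2_delta apply_schrodinger abs_le_iff)
  moreover have "(E - c * apply_bcontfun V n) * Re (apply_ell2 u n) \<le> 2 * K * Re (apply_ell2 u n)"
    using E(2) cV nonneg_Re[OF u(3), of n] by (intro mult_right_mono) (auto simp: abs_le_iff)
  ultimately show ?thesis by (simp add: algebra_simps)
qed

lemma growth_chain:
  fixes f :: "nat \<Rightarrow> real"
  assumes "\<And>i. i < k \<Longrightarrow> f (Suc i) \<le> M * f i + e" "1 \<le> M" "0 \<le> e"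
  shows "f k \<le> M ^ k * (f 0 + real k * e)"
  using assms(1)
proof (induction k)
  case (Suc k)
  have IH: "f k \<le> M ^ k * (f 0 + real k * e)" using Suc by simp
  have "f (Suc k) \<le> M * (M ^ k * (f 0 + real k * e)) + e"
    using Suc.prems[of k] mult_left_mono[OF IH, of M] assms(2) by linarith
  moreover have "e \<le> M ^ Suc k * e" using mult_right_mono[of 1 "M ^ Suc k" e] assms one_le_power[of M "Suc k"] by simp
  ultimately have "f (Suc k) \<le> M * (M ^ k * (f 0 + real k * e)) + M ^ Suc k * e" by linarith
  then show ?case by (simp add: algebra_simps)
qed simp

text \<open>By the min-max principle the second level on \<open>S\<close> is at most the top level
  \<open>E\<^sub>0\<close> on \<open>S - {0}\<close>, a restriction of codimension one. So if
  \<open>E\<^sub>1\<close> exceeds \<open>E\<^sub>0\<close> by \<open>g\<close>, it is isolated and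
  simple, and an energy above \<open>E\<^sub>0 + g / 2\<close> and away from
  \<open>E\<^sub>1\<close> is in the resolvent set. The proof splits \<open>u\<close> along a near
  maximizer \<open>\<phi>\<close> and its complement.\<close>

lemma spectral_gap_complement:
  assumes H: "hermitian_op H" "norm H \<le> K" and K: "0 < K"
    and top: "is_top H S E\<^sub>1" "\<bar>E\<^sub>1\<bar> \<le> K" and E\<^sub>0: "\<And>u. supp_in (S - {0}) u \<Longrightarrow> form H u \<le> E\<^sub>0 * (norm u)\<^sup>2"
    and g: "0 < g" "E\<^sub>0 + g \<le> E\<^sub>1" and E: "E\<^sub>0 + g / 2 \<le> E" "b \<le> \<bar>E - E\<^sub>1\<bar>" "0 < b"
    and u: "supp_in S u" "real_ell2 u"
  shows "norm u \<le> (8 / g + 4 / b) * norm (blinfun_apply H u - E *\<^sub>R u)"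
proof -
  define D where "D = 4 / g + 2 / b"
  have D: "0 < D" using g E by (simp add: D_def add_pos_pos)
  \<comment> \<open>\<open>\<tau> \<le> g / 2\<close> keeps the energy of \<open>\<phi>\<close>
    above \<open>E\<^sub>0 + g / 2\<close>, and \<open>\<tau> \<le> b / 2\<close> keeps it away from
    \<open>E\<close>. The other two bounds give the residual
    \<open>\<tau>' = sqrt (2 * K * \<tau>)\<close> the properties
    \<open>\<tau>'\<^sup>2 \<le> g\<^sup>2 / 8\<close> and \<open>\<tau>' * D \<le> 1 / 2\<close>,
    so that its contributions can be absorbed.\<close>
  define \<tau> where "\<tau> = min (min (g / 2) (b / 2)) (min (g\<^sup>2 / (16 * K)) (1 / (8 * K * D\<^sup>2)))"
  have \<tau>: "0 < \<tau>" "\<tau> \<le> g / 2" "\<tau> \<le> b / 2" "\<tau> \<le> g\<^sup>2 / (16 * K)" "\<tau> \<le> 1 / (8 * K * D\<^sup>2)"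
    using g E K D by (auto simp: \<tau>_def)
  define \<tau>' where "\<tau>' = sqrt (2 * K * \<tau>)"
  have \<tau>'0: "0 \<le> \<tau>'" using K \<tau> by (simp add: \<tau>'_def)
  have \<tau>'2: "\<tau>'\<^sup>2 \<le> g\<^sup>2 / 8" using \<tau>(4) K \<tau>(1) by (simp add: \<tau>'_def field_simps)
  have \<tau>'D: "\<tau>' * D \<le> 1 / 2"
  proof -
    have "(\<tau>' * D)\<^sup>2 \<le> (1 / 2)\<^sup>2" using \<tau>(5) K D \<tau>(1) by (simp add: \<tau>'_def power_mult_distrib power_divide field_simps)
    then show ?thesis by (rule power2_le_imp_le) simp
  qed
  obtain \<phi> where \<phi>: "supp_in S \<phi>" "norm \<phi> = 1" "nonneg_ell2 \<phi>" "E\<^sub>1 - \<tau> < form H \<phi>" using is_top_near[OF top(1) \<tau>(1)] .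
  have \<phi>\<phi>: "\<phi> \<bullet> \<phi> = 1" using \<phi>(2) by (simp add: power2_norm_eq_inner[symmetric])
  have res: "\<bar>E\<^sub>1 * (\<phi> \<bullet> w) - blinfun_apply H \<phi> \<bullet> w\<bar> \<le> \<tau>' * norm w" if "supp_in S w" for w
    unfolding \<tau>'_def by (rule near_top_residual[OF H is_top_le[OF top(1)] top(2) \<phi>(1,2) less_imp_le[OF \<phi>(4)] that])
  have Re\<phi>: "Re (apply_ell2 \<phi> 0) \<noteq> 0"
  proof
    assume "Re (apply_ell2 \<phi> 0) = 0"
    then have "apply_ell2 \<phi> 0 = 0" using \<phi>(3) nonneg_real_ell2[OF \<phi>(3)] by (simp add: real_ell2_def complex_eq_iff)
    then have "supp_in (S - {0}) \<phi>" using \<phi>(1) by (auto simp: supp_in_def)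
    from E\<^sub>0[OF this] show False using \<phi>(2,4) \<tau>(2) g by simp
  qed
  define \<alpha> where "\<alpha> = u \<bullet> \<phi>"
  define v where "v = u - \<alpha> *\<^sub>R \<phi>"
  have uv: "u = \<alpha> *\<^sub>R \<phi> + v" by (simp add: v_def)
  have v\<phi>: "v \<bullet> \<phi> = 0" by (simp add: v_def inner_diff_left \<phi>\<phi> \<alpha>_def)
  then have \<phi>v: "\<phi> \<bullet> v = 0" by (simp add: inner_commute)
  have sv: "supp_in S v" unfolding v_def by (intro supp_in_diff u supp_in_scaleR \<phi>)
  have rv: "real_ell2 v" using u(2) nonneg_real_ell2[OF \<phi>(3)] by (simp add: v_def real_ell2_def)
  define e where "e = blinfun_apply H u - E *\<^sub>R u"
  have \<alpha>u: "\<bar>\<alpha>\<bar> \<le> norm u" unfolding \<alpha>_def using Cauchy_Schwarz_ineq2[of u \<phi>] \<phi>(2) by simp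
  have vu: "norm v \<le> norm u"
  proof -
    have "(norm u)\<^sup>2 = \<alpha>\<^sup>2 + (norm v)\<^sup>2"
    proof -
      have "u \<bullet> u = (\<alpha> *\<^sub>R \<phi> + v) \<bullet> (\<alpha> *\<^sub>R \<phi> + v)" by (simp only: uv[symmetric])
      also have "\<dots> = \<alpha>\<^sup>2 + v \<bullet> v" by (simp add: inner_add v\<phi> \<phi>v \<phi>\<phi> power2_eq_square)
      finally show ?thesis by (simp only: power2_norm_eq_inner)
    qed
    then have "(norm v)\<^sup>2 \<le> (norm u)\<^sup>2" using zero_le_power2[of \<alpha>] by linarith
    then show ?thesis by (rule power2_le_imp_le) simp
  qed
  have sym: "blinfun_apply H x \<bullet> y = blinfun_apply H y \<bullet> x" for x y
    using hermitian_op_sym[OF H(1), of x y] by (simp add: inner_commute)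
  have Hv\<phi>: "\<bar>blinfun_apply H \<phi> \<bullet> v\<bar> \<le> \<tau>' * norm v" using res[OF sv] by (simp add: \<phi>v)
  \<comment> \<open>With this \<open>s\<close> the vector \<open>z\<close> vanishes at 0, so the
    bound by \<open>E\<^sub>0\<close> applies to it and, \<open>\<phi>\<close> having higher energy,
    passes to \<open>v\<close>. A real factor is enough because \<open>v\<close> and
    \<open>\<phi>\<close> are real; this is where reality of \<open>u\<close> enters.\<close>
  define s where "s = Re (apply_ell2 v 0) / Re (apply_ell2 \<phi> 0)"
  define z where "z = v - s *\<^sub>R \<phi>"
  have "apply_ell2 z 0 = 0"
    using rv nonneg_real_ell2[OF \<phi>(3)] Re\<phi> by (simp add: z_def s_def real_ell2_def complex_eq_iff)
  then have "supp_in (S - {0}) z"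
    using supp_in_diff[OF sv supp_in_scaleR[OF \<phi>(1)], of s] by (auto simp: supp_in_def z_def)
  note E0z = E\<^sub>0[OF this]
  have nz: "(norm z)\<^sup>2 = (norm v)\<^sup>2 + s\<^sup>2"
    unfolding power2_norm_eq_inner z_def by (simp add: inner_diff v\<phi> \<phi>v \<phi>\<phi> power2_eq_square algebra_simps)
  have fz: "form H z = form H v - 2 * s * (blinfun_apply H \<phi> \<bullet> v) + s\<^sup>2 * form H \<phi>"
    by (simp add: z_def blinfun.bilinear_simps inner_diff sym[of v \<phi>] power2_eq_square algebra_simps)
  have "form H v - 2 * s * (blinfun_apply H \<phi> \<bullet> v) + s\<^sup>2 * form H \<phi> \<le> E\<^sub>0 * ((norm v)\<^sup>2 + s\<^sup>2)"
    using E0z unfolding nz fz .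
  moreover have "s\<^sup>2 * (E\<^sub>0 + g / 2) \<le> s\<^sup>2 * form H \<phi>" using \<phi>(4) \<tau>(2) g by (intro mult_left_mono) auto
  moreover have "2 * s * (blinfun_apply H \<phi> \<bullet> v) \<le> g / 2 * s\<^sup>2 + (g / 4) * (norm v)\<^sup>2"
  proof -
    have "2 * s * (blinfun_apply H \<phi> \<bullet> v) \<le> \<bar>2 * s * (blinfun_apply H \<phi> \<bullet> v)\<bar>" by (rule abs_ge_self)
    also have "\<dots> = 2 * \<bar>s\<bar> * \<bar>blinfun_apply H \<phi> \<bullet> v\<bar>" by (simp add: abs_mult)
    also have "\<dots> \<le> 2 * \<bar>s\<bar> * (\<tau>' * norm v)" by (rule mult_left_mono[OF Hv\<phi>]) simp
    finally have s1: "2 * s * (blinfun_apply H \<phi> \<bullet> v) \<le> 2 * \<bar>s\<bar> * (\<tau>' * norm v)" .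
    have s2: "2 * \<bar>s\<bar> * (\<tau>' * norm v) \<le> g / 2 * s\<^sup>2 + (2 / g) * (\<tau>' * norm v)\<^sup>2"
    proof -
      have "0 \<le> (g / 2) * (\<bar>s\<bar> - (2 / g) * (\<tau>' * norm v))\<^sup>2" using g by simp
      also have "\<dots> = g / 2 * s\<^sup>2 + (2 / g) * (\<tau>' * norm v)\<^sup>2 - 2 * \<bar>s\<bar> * (\<tau>' * norm v)"
        using g by (simp add: power2_eq_square field_simps)
      finally show ?thesis by simp
    qed
    have s3: "(2 / g) * (\<tau>' * norm v)\<^sup>2 \<le> (g / 4) * (norm v)\<^sup>2"
    proof -
      have "(2 / g) * \<tau>'\<^sup>2 \<le> g / 4" using \<tau>'2 g by (simp add: power2_eq_square field_simps)
      then show ?thesis using mult_right_mono[of "(2 / g) * \<tau>'\<^sup>2" "g / 4" "(norm v)\<^sup>2"] by (simp add: power_mult_distrib mult.assoc)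
    qed
    show ?thesis using s1 s2 s3 by linarith
  qed
  ultimately have fv: "form H v \<le> (E\<^sub>0 + g / 4) * (norm v)\<^sup>2" by (simp add: algebra_simps)
  have ev: "- (e \<bullet> v) = E * (norm v)\<^sup>2 - form H v - \<alpha> * (blinfun_apply H \<phi> \<bullet> v)"
    unfolding e_def power2_norm_eq_inner
    by (subst (1 2) uv) (simp add: blinfun.bilinear_simps inner_add inner_diff \<phi>v algebra_simps)
  have "g / 4 * (norm v)\<^sup>2 \<le> E * (norm v)\<^sup>2 - form H v"
    using fv mult_right_mono[of "E\<^sub>0 + g / 2" E "(norm v)\<^sup>2"] E(1) by (simp add: algebra_simps)
  also have "\<dots> = - (e \<bullet> v) + \<alpha> * (blinfun_apply H \<phi> \<bullet> v)" using ev by simp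
  also have "\<dots> \<le> norm e * norm v + \<bar>\<alpha>\<bar> * (\<tau>' * norm v)"
  proof (rule add_mono)
    show "- (e \<bullet> v) \<le> norm e * norm v" using Cauchy_Schwarz_ineq2[of e v] by linarith
    have "\<alpha> * (blinfun_apply H \<phi> \<bullet> v) \<le> \<bar>\<alpha>\<bar> * \<bar>blinfun_apply H \<phi> \<bullet> v\<bar>" by (metis abs_ge_self abs_mult)
    also have "\<dots> \<le> \<bar>\<alpha>\<bar> * (\<tau>' * norm v)" by (rule mult_left_mono[OF Hv\<phi>]) simp
    finally show "\<alpha> * (blinfun_apply H \<phi> \<bullet> v) \<le> \<bar>\<alpha>\<bar> * (\<tau>' * norm v)" .
  qed
  finally have "norm v * (g / 4 * norm v) \<le> norm v * (norm e + \<bar>\<alpha>\<bar> * \<tau>')" by (simp add: power2_eq_square algebra_simps)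
  then have 1: "norm v \<le> 4 / g * (norm e + norm u * \<tau>')"
  proof (cases "norm v = 0")
    case False
    then have "g / 4 * norm v \<le> norm e + \<bar>\<alpha>\<bar> * \<tau>'"
      using \<open>norm v * (g / 4 * norm v) \<le> _\<close> by (simp add: mult_le_cancel_left_pos)
    also have "\<dots> \<le> norm e + norm u * \<tau>'" using \<alpha>u \<tau>'0 by (simp add: mult_right_mono)
    finally show ?thesis using g by (simp add: field_simps)
  qed (use \<tau>'0 g in simp)
  define r where "r = E\<^sub>1 - form H \<phi>"
  have r: "0 \<le> r" "r \<le> \<tau>" using is_top_le[OF top(1) \<phi>(1)] \<phi>(2,4) by (auto simp: r_def)
  \<comment> \<open>Pairing with \<open>\<phi>\<close> controls the component
    \<open>\<alpha>\<close>: along \<open>\<phi>\<close> the operator acts as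
    \<open>E\<^sub>1\<close>, up to \<open>r\<close> and the residual.\<close>
  have ep: "- (e \<bullet> \<phi>) = \<alpha> * (E - E\<^sub>1 + r) - blinfun_apply H \<phi> \<bullet> v"
    unfolding e_def
    by (subst (1 2) uv) (simp add: blinfun.bilinear_simps inner_add inner_diff v\<phi> \<phi>\<phi> sym[of v \<phi>] r_def algebra_simps)
  have "b / 2 \<le> \<bar>E - E\<^sub>1 + r\<bar>" using E(2) r \<tau>(3) by linarith
  then have "\<bar>\<alpha>\<bar> * (b / 2) \<le> \<bar>\<alpha> * (E - E\<^sub>1 + r)\<bar>" unfolding abs_mult by (intro mult_left_mono) auto
  also have "\<dots> \<le> norm e + \<tau>' * norm v"
    using ep Cauchy_Schwarz_ineq2[of e \<phi>] Hv\<phi> \<phi>(2) by simp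
  also have "\<dots> \<le> norm e + norm u * \<tau>'" using vu \<tau>'0 by (simp add: mult.commute mult_left_mono)
  finally have 2: "\<bar>\<alpha>\<bar> \<le> 2 / b * (norm e + norm u * \<tau>')" using E(3) by (simp add: field_simps)
  have "norm u \<le> \<bar>\<alpha>\<bar> + norm v" using norm_triangle_ineq[of "\<alpha> *\<^sub>R \<phi>" v] uv \<phi>(2) by simp
  also have "\<dots> \<le> D * (norm e + norm u * \<tau>')" using 1 2 by (simp add: D_def distrib_right)
  also have "\<dots> = D * norm e + norm u * (\<tau>' * D)" by (simp add: algebra_simps)
  also have "\<dots> \<le> D * norm e + norm u * (1 / 2)" using \<tau>'D by (intro add_left_mono mult_left_mono) auto
  finally have "norm u \<le> (2 * D) * norm e" by simp
  also have "2 * D = 8 / g + 4 / b" by (simp add: D_def)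
  finally show ?thesis by (simp add: e_def)
qed

section \<open>Finite windows of a periodic potential\<close>

lemma truncation_tendsto: "(\<lambda>N. proj_op {- int N..int N} u) \<longlonglongrightarrow> u"
proof (rule metric_LIMSEQ_I)
  fix e :: real assume e: "0 < e"
  obtain F where F: "finite F" "(norm u)\<^sup>2 - (e / 2)\<^sup>2 \<le> (\<Sum>n\<in>F. (cmod (apply_ell2 u n))\<^sup>2)"
  proof (cases "norm u \<le> e / 2")
    case True
    then have "(norm u)\<^sup>2 \<le> (e / 2)\<^sup>2" by (intro power_mono) auto
    then show ?thesis using that[of "{}"] by simp
  next
    case False
    define B where "B = sqrt ((norm u)\<^sup>2 - (e / 2)\<^sup>2)"
    have "(e / 2)\<^sup>2 \<le> (norm u)\<^sup>2" using False e by (intro power_mono) auto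
    then have B2: "B\<^sup>2 = (norm u)\<^sup>2 - (e / 2)\<^sup>2" "0 \<le> B" by (auto simp: B_def)
    have "\<exists>F. finite F \<and> B\<^sup>2 < (\<Sum>n\<in>F. (cmod (apply_ell2 u n))\<^sup>2)"
    proof (rule ccontr)
      assume "\<not> ?thesis"
      then have "norm u \<le> B" by (intro norm_ell2_le B2(2)) (auto simp: not_less)
      then have "(norm u)\<^sup>2 \<le> B\<^sup>2" by (intro power_mono) auto
      then show False using B2 e by simp
    qed
    then show ?thesis using that B2 by fastforce
  qed
  obtain M where M: "\<And>n. n \<in> F \<Longrightarrow> \<bar>n\<bar> \<le> int M"
    using finite_nat_set_iff_bounded_le[of "(\<lambda>n. nat \<bar>n\<bar>) ` F"] F(1) by (metis finite_imageI imageI nat_le_iff)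
  have "dist (proj_op {- int N..int N} u) u < e" if "M \<le> N" for N
  proof -
    define v where "v = u - proj_op {- int N..int N} u"
    have "norm v \<le> e / 2"
    proof (rule norm_ell2_le)
      fix G :: "int set" assume G: "finite G"
      have FN: "F \<subseteq> {- int N..int N}" using M that by (force simp: abs_le_iff)
      have "(\<Sum>n\<in>G. (cmod (apply_ell2 v n))\<^sup>2) = (\<Sum>n\<in>G. if n \<in> {- int N..int N} then 0 else (cmod (apply_ell2 u n))\<^sup>2)"
        by (intro sum.cong refl) (simp add: v_def)
      also have "\<dots> = (\<Sum>n\<in>G - {- int N..int N}. (cmod (apply_ell2 u n))\<^sup>2)"
        using G by (intro sum.mono_neutral_cong_right) auto
      also have "\<dots> = (\<Sum>n\<in>(G - {- int N..int N}) \<union> F. (cmod (apply_ell2 u n))\<^sup>2) - (\<Sum>n\<in>F. (cmod (apply_ell2 u n))\<^sup>2)"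
        using G F(1) FN by (subst sum.union_disjoint) auto
      also have "\<dots> \<le> (norm u)\<^sup>2 - ((norm u)\<^sup>2 - (e / 2)\<^sup>2)"
        using G F by (intro diff_mono sum_le_norm_ell2) auto
      finally show "(\<Sum>n\<in>G. (cmod (apply_ell2 v n))\<^sup>2) \<le> (e / 2)\<^sup>2" by simp
    qed (use e in simp)
    then show ?thesis using e by (simp add: v_def dist_norm norm_minus_commute)
  qed
  then show "\<exists>M. \<forall>N\<ge>M. dist (proj_op {- int N..int N} u) u < e" by blast
qed

lemma form_le_of_finite_supp:
  assumes "\<And>N u. supp_in {- int N..int N} u \<Longrightarrow> form H u \<le> \<mu> * (norm u)\<^sup>2"
  shows "form H u \<le> \<mu> * (norm u)\<^sup>2"
proof (rule LIMSEQ_le)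
  define v where "v N = proj_op {- int N..int N} u" for N
  have v: "v \<longlonglongrightarrow> u" unfolding v_def by (rule truncation_tendsto)
  show "(\<lambda>N. form H (v N)) \<longlonglongrightarrow> form H u" by (intro tendsto_intros v)
  show "(\<lambda>N. \<mu> * (norm (v N))\<^sup>2) \<longlonglongrightarrow> \<mu> * (norm u)\<^sup>2" by (intro tendsto_intros v)
  show "\<exists>N. \<forall>n\<ge>N. form H (v n) \<le> \<mu> * (norm (v n))\<^sup>2"
    by (intro exI allI impI assms) (auto simp: supp_in_def v_def)
qed

lemma inner_ell2_shift: "ell2_shift k u \<bullet> ell2_shift k v = u \<bullet> v"
  unfolding inner_ell2_def ell2_shift.rep_eq
  using infsum_reindex_bij_betw[of "\<lambda>n. n + k" UNIV UNIV "\<lambda>n. apply_ell2 u n \<bullet> apply_ell2 v n"]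
  by (simp add: bij_plus_right)

text \<open>Each site lies in \<open>l\<close> of the windows, each bond in only
  \<open>l - 1\<close> of them; the missing bonds make up the Laplacian term.\<close>

lemma sum_window_form:
  assumes u: "supp_in {- int N..int N} u" and l: "1 \<le> l"
  shows "(\<Sum>m\<in>{- int N - l + 1..int N}. form (schrodinger c V) (proj_op {m..<m + l} u))
     = of_int l * form (schrodinger c V) u - form laplacian u" (is "?L = ?R")
    and "(\<Sum>m\<in>{- int N - l + 1..int N}. (norm (proj_op {m..<m + l} u))\<^sup>2) = of_int l * (norm u)\<^sup>2" (is "?L' = ?R'")
proof -
  define S where "S = {- int N..int N}"
  define F where "F = {- int N - l + 1..int N}"
  define x where "x n = apply_ell2 u n" for n
  have fS: "finite S" "finite F" by (auto simp: S_def F_def)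
  have su: "supp_in S (proj_op {m..<m + l} u)" for m using u by (auto simp: supp_in_def S_def)
  have c0: "real (card {m \<in> F. n \<in> {m..<m + l}}) = of_int l" if "n \<in> S" for n
  proof -
    have "{m \<in> F. n \<in> {m..<m + l}} = {n - l + 1..n}" using that by (auto simp: F_def S_def)
    then show ?thesis using l by simp
  qed
  have c1: "real (card {m \<in> F. n \<in> {m..<m + l} \<and> n + 1 \<in> {m..<m + l}}) = of_int l - 1" if "n \<in> S" for n
  proof -
    have "{m \<in> F. n \<in> {m..<m + l} \<and> n + 1 \<in> {m..<m + l}} = {n - l + 2..n}" using that by (auto simp: F_def S_def)
    then show ?thesis using l by simp
  qed
  have c2: "real (card {m \<in> F. n \<in> {m..<m + l} \<and> n - 1 \<in> {m..<m + l}}) = of_int l - 1" if "n \<in> S" for n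
  proof -
    have "{m \<in> F. n \<in> {m..<m + l} \<and> n - 1 \<in> {m..<m + l}} = {n - l + 1..n - 1}" using that by (auto simp: F_def S_def)
    then show ?thesis using l by simp
  qed
  have ind: "(\<Sum>m\<in>F. if P m then (y::real) else 0) = real (card {m \<in> F. P m}) * y" for P y
    using fS by (simp add: sum.If_cases Int_def)
  have "?L = (\<Sum>m\<in>F. \<Sum>n\<in>S. (if n \<in> {m..<m + l} \<and> n + 1 \<in> {m..<m + l} then x n \<bullet> x (n + 1) else 0)
      + (if n \<in> {m..<m + l} \<and> n - 1 \<in> {m..<m + l} then x n \<bullet> x (n - 1) else 0)
      + (if n \<in> {m..<m + l} then c * apply_bcontfun V n * (cmod (x n))\<^sup>2 else 0))"
    unfolding F_def[symmetric]
  proof (intro sum.cong refl)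
    fix m
    have *: "y \<bullet> (of_real r * y) = r * (cmod y)\<^sup>2" for r and y :: complex
      by (simp add: scaleR_conv_of_real[symmetric] power2_norm_eq_inner)
    show "form (schrodinger c V) (proj_op {m..<m + l} u) = (\<Sum>n\<in>S. (if n \<in> {m..<m + l} \<and> n + 1 \<in> {m..<m + l} then x n \<bullet> x (n + 1) else 0)
      + (if n \<in> {m..<m + l} \<and> n - 1 \<in> {m..<m + l} then x n \<bullet> x (n - 1) else 0)
      + (if n \<in> {m..<m + l} then c * apply_bcontfun V n * (cmod (x n))\<^sup>2 else 0))"
      unfolding inner_commute[of "blinfun_apply (schrodinger c V) _"] inner_finite_supp[OF fS(1) su]
    proof (intro sum.cong refl)
      fix n
      show "apply_ell2 (proj_op {m..<m + l} u) n \<bullet> apply_ell2 (schrodinger c V (proj_op {m..<m + l} u)) n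
        = (if n \<in> {m..<m + l} \<and> n + 1 \<in> {m..<m + l} then x n \<bullet> x (n + 1) else 0)
      + (if n \<in> {m..<m + l} \<and> n - 1 \<in> {m..<m + l} then x n \<bullet> x (n - 1) else 0)
      + (if n \<in> {m..<m + l} then c * apply_bcontfun V n * (cmod (x n))\<^sup>2 else 0)"
        unfolding apply_schrodinger proj_op_apply x_def[symmetric]
        by (cases "n \<in> {m..<m + l}"; cases "n + 1 \<in> {m..<m + l}"; cases "n - 1 \<in> {m..<m + l}")
           (simp_all only: if_True if_False inner_add_right inner_zero_left inner_zero_right simp_thms add_0_left add_0_right mult_zero_right *)
    qed
  qed
  also have "\<dots> = (\<Sum>n\<in>S. (of_int l - 1) * (x n \<bullet> x (n + 1)) + (of_int l - 1) * (x n \<bullet> x (n - 1)) + of_int l * (c * apply_bcontfun V n * (cmod (x n))\<^sup>2))"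
    by (subst sum.swap) (intro sum.cong refl, simp only: sum.distrib ind c0 c1 c2)
  also have "\<dots> = ?R"
  proof -
    have 1: "form (schrodinger c V) u = (\<Sum>n\<in>S. x n \<bullet> x (n + 1) + x n \<bullet> x (n - 1) + c * apply_bcontfun V n * (cmod (x n))\<^sup>2)"
      unfolding inner_commute[of "blinfun_apply (schrodinger c V) _"] inner_finite_supp[OF fS(1) u[folded S_def]]
    proof (intro sum.cong refl)
      fix n
      have *: "x n \<bullet> (of_real r * x n) = r * (cmod (x n))\<^sup>2" for r
        by (simp add: scaleR_conv_of_real[symmetric] power2_norm_eq_inner)
      show "apply_ell2 u n \<bullet> apply_ell2 (schrodinger c V u) n = x n \<bullet> x (n + 1) + x n \<bullet> x (n - 1) + c * apply_bcontfun V n * (cmod (x n))\<^sup>2"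
        unfolding apply_schrodinger x_def[symmetric] inner_add_right * ..
    qed
    have 2: "form laplacian u = (\<Sum>n\<in>S. x n \<bullet> x (n + 1) + x n \<bullet> x (n - 1))"
      unfolding inner_commute[of "blinfun_apply laplacian _"] inner_finite_supp[OF fS(1) u[folded S_def]]
      by (intro sum.cong refl) (simp add: laplacian.rep_eq ell2_shift.rep_eq x_def inner_add_right)
    show ?thesis unfolding 1 2 sum_distrib_left sum_subtractf[symmetric]
      by (intro sum.cong refl) (simp add: algebra_simps)
  qed
  finally show "?L = ?R" .
  have "?L' = (\<Sum>m\<in>F. \<Sum>n\<in>S. if n \<in> {m..<m + l} then (cmod (x n))\<^sup>2 else 0)"
    unfolding F_def[symmetric] norm_finite_supp[OF fS(1) su] by (intro sum.cong refl) (simp add: x_def)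
  also have "\<dots> = (\<Sum>n\<in>S. of_int l * (cmod (x n))\<^sup>2)"
    by (subst sum.swap) (intro sum.cong refl, simp only: ind c0)
  also have "\<dots> = ?R'" using norm_finite_supp[OF fS(1) u[folded S_def]] by (simp add: sum_distrib_left x_def)
  finally show "?L' = ?R'" .
qed

lemma supp_in_shift: "supp_in S u \<Longrightarrow> supp_in {n. n + k \<in> S} (ell2_shift k u)"
  by (simp add: supp_in_def ell2_shift.rep_eq)

lemma schrodinger_shift:
  assumes "\<And>n. apply_bcontfun V (n + k) = apply_bcontfun V n"
  shows "schrodinger c V (ell2_shift k u) = ell2_shift k (schrodinger c V u)"
  by (rule ell2_eqI) (simp add: apply_schrodinger ell2_shift.rep_eq assms add.commute add.left_commute algebra_simps)

lemma int_periodic_mult: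
  fixes f :: "int \<Rightarrow> 'a" assumes "\<And>n. f (n + q) = f n" shows "f (n + k * q) = f n"
proof (induction k rule: int_induct[where k = 0])
  case (step1 i)
  then show ?case using assms[of "n + i * q"] by (simp add: algebra_simps)
next
  case (step2 i)
  then show ?case using assms[of "n + (i - 1) * q"] by (simp add: algebra_simps)
qed simp

text \<open>Averaging over all windows of length \<open>l\<close> loses only \<open>O(1/l)\<close> of the maximal energy.\<close>

lemma window_near_top:
  assumes top: "is_top (schrodinger c V) UNIV \<nu>" and per: "\<And>n. apply_bcontfun V (n + q) = apply_bcontfun V n" and q: "0 < q" and l: "1 \<le> l"
  shows "\<exists>u. supp_in {m..<m + l + q} u \<and> norm u = 1 \<and> \<nu> - 3 / of_int l \<le> form (schrodinger c V) u"
proof (rule ccontr)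
  assume contr: "\<not> ?thesis"
  \<comment> \<open>Two thirds of the loss \<open>3 / l\<close> pay for the bonds cut by the
    windows, since the Laplacian form is at most 2; the last \<open>1 / l\<close> is the slack of
    the near maximizer in the contradiction.\<close>
  define \<mu> where "\<mu> = \<nu> - 3 / of_int l"
  define H where "H = schrodinger c V"
  have 1: "form H u \<le> \<mu> * (norm u)\<^sup>2" if "supp_in {m..<m + l + q} u" for u
  proof (cases "u = 0")
    case False
    have "form H ((1 / norm u) *\<^sub>R u) < \<mu>"
    proof -
      define w where "w = (1 / norm u) *\<^sub>R u"
      have "supp_in {m..<m + l + q} w" "norm w = 1" using False supp_in_scaleR[OF that] by (simp_all add: w_def)
      then have "\<not> \<nu> - 3 / of_int l \<le> form (schrodinger c V) w" using contr by blast
      then show ?thesis by (simp add: w_def[symmetric] \<mu>_def H_def)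
    qed
    then show ?thesis using False by (simp only: form_scaleR) (simp add: power_divide field_simps)
  qed simp
  have 2: "form H u \<le> \<mu> * (norm u)\<^sup>2" if u: "supp_in {m'..<m' + l} u" for m' u
  proof -
    \<comment> \<open>A shift by a multiple of the period moves any window of length
      \<open>l\<close> into the prescribed one, which is longer by \<open>q\<close>.\<close>
    define k where "k = (m' - m) div q"
    have k: "m \<le> m' - k * q" "m' - k * q < m + q"
      unfolding k_def using pos_mod_sign[OF q, of "m' - m"] pos_mod_bound[OF q, of "m' - m"] div_mult_mod_eq[of "m' - m" q] by linarith+
    have "supp_in {m..<m + l + q} (ell2_shift (k * q) u)"
      by (rule supp_in_mono[OF supp_in_shift[OF u]]) (use k in auto)
    from 1[OF this] show ?thesis
      unfolding H_def using schrodinger_shift[of V "k * q" c u] int_periodic_mult[of "apply_bcontfun V" q _ k] per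
      by (simp add: inner_ell2_shift norm_ell2_shift)
  qed
  have "form H u \<le> (\<mu> + 2 / of_int l) * (norm u)\<^sup>2" for u
  proof (rule form_le_of_finite_supp)
    fix N u assume u: "supp_in {- int N..int N} u"
    have "of_int l * form H u - form laplacian u \<le> \<mu> * (of_int l * (norm u)\<^sup>2)"
      unfolding H_def sum_window_form(1)[OF u l, symmetric] sum_window_form(2)[OF u l, symmetric] sum_distrib_left
      by (intro sum_mono 2[unfolded H_def]) (auto simp: supp_in_def)
    moreover have "form laplacian u \<le> 2 * (norm u)\<^sup>2"
    proof -
      have "form laplacian u \<le> norm (blinfun_apply laplacian u) * norm u" by (rule norm_cauchy_schwarz)
      also have "\<dots> \<le> (2 * norm u) * norm u" by (intro mult_right_mono norm_laplacian_le) simp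
      finally show ?thesis by (simp add: power2_eq_square)
    qed
    moreover have "of_int l * ((\<mu> + 2 / of_int l) * (norm u)\<^sup>2) = \<mu> * (of_int l * (norm u)\<^sup>2) + 2 * (norm u)\<^sup>2"
      using l by (simp add: field_simps)
    ultimately have "of_int l * form H u \<le> of_int l * ((\<mu> + 2 / of_int l) * (norm u)\<^sup>2)" by linarith
    then show "form H u \<le> (\<mu> + 2 / of_int l) * (norm u)\<^sup>2" using l by simp
  qed
  moreover obtain u where "norm u = 1" "\<nu> - 1 / of_int l < form H u"
    using is_top_near[OF top, of "1 / of_int l"] l unfolding H_def by auto
  ultimately have "\<nu> - 1 / of_int l < \<mu> + 2 / of_int l" by (metis less_le_trans mult.right_neutral one_power2)
  then show False using l by (simp add: \<mu>_def field_simps)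
qed

section \<open>Cut-offs and decoupling of distant pieces\<close>

definition cut_op :: "(int \<Rightarrow> real) \<Rightarrow> ell2 \<Rightarrow>\<^sub>L ell2" where
  "cut_op J = mult_op (bfun (\<lambda>n. complex_of_real (J n)))"

lemma cut_op_apply:
  assumes "\<And>n. \<bar>J n\<bar> \<le> 1" shows "apply_ell2 (cut_op J u) n = of_real (J n) * apply_ell2 u n"
  using bfun_apply[of "\<lambda>n. complex_of_real (J n)" 1 n] assms by (simp add: cut_op_def)

lemma norm_cut_op_le: assumes "\<And>n. \<bar>J n\<bar> \<le> 1" shows "norm (cut_op J u) \<le> norm u"
  by (rule norm_ell2_mono) (use assms in \<open>simp add: cut_op_apply norm_mult mult_left_le_one_le\<close>)

text \<open>The potential commutes with the cut-off, so the commutator contains only the increments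
  of \<open>J\<close>, once for each neighbour.\<close>

lemma cut_op_residual:
  assumes J: "\<And>n. \<bar>J n\<bar> \<le> 1" and \<eta>: "\<And>n. \<bar>J (n + 1) - J n\<bar> \<le> \<eta>"
  shows "norm (schrodinger c V (cut_op J u) - E *\<^sub>R cut_op J u)
     \<le> norm (cut_op J (schrodinger c V u - E *\<^sub>R u)) + 2 * \<eta> * norm u"
proof -
  define b1 where "b1 = bfun (\<lambda>n. complex_of_real (J (n + 1) - J n))"
  define b2 where "b2 = bfun (\<lambda>n. complex_of_real (J (n - 1) - J n))"
  have \<eta>0: "0 \<le> \<eta>" using \<eta>[of 0] by linarith
  have \<eta>': "\<bar>J (n - 1) - J n\<bar> \<le> \<eta>" for n using \<eta>[of "n - 1"] by (simp add: abs_minus_commute)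
  have b1: "apply_bcontfun b1 n = of_real (J (n + 1) - J n)" for n
    unfolding b1_def by (rule bfun_apply[where C = \<eta>]) (simp only: norm_of_real \<eta>)
  have b2: "apply_bcontfun b2 n = of_real (J (n - 1) - J n)" for n
    unfolding b2_def by (rule bfun_apply[where C = \<eta>]) (simp only: norm_of_real \<eta>')
  have eq: "schrodinger c V (cut_op J u) - E *\<^sub>R cut_op J u
     = cut_op J (schrodinger c V u - E *\<^sub>R u)
       + (mult_op b1 (ell2_shift 1 u) + mult_op b2 (ell2_shift (-1) u))"
    by (rule ell2_eqI) (simp add: cut_op_apply[OF J] apply_schrodinger b1 b2 ell2_shift.rep_eq scaleR_conv_of_real algebra_simps)
  have "norm (mult_op b1 (ell2_shift 1 u)) \<le> \<eta> * norm u"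
    using norm_mult_op_le[of b1 \<eta> "ell2_shift 1 u"] \<eta> \<eta>0 by (simp add: b1 norm_ell2_shift del: of_real_diff)
  moreover have "norm (mult_op b2 (ell2_shift (-1) u)) \<le> \<eta> * norm u"
    using norm_mult_op_le[of b2 \<eta> "ell2_shift (-1) u"] \<eta>' \<eta>0 by (simp add: b2 norm_ell2_shift del: of_real_diff)
  ultimately show ?thesis unfolding eq
    using norm_triangle_ineq[of "cut_op J (schrodinger c V u - E *\<^sub>R u)"
        "mult_op b1 (ell2_shift 1 u) + mult_op b2 (ell2_shift (-1) u)"]
      norm_triangle_ineq[of "mult_op b1 (ell2_shift 1 u)" "mult_op b2 (ell2_shift (-1) u)"]
    by linarith
qed

text \<open>The operator spreads a piece of radius \<open>\<rho>\<close> to radius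
  \<open>\<rho> + 1\<close>. Centres at distance \<open>2 * \<rho> + 3\<close> make these enlarged
  pieces disjoint, so the squares of the bounds for the single pieces add up.\<close>

lemma separated_pieces_bound:
  assumes C: "\<And>p p'. p \<in> C \<Longrightarrow> p' \<in> C \<Longrightarrow> p \<noteq> p' \<Longrightarrow> 2 * \<rho> + 3 \<le> \<bar>p - p'\<bar>" and D: "0 \<le> D"
    and piece: "\<And>p w. p \<in> C \<Longrightarrow> supp_in {p - \<rho>..p + \<rho>} w \<Longrightarrow> norm w \<le> D * norm (schrodinger c V w - E *\<^sub>R w)"
    and v: "supp_in (\<Union>p\<in>C. {p - \<rho>..p + \<rho>}) v"
  shows "norm v \<le> D * norm (schrodinger c V v - E *\<^sub>R v)"
proof (rule norm_ell2_le)
  define T where "T = (\<lambda>v. schrodinger c V v - E *\<^sub>R v)"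
  define w where "w p = proj_op {p - \<rho>..p + \<rho>} v" for p
  define I where "I p = {p - \<rho> - 1..p + \<rho> + 1}" for p :: int
  have v0: "apply_ell2 v n = 0" if "n \<in> I p" "n \<notin> {p - \<rho>..p + \<rho>}" "p \<in> C" for n p
  proof -
    have "n \<notin> (\<Union>p\<in>C. {p - \<rho>..p + \<rho>})"
    proof
      assume "n \<in> (\<Union>p\<in>C. {p - \<rho>..p + \<rho>})"
      then obtain p' where "p' \<in> C" "n \<in> {p' - \<rho>..p' + \<rho>}" by blast
      then show False using C[OF that(3), of p'] that by (cases "p = p'") (auto simp: I_def)
    qed
    then show ?thesis using v by (auto simp: supp_in_def)
  qed
  have v00: "apply_ell2 v n = 0" if "n \<in> {p - \<rho> - 2..p + \<rho> + 2}" "n \<notin> {p - \<rho>..p + \<rho>}" "p \<in> C" for n p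
  proof -
    have "n \<notin> (\<Union>p\<in>C. {p - \<rho>..p + \<rho>})"
    proof
      assume "n \<in> (\<Union>p\<in>C. {p - \<rho>..p + \<rho>})"
      then obtain p' where "p' \<in> C" "n \<in> {p' - \<rho>..p' + \<rho>}" by blast
      then show False using C[OF that(3), of p'] that by (cases "p = p'") auto
    qed
    then show ?thesis using v by (auto simp: supp_in_def)
  qed
  have Tw: "T (w p) = proj_op (I p) (T v)" if p: "p \<in> C" for p
  proof (rule ell2_eqI)
    fix n
    have wv: "apply_ell2 (w p) k = apply_ell2 v k" if "n \<in> I p" "\<bar>k - n\<bar> \<le> 1" for k
      using v00[of k p] p that by (auto simp: w_def I_def)
    have w0: "apply_ell2 (w p) k = 0" if "n \<notin> I p" "\<bar>k - n\<bar> \<le> 1" for k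
      using that by (auto simp: w_def I_def)
    show "apply_ell2 (T (w p)) n = apply_ell2 (proj_op (I p) (T v)) n"
      using wv[of n] wv[of "n + 1"] wv[of "n - 1"] w0[of n] w0[of "n + 1"] w0[of "n - 1"]
      by (auto simp: T_def apply_schrodinger)
  qed
  fix F :: "int set" assume F: "finite F"
  define CF where "CF = {p \<in> C. \<exists>n\<in>F. n \<in> {p - \<rho>..p + \<rho>}}"
  have fin: "finite CF"
  proof (rule finite_subset)
    show "CF \<subseteq> (\<Union>n\<in>F. {n - \<rho>..n + \<rho>})" by (force simp: CF_def)
  qed (use F in auto)
  have disj: "I p \<inter> I p' = {}" if "p \<in> CF" "p' \<in> CF" "p \<noteq> p'" for p p'
    using C[of p p'] that by (auto simp: I_def CF_def)
  have nw: "(norm (w p))\<^sup>2 \<le> D\<^sup>2 * (\<Sum>n\<in>I p. (cmod (apply_ell2 (T v) n))\<^sup>2)" if p: "p \<in> CF" for p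
  proof -
    have pC: "p \<in> C" using p by (simp add: CF_def)
    have "norm (w p) \<le> D * norm (T (w p))" unfolding T_def by (rule piece[OF pC]) (auto simp: w_def supp_in_def)
    then have "(norm (w p))\<^sup>2 \<le> (D * norm (T (w p)))\<^sup>2" by (intro power_mono) auto
    also have "\<dots> = D\<^sup>2 * (\<Sum>n\<in>I p. (cmod (apply_ell2 (T v) n))\<^sup>2)"
      unfolding power_mult_distrib Tw[OF pC]
      by (subst norm_finite_supp[of "I p"]) (auto simp: I_def supp_in_def)
    finally show ?thesis .
  qed
  have "(\<Sum>n\<in>F. (cmod (apply_ell2 v n))\<^sup>2) \<le> (\<Sum>n\<in>(\<Union>p\<in>CF. {p - \<rho>..p + \<rho>}). (cmod (apply_ell2 v n))\<^sup>2)"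
  proof -
    have "(\<Sum>n\<in>F. (cmod (apply_ell2 v n))\<^sup>2) = (\<Sum>n\<in>F \<inter> (\<Union>p\<in>CF. {p - \<rho>..p + \<rho>}). (cmod (apply_ell2 v n))\<^sup>2)"
    proof (intro sum.mono_neutral_right ballI)
      fix n assume n: "n \<in> F - F \<inter> (\<Union>p\<in>CF. {p - \<rho>..p + \<rho>})"
      have "n \<notin> (\<Union>p\<in>C. {p - \<rho>..p + \<rho>})"
      proof
        assume "n \<in> (\<Union>p\<in>C. {p - \<rho>..p + \<rho>})"
        then obtain p where p: "p \<in> C" "n \<in> {p - \<rho>..p + \<rho>}" by blast
        then have "p \<in> CF" using n by (auto simp: CF_def)
        then show False using n p by blast
      qed
      then show "(cmod (apply_ell2 v n))\<^sup>2 = 0" using v by (simp add: supp_in_def)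
    qed (use F in auto)
    also have "\<dots> \<le> (\<Sum>n\<in>(\<Union>p\<in>CF. {p - \<rho>..p + \<rho>}). (cmod (apply_ell2 v n))\<^sup>2)"
      using fin by (intro sum_mono2) auto
    finally show ?thesis .
  qed
  also have "\<dots> = (\<Sum>p\<in>CF. \<Sum>n\<in>{p - \<rho>..p + \<rho>}. (cmod (apply_ell2 v n))\<^sup>2)"
  proof (intro sum.UNION_disjoint fin ballI impI)
    fix p p' assume "p \<in> CF" "p' \<in> CF" "p \<noteq> p'"
    from disj[OF this] show "{p - \<rho>..p + \<rho>} \<inter> {p' - \<rho>..p' + \<rho>} = {}" unfolding I_def by force
  qed auto
  also have "\<dots> = (\<Sum>p\<in>CF. (norm (w p))\<^sup>2)"
  proof (intro sum.cong refl)
    fix p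
    have "(norm (w p))\<^sup>2 = (\<Sum>n\<in>{p - \<rho>..p + \<rho>}. (cmod (apply_ell2 (w p) n))\<^sup>2)"
      by (rule norm_finite_supp) (auto simp: w_def supp_in_def)
    then show "(\<Sum>n\<in>{p - \<rho>..p + \<rho>}. (cmod (apply_ell2 v n))\<^sup>2) = (norm (w p))\<^sup>2" by (simp add: w_def)
  qed
  also have "\<dots> \<le> (\<Sum>p\<in>CF. D\<^sup>2 * (\<Sum>n\<in>I p. (cmod (apply_ell2 (T v) n))\<^sup>2))" by (intro sum_mono nw)
  also have "\<dots> = D\<^sup>2 * (\<Sum>n\<in>(\<Union>p\<in>CF. I p). (cmod (apply_ell2 (T v) n))\<^sup>2)"
    using fin disj by (subst sum.UNION_disjoint) (auto simp: I_def sum_distrib_left)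
  also have "\<dots> \<le> D\<^sup>2 * (norm (T v))\<^sup>2"
    using fin by (intro mult_left_mono sum_le_norm_ell2) (auto simp: I_def)
  finally show "(\<Sum>n\<in>F. (cmod (apply_ell2 v n))\<^sup>2) \<le> (D * norm (schrodinger c V v - E *\<^sub>R v))\<^sup>2"
    by (simp add: T_def power_mult_distrib)
qed (use D in simp)

section \<open>The gap below the top level of a single well\<close>

lemma proj_op_inner: "proj_op S u \<bullet> u = (norm (proj_op S u))\<^sup>2"
  unfolding power2_norm_eq_inner inner_ell2_def by (rule infsum_cong) simp

text \<open>Raising \<open>V\<close> by \<open>d\<close> on a core long enough to hold a near
  maximizer of \<open>V\<close> lifts the top level by almost \<open>c * d\<close>, even with the
  site 0 removed. Restoring the site 0 lifts it once more: a nonnegative near maximizer on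
  \<open>S - {0}\<close> has most of its mass in the core, so by the Harnack inequality it is not
  small next to 0, and the bonds to 0 yield energy. All bounds depend only on \<open>K\<close> and
  \<open>l\<close>, hence hold uniformly in \<open>V\<close>.\<close>

lemma core_gap:
  fixes q l0 l :: int
  assumes per: "\<And>n. apply_bcontfun V (n + q) = apply_bcontfun V n" and q: "0 < q"
    and U: "\<And>n. apply_bcontfun U n = apply_bcontfun V n + (if \<bar>n\<bar> \<le> l then d else 0)"
    and cd: "0 < c" "0 < d" and top: "is_top (schrodinger c V) UNIV \<nu>"
    and K: "norm (schrodinger c U) \<le> K" "1 \<le> K" "\<And>n. \<bar>c * apply_bcontfun U n\<bar> \<le> K"
    and l: "l = l0 + q" "1 \<le> l0" "3 / of_int l0 \<le> c * d / 16"
    and S: "{- l - 1..l + 1} \<subseteq> S"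
    and E1: "is_top (schrodinger c U) S E\<^sub>1" "\<bar>E\<^sub>1\<bar> \<le> K" and E0: "is_top (schrodinger c U) (S - {0}) E\<^sub>0" "\<bar>E\<^sub>0\<bar> \<le> K"
  shows "\<nu> + 15 / 16 * (c * d) \<le> E\<^sub>0"
    and "E\<^sub>0 + (1 / ((2 * K) ^ nat l * (4 * sqrt (of_int l))))\<^sup>2 / (4 * K) \<le> E\<^sub>1"
proof -
  define H where "H = schrodinger c U"
  have l1: "1 \<le> l" using l q by simp
  define core where "core = {- l..l}"
  have HU: "blinfun_apply H u = schrodinger c V u + (c * d) *\<^sub>R proj_op core u" for u
    by (rule ell2_eqI) (auto simp: H_def core_def apply_schrodinger U abs_le_iff scaleR_conv_of_real algebra_simps)
  have form_eq: "form H u = form (schrodinger c V) u + (c * d) * (norm (proj_op core u))\<^sup>2" for u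
    by (simp add: HU inner_add_left proj_op_inner)
  \<comment> \<open>The trial vector lies to the right of 0 and, as \<open>l = l0 + q\<close>,
    inside the core; so it gains the full \<open>c * d\<close> and serves for \<open>S - {0}\<close>
    as well.\<close>
  obtain u where u: "supp_in {1..<1 + l0 + q} u" "norm u = 1" "\<nu> - 3 / of_int l0 \<le> form (schrodinger c V) u"
    using window_near_top[OF top per q l(2), of 1] by blast
  have "proj_op core u = u"
  proof (rule ell2_eqI)
    fix n
    have "apply_ell2 u n = 0" if "n \<notin> core"
    proof -
      have "n \<notin> {1..<1 + l0 + q}" using that l by (auto simp: core_def)
      then show ?thesis using u(1) by (simp add: supp_in_def)
    qed
    then show "apply_ell2 (proj_op core u) n = apply_ell2 u n" by simp
  qed
  then have "form H u = form (schrodinger c V) u + c * d" using form_eq[of u] u(2) by simp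
  moreover have "supp_in (S - {0}) u" by (rule supp_in_mono[OF u(1)]) (use S l in auto)
  ultimately show E0low: "\<nu> + 15 / 16 * (c * d) \<le> E\<^sub>0"
    using is_top_le[OF E0(1), of u] u(2,3) l(3) by (simp add: H_def)
  define M where "M = 2 * K"
  have M: "1 \<le> M" using K by (simp add: M_def)
  \<comment> \<open>Half of what the Harnack chain yields: some core site carries at least
    \<open>1 / (2 * sqrt l)\<close>, and fewer than \<open>l\<close> steps, each costing a factor
    \<open>M\<close>, lead from it to a neighbour of 0. The other half absorbs the accumulated
    errors \<open>l * \<epsilon>\<close>.\<close>
  define w where "w = 1 / (M ^ nat l * (4 * sqrt (of_int l)))"
  have w: "0 < w" using M l1 by (simp add: w_def)
  define \<tau> where "\<tau> = min (c * d / 16) (min (w\<^sup>2 / (4 * K)) (w\<^sup>2 / (2 * K * (of_int l)\<^sup>2)))"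
  have \<tau>: "0 < \<tau>" "\<tau> \<le> c * d / 16" "\<tau> \<le> w\<^sup>2 / (4 * K)" "\<tau> \<le> w\<^sup>2 / (2 * K * (of_int l)\<^sup>2)"
    using cd w K l1 by (auto simp: \<tau>_def)
  define \<epsilon> where "\<epsilon> = sqrt (2 * K * \<tau>)"
  have \<epsilon>0: "0 \<le> \<epsilon>" using K \<tau> by (simp add: \<epsilon>_def)
  have \<epsilon>: "of_int l * \<epsilon> \<le> w"
  proof -
    have "(of_int l * \<epsilon>)\<^sup>2 = (of_int l)\<^sup>2 * (2 * K * \<tau>)" using K \<tau> by (simp add: \<epsilon>_def power_mult_distrib)
    also have "\<dots> \<le> w\<^sup>2" using \<tau>(4) K l1 by (simp add: field_simps)
    finally show ?thesis using w by (intro power2_le_imp_le[of "of_int l * \<epsilon>" w]) auto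
  qed
  obtain z where z: "supp_in (S - {0}) z" "norm z = 1" "nonneg_ell2 z" "E\<^sub>0 - \<tau> < form H z"
    using is_top_near[OF E0(1) \<tau>(1)] unfolding H_def by metis
  define x where "x n = Re (apply_ell2 z n)" for n
  have x0: "0 \<le> x n" for n using nonneg_Re[OF z(3)] by (simp add: x_def)
  have xz: "apply_ell2 z n = of_real (x n)" for n
    using nonneg_real_ell2[OF z(3)] by (simp add: x_def real_ell2_def complex_eq_iff)
  have z0: "x 0 = 0" using z(1) by (simp add: supp_in_def x_def)
  have step: "x (n + 1) + x (n - 1) \<le> M * x n + \<epsilon>" if "n \<in> S" "n \<noteq> 0" for n
    using near_top_residual_site[OF K(1) E0(1) E0(2) K(3) z(1,2,3), of \<tau> n] z(4) that
    by (simp add: x_def M_def \<epsilon>_def H_def)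
  \<comment> \<open>Off the core the energy is only that of \<open>V\<close>, at most
    \<open>\<nu>\<close>. An energy near \<open>\<nu> + 15 / 16 * (c * d)\<close> is impossible with
    less than \<open>14 / 16\<close> of the mass in the core.\<close>
  have mass: "1 / 2 \<le> (\<Sum>n\<in>core. (x n)\<^sup>2)"
  proof -
    have "(norm (proj_op core z))\<^sup>2 = (\<Sum>n\<in>core. (x n)\<^sup>2)"
      by (subst norm_finite_supp[of core]) (auto simp: core_def supp_in_def xz)
    moreover have "form (schrodinger c V) z \<le> \<nu>" using is_top_le[OF top, of z] z(2) by (simp add: supp_in_def)
    moreover have "E\<^sub>0 - \<tau> \<le> form (schrodinger c V) z + (c * d) * (norm (proj_op core z))\<^sup>2"
      using z(4) form_eq[of z] by simp
    ultimately have "c * d * (14 / 16) \<le> c * d * (\<Sum>n\<in>core. (x n)\<^sup>2)" using E0low \<tau>(2) by (simp add: algebra_simps)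
    then have "14 / 16 \<le> (\<Sum>n\<in>core. (x n)\<^sup>2)" using cd by (simp add: mult_le_cancel_left_pos)
    then show ?thesis by simp
  qed
  \<comment> \<open>The mass at least 1/2 is shared by \<open>2 * l\<close> sites, as
    \<open>z\<close> vanishes at 0.\<close>
  have "\<exists>n\<in>core. n \<noteq> 0 \<and> 1 / (4 * of_int l) \<le> (x n)\<^sup>2"
  proof (rule ccontr)
    assume "\<not> ?thesis"
    then have lt: "(x n)\<^sup>2 < 1 / (4 * of_int l)" if "n \<in> core - {0}" for n using that by force
    have "(\<Sum>n\<in>core. (x n)\<^sup>2) = (\<Sum>n\<in>core - {0}. (x n)\<^sup>2)"
      by (intro sum.mono_neutral_right) (auto simp: core_def z0)
    also have "\<dots> < (\<Sum>n\<in>core - {0}. 1 / (4 * of_int l))"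
    proof (rule sum_strict_mono)
      have "1 \<in> core - {0}" using l1 by (simp add: core_def)
      then show "core - {0} \<noteq> {}" by blast
    qed (use lt in \<open>auto simp: core_def\<close>)
    also have "\<dots> = 1 / 2" using l1 by (simp add: core_def card_Diff_singleton)
    finally show False using mass by simp
  qed
  then obtain n where n: "n \<in> core" "n \<noteq> 0" "1 / (4 * of_int l) \<le> (x n)\<^sup>2" by blast
  have xn: "1 / (2 * sqrt (of_int l)) \<le> x n"
  proof (rule power2_le_imp_le)
    show "(1 / (2 * sqrt (of_int l)))\<^sup>2 \<le> (x n)\<^sup>2" using n(3) l1 by (simp add: power_divide power_mult_distrib)
  qed (rule x0)
  have chain: "x n \<le> M ^ nat l * (x 1 + x (-1) + of_int l * \<epsilon>)"
  proof (cases "n > 0")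
    case True
    define f where "f i = x (1 + int i)" for i :: nat
    define k where "k = nat (n - 1)"
    have kl: "k \<le> nat l" "int k \<le> l" "n = 1 + int k" using True n(1) by (auto simp: k_def core_def)
    have "f k \<le> M ^ k * (f 0 + real k * \<epsilon>)"
    proof (rule growth_chain[OF _ M \<epsilon>0])
      fix i assume "i < k"
      then have "1 + int i \<in> S" using S kl by auto
      from step[OF this] show "f (Suc i) \<le> M * f i + \<epsilon>" using x0[of "int i"] by (simp add: f_def add.commute)
    qed
    also have "\<dots> \<le> M ^ nat l * (x 1 + x (-1) + of_int l * \<epsilon>)"
    proof (rule mult_mono)
      show "M ^ k \<le> M ^ nat l" using M kl by (intro power_increasing)
      have "real k * \<epsilon> \<le> of_int l * \<epsilon>" using kl \<epsilon>0 by (intro mult_right_mono) linarith+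
      then show "f 0 + real k * \<epsilon> \<le> x 1 + x (-1) + of_int l * \<epsilon>" using x0[of 1] x0[of "-1"] by (simp add: f_def)
      show "0 \<le> f 0 + real k * \<epsilon>" using x0[of "1"] \<epsilon>0 by (simp add: f_def)
    qed (use M in simp)
    finally show ?thesis using kl by (simp add: f_def)
  next
    case False
    define f where "f i = x (- 1 - int i)" for i :: nat
    define k where "k = nat (- n - 1)"
    have kl: "k \<le> nat l" "int k \<le> l" "n = - 1 - int k" using False n(1,2) by (auto simp: k_def core_def)
    have "f k \<le> M ^ k * (f 0 + real k * \<epsilon>)"
    proof (rule growth_chain[OF _ M \<epsilon>0])
      fix i assume "i < k"
      then have "- 1 - int i \<in> S" using S kl by auto
      from step[OF this] show "f (Suc i) \<le> M * f i + \<epsilon>" using x0[of "- int i"] by (simp add: f_def algebra_simps)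
    qed
    also have "\<dots> \<le> M ^ nat l * (x 1 + x (-1) + of_int l * \<epsilon>)"
    proof (rule mult_mono)
      show "M ^ k \<le> M ^ nat l" using M kl by (intro power_increasing)
      have "real k * \<epsilon> \<le> of_int l * \<epsilon>" using kl \<epsilon>0 by (intro mult_right_mono) linarith+
      then show "f 0 + real k * \<epsilon> \<le> x 1 + x (-1) + of_int l * \<epsilon>" using x0[of 1] x0[of "-1"] by (simp add: f_def)
      show "0 \<le> f 0 + real k * \<epsilon>" using x0[of "-1"] \<epsilon>0 by (simp add: f_def)
    qed (use M in simp)
    finally show ?thesis using kl by (simp add: f_def)
  qed
  have Mp: "0 < M ^ nat l" using M by simp
  have "2 * w \<le> x 1 + x (-1) + of_int l * \<epsilon>"
  proof -
    have "M ^ nat l * (2 * w) = 1 / (2 * sqrt (of_int l))" using Mp M l1 by (simp add: w_def field_simps)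
    then have "M ^ nat l * (2 * w) \<le> M ^ nat l * (x 1 + x (-1) + of_int l * \<epsilon>)" using xn chain by simp
    then show ?thesis using Mp by (simp add: mult_le_cancel_left_pos)
  qed
  then have xx: "w \<le> x 1 + x (-1)" using \<epsilon> by simp
  \<comment> \<open>Adding \<open>s\<close> times the unit vector at 0 gains
    \<open>2 * s * w\<close> through the two bonds and loses at most
    \<open>2 * K * s\<^sup>2\<close>; this \<open>s\<close> is optimal.\<close>
  define s where "s = w / (2 * K)"
  define y where "y = z + s *\<^sub>R ell2_delta 0"
  have zd: "z \<bullet> ell2_delta 0 = 0" using z0 by (simp add: inner_ell2_delta x_def)
  have S0: "0 \<in> S" using S l1 by auto
  have "supp_in S y" unfolding y_def using z(1) S0 by (intro supp_in_add supp_in_scaleR supp_in_delta) (auto simp: supp_in_def)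
  moreover have ny: "(norm y)\<^sup>2 = 1 + s\<^sup>2"
  proof -
    have "z \<bullet> z = 1" using z(2) by (simp add: power2_norm_eq_inner[symmetric])
    moreover have "ell2_delta 0 \<bullet> ell2_delta 0 = 1" by (simp add: power2_norm_eq_inner[symmetric])
    ultimately show ?thesis using zd inner_commute[of "ell2_delta 0" z]
      unfolding power2_norm_eq_inner y_def by (simp add: inner_add power2_eq_square)
  qed
  ultimately have up: "form H y \<le> E\<^sub>1 * (1 + s\<^sup>2)" using is_top_le[OF E1(1), of y] by (simp add: H_def)
  have "form H y = form H z + 2 * s * (blinfun_apply H z \<bullet> ell2_delta 0) + s\<^sup>2 * form H (ell2_delta 0)"
    using hermitian_op_sym[OF hermitian_schrodinger, of c U "ell2_delta 0" z, folded H_def] inner_commute[of "ell2_delta 0" "blinfun_apply H z"]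
    by (simp add: y_def blinfun.bilinear_simps inner_add power2_eq_square algebra_simps)
  moreover have "blinfun_apply H z \<bullet> ell2_delta 0 = x 1 + x (-1)"
    by (simp add: inner_ell2_delta H_def apply_schrodinger x_def z0[unfolded x_def])
  moreover have "- K \<le> form H (ell2_delta 0)" using abs_form_le[OF K(1), of "ell2_delta 0"] by (simp add: H_def abs_le_iff)
  moreover have "s\<^sup>2 * (- K) \<le> s\<^sup>2 * form H (ell2_delta 0)" using calculation(3) by (intro mult_left_mono) auto
  moreover have "2 * s * w \<le> 2 * s * (x 1 + x (-1))" using xx w K by (intro mult_left_mono) (auto simp: s_def)
  moreover have "E\<^sub>1 * s\<^sup>2 \<le> K * s\<^sup>2" using E1(2) by (intro mult_right_mono) (auto simp: abs_le_iff)
  ultimately have "E\<^sub>0 - \<tau> + 2 * s * w - K * s\<^sup>2 \<le> E\<^sub>1 + K * s\<^sup>2" using up z(4) by (simp add: algebra_simps)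
  moreover have "2 * s * w - 2 * (K * s\<^sup>2) = w\<^sup>2 / (2 * K)" using K(2) by (simp add: s_def power2_eq_square field_simps)
  moreover have "w\<^sup>2 / (2 * K) = w\<^sup>2 / (4 * K) + w\<^sup>2 / (4 * K)" using K(2) by (simp add: field_simps)
  ultimately have "E\<^sub>0 + w\<^sup>2 / (4 * K) \<le> E\<^sub>1" using \<tau>(3) by linarith
  then show "E\<^sub>0 + (1 / ((2 * K) ^ nat l * (4 * sqrt (of_int l))))\<^sup>2 / (4 * K) \<le> E\<^sub>1" by (simp add: w_def M_def)
qed

lift_definition ell2_Re :: "ell2 \<Rightarrow> ell2" is "\<lambda>u n. of_real (Re (u n))"
  by (erule summable_on_comparison_test) (auto simp: abs_Re_le_cmod abs_le_square_iff[symmetric] intro!: power_mono)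

lift_definition ell2_Im :: "ell2 \<Rightarrow> ell2" is "\<lambda>u n. of_real (Im (u n))"
  by (erule summable_on_comparison_test) (auto simp: abs_Im_le_cmod abs_le_square_iff[symmetric] intro!: power_mono)

lemma norm_Re_Im: "(norm u)\<^sup>2 = (norm (ell2_Re u))\<^sup>2 + (norm (ell2_Im u))\<^sup>2"
proof -
  have "(\<Sum>\<^sub>\<infinity>n. (cmod (apply_ell2 u n))\<^sup>2) = (\<Sum>\<^sub>\<infinity>n. (cmod (apply_ell2 (ell2_Re u) n))\<^sup>2 + (cmod (apply_ell2 (ell2_Im u) n))\<^sup>2)"
    by (intro infsum_cong) (simp add: ell2_Re.rep_eq ell2_Im.rep_eq cmod_power2)
  then show ?thesis unfolding norm_ell2_power2 by (simp add: infsum_add ell2_summable)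
qed

text \<open>The operator is real, so real and imaginary parts can be treated separately and their
  squared norms added.\<close>

lemma spectral_gap_complement_complex:
  assumes K: "norm (schrodinger c V) \<le> K" "0 < K"
    and top: "is_top (schrodinger c V) S E\<^sub>1" "\<bar>E\<^sub>1\<bar> \<le> K" and E\<^sub>0: "is_top (schrodinger c V) (S - {0}) E\<^sub>0"
    and g: "0 < g" "E\<^sub>0 + g \<le> E\<^sub>1" and E: "E\<^sub>0 + g / 2 \<le> E" "b \<le> \<bar>E - E\<^sub>1\<bar>" "0 < b"
    and u: "supp_in S u"
  shows "norm u \<le> (8 / g + 4 / b) * norm (schrodinger c V u - E *\<^sub>R u)"
proof -
  define T where "T v = schrodinger c V v - E *\<^sub>R v" for v
  define D where "D = 8 / g + 4 / b"
  have D: "0 \<le> D" using g E by (simp add: D_def)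
  have r: "norm v \<le> D * norm (T v)" if "supp_in S v" "real_ell2 v" for v
    unfolding T_def D_def
    by (rule spectral_gap_complement[OF hermitian_schrodinger K top is_top_le[OF E\<^sub>0] g E that])
  have 1: "norm (ell2_Re u) \<le> D * norm (T (ell2_Re u))" "norm (ell2_Im u) \<le> D * norm (T (ell2_Im u))"
    by (rule r; use u in \<open>simp add: supp_in_def real_ell2_def ell2_Re.rep_eq ell2_Im.rep_eq\<close>)+
  have 2: "T (ell2_Re u) = ell2_Re (T u)" "T (ell2_Im u) = ell2_Im (T u)"
    by (rule ell2_eqI; simp add: T_def apply_schrodinger ell2_Re.rep_eq ell2_Im.rep_eq complex_eq_iff)+
  have "(norm u)\<^sup>2 \<le> (D * norm (ell2_Re (T u)))\<^sup>2 + (D * norm (ell2_Im (T u)))\<^sup>2"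
    unfolding norm_Re_Im[of u] using 1 unfolding 2 by (intro add_mono power_mono) auto
  also have "\<dots> = (D * norm (T u))\<^sup>2" by (simp add: norm_Re_Im[of "T u"] power_mult_distrib distrib_left)
  finally have "norm u \<le> D * norm (T u)" by (rule power2_le_imp_le) (use D in simp)
  then show ?thesis by (simp add: T_def D_def)
qed

section \<open>Hierarchical wells\<close>

text \<open>One period consists of the tiles from \<open>s i\<close> to \<open>s (Suc i)\<close>,
  \<open>i \<le> N\<close>, tile \<open>i\<close> carrying a well centred at \<open>p i\<close>. The
  margins leave room for cut-offs of radius \<open>3 * L\<close> and for the separation demanded by
  \<open>separated_pieces_bound\<close>.\<close>

locale tiling =
  fixes N :: nat and p s :: "nat \<Rightarrow> int" and L :: int
  assumes L: "1 \<le> L"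
    and tile_left: "\<And>i. i \<le> N \<Longrightarrow> s i + 3 * L + 3 \<le> p i"
    and tile_right: "\<And>i. i \<le> N \<Longrightarrow> p i + 3 * L + 3 \<le> s (Suc i)"
begin

definition P :: int where "P = s (Suc N) - s 0"
definition pos :: "int \<Rightarrow> int" where "pos n = (n - s 0) mod P + s 0"
definition tile :: "nat \<Rightarrow> int set" where "tile i = {n. s i \<le> pos n \<and> pos n < s (Suc i)}"
definition cls :: "int \<Rightarrow> nat" where "cls n = (THE i. i \<le> N \<and> n \<in> tile i)"
definition dd :: "int \<Rightarrow> int" where "dd n = \<bar>pos n - p (cls n)\<bar>"

lemma s_step: "i \<le> N \<Longrightarrow> s i + 6 * L + 6 \<le> s (Suc i)"
  using tile_left[of i] tile_right[of i] by linarith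

lemma s_mono: "i \<le> j \<Longrightarrow> j \<le> Suc N \<Longrightarrow> s i \<le> s j"
proof (induction j rule: dec_induct)
  case (step k)
  then show ?case using s_step[of k] L by simp
qed simp

lemma P_pos: "0 < P"
  using s_mono[of 0 N] s_step[of N] L by (simp add: P_def)

lemma pos_range: "s 0 \<le> pos n" "pos n < s (Suc N)"
  using pos_mod_sign[OF P_pos, of "n - s 0"] pos_mod_bound[OF P_pos, of "n - s 0"] by (simp_all add: pos_def P_def)

lemma pos_eq: "s 0 \<le> m \<Longrightarrow> m < s (Suc N) \<Longrightarrow> pos (m + k * P) = m"
  by (simp add: pos_def add.commute[of m] add_diff_eq[symmetric] mod_pos_pos_trivial P_def)

lemma pos_decomp: "\<exists>k. n = pos n + k * P"
  using div_mult_mod_eq[of "n - s 0" P] by (intro exI[of _ "(n - s 0) div P"]) (simp add: pos_def)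

lemma pos_add_P: "pos (n + P) = pos n"
proof -
  obtain k where "n = pos n + k * P" using pos_decomp by blast
  then have "n + P = pos n + (k + 1) * P" by (simp add: algebra_simps)
  then show ?thesis using pos_eq[OF pos_range] by metis
qed

lemma ex_tile: "\<exists>i\<le>N. n \<in> tile i"
proof -
  define k where "k = (LEAST k. pos n < s k)"
  have k: "pos n < s k" "k \<le> Suc N" "\<And>j. j < k \<Longrightarrow> s j \<le> pos n"
    unfolding k_def using pos_range(2)[of n] by (auto intro: LeastI Least_le dest: not_less_Least)
  have "k \<noteq> 0" using k(1) pos_range(1)[of n] by (metis not_less)
  then obtain i where "k = Suc i" using not0_implies_Suc by blast
  then show ?thesis using k by (intro exI[of _ i]) (auto simp: tile_def)
qed

lemma tile_unique: "i \<le> N \<Longrightarrow> j \<le> N \<Longrightarrow> n \<in> tile i \<Longrightarrow> n \<in> tile j \<Longrightarrow> i = j"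
proof (rule ccontr)
  assume a: "i \<le> N" "j \<le> N" "n \<in> tile i" "n \<in> tile j" "i \<noteq> j"
  then show False
  proof (cases "i < j")
    case True
    then show False using s_mono[of "Suc i" j] a by (auto simp: tile_def)
  next
    case False
    then show False using s_mono[of "Suc j" i] a by (auto simp: tile_def)
  qed
qed

lemma cls_eq: "i \<le> N \<Longrightarrow> n \<in> tile i \<Longrightarrow> cls n = i"
  unfolding cls_def using tile_unique by (intro the_equality) auto

lemma cls: "cls n \<le> N" "s (cls n) \<le> pos n" "pos n < s (Suc (cls n))"
  using ex_tile[of n] cls_eq[of _ n] by (auto simp: tile_def)

lemma cls_eqI: "i \<le> N \<Longrightarrow> s i \<le> pos n \<Longrightarrow> pos n < s (Suc i) \<Longrightarrow> cls n = i"
  by (rule cls_eq) (auto simp: tile_def)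

lemma cls_add_P: "cls (n + P) = cls n"
  using cls[of n] by (intro cls_eqI) (simp_all add: pos_add_P)

lemma dd_add_P: "dd (n + P) = dd n"
  by (simp add: dd_def cls_add_P pos_add_P)

lemma pos_Suc: "pos (n + 1) = (if pos n + 1 < s (Suc N) then pos n + 1 else s 0)"
proof -
  obtain k where k: "n = pos n + k * P" using pos_decomp by blast
  show ?thesis
  proof (cases "pos n + 1 < s (Suc N)")
    case True
    have "n + 1 = (pos n + 1) + k * P" using k by simp
    then have "pos (n + 1) = pos (pos n + 1 + k * P)" by (rule arg_cong)
    also have "\<dots> = pos n + 1" using pos_range(1)[of n] True by (intro pos_eq) auto
    finally show ?thesis using True by simp
  next
    case False
    then have "pos n + 1 = s (Suc N)" using pos_range(2)[of n] by simp
    then have "n + 1 = s 0 + (k + 1) * P" using k by (simp add: P_def algebra_simps)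
    then have "pos (n + 1) = s 0" using pos_eq[of "s 0" "k + 1"] P_pos by (simp add: P_def)
    then show ?thesis using False by simp
  qed
qed

text \<open>The tile index and the distance to the centre jump only at tile boundaries, and there
  both neighbours are far from their centres. Functions of \<open>dd\<close> that are constant
  beyond \<open>3 * L\<close> therefore do not see the jumps.\<close>

lemma neighbour_cases: "(cls (n + 1) = cls n \<and> pos (n + 1) = pos n + 1) \<or> (dd n > 3 * L \<and> dd (n + 1) > 3 * L)"
proof (cases "pos n + 1 < s (Suc (cls n))")
  case True
  then have "pos n + 1 < s (Suc N)" using s_mono[of "Suc (cls n)" "Suc N"] cls(1)[of n] by simp
  then have e: "pos (n + 1) = pos n + 1" by (simp add: pos_Suc)
  have "cls (n + 1) = cls n" using cls[of n] True by (intro cls_eqI) (auto simp: e)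
  then show ?thesis using e by simp
next
  case False
  then have e: "pos n + 1 = s (Suc (cls n))" using cls(3)[of n] by simp
  have 1: "dd n > 3 * L" using tile_right[OF cls(1)[of n]] e L by (simp add: dd_def)
  have "dd (n + 1) > 3 * L"
  proof (cases "cls n = N")
    case True
    then have e': "pos (n + 1) = s 0" using e by (simp add: pos_Suc)
    have "cls (n + 1) = 0" using s_step[of 0] L by (intro cls_eqI) (auto simp: e')
    then show ?thesis using e' tile_left[of 0] L by (simp add: dd_def)
  next
    case False
    then have lt: "Suc (cls n) \<le> N" using cls(1)[of n] by simp
    have "pos n + 1 < s (Suc N)" using e s_mono[of "Suc (Suc (cls n))" "Suc N"] s_step[OF lt] lt L by simp
    then have e': "pos (n + 1) = s (Suc (cls n))" using e by (simp add: pos_Suc)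
    have "cls (n + 1) = Suc (cls n)" using s_step[OF lt] lt L by (intro cls_eqI) (auto simp: e')
    then show ?thesis using e' tile_left[OF lt] L by (simp add: dd_def)
  qed
  then show ?thesis using 1 by simp
qed

lemma near_center:
  assumes "i \<le> N" "\<bar>m\<bar> \<le> 3 * L + 2"
  shows "pos (p i + k * P + m) = p i + m" "cls (p i + k * P + m) = i" "dd (p i + k * P + m) = \<bar>m\<bar>"
proof -
  have r: "s i \<le> p i + m" "p i + m < s (Suc i)" using tile_left[OF assms(1)] tile_right[OF assms(1)] assms(2) by auto
  then have "s 0 \<le> p i + m" "p i + m < s (Suc N)" using s_mono[of 0 i] s_mono[of "Suc i" "Suc N"] assms(1) by auto
  then show 1: "pos (p i + k * P + m) = p i + m" using pos_eq[of "p i + m" k] by (simp add: algebra_simps)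
  show 2: "cls (p i + k * P + m) = i" by (rule cls_eqI[OF assms(1)]) (use r in \<open>simp_all only: 1\<close>)
  show "dd (p i + k * P + m) = \<bar>m\<bar>" by (simp add: dd_def 1 2)
qed

lemma center_of:
  assumes "dd n \<le> 3 * L" obtains k where "n \<in> {p (cls n) + k * P - 3 * L..p (cls n) + k * P + 3 * L}"
proof -
  obtain k where k: "n = pos n + k * P" using pos_decomp by blast
  then show ?thesis using assms by (intro that[of k]) (auto simp: dd_def)
qed

lemma centers_separated:
  assumes i: "i \<le> N" "j \<le> N" and ne: "p i + k * P \<noteq> p j + m * P"
  shows "2 * (3 * L) + 3 \<le> \<bar>(p i + k * P) - (p j + m * P)\<bar>"
proof (rule ccontr)
  assume "\<not> ?thesis"
  then have lt: "\<bar>(p i + k * P) - (p j + m * P)\<bar> \<le> 6 * L + 2" by simp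
  define d where "d = (p j + m * P) - (p i + k * P)"
  define h where "h = (if d > 0 then min d (3 * L + 2) else max d (- (3 * L + 2)))"
  have h: "\<bar>h\<bar> \<le> 3 * L + 2" "\<bar>h - d\<bar> \<le> 3 * L + 2" using lt L by (auto simp: h_def d_def)
  have eq: "p i + k * P + h = p j + m * P + (h - d)" by (simp add: d_def)
  have "i = j" using near_center(2)[OF i(1) h(1), of k] near_center(2)[OF i(2) h(2), of m] eq by simp
  moreover have "p i + h = p j + (h - d)" using near_center(1)[OF i(1) h(1), of k] near_center(1)[OF i(2) h(2), of m] eq by simp
  ultimately have "d = 0" by simp
  then show False using ne by (simp add: d_def)
qed

definition clamp :: "real \<Rightarrow> real" where "clamp x = max 0 (min 1 x)"

lemma clamp_lipschitz: "\<bar>clamp x - clamp y\<bar> \<le> \<bar>x - y\<bar>"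
  by (auto simp: clamp_def max_def min_def)

lemma clamp_bounds: "0 \<le> clamp x" "clamp x \<le> 1" "\<bar>clamp x\<bar> \<le> 1"
  by (auto simp: clamp_def)

text \<open>Equal to 1 up to distance \<open>2 * L\<close> from a centre and to 0 from
  \<open>3 * L\<close> on, whereas \<open>moat\<close> is 0 up to \<open>L\<close> and 1 from
  \<open>2 * L\<close> on. So the two cover everything outside the classes in \<open>X\<close>, with
  slope \<open>1 / L\<close>.\<close>

definition bump :: "nat set \<Rightarrow> int \<Rightarrow> real" where
  "bump X n = (if cls n \<in> X then 0 else clamp ((3 * of_int L - of_int (dd n)) / of_int L))"

definition moat :: "int \<Rightarrow> real" where "moat n = clamp ((of_int (dd n) - of_int L) / of_int L)"

lemma dd_neighbour:
  "cls (n + 1) = cls n \<and> \<bar>dd (n + 1) - dd n\<bar> \<le> 1 \<or> (dd n > 3 * L \<and> dd (n + 1) > 3 * L)"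
  using neighbour_cases[of n] by (auto simp: dd_def)

lemma clamp_dd_lipschitz:
  assumes "\<bar>dd (n + 1) - dd n\<bar> \<le> 1"
  shows "\<bar>clamp ((3 * of_int L - of_int (dd (n + 1))) / of_int L) - clamp ((3 * of_int L - of_int (dd n)) / of_int L)\<bar> \<le> 1 / of_int L"
    "\<bar>clamp ((of_int (dd (n + 1)) - of_int L) / of_int L) - clamp ((of_int (dd n) - of_int L) / of_int L)\<bar> \<le> 1 / of_int L"
proof -
  have "\<bar>real_of_int (dd (n + 1)) - of_int (dd n)\<bar> \<le> 1" using assms by linarith
  then have *: "\<bar>real_of_int (dd (n + 1)) - of_int (dd n)\<bar> / of_int L \<le> 1 / of_int L" using L by (intro divide_right_mono) auto
  show "\<bar>clamp ((3 * of_int L - of_int (dd (n + 1))) / of_int L) - clamp ((3 * of_int L - of_int (dd n)) / of_int L)\<bar> \<le> 1 / of_int L"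
  proof (rule order_trans[OF clamp_lipschitz])
    have "(3 * of_int L - of_int (dd (n + 1))) / of_int L - (3 * of_int L - of_int (dd n)) / of_int L = - ((real_of_int (dd (n + 1)) - of_int (dd n)) / of_int L)"
      by (simp add: diff_divide_distrib)
    then show "\<bar>(3 * of_int L - of_int (dd (n + 1))) / of_int L - (3 * of_int L - of_int (dd n)) / of_int L\<bar> \<le> 1 / real_of_int L"
      using * L by (simp add: abs_divide)
  qed
  show "\<bar>clamp ((of_int (dd (n + 1)) - of_int L) / of_int L) - clamp ((of_int (dd n) - of_int L) / of_int L)\<bar> \<le> 1 / of_int L"
  proof (rule order_trans[OF clamp_lipschitz])
    have "(of_int (dd (n + 1)) - of_int L) / of_int L - (of_int (dd n) - of_int L) / of_int L = (real_of_int (dd (n + 1)) - of_int (dd n)) / of_int L"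
      by (simp add: diff_divide_distrib)
    then show "\<bar>(of_int (dd (n + 1)) - of_int L) / of_int L - (of_int (dd n) - of_int L) / of_int L\<bar> \<le> 1 / real_of_int L"
      using * L by (simp add: abs_divide)
  qed
qed

lemma bump_lipschitz: "\<bar>bump X (n + 1) - bump X n\<bar> \<le> 1 / of_int L"
proof -
  have far: "clamp ((3 * of_int L - of_int (dd m)) / of_int L) = 0" if "dd m > 3 * L" for m
  proof -
    have "(3 * of_int L - of_int (dd m)) / real_of_int L \<le> 0" using that L by (intro divide_nonpos_pos) auto
    then show ?thesis by (simp add: clamp_def)
  qed
  show ?thesis using dd_neighbour[of n]
  proof
    assume "cls (n + 1) = cls n \<and> \<bar>dd (n + 1) - dd n\<bar> \<le> 1"
    then show ?thesis using clamp_dd_lipschitz(1)[of n] L by (auto simp: bump_def)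
  next
    assume "dd n > 3 * L \<and> dd (n + 1) > 3 * L"
    then show ?thesis using far[of n] far[of "n + 1"] L by (simp add: bump_def)
  qed
qed

lemma moat_lipschitz: "\<bar>moat (n + 1) - moat n\<bar> \<le> 1 / of_int L"
proof -
  have far: "moat m = 1" if "dd m > 3 * L" for m
  proof -
    have "1 \<le> (of_int (dd m) - of_int L) / real_of_int L" using that L by (simp add: field_simps)
    then show ?thesis by (simp add: clamp_def moat_def)
  qed
  show ?thesis using dd_neighbour[of n]
  proof
    assume "cls (n + 1) = cls n \<and> \<bar>dd (n + 1) - dd n\<bar> \<le> 1"
    then show ?thesis using clamp_dd_lipschitz(2)[of n] by (auto simp: moat_def)
  next
    assume "dd n > 3 * L \<and> dd (n + 1) > 3 * L"
    then show ?thesis using far[of n] far[of "n + 1"] L by simp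
  qed
qed

lemma bump_moat_cover: "cls n \<notin> X \<Longrightarrow> 1 \<le> bump X n + moat n"
proof -
  assume X: "cls n \<notin> X"
  show ?thesis
  proof (cases "dd n \<le> 2 * L")
    case True
    have "1 \<le> (3 * of_int L - of_int (dd n)) / real_of_int L" using True L by (simp add: field_simps)
    then show ?thesis using X clamp_bounds(1)[of "(of_int (dd n) - of_int L) / of_int L"] by (simp add: bump_def moat_def clamp_def)
  next
    case False
    have "1 \<le> (of_int (dd n) - of_int L) / real_of_int L" using False L by (simp add: field_simps)
    then show ?thesis using X clamp_bounds(1)[of "(3 * of_int L - of_int (dd n)) / of_int L"] by (simp add: bump_def moat_def clamp_def)
  qed
qed

end

text \<open>\<open>VG\<close> adds to \<open>V\<close> a well of depth \<open>d\<close> in every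
  tile and lifts tile \<open>i\<close> by the small step \<open>i * \<xi>\<close>; \<open>U\<close>
  is the one-well model. As \<open>p i\<close> and \<open>P\<close> are multiples of
  \<open>q\<close>, every well sees the same \<open>V\<close>, so the top level of class
  \<open>i\<close> is near \<open>E1 + c * i * \<xi>\<close>. The smallness conditions keep the
  whole staircase within a fraction of the gap \<open>g\<close> and of the depth
  \<open>c * d\<close>: different classes are separated by \<open>c * \<xi>\<close>, and nothing
  else comes close.\<close>

locale guard_potential = tiling +
  fixes q l :: int and d \<xi> c K g \<nu> E1 E0 :: real and V U VG :: "int \<Rightarrow>\<^sub>C real"
  assumes q: "0 < q" "\<And>n. apply_bcontfun V (n + q) = apply_bcontfun V n"
    and dvd: "\<And>i. i \<le> N \<Longrightarrow> q dvd p i" "q dvd P"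
    and l: "1 \<le> l" "l + 1 \<le> L"
    and VG: "\<And>n. apply_bcontfun VG n = apply_bcontfun V n + (real (cls n) * \<xi> + (if dd n \<le> l then d else 0))"
    and U: "\<And>n. apply_bcontfun U n = apply_bcontfun V n + (if \<bar>n\<bar> \<le> l then d else 0)"
    and pos: "0 < c" "0 < d" "0 < \<xi>" "1 \<le> K" "0 < g"
    and top: "is_top (schrodinger c V) UNIV \<nu>"
    and K: "norm (schrodinger c U) \<le> K" "norm (schrodinger c VG) \<le> K" "\<And>n. \<bar>c * apply_bcontfun VG n\<bar> \<le> K"
    and E1: "is_top (schrodinger c U) {- 3 * L..3 * L} E1" "\<bar>E1\<bar> \<le> K"
    and E0: "is_top (schrodinger c U) ({- 3 * L..3 * L} - {0}) E0" "E0 + g \<le> E1" "\<nu> + 15 / 16 * (c * d) \<le> E0"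
    and small: "c * (real N * \<xi>) \<le> c * d / 16" "c * (real N + 1) * \<xi> \<le> g / 4"
begin

abbreviation "H \<equiv> schrodinger c VG"

lemma V_shift: "apply_bcontfun V (p i + k * P + n) = apply_bcontfun V n" if "i \<le> N"
proof -
  have "q dvd p i" using dvd(1) that by blast
  then obtain a b where ab: "p i = q * a" "P = q * b" using dvd(2) by (auto elim!: dvdE)
  then have "p i + k * P + n = n + (a + k * b) * q" by (simp add: algebra_simps)
  then show ?thesis using int_periodic_mult[of "apply_bcontfun V" q n "a + k * b"] q(2) by (simp add: add.commute)
qed

text \<open>Seen from its centre, a tile of class \<open>i\<close> is the one-well model lifted by
  the constant \<open>c * (real i * \<xi>)\<close>.\<close>

lemma local_shift:
  assumes i: "i \<le> N" and w: "supp_in {p i + k * P - 3 * L..p i + k * P + 3 * L} w"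
  shows "ell2_shift (p i + k * P) (blinfun_apply H w)
    = schrodinger c U (ell2_shift (p i + k * P) w) + (c * (real i * \<xi>)) *\<^sub>R ell2_shift (p i + k * P) w"
proof (rule ell2_eqI)
  fix n
  define a where "a = p i + k * P"
  have "of_real (c * apply_bcontfun VG (n + a)) * apply_ell2 w (n + a)
      = (of_real (c * apply_bcontfun U n) + of_real (c * (real i * \<xi>))) * apply_ell2 w (n + a)"
  proof (cases "\<bar>n\<bar> \<le> 3 * L")
    case True
    then have n: "\<bar>n\<bar> \<le> 3 * L + 2" by simp
    have "apply_bcontfun VG (a + n) = apply_bcontfun U n + real i * \<xi>"
      unfolding VG U a_def near_center[OF i n] V_shift[OF i] by simp
    then show ?thesis by (simp add: add.commute[of n a] distrib_left)
  next
    case False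
    then have "n + a \<notin> {a - 3 * L..a + 3 * L}" by auto
    then have "apply_ell2 w (n + a) = 0" using w unfolding supp_in_def a_def by blast
    then show ?thesis by simp
  qed
  then show "apply_ell2 (ell2_shift (p i + k * P) (blinfun_apply H w)) n
    = apply_ell2 (schrodinger c U (ell2_shift (p i + k * P) w) + (c * (real i * \<xi>)) *\<^sub>R ell2_shift (p i + k * P) w) n"
    unfolding a_def[symmetric] by (simp add: ell2_shift.rep_eq apply_schrodinger scaleR_conv_of_real algebra_simps)
qed

lemma form_upper:
  "form H u \<le> (\<nu> + c * (real N * \<xi>)) * (norm u)\<^sup>2 + c * d * (norm (proj_op {n. dd n \<le> l} u))\<^sup>2"
proof -
  have nV: "form (schrodinger c V) u \<le> \<nu> * (norm u)\<^sup>2" using is_top_le[OF top, of u] by (simp add: supp_in_def)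
  have "form H u \<le> (schrodinger c V u + (c * (real N * \<xi>)) *\<^sub>R u + (c * d) *\<^sub>R proj_op {n. dd n \<le> l} u) \<bullet> u"
    unfolding inner_ell2_def
  proof (rule infsum_mono[OF ell2_inner_summable ell2_inner_summable])
    fix n
    define x where "x = apply_ell2 u n"
    have *: "(of_real r * x) \<bullet> x = r * (cmod x)\<^sup>2" for r
      by (simp add: scaleR_conv_of_real[symmetric] power2_norm_eq_inner)
    have "real (cls n) * \<xi> \<le> real N * \<xi>" using cls(1)[of n] pos by (intro mult_right_mono) auto
    then have "c * (real (cls n) * \<xi> + (if dd n \<le> l then d else 0)) * (cmod x)\<^sup>2 \<le> c * (real N * \<xi> + (if dd n \<le> l then d else 0)) * (cmod x)\<^sup>2"
      using pos by (intro mult_right_mono mult_left_mono) auto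
    moreover have "apply_ell2 (blinfun_apply H u) n \<bullet> x = apply_ell2 (schrodinger c V u) n \<bullet> x
        + c * (real (cls n) * \<xi> + (if dd n \<le> l then d else 0)) * (cmod x)\<^sup>2"
      unfolding apply_schrodinger VG x_def[symmetric] inner_add_left * by (simp add: algebra_simps)
    moreover have "apply_ell2 (schrodinger c V u + (c * (real N * \<xi>)) *\<^sub>R u + (c * d) *\<^sub>R proj_op {n. dd n \<le> l} u) n \<bullet> x
        = apply_ell2 (schrodinger c V u) n \<bullet> x + c * (real N * \<xi> + (if dd n \<le> l then d else 0)) * (cmod x)\<^sup>2"
      by (simp add: inner_add_left x_def[symmetric] power2_norm_eq_inner algebra_simps)
    ultimately show "apply_ell2 (blinfun_apply H u) n \<bullet> apply_ell2 u n
      \<le> apply_ell2 (schrodinger c V u + (c * (real N * \<xi>)) *\<^sub>R u + (c * d) *\<^sub>R proj_op {n. dd n \<le> l} u) n \<bullet> apply_ell2 u n"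
      by (simp only: x_def[symmetric])
  qed
  also have "\<dots> = form (schrodinger c V) u + c * (real N * \<xi>) * (norm u)\<^sup>2 + c * d * (norm (proj_op {n. dd n \<le> l} u))\<^sup>2"
    by (simp only: inner_add_left inner_scaleR_left proj_op_inner power2_norm_eq_inner[symmetric])
  finally show ?thesis using nV by (simp add: algebra_simps)
qed

text \<open>An approximate eigenvector at energy \<open>E\<close> lives on the tiles whose core level is resonant with
  \<open>E\<close>: off the cores the energy is too low, and the other cores have no level near \<open>E\<close>.\<close>

lemma off_class_bound:
  assumes E: "\<nu> + c * (real N * \<xi>) + c * d / 2 \<le> E" and b: "0 < b"
    and X: "\<And>i. i \<le> N \<Longrightarrow> i \<notin> X \<Longrightarrow> b \<le> \<bar>E - c * (real i * \<xi>) - E1\<bar> \<and> E0 + g / 2 \<le> E - c * (real i * \<xi>)"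
  shows "norm (proj_op {n. cls n \<notin> X} u)
     \<le> (8 / g + 4 / b + 2 / (c * d)) * (norm (blinfun_apply H u - E *\<^sub>R u) + 2 / of_int L * norm u)"
proof -
  define r where "r = norm (blinfun_apply H u - E *\<^sub>R u) + 2 / of_int L * norm u"
  have Bb: "\<bar>bump X n\<bar> \<le> 1" for n by (simp add: bump_def clamp_bounds)
  have Mb: "\<bar>moat n\<bar> \<le> 1" for n by (simp add: moat_def clamp_bounds)
  define v where "v = cut_op (bump X) u"
  define v' where "v' = cut_op moat u"
  have res: "norm (blinfun_apply H v - E *\<^sub>R v) \<le> r"
    using cut_op_residual[of "bump X" "1 / of_int L" c VG u E, OF Bb bump_lipschitz]
      norm_cut_op_le[of "bump X" "blinfun_apply H u - E *\<^sub>R u", OF Bb] by (simp add: v_def r_def)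
  have res': "norm (blinfun_apply H v' - E *\<^sub>R v') \<le> r"
    using cut_op_residual[of moat "1 / of_int L" c VG u E, OF Mb moat_lipschitz]
      norm_cut_op_le[of moat "blinfun_apply H u - E *\<^sub>R u", OF Mb] by (simp add: v'_def r_def)
  \<comment> \<open>On the bump part the wells decouple; each piece is a translate of the one-well
    problem at the energy \<open>E - c * (real i * \<xi>)\<close>, where
    \<open>spectral_gap_complement_complex\<close> applies by the choice of
    \<open>X\<close>.\<close>
  define C where "C = {p i + k * P | i k. i \<le> N \<and> i \<notin> X}"
  have D0: "0 \<le> 8 / g + 4 / b" using pos b by simp
  have "norm v \<le> (8 / g + 4 / b) * norm (blinfun_apply H v - E *\<^sub>R v)"
  proof (rule separated_pieces_bound[where C = C and \<rho> = "3 * L", OF _ D0])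
    fix x y assume "x \<in> C" "y \<in> C" "x \<noteq> y"
    then show "2 * (3 * L) + 3 \<le> \<bar>x - y\<bar>" unfolding C_def using centers_separated by blast
  next
    fix x w assume x: "x \<in> C" and w: "supp_in {x - 3 * L..x + 3 * L} w"
    obtain i k where ik: "x = p i + k * P" "i \<le> N" "i \<notin> X" using x by (auto simp: C_def)
    have sw: "supp_in {- 3 * L..3 * L} (ell2_shift x w)"
      by (rule supp_in_mono[OF supp_in_shift[OF w]]) auto
    have "norm (ell2_shift x w) \<le> (8 / g + 4 / b) * norm (schrodinger c U (ell2_shift x w) - (E - c * (real i * \<xi>)) *\<^sub>R ell2_shift x w)"
      by (rule spectral_gap_complement_complex[OF K(1) _ E1 E0(1) pos(5) E0(2)]) (use X[OF ik(2,3)] b sw pos in auto)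
    moreover have "schrodinger c U (ell2_shift x w) - (E - c * (real i * \<xi>)) *\<^sub>R ell2_shift x w
        = ell2_shift x (blinfun_apply H w - E *\<^sub>R w)"
    proof -
      have "ell2_shift x (blinfun_apply H w - E *\<^sub>R w) = ell2_shift x (blinfun_apply H w) - E *\<^sub>R ell2_shift x w"
        by (rule ell2_eqI) (simp add: ell2_shift.rep_eq)
      then show ?thesis using local_shift[OF ik(2) w[unfolded ik(1)]] by (simp add: ik(1) algebra_simps)
    qed
    ultimately show "norm w \<le> (8 / g + 4 / b) * norm (blinfun_apply H w - E *\<^sub>R w)" by (simp add: norm_ell2_shift)
  next
    show "supp_in (\<Union>p\<in>C. {p - 3 * L..p + 3 * L}) v"
      unfolding supp_in_def
    proof (intro allI impI)
      fix n assume n: "n \<notin> (\<Union>p\<in>C. {p - 3 * L..p + 3 * L})"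
      have "bump X n = 0"
      proof (cases "cls n \<in> X \<or> dd n > 3 * L")
        case True
        then show ?thesis
        proof
          assume "dd n > 3 * L"
          then have "(3 * of_int L - of_int (dd n)) / real_of_int L \<le> 0" using L by (intro divide_nonpos_pos) auto
          then show ?thesis by (simp add: bump_def clamp_def)
        qed (simp add: bump_def)
      next
        case False
        then obtain k where "n \<in> {p (cls n) + k * P - 3 * L..p (cls n) + k * P + 3 * L}" using center_of[of n] by auto
        moreover have "p (cls n) + k * P \<in> C" using False cls(1) by (auto simp: C_def)
        ultimately show ?thesis using n by blast
      qed
      then show "apply_ell2 v n = 0" by (simp add: v_def cut_op_apply[of "bump X", OF Bb])
    qed
  qed
  also have "\<dots> \<le> (8 / g + 4 / b) * r" by (rule mult_left_mono[OF res D0])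
  finally have 1: "norm v \<le> (8 / g + 4 / b) * r" .
  \<comment> \<open>The moat part avoids the cores, since \<open>l < L\<close>. Its form is
    therefore at most \<open>\<nu> + c * (real N * \<xi>)\<close>, which lies
    \<open>c * d / 2\<close> below \<open>E\<close>, and \<open>E - H\<close> is coercive on
    it.\<close>
  have v'0: "proj_op {n. dd n \<le> l} v' = 0"
  proof (rule ell2_eqI)
    fix n
    have "moat n = 0" if "dd n \<le> l"
    proof -
      have "(of_int (dd n) - of_int L) / real_of_int L \<le> 0" using that l L by (intro divide_nonpos_pos) auto
      then show ?thesis by (simp add: moat_def clamp_def)
    qed
    then show "apply_ell2 (proj_op {n. dd n \<le> l} v') n = apply_ell2 0 n"
      by (simp add: v'_def cut_op_apply[of moat, OF Mb])
  qed
  have "(c * d / 2) * (norm v')\<^sup>2 \<le> (E - (\<nu> + c * (real N * \<xi>))) * (norm v')\<^sup>2" using E by (intro mult_right_mono) auto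
  also have "\<dots> \<le> E * (norm v')\<^sup>2 - form H v'" using form_upper[of v'] v'0 by (simp add: algebra_simps)
  also have "\<dots> = - ((blinfun_apply H v' - E *\<^sub>R v') \<bullet> v')" by (simp add: inner_diff_left power2_norm_eq_inner)
  also have "\<dots> \<le> norm (blinfun_apply H v' - E *\<^sub>R v') * norm v'"
    using Cauchy_Schwarz_ineq2[of "blinfun_apply H v' - E *\<^sub>R v'" v'] by linarith
  also have "\<dots> \<le> r * norm v'" by (rule mult_right_mono[OF res']) simp
  finally have "norm v' * (c * d / 2 * norm v') \<le> norm v' * r" by (simp add: power2_eq_square mult_ac)
  moreover have r0: "0 \<le> r" using L by (simp add: r_def)
  ultimately have 2: "norm v' \<le> 2 / (c * d) * r"
    using pos by (cases "norm v' = 0") (auto simp: field_simps)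
  have "norm (proj_op {n. cls n \<notin> X} u) \<le> norm (v + v')"
  proof (rule norm_ell2_mono)
    fix n
    have "apply_ell2 (v + v') n = of_real (bump X n + moat n) * apply_ell2 u n"
      by (simp add: v_def v'_def cut_op_apply[of "bump X", OF Bb] cut_op_apply[of moat, OF Mb] algebra_simps)
    then have eq: "cmod (apply_ell2 (v + v') n) = \<bar>bump X n + moat n\<bar> * cmod (apply_ell2 u n)" by (simp only: norm_mult norm_of_real)
    show "cmod (apply_ell2 (proj_op {n. cls n \<notin> X} u) n) \<le> cmod (apply_ell2 (v + v') n)"
      unfolding eq using bump_moat_cover[of n X] mult_right_mono[of 1 "\<bar>bump X n + moat n\<bar>" "cmod (apply_ell2 u n)"] by auto
  qed
  also have "\<dots> \<le> norm v + norm v'" by (rule norm_triangle_ineq)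
  also have "\<dots> \<le> (8 / g + 4 / b) * r + 2 / (c * d) * r" using 1 2 by (rule add_mono)
  finally show ?thesis unfolding r_def by (simp only: distrib_right)
qed

end

section \<open>A polynomial spectral filter\<close>

definition damp :: "real \<Rightarrow> (ell2 \<Rightarrow>\<^sub>L ell2) \<Rightarrow> ell2 \<Rightarrow>\<^sub>L ell2" where
  "damp R A = id_blinfun - (1 / R\<^sup>2) *\<^sub>R (A o\<^sub>L A)"

primrec op_power :: "(ell2 \<Rightarrow>\<^sub>L ell2) \<Rightarrow> nat \<Rightarrow> ell2 \<Rightarrow>\<^sub>L ell2" where
  "op_power B 0 = id_blinfun"
| "op_power B (Suc k) = B o\<^sub>L op_power B k"

text \<open>With \<open>A = H - E\<close> this is a polynomial in \<open>H\<close> imitating the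
  spectral projection at \<open>E\<close>: \<open>damp\<close> fixes the kernel of \<open>A\<close>
  and shrinks the rest, and the mean ergodic average converges to the projection onto its fixed
  vectors. Unlike that projection it depends on \<open>H\<close> in a Lipschitz way for fixed
  \<open>m\<close>.\<close>

definition avg_op :: "real \<Rightarrow> nat \<Rightarrow> (ell2 \<Rightarrow>\<^sub>L ell2) \<Rightarrow> ell2 \<Rightarrow>\<^sub>L ell2" where
  "avg_op R m A = (1 / real m) *\<^sub>R (\<Sum>k<m. op_power (damp R A) k)"

lemma damp_apply: "damp R A u = u - (1 / R\<^sup>2) *\<^sub>R blinfun_apply A (blinfun_apply A u)"
  by (simp add: damp_def blinfun.diff_left blinfun.scaleR_left)

lemma avg_op_apply: "avg_op R m A u = (1 / real m) *\<^sub>R (\<Sum>k<m. op_power (damp R A) k u)"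
  by (simp add: avg_op_def blinfun.scaleR_left blinfun.sum_left)

text \<open>In the expanded square the cross term, twice
  \<open>(norm (A u))\<^sup>2 / R\<^sup>2\<close>, outweighs the last term, which is at most once
  that quantity.\<close>

lemma norm_damp_le:
  assumes A: "hermitian_op A" "norm A \<le> R" and R: "0 < R"
  shows "norm (damp R A u) \<le> norm u"
proof (rule power2_le_imp_le)
  define v where "v = blinfun_apply A u"
  have "(norm (u - (1 / R\<^sup>2) *\<^sub>R blinfun_apply A v))\<^sup>2
      = (norm u)\<^sup>2 - 2 * (1 / R\<^sup>2) * (u \<bullet> blinfun_apply A v) + (1 / R\<^sup>2)\<^sup>2 * (norm (blinfun_apply A v))\<^sup>2"
    unfolding power2_norm_eq_inner
    by (simp only: inner_diff_left inner_diff_right inner_scaleR_left inner_scaleR_right inner_commute[of "blinfun_apply A v" u] power2_eq_square[of "1 / R\<^sup>2"])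
      (simp only: algebra_simps)
  also have "u \<bullet> blinfun_apply A v = (norm v)\<^sup>2"
    using hermitian_op_sym[OF A(1), of u v] by (simp add: v_def power2_norm_eq_inner)
  also have "(1 / R\<^sup>2)\<^sup>2 * (norm (blinfun_apply A v))\<^sup>2 \<le> (1 / R\<^sup>2)\<^sup>2 * (R * norm v)\<^sup>2"
    by (intro mult_left_mono power_mono norm_blinfun_le[OF A(2)]) auto
  also have "(1 / R\<^sup>2)\<^sup>2 * (R * norm v)\<^sup>2 = 1 / R\<^sup>2 * (norm v)\<^sup>2"
    using R by (simp add: power_mult_distrib power_divide field_simps power2_eq_square)
  also have "(norm u)\<^sup>2 - 2 * (1 / R\<^sup>2) * (norm v)\<^sup>2 + 1 / R\<^sup>2 * (norm v)\<^sup>2 \<le> (norm u)\<^sup>2"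
    using R by (simp add: field_simps)
  finally show "(norm (damp R A u))\<^sup>2 \<le> (norm u)\<^sup>2" by (simp add: damp_apply v_def)
qed simp

context
  fixes R :: real and A :: "ell2 \<Rightarrow>\<^sub>L ell2"
  assumes A: "hermitian_op A" "norm A \<le> R" and R: "0 < R"
begin

lemma norm_op_power_damp_le: "norm (op_power (damp R A) k u) \<le> norm u"
  by (induction k) (auto intro: order_trans[OF norm_damp_le[OF A R]])

lemma norm_avg_op_le: "norm (avg_op R m A u) \<le> norm u"
proof (cases "m = 0")
  case False
  have "norm (\<Sum>k<m. op_power (damp R A) k u) \<le> real m * norm u"
    using sum_norm_bound[of "{..<m}" "\<lambda>k. op_power (damp R A) k u" "norm u"] norm_op_power_damp_le by simp
  then show ?thesis using False by (simp add: avg_op_apply field_simps)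
qed (simp add: avg_op_apply)

lemma op_power_damp_sym: "op_power (damp R A) k u \<bullet> v = u \<bullet> op_power (damp R A) k v"
proof -
  have d: "damp R A u \<bullet> v = u \<bullet> damp R A v" for u v
    by (simp add: damp_apply inner_diff_left inner_diff_right hermitian_op_sym[OF A(1)])
  have c: "op_power B k (blinfun_apply B u) = blinfun_apply B (op_power B k u)" for B k u
    by (induction k) auto
  show ?thesis by (induction k arbitrary: u v) (simp_all add: d c[symmetric])
qed

lemma avg_op_sym: "avg_op R m A u \<bullet> v = u \<bullet> avg_op R m A v"
  by (simp add: avg_op_apply inner_sum_left inner_sum_right op_power_damp_sym)

text \<open>Approximate eigenvectors survive the filter: each damping is a contraction and moves
  \<open>u\<close> by at most \<open>norm (A u) / R\<close>.\<close>

lemma avg_op_near: "norm (avg_op R m A u - u) \<le> real m * norm (blinfun_apply A u) / R" if "0 < m"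
proof -
  have 1: "norm (damp R A u - u) \<le> norm (blinfun_apply A u) / R"
  proof -
    have "norm (blinfun_apply A (blinfun_apply A u)) / R\<^sup>2 \<le> R * norm (blinfun_apply A u) / R\<^sup>2"
      by (intro divide_right_mono norm_blinfun_le[OF A(2)]) simp
    then show ?thesis using R by (simp add: damp_apply power2_eq_square)
  qed
  have k: "norm (op_power (damp R A) k u - u) \<le> real k * (norm (blinfun_apply A u) / R)" for k
  proof (induction k)
    case (Suc k)
    have "op_power (damp R A) (Suc k) u - u = damp R A (op_power (damp R A) k u - u)
        + (damp R A u - u)" by (simp add: blinfun.bilinear_simps)
    also have "norm \<dots> \<le> norm (op_power (damp R A) k u - u) + norm (blinfun_apply A u) / R"
      by (rule order_trans[OF norm_triangle_ineq add_mono[OF norm_damp_le[OF A R] 1]])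
    finally show ?case using Suc.IH by (simp add: algebra_simps add_divide_distrib)
  qed simp
  have "avg_op R m A u - u = (1 / real m) *\<^sub>R (\<Sum>k<m. op_power (damp R A) k u - u)"
    using that by (simp add: avg_op_apply sum_subtractf scaleR_diff_right sum_constant_scaleR)
  also have "norm \<dots> \<le> (1 / real m) * (\<Sum>k<m. real m * (norm (blinfun_apply A u) / R))"
    unfolding norm_scaleR using that R
    by (intro mult_mono sum_norm_le) (auto intro!: order_trans[OF k] mult_right_mono divide_right_mono)
  also have "\<dots> = real m * norm (blinfun_apply A u) / R" using that by simp
  finally show ?thesis .
qed

text \<open>The image of the filter consists of approximate eigenvectors. The geometric sum
  telescopes, so \<open>A\<^sup>2\<close> applied to the average is of order
  \<open>R\<^sup>2 / m\<close>; pairing with the average itself gives \<open>A\<close>. Being linear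
  in the norm of the filtered vector, the bound is useful once that norm is bounded below.\<close>

lemma avg_op_residual:
  assumes m: "0 < m"
  shows "(norm (blinfun_apply A (avg_op R m A u)))\<^sup>2 \<le> 2 * R\<^sup>2 / real m * norm u * norm (avg_op R m A u)"
proof -
  define f where "f = avg_op R m A u"
  have tel: "(1 / R\<^sup>2) *\<^sub>R blinfun_apply A (blinfun_apply A (\<Sum>k<n. op_power (damp R A) k u))
      = u - op_power (damp R A) n u" for n
  proof (induction n)
    case (Suc n)
    then show ?case by (simp add: damp_apply blinfun.bilinear_simps scaleR_add_right)
  qed (simp add: blinfun.bilinear_simps)
  have "(1 / R\<^sup>2) *\<^sub>R blinfun_apply A (blinfun_apply A f) = (1 / real m) *\<^sub>R (u - op_power (damp R A) m u)"
    unfolding f_def avg_op_apply blinfun.scaleR_right scaleR_left_commute[of "1 / R\<^sup>2"] tel ..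
  then have "blinfun_apply A (blinfun_apply A f) = (R\<^sup>2 / real m) *\<^sub>R (u - op_power (damp R A) m u)"
    using R by (metis (no_types, lifting) div_by_1 divide_divide_eq_right less_irrefl mult.right_neutral nonzero_mult_div_cancel_left power_not_zero scaleR_one scaleR_scaleR times_divide_eq_left times_divide_eq_right)
  then have "norm (blinfun_apply A (blinfun_apply A f)) = R\<^sup>2 / real m * norm (u - op_power (damp R A) m u)" by simp
  also have "\<dots> \<le> R\<^sup>2 / real m * (norm u + norm u)"
    by (intro mult_left_mono order_trans[OF norm_triangle_ineq4] add_mono norm_op_power_damp_le order_refl) auto
  finally have "norm (blinfun_apply A (blinfun_apply A f)) * norm f \<le> R\<^sup>2 / real m * (norm u + norm u) * norm f"
    by (rule mult_right_mono) simp
  moreover have "(norm (blinfun_apply A f))\<^sup>2 \<le> norm (blinfun_apply A (blinfun_apply A f)) * norm f"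
    using norm_cauchy_schwarz[of "blinfun_apply A (blinfun_apply A f)" f] hermitian_op_sym[OF A(1), of "blinfun_apply A f" f]
    by (simp add: power2_norm_eq_inner)
  ultimately show ?thesis unfolding f_def by (simp add: mult_ac)
qed

lemma op_power_damp_commute:
  assumes "\<And>u. blinfun_apply Z (blinfun_apply A u) = blinfun_apply A (blinfun_apply Z u)"
  shows "blinfun_apply Z (op_power (damp R A) k u) = op_power (damp R A) k (blinfun_apply Z u)"
  by (induction k) (simp_all add: damp_apply blinfun.bilinear_simps assms)

lemma avg_op_commute:
  assumes "\<And>u. blinfun_apply Z (blinfun_apply A u) = blinfun_apply A (blinfun_apply Z u)"
  shows "blinfun_apply Z (avg_op R m A u) = avg_op R m A (blinfun_apply Z u)"
  by (simp add: avg_op_apply blinfun.bilinear_simps op_power_damp_commute[OF assms])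

lemma avg_op_lipschitz:
  assumes A': "hermitian_op A'" "norm A' \<le> R" and e: "\<And>u. norm (blinfun_apply A u - blinfun_apply A' u) \<le> e * norm u" "0 \<le> e"
  shows "norm (avg_op R m A u - avg_op R m A' u) \<le> real m * (2 * e / R) * norm u"
proof (cases "m = 0")
  case False
  have d: "norm (damp R A v - damp R A' v) \<le> 2 * e / R * norm v" for v
  proof -
    have eq: "blinfun_apply A (blinfun_apply A v) - blinfun_apply A' (blinfun_apply A' v)
      = blinfun_apply A (blinfun_apply A v - blinfun_apply A' v) + (blinfun_apply A (blinfun_apply A' v) - blinfun_apply A' (blinfun_apply A' v))"
      by (simp add: blinfun.bilinear_simps)
    have "norm (blinfun_apply A (blinfun_apply A v) - blinfun_apply A' (blinfun_apply A' v)) \<le> R * (e * norm v) + e * (R * norm v)"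
      unfolding eq
    proof (rule order_trans[OF norm_triangle_ineq add_mono])
      show "norm (blinfun_apply A (blinfun_apply A v - blinfun_apply A' v)) \<le> R * (e * norm v)"
        by (rule order_trans[OF norm_blinfun_le[OF A(2)] mult_left_mono[OF e(1)]]) (use R in simp)
      show "norm (blinfun_apply A (blinfun_apply A' v) - blinfun_apply A' (blinfun_apply A' v)) \<le> e * (R * norm v)"
        by (rule order_trans[OF e(1) mult_left_mono[OF norm_blinfun_le[OF A'(2)] e(2)]])
    qed
    then have "norm (blinfun_apply A (blinfun_apply A v) - blinfun_apply A' (blinfun_apply A' v)) / R\<^sup>2 \<le> (2 * e * norm v * R) / R\<^sup>2"
      by (intro divide_right_mono) (auto simp: algebra_simps)
    also have "\<dots> = 2 * e / R * norm v" using R by (simp add: power2_eq_square)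
    finally have "norm (blinfun_apply A (blinfun_apply A v) - blinfun_apply A' (blinfun_apply A' v)) / R\<^sup>2 \<le> 2 * e / R * norm v" .
    moreover have "damp R A v - damp R A' v = - ((1 / R\<^sup>2) *\<^sub>R (blinfun_apply A (blinfun_apply A v) - blinfun_apply A' (blinfun_apply A' v)))"
      by (simp add: damp_apply algebra_simps)
    ultimately show ?thesis by simp
  qed
  have k: "norm (op_power (damp R A) k u - op_power (damp R A') k u) \<le> real k * (2 * e / R * norm u)" for k
  proof (induction k)
    case (Suc k)
    define v v' where "v = op_power (damp R A) k u" and "v' = op_power (damp R A') k u"
    have v': "norm v' \<le> norm u" unfolding v'_def
      by (induction k) (auto intro: order_trans[OF norm_damp_le[OF A' R]])
    have "damp R A v - damp R A' v' = damp R A (v - v') + (damp R A v' - damp R A' v')"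
      by (simp add: blinfun.bilinear_simps)
    also have "norm \<dots> \<le> norm (v - v') + 2 * e / R * norm u"
    proof (rule order_trans[OF norm_triangle_ineq add_mono[OF norm_damp_le[OF A R]]])
      show "norm (damp R A v' - damp R A' v') \<le> 2 * e / R * norm u"
        by (rule order_trans[OF d mult_left_mono[OF v']]) (use e R in simp)
    qed
    finally show ?case using Suc.IH by (simp add: v_def v'_def distrib_right add_divide_distrib)
  qed simp
  have "avg_op R m A u - avg_op R m A' u
      = (1 / real m) *\<^sub>R (\<Sum>k<m. op_power (damp R A) k u - op_power (damp R A') k u)"
    by (simp add: avg_op_apply sum_subtractf scaleR_diff_right)
  also have "norm \<dots> \<le> (1 / real m) * (\<Sum>k<m. real m * (2 * e / R * norm u))"
    unfolding norm_scaleR using R e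
    by (intro mult_mono sum_norm_le) (auto intro!: order_trans[OF k] mult_right_mono divide_right_mono)
  also have "\<dots> = real m * (2 * e / R) * norm u" using False by simp
  finally show ?thesis .
qed (simp add: avg_op_apply)

end

section \<open>Energies and modes of the classes of wells\<close>

context guard_potential
begin

text \<open>The window reaches from left of the origin to beyond the first well of class
  \<open>i\<close>, but contains no site of a higher class. Within it class \<open>i\<close> has the
  highest step, which determines the top level. The nonnegative near maximizer cannot vanish at the
  origin by the Harnack inequality, so the origin overlaps with the mode of each class, by an amount
  exponentially small in \<open>p i\<close>. This is why the wells are placed
  hierarchically.\<close>

lemma class_energy:
  assumes i: "i \<le> N" and \<Lambda>: "3 * L \<le> \<Lambda>" "s 0 \<le> - \<Lambda>" "p i + \<Lambda> < s (Suc i)" and p0: "l \<le> p 0"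
    and Lbig: "8 * (8 / g + 16 / (c * \<xi>) + 2 / (c * d)) \<le> of_int L"
    and Lambig: "16 * (8 / g + 16 / (c * \<xi>) + 2 / (c * d)) < of_int (\<Lambda> - l)"
    and top: "is_top H {- \<Lambda>..p i + \<Lambda>} E" "\<bar>E\<bar> \<le> K"
  shows class_energy_bound: "\<bar>E - (E1 + c * (real i * \<xi>))\<bar> \<le> c * \<xi> / 4"
    and class_mode: "\<exists>\<phi>. norm \<phi> \<le> 1 \<and> norm (blinfun_apply H \<phi> - E *\<^sub>R \<phi>) \<le> 4 / of_int (\<Lambda> - l)
      \<and> 1 / ((2 * K) ^ nat (p i + l) * (2 * sqrt (2 * of_int (p i + l + 1)))) \<le> Re (apply_ell2 \<phi> 0)"
proof -
  define \<Omega> where "\<Omega> = {- \<Lambda>..p i + \<Lambda>}"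
  have p_mono: "p 0 \<le> p j" if "j \<le> N" for j
  proof (cases "j = 0")
    case False
    have "p 0 \<le> s 1" using tile_right[of 0] L by simp
    also have "\<dots> \<le> s j" using s_mono[of 1 j] False that by simp
    also have "\<dots> \<le> p j" using tile_left[OF that] L by simp
    finally show ?thesis .
  qed simp
  have p_le: "p j \<le> p i" if "j \<le> i" for j
  proof (cases "j = i")
    case False
    have "p j \<le> s (Suc j)" using tile_right[of j] that i L by simp
    also have "\<dots> \<le> s i" using s_mono[of "Suc j" i] False that i by simp
    also have "\<dots> \<le> p i" using tile_left[OF i] L by simp
    finally show ?thesis .
  qed simp
  have l0: "0 < l" using l by simp
  have pi0: "0 < p i" using p_mono[OF i] p0 l0 by simp
  have \<Omega>pos: "pos n = n" and \<Omega>cls: "cls n \<le> i" if "n \<in> \<Omega>" for n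
  proof -
    have n: "s 0 \<le> n" "n < s (Suc i)" using that \<Lambda> by (auto simp: \<Omega>_def)
    then have "n < s (Suc N)" using s_mono[of "Suc i" "Suc N"] i by simp
    then show e: "pos n = n" using pos_eq[of n 0] n by simp
    show "cls n \<le> i"
    proof (rule ccontr)
      assume "\<not> cls n \<le> i"
      then have "s (Suc i) \<le> s (cls n)" using s_mono[of "Suc i" "cls n"] cls(1)[of n] by simp
      then show False using cls(2)[of n] e n by simp
    qed
  qed
  have core: "n \<in> {0..p i + l}" if "n \<in> \<Omega>" "dd n \<le> l" for n
    using \<Omega>pos[OF that(1)] p_le[OF \<Omega>cls[OF that(1)]] p_mono[OF cls(1)[of n]] that(2) p0 by (auto simp: dd_def)
  have small': "0 < c * \<xi>" "c * (real i * \<xi>) \<le> c * (real N * \<xi>)" using pos i by auto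
  \<comment> \<open>The one-well near maximizer, moved to \<open>p i\<close>, is admissible in the
    window.\<close>
  have lower: "E1 + c * (real i * \<xi>) \<le> E"
  proof (rule field_le_epsilon)
    fix \<tau> :: real assume "0 < \<tau>"
    obtain u where u: "supp_in {- 3 * L..3 * L} u" "norm u = 1" "E1 - \<tau> < form (schrodinger c U) u"
      using is_top_near[OF E1(1) \<open>0 < \<tau>\<close>] by metis
    define w where "w = ell2_shift (- p i) u"
    have wu: "ell2_shift (p i) w = u" by (rule ell2_eqI) (simp add: w_def ell2_shift.rep_eq)
    have sw: "supp_in {p i - 3 * L..p i + 3 * L} w" using u(1) unfolding w_def supp_in_def ell2_shift.rep_eq by auto
    have "form H w = ell2_shift (p i) (blinfun_apply H w) \<bullet> ell2_shift (p i) w" by (simp add: inner_ell2_shift)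
    also have "\<dots> = form (schrodinger c U) u + c * (real i * \<xi>) * (norm u)\<^sup>2"
      using local_shift[OF i, of 0 w] sw by (simp add: wu inner_add_left power2_norm_eq_inner)
    finally have "form H w > E1 - \<tau> + c * (real i * \<xi>)" using u by simp
    moreover have "supp_in {- \<Lambda>..p i + \<Lambda>} w" by (rule supp_in_mono[OF sw]) (use \<Lambda> pi0 in auto)
    then have "form H w \<le> E" using is_top_le[OF top(1), of w] u(2) by (simp add: w_def norm_ell2_shift)
    ultimately show "E1 + c * (real i * \<xi>) \<le> E + \<tau>" by simp
  qed
  define M where "M = 2 * K"
  have M: "1 \<le> M" using pos by (simp add: M_def)
  define k where "k = nat (p i + l)"
  have k: "of_int (p i + l) = real k" "p i + l = int k" using pi0 l0 by (auto simp: k_def)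
  define w where "w = 1 / (M ^ k * (2 * sqrt (2 * (real k + 1))))"
  have w: "0 < w" using M by (simp add: w_def)
  have \<Lambda>l: "0 < real_of_int (\<Lambda> - l)"
  proof -
    have "0 < \<Lambda> - l" using \<Lambda>(1) l L by linarith
    then show ?thesis by (simp only: of_int_0_less_iff)
  qed
  \<comment> \<open>The three bounds serve the mass estimate in the cores, the errors along the
    Harnack chain, and the residual left after the cut-off.\<close>
  define \<tau> where "\<tau> = min (c * d / 4) (min ((w / (real k + 1))\<^sup>2 / (2 * K)) ((2 / of_int (\<Lambda> - l))\<^sup>2 / (2 * K)))"
  have \<tau>: "0 < \<tau>" "\<tau> \<le> c * d / 4" "\<tau> \<le> (w / (real k + 1))\<^sup>2 / (2 * K)" "\<tau> \<le> (2 / of_int (\<Lambda> - l))\<^sup>2 / (2 * K)"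
    using pos w \<Lambda>l by (auto simp: \<tau>_def)
  define \<epsilon> where "\<epsilon> = sqrt (2 * K * \<tau>)"
  have \<epsilon>0: "0 \<le> \<epsilon>" using pos \<tau> by (simp add: \<epsilon>_def)
  have \<epsilon>1: "\<epsilon> \<le> w / (real k + 1)" unfolding \<epsilon>_def
    by (rule real_le_lsqrt) (use \<tau> pos w in \<open>auto simp: field_simps\<close>)
  have \<epsilon>2: "\<epsilon> \<le> 2 / of_int (\<Lambda> - l)" unfolding \<epsilon>_def
    by (rule real_le_lsqrt) (use \<tau> pos \<Lambda>l in \<open>auto simp: field_simps\<close>)
  obtain u where u: "supp_in \<Omega> u" "norm u = 1" "nonneg_ell2 u" "E - \<tau> < form H u"
    using is_top_near[OF top(1) \<tau>(1)] unfolding \<Omega>_def by metis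
  define x where "x n = Re (apply_ell2 u n)" for n
  have x0: "0 \<le> x n" for n using nonneg_Re[OF u(3)] by (simp add: x_def)
  have xu: "apply_ell2 u n = of_real (x n)" for n
    using nonneg_real_ell2[OF u(3)] by (simp add: x_def real_ell2_def complex_eq_iff)
  have step: "x (n + 1) \<le> M * x n + \<epsilon>" if "n \<in> \<Omega>" for n
    using near_top_residual_site[OF K(2) top(1)[folded \<Omega>_def] top(2) K(3) u(1,2,3), of \<tau> n] u(4) that x0[of "n - 1"]
    by (simp add: x_def M_def \<epsilon>_def)
  have mass: "1 / 2 \<le> (\<Sum>n\<in>{0..p i + l}. (x n)\<^sup>2)"
  proof -
    have "(norm (proj_op {n. dd n \<le> l} u))\<^sup>2 \<le> (norm (proj_op {0..p i + l} u))\<^sup>2"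
      using core u(1) by (intro power_mono norm_ell2_mono) (auto simp: supp_in_def)
    also have "\<dots> = (\<Sum>n\<in>{0..p i + l}. (x n)\<^sup>2)"
      by (subst norm_finite_supp[of "{0..p i + l}"]) (auto simp: supp_in_def xu)
    finally have "c * d * (norm (proj_op {n. dd n \<le> l} u))\<^sup>2 \<le> c * d * (\<Sum>n\<in>{0..p i + l}. (x n)\<^sup>2)"
      using pos by (intro mult_left_mono) auto
    moreover have "0 \<le> c * (real i * \<xi>)" using pos by simp
    moreover have "cd * (1 / 2) \<le> S"
      if "P \<le> S" "0 \<le> a" "F \<le> \<nu> + b + P" "E - \<tau> < F" "E1 + a \<le> E" "b \<le> cd / 16" "\<nu> + 15 / 16 * cd \<le> E0" "\<tau> \<le> cd / 4" "0 < cd"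
      for P S a F b cd using that E0(2) pos(5) by linarith
    ultimately have "c * d * (1 / 2) \<le> c * d * (\<Sum>n\<in>{0..p i + l}. (x n)\<^sup>2)"
      using form_upper[of u, unfolded u(2) power_one mult_1_right] u(4) lower E0(3) small(1) \<tau>(2) mult_pos_pos[OF pos(1,2)] by blast
    then show ?thesis using pos by (simp add: mult_le_cancel_left_pos)
  qed
  have card: "(\<Sum>n\<in>{0..p i + l}. r) = (real k + 1) * r" for r :: real using k by simp
  have "\<exists>n\<in>{0..p i + l}. 1 / (2 * (real k + 1)) \<le> (x n)\<^sup>2"
  proof (rule ccontr)
    assume "\<not> ?thesis"
    then have "(\<Sum>n\<in>{0..p i + l}. (x n)\<^sup>2) < (\<Sum>n\<in>{0..p i + l}. 1 / (2 * (real k + 1)))"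
      using k(2) by (intro sum_strict_mono) (auto simp: not_le)
    also have "\<dots> = 1 / 2" unfolding card by (simp add: field_simps)
    finally show False using mass by simp
  qed
  then obtain n where n: "n \<in> {0..p i + l}" "1 / (2 * (real k + 1)) \<le> (x n)\<^sup>2" by blast
  have xn: "1 / sqrt (2 * (real k + 1)) \<le> x n"
  proof (rule power2_le_imp_le)
    show "(1 / sqrt (2 * (real k + 1)))\<^sup>2 \<le> (x n)\<^sup>2" using n(2) by (simp add: power_divide)
  qed (rule x0)
  have chain: "x n \<le> M ^ k * (x 0 + (real k + 1) * \<epsilon>)"
  proof -
    define f where "f j = x (int j)" for j
    have nk: "nat n \<le> k" "n = int (nat n)" using n(1) k by auto
    have "f (nat n) \<le> M ^ nat n * (f 0 + real (nat n) * \<epsilon>)"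
    proof (rule growth_chain[OF _ M \<epsilon>0])
      fix j assume "j < nat n"
      then have "int j \<in> \<Omega>" using nk k \<Lambda>(1) l L pi0 by (auto simp: \<Omega>_def)
      from step[OF this] show "f (Suc j) \<le> M * f j + \<epsilon>" by (simp add: f_def add.commute)
    qed
    also have "\<dots> \<le> M ^ k * (x 0 + (real k + 1) * \<epsilon>)"
    proof (rule mult_mono)
      show "M ^ nat n \<le> M ^ k" using M nk by (intro power_increasing)
      have "real (nat n) * \<epsilon> \<le> (real k + 1) * \<epsilon>" using nk \<epsilon>0 by (intro mult_right_mono) auto
      then show "f 0 + real (nat n) * \<epsilon> \<le> x 0 + (real k + 1) * \<epsilon>" by (simp add: f_def)
      show "0 \<le> f 0 + real (nat n) * \<epsilon>" using x0[of 0] \<epsilon>0 by (simp add: f_def)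
    qed (use M in simp)
    finally show ?thesis using nk by (simp add: f_def)
  qed
  have x0w: "w \<le> x 0"
  proof -
    have Mp: "0 < M ^ k" using M by simp
    have "M ^ k * (2 * w) = 1 / sqrt (2 * (real k + 1))" using M by (simp add: w_def field_simps)
    then have "M ^ k * (2 * w) \<le> M ^ k * (x 0 + (real k + 1) * \<epsilon>)" using xn chain by simp
    then have "2 * w \<le> x 0 + (real k + 1) * \<epsilon>" using Mp by (simp add: mult_le_cancel_left_pos)
    moreover have "(real k + 1) * \<epsilon> \<le> w" using \<epsilon>1 by (simp add: field_simps)
    ultimately show ?thesis by simp
  qed
  \<comment> \<open>The window's near maximizer solves the equation only against vectors supported
    in the window. A cut-off equal to 1 on \<open>{- l..p i + l}\<close> and vanishing outside the
    window turns it into an approximate eigenvector on the whole line, at the price of its slope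
    \<open>1 / (\<Lambda> - l)\<close>.\<close>
  define J where "J n = clamp ((of_int \<Lambda> - of_int (max (- n) (n - p i))) / of_int (\<Lambda> - l))" for n
  have Jb: "\<bar>J n\<bar> \<le> 1" for n by (simp add: J_def clamp_bounds)
  have Jl: "\<bar>J (n + 1) - J n\<bar> \<le> 1 / of_int (\<Lambda> - l)" for n
  proof -
    have "\<bar>real_of_int (max (- n) (n - p i)) - of_int (max (- (n + 1)) (n + 1 - p i))\<bar> \<le> 1" by (simp add: max_def)
    then have "\<bar>real_of_int (max (- n) (n - p i)) - of_int (max (- (n + 1)) (n + 1 - p i))\<bar> / of_int (\<Lambda> - l) \<le> 1 / of_int (\<Lambda> - l)"
      using \<Lambda>l by (intro divide_right_mono) auto
    moreover have "(of_int \<Lambda> - of_int (max (- (n + 1)) (n + 1 - p i))) / of_int (\<Lambda> - l) - (of_int \<Lambda> - of_int (max (- n) (n - p i))) / of_int (\<Lambda> - l)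
        = (real_of_int (max (- n) (n - p i)) - of_int (max (- (n + 1)) (n + 1 - p i))) / of_int (\<Lambda> - l)"
      by (simp add: diff_divide_distrib)
    ultimately show ?thesis unfolding J_def using \<Lambda>l
      by (intro order_trans[OF clamp_lipschitz]) (simp only: abs_divide abs_of_pos)
  qed
  have J1: "J n = 1" if "n \<in> {0..p i + l}" for n
  proof -
    have "max (- n) (n - p i) \<le> l" using that l0 by auto
    then have "real_of_int (\<Lambda> - l) \<le> of_int \<Lambda> - of_int (max (- n) (n - p i))" by linarith
    then have "(1::real) \<le> (of_int \<Lambda> - of_int (max (- n) (n - p i))) / of_int (\<Lambda> - l)" using \<Lambda>l by (simp only: le_divide_eq_1_pos)
    then show ?thesis by (simp add: J_def clamp_def)
  qed
  have J0: "J n = 0" if "n \<notin> \<Omega>" for n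
  proof -
    have "\<Lambda> \<le> max (- n) (n - p i)" using that by (auto simp: \<Omega>_def)
    then have "of_int \<Lambda> - real_of_int (max (- n) (n - p i)) \<le> 0" by linarith
    then have "(of_int \<Lambda> - of_int (max (- n) (n - p i))) / real_of_int (\<Lambda> - l) \<le> 0" using \<Lambda>l by (intro divide_nonpos_pos)
    then show ?thesis by (simp add: J_def clamp_def)
  qed
  define \<phi> where "\<phi> = cut_op J u"
  have \<phi>1: "norm \<phi> \<le> 1" using norm_cut_op_le[of J u, OF Jb] u(2) by (simp add: \<phi>_def)
  have res: "norm (blinfun_apply H \<phi> - E *\<^sub>R \<phi>) \<le> 4 / of_int (\<Lambda> - l)"
  proof -
    define r where "r = blinfun_apply H u - E *\<^sub>R u"
    define v where "v = proj_op \<Omega> r"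
    have "supp_in \<Omega> v" by (simp add: v_def supp_in_def)
    then have "\<bar>E * (u \<bullet> v) - blinfun_apply H u \<bullet> v\<bar> \<le> \<epsilon> * norm v"
      unfolding \<epsilon>_def using near_top_residual[OF hermitian_schrodinger K(2) is_top_le[OF top(1)[folded \<Omega>_def]] top(2) u(1,2)] u(4) by simp
    moreover have "r \<bullet> v = (norm v)\<^sup>2" unfolding v_def using proj_op_inner[of \<Omega> r] by (simp add: inner_commute)
    ultimately have "norm v * norm v \<le> \<epsilon> * norm v" by (simp add: r_def inner_diff_left power2_eq_square abs_le_iff)
    then have "norm v \<le> \<epsilon>" using \<epsilon>0 by (cases "norm v = 0") auto
    moreover have "norm (cut_op J r) \<le> norm v"
      by (rule norm_ell2_mono) (use Jb J0 in \<open>auto simp: v_def cut_op_apply[of J, OF Jb] norm_mult mult_left_le_one_le\<close>)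
    ultimately have "norm (cut_op J r) \<le> 2 / of_int (\<Lambda> - l)" using \<epsilon>2 by simp
    then show ?thesis
      using cut_op_residual[of J "1 / of_int (\<Lambda> - l)" c VG u E, OF Jb Jl] u(2) by (simp add: \<phi>_def r_def)
  qed
  show "\<exists>\<phi>. norm \<phi> \<le> 1 \<and> norm (blinfun_apply H \<phi> - E *\<^sub>R \<phi>) \<le> 4 / of_int (\<Lambda> - l)
      \<and> 1 / ((2 * K) ^ nat (p i + l) * (2 * sqrt (2 * of_int (p i + l + 1)))) \<le> Re (apply_ell2 \<phi> 0)"
  proof (intro exI[of _ \<phi>] conjI \<phi>1 res)
    have "Re (apply_ell2 \<phi> 0) = x 0" using J1[of 0] pi0 l0 by (simp add: \<phi>_def cut_op_apply[of J, OF Jb] xu)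
    moreover have "1 / ((2 * K) ^ nat (p i + l) * (2 * sqrt (2 * of_int (p i + l + 1)))) = w"
    proof -
      have "nat (p i + l) = k" by (simp only: k_def)
      moreover have "real_of_int (p i + l + 1) = real k + 1" using k(1) by (simp only: of_int_add of_int_1)
      ultimately show ?thesis by (simp only: w_def M_def)
    qed
    ultimately show "1 / ((2 * K) ^ nat (p i + l) * (2 * sqrt (2 * of_int (p i + l + 1)))) \<le> Re (apply_ell2 \<phi> 0)" using x0w by simp
  qed
  \<comment> \<open>A higher energy would be resonant with no class \<open>j \<le> i\<close>. Then
    \<open>off_class_bound\<close>, applied with the higher classes as \<open>X\<close>, makes
    \<open>\<phi>\<close> small, although it carries half of the mass and no higher class meets the
    window.\<close>
  have "E \<le> E1 + c * (real i * \<xi>) + c * \<xi> / 4"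
  proof (rule ccontr)
    assume "\<not> ?thesis"
    then have big: "E1 + c * (real i * \<xi>) + c * \<xi> / 4 < E" by simp
    define D where "D = 8 / g + 16 / (c * \<xi>) + 2 / (c * d)"
    have Dp: "0 < D" using pos by (simp add: D_def add_pos_pos)
    have "norm (proj_op {n. cls n \<notin> {j. i < j}} \<phi>)
        \<le> (8 / g + 4 / (c * \<xi> / 4) + 2 / (c * d)) * (norm (blinfun_apply H \<phi> - E *\<^sub>R \<phi>) + 2 / of_int L * norm \<phi>)"
    proof (rule off_class_bound)
      have "0 \<le> c * (real i * \<xi>)" using pos by simp
      moreover have "0 < c * d" using pos by simp
      ultimately show "\<nu> + c * (real N * \<xi>) + c * d / 2 \<le> E"
        using E0(2,3) small(1) lower pos(5) by linarith
      show "0 < c * \<xi> / 4" using pos by simp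
      fix j assume j: "j \<le> N" "j \<notin> {j. i < j}"
      then have "c * (real j * \<xi>) \<le> c * (real i * \<xi>)" using pos by simp
      then show "c * \<xi> / 4 \<le> \<bar>E - c * (real j * \<xi>) - E1\<bar> \<and> E0 + g / 2 \<le> E - c * (real j * \<xi>)"
        using big E0(2) small'(1) pos(5) by (simp add: abs_if)
    qed
    moreover have "proj_op {n. cls n \<notin> {j. i < j}} \<phi> = \<phi>"
    proof (rule ell2_eqI)
      fix n
      show "apply_ell2 (proj_op {n. cls n \<notin> {j. i < j}} \<phi>) n = apply_ell2 \<phi> n"
        using J0[of n] \<Omega>cls[of n] by (cases "n \<in> \<Omega>") (auto simp: \<phi>_def cut_op_apply[of J, OF Jb])
    qed
    ultimately have "norm \<phi> \<le> D * (4 / of_int (\<Lambda> - l) + 2 / of_int L * norm \<phi>)"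
      using res Dp by (simp add: D_def[symmetric]) (meson add_right_mono less_imp_le mult_left_mono order_trans)
    moreover have "D * (4 / of_int (\<Lambda> - l)) < 1 / 4" using Lambig \<Lambda>l unfolding D_def[symmetric] by (simp add: field_simps)
    moreover have "D * (2 / of_int L) \<le> 1 / 4" using Lbig L unfolding D_def[symmetric] by (simp add: field_simps)
    then have "D * (2 / of_int L) * norm \<phi> \<le> 1 / 4 * norm \<phi>" by (intro mult_right_mono) auto
    ultimately have "norm \<phi> < 1 / 2" by (simp add: distrib_left)
    moreover have "1 / 2 \<le> (norm \<phi>)\<^sup>2"
    proof -
      have "(\<Sum>n\<in>{0..p i + l}. (x n)\<^sup>2) = (\<Sum>n\<in>{0..p i + l}. (cmod (apply_ell2 \<phi> n))\<^sup>2)"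
        by (intro sum.cong) (simp_all add: \<phi>_def cut_op_apply[of J, OF Jb] J1 xu)
      also have "\<dots> \<le> (norm \<phi>)\<^sup>2" by (rule sum_le_norm_ell2) simp
      finally show ?thesis using mass by simp
    qed
    moreover have "(norm \<phi>)\<^sup>2 \<le> 1 / 2 * norm \<phi>" unfolding power2_eq_square using calculation(1) by (intro mult_right_mono) auto
    ultimately show False by simp
  qed
  then show "\<bar>E - (E1 + c * (real i * \<xi>))\<bar> \<le> c * \<xi> / 4" using lower small'(1) by (simp add: abs_if)
qed

end

text \<open>\<open>f V\<close> is a state that inherits recurrence of \<open>\<delta>\<^sub>0\<close> and stays in \<open>S\<close> for all times.\<close>

definition guards :: "real \<Rightarrow> real \<Rightarrow> (int \<Rightarrow>\<^sub>C real) set \<Rightarrow> real \<Rightarrow> int set \<Rightarrow> bool" where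
  "guards w C Q c S \<longleftrightarrow> (\<exists>f. \<forall>V\<in>Q. w \<le> norm (f V)
    \<and> (\<forall>t z. norm (evolution (schrodinger c V) t (f V) - cscale_op z (f V))
         \<le> norm (evolution (schrodinger c V) t (ell2_delta 0) - cscale_op z (ell2_delta 0)))
    \<and> (\<forall>t. 10 * norm (proj_op (- S) (evolution (schrodinger c V) t (f V))) \<le> norm (f V))
    \<and> (\<forall>V'\<in>Q. norm (f V - f V') \<le> C * norm (V - V')))"

lemma guards_mono:
  assumes "guards w C Q c S" "w' \<le> w" "C \<le> C'" "Q' \<subseteq> Q"
  shows "guards w' C' Q' c S"
proof -
  obtain f where f: "\<forall>V\<in>Q. w \<le> norm (f V)
    \<and> (\<forall>t z. norm (evolution (schrodinger c V) t (f V) - cscale_op z (f V))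
         \<le> norm (evolution (schrodinger c V) t (ell2_delta 0) - cscale_op z (ell2_delta 0)))
    \<and> (\<forall>t. 10 * norm (proj_op (- S) (evolution (schrodinger c V) t (f V))) \<le> norm (f V))
    \<and> (\<forall>V'\<in>Q. norm (f V - f V') \<le> C * norm (V - V'))"
    using assms(1) unfolding guards_def by blast
  have "C * norm (V - V') \<le> C' * norm (V - V')" for V V' :: "int \<Rightarrow>\<^sub>C real"
    using assms(3) by (intro mult_right_mono) auto
  then show ?thesis unfolding guards_def
    using f assms(2,4) by (intro exI[of _ f]) (meson order_trans subset_iff)
qed

context guard_potential
begin

text \<open>The guarded state is the filter at energy \<open>E\<close> applied to the unit vector at
  0. It inherits returns since the filter is a contraction commuting with the evolution, and it
  stays on class \<open>i\<close> since its residual is conserved in time. The choices are ordered: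
  the overlap \<open>w\<close> comes from \<open>p i\<close>; then \<open>m\<close> is so large that
  the residual is small relative to \<open>w\<close>; then \<open>\<Lambda>\<close> is so large and
  \<open>\<rho>\<close> so small that \<open>m\<close> dampings hardly move the mode.\<close>

lemma class_guards:
  fixes m :: nat
  assumes i: "i \<le> N" and \<Lambda>: "3 * L \<le> \<Lambda>" "s 0 \<le> - \<Lambda>" "p i + \<Lambda> < s (Suc i)" and p0: "l \<le> p 0"
    and D: "8 / g + 16 / (c * \<xi>) + 2 / (c * d) \<le> D"
    and Lbig: "60 * D \<le> of_int L"
    and Lambig: "16 * D < of_int (\<Lambda> - l)"
    and w: "w = 1 / ((2 * K) ^ nat (p i + l) * (2 * sqrt (2 * of_int (p i + l + 1))))"
    and m: "0 < m" "(180 * D * K)\<^sup>2 \<le> real m * w" "real m * (4 / of_int (\<Lambda> - l) + c * \<rho>) \<le> K * w"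
    and \<rho>: "0 \<le> \<rho>" "c * \<rho> \<le> K" "30 * D * (c * \<rho>) \<le> 1"
  shows "guards (w / 2) (real m * (2 * c / (3 * K))) (cball VG \<rho>) c {n. cls n = i}"
proof -
  have D0: "0 < 8 / g + 16 / (c * \<xi>) + 2 / (c * d)" using pos by (simp add: add_pos_pos)
  then have Dp: "0 < D" using D by simp
  have K0: "0 < K" using pos by simp
  have "p 0 \<le> p i"
  proof (cases "i = 0")
    case False
    have "p 0 \<le> s 1" using tile_right[of 0] L by simp
    also have "\<dots> \<le> s i" using s_mono[of 1 i] False i by simp
    also have "\<dots> \<le> p i" using tile_left[OF i] L by simp
    finally show ?thesis .
  qed simp
  then have w0: "0 < w" unfolding w using K0 l p0 by (intro divide_pos_pos mult_pos_pos zero_less_power) auto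
  \<comment> \<open>The energy belongs to the centre \<open>VG\<close> of the ball and is kept fixed
    on it, so the state depends on \<open>V'\<close> only through the filter.\<close>
  obtain E where E: "is_top H {- \<Lambda>..p i + \<Lambda>} E" "\<bar>E\<bar> \<le> K"
  proof -
    have "- \<Lambda> \<le> p i + \<Lambda>" using \<Lambda>(1) \<open>p 0 \<le> p i\<close> p0 l L by linarith
    then have "{- \<Lambda>..p i + \<Lambda>} \<noteq> {}" by simp
    from ex_is_top[OF this K(2)] show ?thesis using that by blast
  qed
  have bigs: "8 * (8 / g + 16 / (c * \<xi>) + 2 / (c * d)) \<le> of_int L" "16 * (8 / g + 16 / (c * \<xi>) + 2 / (c * d)) < of_int (\<Lambda> - l)"
    by (rule order_trans[OF mult_left_mono[OF D]], simp, use Dp Lbig in linarith)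
      (rule le_less_trans[OF mult_left_mono[OF D] Lambig], simp)
  have Ebd: "\<bar>E - (E1 + c * (real i * \<xi>))\<bar> \<le> c * \<xi> / 4"
    by (rule class_energy_bound[OF i \<Lambda> p0 bigs E])
  obtain \<phi> where \<phi>: "norm \<phi> \<le> 1" "norm (blinfun_apply H \<phi> - E *\<^sub>R \<phi>) \<le> 4 / of_int (\<Lambda> - l)" "w \<le> Re (apply_ell2 \<phi> 0)"
    using class_mode[OF i \<Lambda> p0 bigs E] unfolding w[symmetric] by blast
  \<comment> \<open>One \<open>K\<close> each for \<open>H\<close>, for the perturbation of size
    \<open>c * \<rho> \<le> K\<close>, and for the energy.\<close>
  define R where "R = 3 * K"
  have R: "0 < R" using K0 by (simp add: R_def)
  define A where "A V' = schrodinger c V' - E *\<^sub>R id_blinfun" for V'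
  have A_apply: "blinfun_apply (A V') u = schrodinger c V' u - E *\<^sub>R u" for V' u
    by (simp add: A_def blinfun.diff_left blinfun.scaleR_left)
  have herm: "hermitian_op (A V')" for V' unfolding A_def by (rule hermitian_shift[OF hermitian_schrodinger])
  have near: "norm (schrodinger c V' u - blinfun_apply H u) \<le> c * \<rho> * norm u" if "V' \<in> cball VG \<rho>" for V' u
  proof (rule order_trans[OF norm_schrodinger_diff])
    have "norm (V' - VG) \<le> \<rho>" using that by (simp add: dist_norm norm_minus_commute)
    then show "\<bar>c\<bar> * norm (V' - VG) * norm u \<le> c * \<rho> * norm u" using pos by (intro mult_right_mono mult_mono) auto
  qed
  have near': "norm (blinfun_apply (A V') u - (blinfun_apply H u - E *\<^sub>R u)) \<le> c * \<rho> * norm u" if "V' \<in> cball VG \<rho>" for V' u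
    using near[OF that, of u] by (simp add: A_apply)
  have normA: "norm (A V') \<le> R" if "V' \<in> cball VG \<rho>" for V'
  proof (rule norm_blinfun_bound)
    fix u
    have "norm (blinfun_apply (A V') u) \<le> norm (schrodinger c V' u - blinfun_apply H u) + norm (blinfun_apply H u) + norm (E *\<^sub>R u)"
      unfolding A_apply using norm_triangle_ineq[of "schrodinger c V' u - blinfun_apply H u" "blinfun_apply H u"]
        norm_triangle_ineq4[of "schrodinger c V' u" "E *\<^sub>R u"] by simp
    also have "\<dots> \<le> K * norm u + K * norm u + K * norm u"
    proof (intro add_mono)
      show "norm (schrodinger c V' u - blinfun_apply H u) \<le> K * norm u"
        by (rule order_trans[OF near[OF that] mult_right_mono[OF \<rho>(2)]]) simp
      show "norm (E *\<^sub>R u) \<le> K * norm u" using E(2) by (simp add: mult_right_mono)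
    qed (rule norm_blinfun_le[OF K(2)])
    finally show "norm (blinfun_apply (A V') u) \<le> R * norm u" by (simp add: R_def algebra_simps)
  qed (use R in simp)
  define T where "T V' = avg_op R m (A V')" for V'
  define f where "f V' = blinfun_apply (T V') (ell2_delta 0)" for V'
  show ?thesis unfolding guards_def
  proof (intro exI[of _ f] ballI conjI allI)
    fix V' assume V': "V' \<in> cball VG \<rho>"
    note av = herm[of V'] normA[OF V'] R
    have ci: "cscale_op z (blinfun_apply (A V') u) = blinfun_apply (A V') (cscale_op z u)" for z u
      using hermitian_op_cscale[OF herm[of V']] by simp
    have cH: "schrodinger c V' (blinfun_apply (A V') u) = blinfun_apply (A V') (schrodinger c V' u)" for u
      by (simp add: A_apply blinfun.bilinear_simps)
    have Tz: "blinfun_apply (T V') (cscale_op z u) = cscale_op z (blinfun_apply (T V') u)" for z u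
      unfolding T_def using avg_op_commute[OF av, of "cscale_op z" m u] ci by simp
    have TU: "blinfun_apply (T V') (evolution (schrodinger c V') t u) = evolution (schrodinger c V') t (blinfun_apply (T V') u)" for t u
      by (rule commute_evolution[OF hermitian_schrodinger Tz])
        (use avg_op_commute[OF av, of "schrodinger c V'" m] cH in \<open>simp add: T_def\<close>)
    have AU: "blinfun_apply (A V') (evolution (schrodinger c V') t u) = evolution (schrodinger c V') t (blinfun_apply (A V') u)" for t u
      by (rule commute_evolution[OF hermitian_schrodinger]) (simp_all add: ci cH)
    \<comment> \<open>The mode \<open>\<phi>\<close> is paired with the guarded state: the symmetric
      filter moves over to \<open>\<phi>\<close>, changes it by at most \<open>w / 2\<close>, and
      leaves at least \<open>w / 2\<close> of its value at 0.\<close>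
    show f_low: "w / 2 \<le> norm (f V')"
    proof -
      have "norm (blinfun_apply (A V') \<phi>) \<le> 4 / of_int (\<Lambda> - l) + c * \<rho>"
      proof -
        have "norm (blinfun_apply (A V') \<phi>) \<le> norm (blinfun_apply H \<phi> - E *\<^sub>R \<phi>) + c * \<rho> * norm \<phi>"
          using near'[OF V', of \<phi>] norm_triangle_sub[of "blinfun_apply (A V') \<phi>" "blinfun_apply H \<phi> - E *\<^sub>R \<phi>"] by linarith
        moreover have "c * \<rho> * norm \<phi> \<le> c * \<rho> * 1" using \<phi>(1) pos \<rho> by (intro mult_left_mono) auto
        ultimately show ?thesis using \<phi>(2) by simp
      qed
      then have "real m * norm (blinfun_apply (A V') \<phi>) / R \<le> real m * (4 / of_int (\<Lambda> - l) + c * \<rho>) / R"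
        using R by (intro divide_right_mono mult_left_mono) auto
      also have "\<dots> \<le> K * w / R" using m(3) R by (intro divide_right_mono) auto
      also have "\<dots> \<le> w / 2" using K0 w0 by (simp add: R_def)
      finally have "norm (blinfun_apply (T V') \<phi> - \<phi>) \<le> w / 2"
        using order_trans[OF avg_op_near[OF av m(1), of \<phi>]] by (simp only: T_def)
      then have "cmod (apply_ell2 (blinfun_apply (T V') \<phi> - \<phi>) 0) \<le> w / 2" using cmod_le_norm_ell2 order_trans by blast
      then have "w / 2 \<le> Re (apply_ell2 (blinfun_apply (T V') \<phi>) 0)"
        using \<phi>(3) abs_Re_le_cmod[of "apply_ell2 (blinfun_apply (T V') \<phi> - \<phi>) 0"] by simp
      also have "\<dots> = \<phi> \<bullet> f V'"
        using avg_op_sym[OF av, of m \<phi> "ell2_delta 0"] by (simp add: f_def T_def inner_ell2_delta)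
      also have "\<dots> \<le> norm \<phi> * norm (f V')" by (rule norm_cauchy_schwarz)
      also have "\<dots> \<le> norm (f V')" using \<phi>(1) by (simp add: mult_left_le_one_le)
      finally show ?thesis .
    qed
    show "norm (evolution (schrodinger c V') t (f V') - cscale_op z (f V'))
         \<le> norm (evolution (schrodinger c V') t (ell2_delta 0) - cscale_op z (ell2_delta 0))" for t z
    proof -
      have "evolution (schrodinger c V') t (f V') - cscale_op z (f V')
        = blinfun_apply (T V') (evolution (schrodinger c V') t (ell2_delta 0) - cscale_op z (ell2_delta 0))"
        by (simp add: f_def TU Tz blinfun.diff_right)
      then show ?thesis using norm_avg_op_le[OF av] by (simp add: T_def)
    qed
    show "10 * norm (proj_op (- {n. cls n = i}) (evolution (schrodinger c V') t (f V'))) \<le> norm (f V')" for t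
    proof -
      define u where "u = evolution (schrodinger c V') t (f V')"
      have nu: "norm u = norm (f V')" unfolding u_def by (rule norm_evolution[OF hermitian_schrodinger])
      define F where "F = norm (f V')"
      have F0: "0 \<le> F" "w / 2 \<le> F" using f_low by (simp_all add: F_def)
      \<comment> \<open>The operator commutes with the evolution, so this residual is the same at
        all times. The factor 30 yields a third of the final bound with factor 10; the other two
        thirds come from \<open>c * \<rho>\<close> and from the slope \<open>1 / L\<close>.\<close>
      have Au: "30 * D * norm (blinfun_apply (A V') u) \<le> F"
      proof (rule power2_le_imp_le[OF _ F0(1)])
        have "norm (blinfun_apply (A V') u) = norm (blinfun_apply (A V') (f V'))"
          unfolding u_def AU by (rule norm_evolution[OF hermitian_schrodinger])
        then have "(norm (blinfun_apply (A V') u))\<^sup>2 \<le> 2 * R\<^sup>2 / real m * F"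
          using avg_op_residual[OF av m(1), of "ell2_delta 0"] by (simp add: f_def T_def F_def)
        then have "(30 * D)\<^sup>2 * (norm (blinfun_apply (A V') u))\<^sup>2 \<le> (30 * D)\<^sup>2 * (2 * R\<^sup>2 / real m * F)"
          by (intro mult_left_mono) auto
        also have "\<dots> = (180 * D * K)\<^sup>2 / (2 * real m) * F" by (simp add: R_def power2_eq_square)
        also have "\<dots> \<le> (real m * w) / (2 * real m) * F" by (rule mult_right_mono[OF divide_right_mono[OF m(2)] F0(1)]) simp
        also have "\<dots> = w / 2 * F" using m(1) by simp
        also have "\<dots> \<le> F * F" by (rule mult_right_mono[OF F0(2,1)])
        finally show "(30 * D * norm (blinfun_apply (A V') u))\<^sup>2 \<le> F\<^sup>2" by (simp add: power_mult_distrib power2_eq_square[of F])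
      qed
      have Hu: "norm (blinfun_apply H u - E *\<^sub>R u) \<le> norm (blinfun_apply (A V') u) + c * \<rho> * F"
        using near'[OF V', of u] norm_triangle_sub[of "blinfun_apply H u - E *\<^sub>R u" "blinfun_apply (A V') u"]
        by (simp add: nu F_def norm_minus_commute)
      have off: "norm (proj_op {n. cls n \<notin> {i}} u)
          \<le> (8 / g + 4 / (c * \<xi> / 4) + 2 / (c * d)) * (norm (blinfun_apply H u - E *\<^sub>R u) + 2 / of_int L * norm u)"
      proof (rule off_class_bound)
        have c\<xi>: "0 < c * \<xi>" using pos by simp
        have small': "c * (real N * \<xi>) + c * \<xi> \<le> g / 4" using small(2) by (simp add: algebra_simps)
        have i0: "0 \<le> c * (real i * \<xi>)" using pos by simp
        have "0 < c * d" "0 \<le> c * (real N * \<xi>)" using pos by simp_all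
        then show "\<nu> + c * (real N * \<xi>) + c * d / 2 \<le> E"
          using E0(2,3) small(1) small' Ebd i0 pos(5) c\<xi> by linarith
        show "0 < c * \<xi> / 4" using c\<xi> by simp
        fix j assume j: "j \<le> N" "j \<notin> {i}"
        have jN: "c * (real j * \<xi>) \<le> c * (real N * \<xi>)" using j pos by simp
        have "c * \<xi> \<le> \<bar>c * (real i * \<xi>) - c * (real j * \<xi>)\<bar>"
        proof -
          have "1 \<le> \<bar>real i - real j\<bar>" using j by simp
          then have "c * \<xi> * 1 \<le> c * \<xi> * \<bar>real i - real j\<bar>" using c\<xi> by (intro mult_left_mono) auto
          also have "\<dots> = \<bar>c * \<xi> * (real i - real j)\<bar>" using pos by (simp add: abs_mult)
          also have "c * \<xi> * (real i - real j) = c * (real i * \<xi>) - c * (real j * \<xi>)" by (simp add: algebra_simps)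
          finally show ?thesis by simp
        qed
        then show "c * \<xi> / 4 \<le> \<bar>E - c * (real j * \<xi>) - E1\<bar> \<and> E0 + g / 2 \<le> E - c * (real j * \<xi>)"
          using Ebd E0(2) jN small' i0 c\<xi> pos(5) by linarith
      qed
      define r where "r = norm (blinfun_apply H u - E *\<^sub>R u) + 2 / of_int L * F"
      have L0: "0 < real_of_int L" using L by simp
      have r0: "0 \<le> r" using F0 L0 by (simp add: r_def)
      have D': "8 / g + 4 / (c * \<xi> / 4) + 2 / (c * d) \<le> D" using D by simp
      have "10 * norm (proj_op {n. cls n \<notin> {i}} u) \<le> 10 * (D * r)"
        using order_trans[OF off mult_right_mono[OF D' r0[unfolded r_def F_def, folded nu]]] by (simp add: r_def F_def nu)
      also have "10 * (D * r) \<le> 10 * D * (norm (blinfun_apply (A V') u) + c * \<rho> * F) + 20 * (D / of_int L) * F"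
        using mult_left_mono[OF Hu, of D] Dp by (simp add: r_def algebra_simps)
      also have "\<dots> \<le> F"
      proof -
        have "20 * (D / of_int L) \<le> 1 / 3" using Lbig L0 by (simp add: field_simps)
        then have "20 * (D / of_int L) * F \<le> 1 / 3 * F" by (rule mult_right_mono[OF _ F0(1)])
        moreover have "10 * D * (c * \<rho> * F) \<le> 1 / 3 * F" using mult_right_mono[OF \<rho>(3) F0(1)] by (simp add: mult_ac)
        moreover have "10 * D * norm (blinfun_apply (A V') u) \<le> 1 / 3 * F" using Au by simp
        ultimately show ?thesis unfolding distrib_left by linarith
      qed
      finally show ?thesis by (simp add: F_def u_def Collect_neg_eq)
    qed
    fix V'' assume V'': "V'' \<in> cball VG \<rho>"
    have "norm (blinfun_apply (T V') (ell2_delta 0) - blinfun_apply (T V'') (ell2_delta 0)) \<le> real m * (2 * (c * norm (V' - V'')) / R) * norm (ell2_delta 0)"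
      unfolding T_def
    proof (rule avg_op_lipschitz[OF av herm normA[OF V'']])
      show "norm (blinfun_apply (A V') u - blinfun_apply (A V'') u) \<le> c * norm (V' - V'') * norm u" for u
        using norm_schrodinger_diff[of c V' u V''] pos by (simp add: A_apply)
    qed (use pos in simp)
    then show "norm (f V' - f V'') \<le> real m * (2 * c / (3 * K)) * norm (V' - V'')" by (simp add: f_def R_def)
  qed
qed

end

section \<open>Opening a spectral gap\<close>

type_synonym mat2 = "real \<times> real \<times> real \<times> real"

fun mm2 :: "mat2 \<Rightarrow> mat2 \<Rightarrow> mat2" where
  "mm2 (a, b, c, d) (a', b', c', d') = (a * a' + b * c', a * b' + b * d', c * a' + d * c', c * b' + d * d')"

fun tr2 :: "mat2 \<Rightarrow> real" where "tr2 (a, b, c, d) = a + d"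
fun det2 :: "mat2 \<Rightarrow> real" where "det2 (a, b, c, d) = a * d - b * c"

text \<open>The step from \<open>(u n, u (n - 1))\<close> to \<open>(u (n + 1), u n)\<close> for the
  recursion \<open>u (n + 1) = a * u n - u (n - 1)\<close>; the energy is absorbed in
  \<open>a\<close>.\<close>

definition step2 :: "real \<Rightarrow> mat2" where "step2 a = (a, -1, 1, 0)"

fun monodromy :: "(int \<Rightarrow> real) \<Rightarrow> int \<Rightarrow> nat \<Rightarrow> mat2" where
  "monodromy a x 0 = (1, 0, 0, 1)"
| "monodromy a x (Suc n) = mm2 (step2 (a (x + int n))) (monodromy a x n)"

lemma mm2_assoc: "mm2 (mm2 A B) C = mm2 A (mm2 B C)"
  by (cases A; cases B; cases C) (simp add: algebra_simps)

lemma mm2_one [simp]: "mm2 (1, 0, 0, 1) A = A" "mm2 A (1, 0, 0, 1) = A"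
  by (cases A; simp)+

lemma tr2_commute: "tr2 (mm2 A B) = tr2 (mm2 B A)"
  by (cases A; cases B) (simp add: algebra_simps)

lemma det2_mm2: "det2 (mm2 A B) = det2 A * det2 B"
  by (cases A; cases B) (simp add: algebra_simps)

lemma det2_monodromy [simp]: "det2 (monodromy a x n) = 1"
  by (induction n) (simp_all add: det2_mm2 step2_def)

lemma monodromy_add: "monodromy a x (m + n) = mm2 (monodromy a (x + int m) n) (monodromy a x m)"
  by (induction n) (simp_all add: mm2_assoc algebra_simps)

lemma monodromy_cong:
  "(\<And>i. x \<le> i \<Longrightarrow> i < x + int n \<Longrightarrow> a i = b i) \<Longrightarrow> monodromy a x n = monodromy b x n"
  by (induction n) simp_all

lemma monodromy_shift: "(\<And>i. a (i + q) = a i) \<Longrightarrow> monodromy a (x + q) n = monodromy a x n"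
proof (induction n)
  case (Suc n)
  then show ?case using Suc.prems[of "x + int n"] by (simp add: algebra_simps)
qed simp

text \<open>Starting one site later conjugates the monodromy by the invertible step matrix of the
  skipped site.\<close>

lemma tr2_monodromy_const:
  assumes "\<And>i. a (i + int q) = a i"
  shows "tr2 (monodromy a x q) = tr2 (monodromy a 0 q)"
proof -
  have step: "tr2 (monodromy a (x + 1) q) = tr2 (monodromy a x q)" for x
  proof -
    have "mm2 (monodromy a (x + 1) q) (step2 (a x)) = monodromy a x (1 + q)"
      using monodromy_add[of a x 1 q] by simp
    also have "\<dots> = mm2 (step2 (a x)) (monodromy a x q)"
      using assms[of x] by simp
    finally have *: "mm2 (monodromy a (x + 1) q) (step2 (a x)) = mm2 (step2 (a x)) (monodromy a x q)" .
    define S where "S = (0::real, 1::real, -1::real, a x)"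
    have S: "mm2 (step2 (a x)) S = (1, 0, 0, 1)" by (simp add: S_def step2_def)
    have S': "mm2 S (step2 (a x)) = (1, 0, 0, 1)" by (simp add: S_def step2_def)
    have "monodromy a (x + 1) q = mm2 (mm2 (monodromy a (x + 1) q) (step2 (a x))) S"
      by (simp add: mm2_assoc S)
    also have "tr2 \<dots> = tr2 (mm2 S (mm2 (step2 (a x)) (monodromy a x q)))"
      unfolding * by (rule tr2_commute)
    also have "\<dots> = tr2 (monodromy a x q)" by (simp add: mm2_assoc[symmetric] S')
    finally show ?thesis .
  qed
  show ?thesis
  proof (induction x rule: int_induct[where k = 0])
    case (step1 i) then show ?case by (simp add: step)
  next
    case (step2 i) then show ?case using step[of "i - 1"] by simp
  qed simp
qed

definition e11 :: "mat2 \<Rightarrow> real" where "e11 M = fst M"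
definition e12 :: "mat2 \<Rightarrow> real" where "e12 M = fst (snd M)"
definition e21 :: "mat2 \<Rightarrow> real" where "e21 M = fst (snd (snd M))"
definition e22 :: "mat2 \<Rightarrow> real" where "e22 M = snd (snd (snd M))"
lemmas e_defs = e11_def e12_def e21_def e22_def

lemma monodromy_Suc_entries:
  "e11 (monodromy a x (Suc n)) = a (x + int n) * e11 (monodromy a x n) - e21 (monodromy a x n)"
  "e12 (monodromy a x (Suc n)) = a (x + int n) * e12 (monodromy a x n) - e22 (monodromy a x n)"
  "e21 (monodromy a x (Suc n)) = e11 (monodromy a x n)"
  "e22 (monodromy a x (Suc n)) = e12 (monodromy a x n)"
  by (cases "monodromy a x n"; simp add: e_defs step2_def)+

declare monodromy.simps(2) [simp del]

lemma monodromy_bounded: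
  assumes "\<And>n. \<bar>a n\<bar> \<le> B"
  shows "\<exists>C\<ge>0. \<forall>x. \<bar>e11 (monodromy a x n)\<bar> \<le> C \<and> \<bar>e12 (monodromy a x n)\<bar> \<le> C
     \<and> \<bar>e21 (monodromy a x n)\<bar> \<le> C \<and> \<bar>e22 (monodromy a x n)\<bar> \<le> C"
proof (induction n)
  case 0
  show ?case by (rule exI[of _ 1]) (simp add: e_defs)
next
  case (Suc n)
  then obtain C where C: "0 \<le> C" "\<And>x. \<bar>e11 (monodromy a x n)\<bar> \<le> C" "\<And>x. \<bar>e12 (monodromy a x n)\<bar> \<le> C"
     "\<And>x. \<bar>e21 (monodromy a x n)\<bar> \<le> C" "\<And>x. \<bar>e22 (monodromy a x n)\<bar> \<le> C" by blast
  have B: "0 \<le> B" using assms[of 0] by simp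
  have *: "\<bar>a y * s - t\<bar> \<le> B * C + C" if "\<bar>s\<bar> \<le> C" "\<bar>t\<bar> \<le> C" for s t y
  proof -
    have "\<bar>a y * s - t\<bar> \<le> \<bar>a y\<bar> * \<bar>s\<bar> + \<bar>t\<bar>" by (metis abs_mult abs_triangle_ineq4)
    also have "\<dots> \<le> B * C + C" using that assms[of y] B by (intro add_mono mult_mono) auto
    finally show ?thesis .
  qed
  have "C \<le> B * C + C" using B C(1) by simp
  then have D: "\<bar>s\<bar> \<le> B * C + C" if "\<bar>s\<bar> \<le> C" for s using that by linarith
  show ?case
    by (intro exI[of _ "B * C + C"]) (use C B * D in \<open>auto simp: monodromy_Suc_entries\<close>)
qed

text \<open>Variation of constants: for an arbitrary \<open>u\<close> the transfer matrices still
  propagate \<open>u\<close>, up to square summable errors bounded by the norm of the defect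
  \<open>v u\<close>, with a constant independent of \<open>u\<close>.\<close>

lemma transfer_inhomogeneous:
  assumes v: "v = schrodinger 1 V" and a: "\<And>n. a n = - apply_bcontfun V n"
  shows "\<exists>C\<ge>0. \<forall>u. \<exists>F G :: ell2. norm F \<le> C * norm (blinfun_apply v u) \<and> norm G \<le> C * norm (blinfun_apply v u) \<and>
    (\<forall>x. apply_ell2 u (x + int j) = of_real (e11 (monodromy a x j)) * apply_ell2 u x
          + of_real (e12 (monodromy a x j)) * apply_ell2 u (x - 1) + apply_ell2 F x
       \<and> apply_ell2 u (x + int j - 1) = of_real (e21 (monodromy a x j)) * apply_ell2 u x
          + of_real (e22 (monodromy a x j)) * apply_ell2 u (x - 1) + apply_ell2 G x)"
proof (induction j)
  case 0
  show ?case by (rule exI[of _ 0]) (auto simp: e_defs intro!: exI[of _ "0::ell2"])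
next
  case (Suc j)
  then obtain C where C0: "0 \<le> C" and C: "\<And>u. \<exists>F G :: ell2. norm F \<le> C * norm (blinfun_apply v u) \<and> norm G \<le> C * norm (blinfun_apply v u) \<and>
    (\<forall>x. apply_ell2 u (x + int j) = of_real (e11 (monodromy a x j)) * apply_ell2 u x
          + of_real (e12 (monodromy a x j)) * apply_ell2 u (x - 1) + apply_ell2 F x
       \<and> apply_ell2 u (x + int j - 1) = of_real (e21 (monodromy a x j)) * apply_ell2 u x
          + of_real (e22 (monodromy a x j)) * apply_ell2 u (x - 1) + apply_ell2 G x)" by blast
  have B: "\<bar>a n\<bar> \<le> norm V" for n using norm_bounded[of V n] by (simp add: a)
  define D where "D = norm V * C + C + 1"
  have CD: "C \<le> D" using C0 by (simp add: D_def)
  show ?case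
  proof (rule exI[of _ D], intro conjI allI)
    show "0 \<le> D" using C0 CD by linarith
    fix u
    obtain F G where FG: "norm F \<le> C * norm (blinfun_apply v u)" "norm G \<le> C * norm (blinfun_apply v u)"
     "\<And>x. apply_ell2 u (x + int j) = of_real (e11 (monodromy a x j)) * apply_ell2 u x
          + of_real (e12 (monodromy a x j)) * apply_ell2 u (x - 1) + apply_ell2 F x"
     "\<And>x. apply_ell2 u (x + int j - 1) = of_real (e21 (monodromy a x j)) * apply_ell2 u x
          + of_real (e22 (monodromy a x j)) * apply_ell2 u (x - 1) + apply_ell2 G x"
      using C[of u] by (elim exE conjE) (rule that, auto)
    define b where "b = bfun (\<lambda>x. complex_of_real (a (x + int j)))"
    have b: "apply_bcontfun b x = of_real (a (x + int j))" for x
      unfolding b_def by (rule bfun_apply[where C = "norm V"]) (simp add: B)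
    define F' where "F' = mult_op b F - G + ell2_shift (int j) (blinfun_apply v u)"
    have "norm F' \<le> norm (mult_op b F) + norm G + norm (blinfun_apply v u)"
      unfolding F'_def
      using norm_triangle_ineq[of "mult_op b F - G" "ell2_shift (int j) (blinfun_apply v u)"]
        norm_triangle_ineq4[of "mult_op b F" G] by (simp add: norm_ell2_shift)
    also have "\<dots> \<le> norm V * (C * norm (blinfun_apply v u)) + C * norm (blinfun_apply v u) + norm (blinfun_apply v u)"
    proof (intro add_mono FG order_refl)
      have "norm (mult_op b F) \<le> norm V * norm F"
        by (rule norm_mult_op_le) (simp_all add: b B)
      also have "\<dots> \<le> norm V * (C * norm (blinfun_apply v u))" using FG(1) by (intro mult_left_mono) auto
      finally show "norm (mult_op b F) \<le> norm V * (C * norm (blinfun_apply v u))" .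
    qed
    finally have nF: "norm F' \<le> D * norm (blinfun_apply v u)" by (simp add: D_def algebra_simps)
    have nG: "norm F \<le> D * norm (blinfun_apply v u)"
      using FG(1) CD by (meson mult_right_mono norm_ge_zero order_trans)
    show "\<exists>F G :: ell2. norm F \<le> D * norm (blinfun_apply v u) \<and> norm G \<le> D * norm (blinfun_apply v u) \<and>
      (\<forall>x. apply_ell2 u (x + int (Suc j)) = of_real (e11 (monodromy a x (Suc j))) * apply_ell2 u x
          + of_real (e12 (monodromy a x (Suc j))) * apply_ell2 u (x - 1) + apply_ell2 F x
       \<and> apply_ell2 u (x + int (Suc j) - 1) = of_real (e21 (monodromy a x (Suc j))) * apply_ell2 u x
          + of_real (e22 (monodromy a x (Suc j))) * apply_ell2 u (x - 1) + apply_ell2 G x)"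
    proof (intro exI conjI allI)
      show "norm F' \<le> D * norm (blinfun_apply v u)" "norm F \<le> D * norm (blinfun_apply v u)" by fact+
      fix x
      have h: "apply_ell2 (blinfun_apply v u) (x + int j) = apply_ell2 u (x + int (Suc j)) + apply_ell2 u (x + int j - 1)
          - of_real (a (x + int j)) * apply_ell2 u (x + int j)"
        by (simp add: v apply_schrodinger a algebra_simps)
      show "apply_ell2 u (x + int (Suc j)) = of_real (e11 (monodromy a x (Suc j))) * apply_ell2 u x
          + of_real (e12 (monodromy a x (Suc j))) * apply_ell2 u (x - 1) + apply_ell2 F' x"
        using h FG(3)[of x] FG(4)[of x] by (simp add: F'_def b monodromy_Suc_entries ell2_shift.rep_eq algebra_simps)
      show "apply_ell2 u (x + int (Suc j) - 1) = of_real (e21 (monodromy a x (Suc j))) * apply_ell2 u x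
          + of_real (e22 (monodromy a x (Suc j))) * apply_ell2 u (x - 1) + apply_ell2 F x"
        using FG(3)[of x] by (simp add: monodromy_Suc_entries)
    qed
  qed
qed

text \<open>Since \<open>M + M\<inverse> = tr M\<close> for a monodromy matrix, \<open>tr M * u(x) - u(x + q) - u(x - q)\<close> is a
  bounded function of the defect \<open>(H u)\<close>; so \<open>\<bar>tr M\<bar> > 2\<close> bounds \<open>u\<close> by \<open>H u\<close>.\<close>

lemma bounded_below_of_trace:
  assumes a: "\<And>n. a n = - apply_bcontfun V n" and q: "0 < q" and per: "\<And>n. a (n + int q) = a n"
    and tr: "\<bar>tr2 (monodromy a 0 q)\<bar> > 2"
  shows "\<exists>g>0. \<forall>u. g * norm u \<le> norm (schrodinger 1 V u)"
proof -
  define v where "v = schrodinger 1 V"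
  define \<tau> where "\<tau> = tr2 (monodromy a 0 q)"
  have B: "\<bar>a n\<bar> \<le> norm V" for n using norm_bounded[of V n] by (simp add: a)
  obtain M where M: "0 \<le> M" "\<And>x. \<bar>e12 (monodromy a x q)\<bar> \<le> M" "\<And>x. \<bar>e22 (monodromy a x q)\<bar> \<le> M"
    using monodromy_bounded[of a "norm V" q] B by blast
  obtain C where C0: "0 \<le> C" and C: "\<And>u. \<exists>F G :: ell2. norm F \<le> C * norm (blinfun_apply v u) \<and> norm G \<le> C * norm (blinfun_apply v u) \<and>
    (\<forall>x. apply_ell2 u (x + int q) = of_real (e11 (monodromy a x q)) * apply_ell2 u x
          + of_real (e12 (monodromy a x q)) * apply_ell2 u (x - 1) + apply_ell2 F x
       \<and> apply_ell2 u (x + int q - 1) = of_real (e21 (monodromy a x q)) * apply_ell2 u x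
          + of_real (e22 (monodromy a x q)) * apply_ell2 u (x - 1) + apply_ell2 G x)"
    using transfer_inhomogeneous[OF v_def a] by blast
  define D where "D = C + 2 * M * C + 1"
  have D: "D > 0" using C0 M by (simp add: D_def add_nonneg_pos)
  have "(\<bar>\<tau>\<bar> - 2) * norm u \<le> D * norm (blinfun_apply v u)" for u
  proof -
    obtain F G where FG: "norm F \<le> C * norm (blinfun_apply v u)" "norm G \<le> C * norm (blinfun_apply v u)"
     "\<And>x. apply_ell2 u (x + int q) = of_real (e11 (monodromy a x q)) * apply_ell2 u x
          + of_real (e12 (monodromy a x q)) * apply_ell2 u (x - 1) + apply_ell2 F x"
     "\<And>x. apply_ell2 u (x + int q - 1) = of_real (e21 (monodromy a x q)) * apply_ell2 u x
          + of_real (e22 (monodromy a x q)) * apply_ell2 u (x - 1) + apply_ell2 G x"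
      using C[of u] by (elim exE conjE) (rule that, auto)
    define b where "b = bfun (\<lambda>x. complex_of_real (e22 (monodromy a x q)))"
    define d where "d = bfun (\<lambda>x. complex_of_real (e12 (monodromy a x q)))"
    have b: "apply_bcontfun b x = of_real (e22 (monodromy a x q))" for x
      unfolding b_def by (rule bfun_apply[where C = M]) (simp add: M)
    have d: "apply_bcontfun d x = of_real (e12 (monodromy a x q))" for x
      unfolding d_def by (rule bfun_apply[where C = M]) (simp add: M)
    have eq: "\<tau> *\<^sub>R u = ell2_shift (int q) u + ell2_shift (- int q) u - F
        + mult_op b (ell2_shift (- int q) F) - mult_op d (ell2_shift (- int q) G)" (is "_ = ?R")
    proof (rule ell2_eqI)
      fix x
      obtain p r s t where m: "monodromy a x q = (p, r, s, t)" by (cases "monodromy a x q") auto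
      have m': "monodromy a (x - int q) q = (p, r, s, t)"
        using monodromy_shift[of a "int q" "x - int q" q] per m by simp
      have dt: "p * t - r * s = 1" using det2_monodromy[of a x q] m by simp
      have tt: "p + t = \<tau>" using tr2_monodromy_const[of a q x] per m by (simp add: \<tau>_def)
      have 1: "apply_ell2 u (x + int q) = of_real p * apply_ell2 u x + of_real r * apply_ell2 u (x - 1) + apply_ell2 F x"
        using FG(3)[of x] m by (simp add: e_defs)
      have 2: "apply_ell2 u x = of_real p * apply_ell2 u (x - int q) + of_real r * apply_ell2 u (x - int q - 1) + apply_ell2 F (x - int q)"
        using FG(3)[of "x - int q"] m' by (simp add: e_defs)
      have 3: "apply_ell2 u (x - 1) = of_real s * apply_ell2 u (x - int q) + of_real t * apply_ell2 u (x - int q - 1) + apply_ell2 G (x - int q)"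
        using FG(4)[of "x - int q"] m' by (simp add: e_defs algebra_simps)
      \<comment> \<open>Determinant 1 makes the inverse monodromy explicit: it expresses
        \<open>u (x - q)\<close> through \<open>u x\<close> and \<open>u (x - 1)\<close>. Adding the
        forward relation for \<open>u (x + q)\<close> cancels \<open>u (x - 1)\<close> and leaves
        the trace.\<close>
      have dt': "of_real p * of_real t - of_real r * of_real s = (1::complex)"
        using dt by (metis of_real_1 of_real_diff of_real_mult)
      have "of_real t * apply_ell2 u x - of_real r * apply_ell2 u (x - 1)
         = (of_real p * of_real t - of_real r * of_real s) * apply_ell2 u (x - int q)
           + of_real t * apply_ell2 F (x - int q) - of_real r * apply_ell2 G (x - int q)"
        by (subst 2, subst 3) (simp add: algebra_simps)
      then have 4: "of_real t * apply_ell2 u x - of_real r * apply_ell2 u (x - 1)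
         = apply_ell2 u (x - int q) + of_real t * apply_ell2 F (x - int q) - of_real r * apply_ell2 G (x - int q)"
        unfolding dt' by simp
      show "apply_ell2 (\<tau> *\<^sub>R u) x = apply_ell2 ?R x"
        using 1 4 by (simp add: b d m e_defs ell2_shift.rep_eq tt[symmetric] scaleR_conv_of_real algebra_simps)
    qed
    have nb: "norm (mult_op b (ell2_shift (- int q) F)) \<le> M * norm F"
      using norm_mult_op_le[of b M "ell2_shift (- int q) F"] M by (simp add: b norm_ell2_shift)
    have nd: "norm (mult_op d (ell2_shift (- int q) G)) \<le> M * norm G"
      using norm_mult_op_le[of d M "ell2_shift (- int q) G"] M by (simp add: d norm_ell2_shift)
    have tri: "norm (p + r - F + s - t) \<le> norm p + norm r + norm F + norm s + norm t" for p r s t :: ell2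
      using norm_triangle_ineq4[of "p + r - F + s" t] norm_triangle_ineq[of "p + r - F" s]
        norm_triangle_ineq4[of "p + r" F] norm_triangle_ineq[of p r] by linarith
    have "\<bar>\<tau>\<bar> * norm u = norm (\<tau> *\<^sub>R u)" by simp
    also have "\<dots> \<le> 2 * norm u + norm F + M * norm F + M * norm G"
      unfolding eq by (rule order_trans[OF tri]) (use nb nd in \<open>simp add: norm_ell2_shift\<close>)
    also have "\<dots> \<le> 2 * norm u + D * norm (blinfun_apply v u)"
    proof -
      have "M * norm F \<le> M * (C * norm (blinfun_apply v u))" "M * norm G \<le> M * (C * norm (blinfun_apply v u))"
        using FG M(1) by (auto intro!: mult_left_mono)
      moreover have "D * norm (blinfun_apply v u) = C * norm (blinfun_apply v u)
          + M * (C * norm (blinfun_apply v u)) + M * (C * norm (blinfun_apply v u)) + norm (blinfun_apply v u)"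
        by (simp add: D_def algebra_simps)
      ultimately show ?thesis using FG(1) norm_ge_zero[of "blinfun_apply v u"] by linarith
    qed
    finally show ?thesis by (simp add: algebra_simps)
  qed
  then have "(\<bar>\<tau>\<bar> - 2) / D * norm u \<le> norm (blinfun_apply v u)" for u
    using D by (simp add: field_simps)
  then show ?thesis using tr D unfolding v_def \<tau>_def
    by (intro exI[of _ "(\<bar>tr2 (monodromy a 0 q)\<bar> - 2) / D"]) simp
qed

section \<open>Making the monodromy hyperbolic\<close>

definition perturb :: "(int \<Rightarrow> real) \<Rightarrow> nat \<Rightarrow> real \<Rightarrow> real \<Rightarrow> int \<Rightarrow> real" where
  "perturb a q s s' n = a n + (if n mod int q = 0 then s else if n mod int q = 1 then s' else 0)"

lemma perturb_periodic: "(\<And>n. a (n + int q) = a n) \<Longrightarrow> perturb a q s s' (n + int q) = perturb a q s s' n"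
  by (simp add: perturb_def)

text \<open>Changing the value at a site by \<open>r\<close> multiplies its step matrix from the
  right by the shear \<open>(1, 0, - r, 1)\<close>.\<close>

lemma monodromy_perturb:
  assumes q: "2 \<le> q"
  shows "monodromy (perturb a q s s') 0 q
    = mm2 (mm2 (mm2 (monodromy a 2 (q - 2)) (step2 (a 1))) (1, 0, - s', 1)) (mm2 (step2 (a 0)) (1, 0, - s, 1))"
proof -
  obtain k where k: "q = 2 + k" using q le_Suc_ex by blast
  have "monodromy (perturb a q s s') 2 k = monodromy a 2 k"
    by (rule monodromy_cong) (auto simp: perturb_def k)
  moreover have "monodromy (perturb a q s s') 0 2 = mm2 (step2 (a 1 + s')) (step2 (a 0 + s))"
    using q by (simp add: numeral_2_eq_2 monodromy.simps(2) perturb_def)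
  moreover have "step2 (b + r) = mm2 (step2 b) (1, 0, - r, 1)" for b r by (simp add: step2_def)
  ultimately show ?thesis using monodromy_add[of "perturb a q s s'" 0 2 k] by (simp add: k mm2_assoc)
qed

lemma monodromy_split2:
  assumes q: "2 \<le> q"
  shows "monodromy a 0 q = mm2 (mm2 (monodromy a 2 (q - 2)) (step2 (a 1))) (step2 (a 0))"
proof -
  have "perturb a q 0 0 = a" by (auto simp: perturb_def)
  then show ?thesis using monodromy_perturb[OF q, of a 0 0] by simp
qed

text \<open>If the monodromy is a shear up to sign, then two perturbations of opposite signs at neighbouring
  sites make it hyperbolic: the trace becomes \<open>2 + s'(b - s)\<close>.\<close>

lemma tr2_perturb_shear:
  assumes q: "2 \<le> q" and M: "monodromy a 0 q = (\<sigma>, 0, \<sigma> * b, \<sigma>)"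
  shows "tr2 (monodromy (perturb a q s s') 0 q) = \<sigma> * (2 + s' * (b - s))"
proof -
  define N where "N = mm2 (monodromy a 2 (q - 2)) (step2 (a 1))"
  obtain n1 n2 n3 n4 where N: "N = (n1, n2, n3, n4)" by (cases N) auto
  have "mm2 N (step2 (a 0)) = (\<sigma>, 0, \<sigma> * b, \<sigma>)" using monodromy_split2[OF q, of a] M by (simp add: N_def)
  then have n: "n1 = 0" "n2 = \<sigma>" "n3 = - \<sigma>" "n4 = \<sigma> * b + \<sigma> * a 0"
    by (auto simp: N step2_def algebra_simps)
  show ?thesis
    unfolding monodromy_perturb[OF q] N_def[symmetric] N by (simp add: step2_def n algebra_simps)
qed

text \<open>The trace is affine in the perturbation at one site, so it moves at a known speed unless
  the upper right entry vanishes.\<close>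

lemma tr2_perturb_single:
  assumes q: "2 \<le> q"
  shows "tr2 (monodromy (perturb a q s 0) 0 q) = tr2 (monodromy a 0 q) - s * e12 (monodromy a 0 q)"
proof -
  define N where "N = mm2 (monodromy a 2 (q - 2)) (step2 (a 1))"
  have "monodromy (perturb a q s 0) 0 q = mm2 N (mm2 (step2 (a 0)) (1, 0, - s, 1))"
    using monodromy_perturb[OF q, of a s 0] by (simp add: N_def)
  moreover have "monodromy a 0 q = mm2 N (step2 (a 0))"
    using monodromy_split2[OF q, of a] by (simp add: N_def)
  ultimately show ?thesis by (cases N) (simp add: step2_def e_defs algebra_simps)
qed

text \<open>Cayley-Hamilton for determinant 1 and trace \<open>2 * cos \<phi>\<close>: the powers
  are combinations of the matrix and the identity with Chebyshev coefficients.\<close>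

lemma monodromy_multiple:
  assumes per: "\<And>n. a (n + int q) = a n" and M: "monodromy a 0 q = (x, y, z, w)"
    and tr: "x + w = 2 * cos \<phi>" and s: "sin \<phi> \<noteq> 0"
  shows "monodromy a 0 (n * q) = (sin (n * \<phi>) / sin \<phi> * x - sin (n * \<phi> - \<phi>) / sin \<phi>, sin (n * \<phi>) / sin \<phi> * y,
     sin (n * \<phi>) / sin \<phi> * z, sin (n * \<phi>) / sin \<phi> * w - sin (n * \<phi> - \<phi>) / sin \<phi>)"
proof (induction n)
  case 0
  show ?case using s by simp
next
  case (Suc n)
  define \<alpha> where "\<alpha> = sin (n * \<phi>) / sin \<phi>"
  define \<beta> where "\<beta> = sin (n * \<phi> - \<phi>) / sin \<phi>"
  define \<gamma> where "\<gamma> = sin (Suc n * \<phi>) / sin \<phi>"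
  have "sin (Suc n * \<phi>) = 2 * cos \<phi> * sin (n * \<phi>) - sin (n * \<phi> - \<phi>)"
    by (simp add: sin_add sin_diff algebra_simps)
  then have \<gamma>: "\<gamma> = (x + w) * \<alpha> - \<beta>" unfolding \<gamma>_def \<alpha>_def \<beta>_def tr by (simp add: diff_divide_distrib)
  have \<alpha>': "\<alpha> = sin (Suc n * \<phi> - \<phi>) / sin \<phi>" by (simp add: \<alpha>_def algebra_simps)
  have per': "monodromy a (int (n * q)) q = monodromy a 0 q"
  proof (induction n)
    case (Suc n)
    then show ?case using monodromy_shift[of a "int q" "int (n * q)" q] per by (simp add: algebra_simps)
  qed simp
  have dt: "x * w - y * z = 1" using det2_monodromy[of a 0 q] by (simp add: M)
  have "monodromy a 0 (Suc n * q) = mm2 (x, y, z, w) (\<alpha> * x - \<beta>, \<alpha> * y, \<alpha> * z, \<alpha> * w - \<beta>)"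
    using monodromy_add[of a 0 "n * q" q] per' Suc.IH by (simp add: M \<alpha>_def \<beta>_def add.commute)
  also have "\<dots> = (\<gamma> * x - \<alpha>, \<gamma> * y, \<gamma> * z, \<gamma> * w - \<alpha>)"
  proof -
    have yz: "y * z = x * w - 1" using dt by simp
    have "x * (\<alpha> * x - \<beta>) + y * (\<alpha> * z) = \<gamma> * x - \<alpha>"
    proof -
      have "x * (\<alpha> * x - \<beta>) + y * (\<alpha> * z) = x * (\<alpha> * x - \<beta>) + \<alpha> * (y * z)" by simp
      then show ?thesis unfolding yz \<gamma> by (simp add: algebra_simps)
    qed
    moreover have "z * (\<alpha> * y) + w * (\<alpha> * w - \<beta>) = \<gamma> * w - \<alpha>"
    proof -
      have "z * (\<alpha> * y) + w * (\<alpha> * w - \<beta>) = \<alpha> * (y * z) + w * (\<alpha> * w - \<beta>)" by simp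
      then show ?thesis unfolding yz \<gamma> by (simp add: algebra_simps)
    qed
    ultimately show ?thesis by (simp add: \<gamma> algebra_simps)
  qed
  finally show ?case unfolding \<gamma>_def \<alpha>' .
qed

lemma shear_hyperbolic:
  assumes per: "\<And>n. a (n + int q) = a n" and q: "2 \<le> q"
    and M: "monodromy a 0 q = (\<sigma>, 0, \<sigma> * b, \<sigma>)" and \<sigma>: "\<bar>\<sigma>\<bar> = 1" and d: "0 < d"
  shows "\<exists>a'. (\<forall>n. a' (n + int q) = a' n) \<and> (\<forall>n. \<bar>a' n - a n\<bar> \<le> d) \<and> \<bar>tr2 (monodromy a' 0 q)\<bar> > 2"
proof -
  \<comment> \<open>The first perturbation only ensures that \<open>b - s\<close> is not 0; the sign
    of the second then makes the product positive and the trace exceeds 2 in modulus.\<close>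
  define s where "s = (if b = 0 then d else 0)"
  define s' where "s' = (if b - s > 0 then d else - d)"
  have "s' * (b - s) > 0" using d by (auto simp: s_def s'_def mult_neg_neg mult_pos_neg)
  then have "\<bar>tr2 (monodromy (perturb a q s s') 0 q)\<bar> > 2"
    unfolding tr2_perturb_shear[OF q M] by (simp add: abs_mult \<sigma>)
  then show ?thesis
    by (intro exI[of _ "perturb a q s s'"])
       (use d per in \<open>auto simp: perturb_periodic perturb_def s_def s'_def\<close>)
qed

lemma periodic_mult:
  fixes a :: "int \<Rightarrow> 'a"
  assumes "\<And>n. a (n + q) = a n" shows "a (n + int m * q) = a n"
proof (induction m)
  case (Suc m)
  have "a (n + int (Suc m) * q) = a ((n + int m * q) + q)" by (simp add: algebra_simps)
  then show ?case using assms Suc by simp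
qed simp

text \<open>Either the trace already exceeds 2 in modulus, or the matrix is a shear up to sign, or
  its trace can be moved. Moved far enough it leaves \<open>[-2, 2]\<close>; otherwise it passes a
  value \<open>2 * cos \<phi>\<close> with \<open>\<phi>\<close> a rational multiple of
  \<open>\<pi>\<close>, where a power of the matrix is plus or minus the identity. For the longer
  period this is a shear again.\<close>

lemma hyperbolic_perturbation:
  assumes per: "\<And>n. a (n + int q) = a n" and q: "0 < q" and d: "0 < d"
  shows "\<exists>a' Q. 0 < Q \<and> (\<forall>n. a' (n + int Q) = a' n) \<and> (\<forall>n. \<bar>a' n - a n\<bar> \<le> d) \<and> \<bar>tr2 (monodromy a' 0 Q)\<bar> > 2"
proof -
  \<comment> \<open>Doubling the period provides two different sites per period for
    \<open>perturb\<close>.\<close>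
  define p where "p = 2 * q"
  have p: "2 \<le> p" using q by (simp add: p_def)
  have per_p: "a (n + int p) = a n" for n using periodic_mult[of a "int q" n 2] per by (simp add: p_def)
  obtain x y z w where M: "monodromy a 0 p = (x, y, z, w)" by (cases "monodromy a 0 p") auto
  have dt: "x * w - y * z = 1" using det2_monodromy[of a 0 p] by (simp add: M)
  show ?thesis
  proof (cases "\<bar>x + w\<bar> > 2")
    case True
    then show ?thesis using M per_p p d by (intro exI[of _ a] exI[of _ p]) auto
  next
    case le2: False
    show ?thesis
    proof (cases "y = 0")
      case True
      \<comment> \<open>A triangular matrix of determinant 1 with trace in \<open>[-2, 2]\<close>
        has both diagonal entries equal to 1 or both equal to -1.\<close>
      have xw: "x * w = 1" using dt True by simp
      have "(x - w)\<^sup>2 = (x + w)\<^sup>2 - 4" using xw by (simp add: power2_eq_square algebra_simps)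
      also have "(x + w)\<^sup>2 \<le> 2\<^sup>2" using le2 abs_le_square_iff[of "x + w" 2] by simp
      finally have "x = w" by simp
      then have x1: "\<bar>x\<bar> = 1" using xw by (metis abs_mult abs_one abs_square_eq_1 power2_eq_square)
      have "monodromy a 0 p = (x, 0, x * (z * x), x)"
        using M True \<open>x = w\<close> xw by (simp add: mult.left_commute)
      from shear_hyperbolic[OF per_p p this x1 d] show ?thesis using p
        by (metis less_le_trans zero_less_numeral)
    next
      case y: False
      define t0 where "t0 = x + w"
      define t1 where "t1 = t0 - (d / 2) * y"
      have t01: "t0 \<noteq> t1" using y d by (simp add: t1_def)
      show ?thesis
      proof (cases "\<bar>t1\<bar> > 2")
        case True
        have "tr2 (monodromy (perturb a p (d / 2) 0) 0 p) = t1"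
          unfolding tr2_perturb_single[OF p] by (simp add: M e_defs t1_def t0_def)
        then show ?thesis using True p d per_p
          by (intro exI[of _ "perturb a p (d / 2) 0"] exI[of _ p]) (auto simp: perturb_periodic perturb_def)
      next
        case False
        define f0 where "f0 = arccos (t0 / 2) / pi"
        define f1 where "f1 = arccos (t1 / 2) / pi"
        have t: "-1 \<le> t0 / 2" "t0 / 2 \<le> 1" "-1 \<le> t1 / 2" "t1 / 2 \<le> 1" using le2 False by (auto simp: t0_def)
        have c: "2 * cos (pi * f0) = t0" "2 * cos (pi * f1) = t1" using t by (simp_all add: f0_def f1_def)
        have "f0 \<noteq> f1" using c t01 by auto
        have f: "0 \<le> f0" "f0 \<le> 1" "0 \<le> f1" "f1 \<le> 1"
          using t by (auto simp: f0_def f1_def arccos_lbound arccos_ubound divide_simps)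
        \<comment> \<open>The perturbation \<open>d / 2\<close> would move the rotation number from
          \<open>f0\<close> to \<open>f1\<close>; a rational number strictly between them also
          avoids 0 and 1, where \<open>sin \<phi>\<close> vanishes.\<close>
        obtain r :: rat where r: "min f0 f1 < of_rat r" "of_rat r < max f0 f1"
        proof -
          have "min f0 f1 < max f0 f1" using \<open>f0 \<noteq> f1\<close> by (auto simp: min_def max_def)
          from of_rat_dense[OF this] show ?thesis using that by blast
        qed
        have "0 \<le> min f0 f1" "max f0 f1 \<le> 1" using f by auto
        then have r01: "0 < (of_rat r :: real)" "(of_rat r :: real) < 1" using r by (blast intro: le_less_trans less_le_trans)+
        obtain k m where km: "quotient_of r = (k, m)" by (cases "quotient_of r") auto
        then have m: "0 < m" and rkm: "r = of_int k / of_int m"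
          using quotient_of_denom_pos quotient_of_div by auto
        define \<phi> where "\<phi> = pi * of_rat r"
        have mp: "real (nat m) * \<phi> = of_int k * pi"
          using m by (simp add: \<phi>_def rkm of_rat_divide)
        have s\<phi>: "sin \<phi> > 0" using r01 by (intro sin_gt_zero) (auto simp: \<phi>_def)
        have between: "min t0 t1 \<le> 2 * cos \<phi>" "2 * cos \<phi> \<le> max t0 t1"
        proof -
          have mono: "2 * cos (pi * u) \<ge> 2 * cos (pi * v)" if "0 \<le> u" "u \<le> v" "v \<le> 1" for u v
            using that by (simp add: cos_mono_le_eq)
          have "2 * cos (pi * max f0 f1) \<le> 2 * cos \<phi>" "2 * cos \<phi> \<le> 2 * cos (pi * min f0 f1)"
            unfolding \<phi>_def using r r01 \<open>0 \<le> min f0 f1\<close> \<open>max f0 f1 \<le> 1\<close> by (intro mono; linarith)+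
          then show "min t0 t1 \<le> 2 * cos \<phi>" "2 * cos \<phi> \<le> max t0 t1" using c by (auto simp: max_def min_def split: if_splits)
        qed
        \<comment> \<open>This moves the trace exactly to \<open>2 * cos \<phi>\<close>. It is
          within \<open>d / 2\<close> since the target lies between \<open>t0\<close> and
          \<open>t1\<close>; the other half of \<open>d\<close> is left for the shear case.\<close>
        define s where "s = (t0 - 2 * cos \<phi>) / y"
        have s: "\<bar>s\<bar> \<le> d / 2"
        proof -
          have "\<bar>t0 - 2 * cos \<phi>\<bar> \<le> \<bar>t0 - t1\<bar>" using between by (auto simp: min_def max_def split: if_splits)
          also have "\<dots> = d / 2 * \<bar>y\<bar>" using d by (simp add: t1_def abs_mult)
          finally show ?thesis using y by (simp add: s_def field_simps)
        qed
        define b where "b = perturb a p s 0"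
        have per_b: "b (n + int p) = b n" for n unfolding b_def using per_p by (rule perturb_periodic[where a = a])
        obtain x' y' z' w' where M': "monodromy b 0 p = (x', y', z', w')" by (cases "monodromy b 0 p") auto
        have tr': "x' + w' = 2 * cos \<phi>"
          using tr2_perturb_single[OF p, of a s] M M' y by (simp add: b_def e_defs s_def t0_def)
        \<comment> \<open>Over \<open>m\<close> periods the total angle is \<open>k * \<pi>\<close>,
          so the monodromy is plus or minus the identity.\<close>
        define Q where "Q = nat m * p"
        define \<sigma> where "\<sigma> = cos (of_int k * pi)"
        have sk: "sin (of_int k * pi) = 0" by (simp add: sin_zero_iff_int2)
        have "monodromy b 0 Q = (\<sigma>, 0, \<sigma> * 0, \<sigma>)"
          using monodromy_multiple[OF per_b M' tr', of "nat m"] s\<phi> by (simp add: Q_def mp sk sin_diff \<sigma>_def)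
        moreover have "\<bar>\<sigma>\<bar> = 1"
          using sin_cos_squared_add[of "of_int k * pi"] by (simp add: sk \<sigma>_def abs_square_eq_1)
        moreover have Q: "2 \<le> Q" using p m unfolding Q_def
          by (metis (no_types, lifting) Suc_leI mult_le_mono nat_mult_1 zero_less_nat_eq One_nat_def)
        moreover have "b (n + int Q) = b n" for n
          using periodic_mult[of b "int p" n "nat m"] per_b by (simp add: Q_def)
        ultimately obtain a' where a': "\<forall>n. a' (n + int Q) = a' n" "\<forall>n. \<bar>a' n - b n\<bar> \<le> d / 2"
            "\<bar>tr2 (monodromy a' 0 Q)\<bar> > 2"
          using shear_hyperbolic[of b Q \<sigma> 0 "d / 2"] d by auto
        have "\<bar>a' n - a n\<bar> \<le> d" for n
        proof -
          have "\<bar>b n - a n\<bar> \<le> d / 2" using s d by (simp add: b_def perturb_def)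
          moreover have "\<bar>a' n - b n\<bar> \<le> d / 2" using a'(2) by blast
          ultimately show ?thesis by linarith
        qed
        then show ?thesis using a' Q by (intro exI[of _ a'] exI[of _ Q]) auto
      qed
    qed
  qed
qed

text \<open>At energy \<open>E\<close> the recursion has coefficients \<open>E - c * V\<close>, so a
  change of these by \<open>c * d\<close> is a change of \<open>V\<close> by \<open>d\<close>.
  Hyperbolicity of the trace bounds \<open>H - E\<close> from below.\<close>

lemma gap_opening:
  assumes V: "periodic_seq V" and c: "0 < c" and d: "0 < d"
  shows "\<exists>w. periodic_seq w \<and> norm w \<le> d \<and>
     (\<exists>g>0. \<forall>u. g * norm u \<le> norm (schrodinger c (V + w) u - E *\<^sub>R u))"
proof -
  obtain q where q: "q > 0" "\<And>n. apply_bcontfun V (n + q) = apply_bcontfun V n"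
    using V by (auto simp: periodic_seq_def)
  define a where "a n = E - c * apply_bcontfun V n" for n
  have "a (n + int (nat q)) = a n" for n using q by (simp add: a_def)
  then obtain a' Q where a': "0 < Q" "\<And>n. a' (n + int Q) = a' n" "\<And>n. \<bar>a' n - a n\<bar> \<le> c * d"
      "\<bar>tr2 (monodromy a' 0 Q)\<bar> > 2"
    using hyperbolic_perturbation[of a "nat q" "c * d"] q c d by auto
  define w where "w = bfun (\<lambda>n. (a n - a' n) / c)"
  have wb: "norm ((a n - a' n) / c) \<le> d" for n
    using a'(3)[of n] c by (simp add: field_simps abs_minus_commute)
  have w: "apply_bcontfun w n = (a n - a' n) / c" for n unfolding w_def by (rule bfun_apply[OF wb])
  have pw: "periodic_seq w"
    unfolding periodic_seq_def
  proof (intro exI[of _ "q * int Q"] conjI allI)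
    show "0 < q * int Q" using q a' by simp
    fix n
    have "a (n + int Q * q) = a n" using periodic_mult[of a q n Q] q by (simp add: a_def)
    moreover have "a' (n + int (nat q) * int Q) = a' n" using periodic_mult[of a' "int Q" n "nat q"] a' by simp
    ultimately show "apply_bcontfun w (n + q * int Q) = apply_bcontfun w n"
      using q by (simp add: w mult.commute)
  qed
  define V' where "V' = bfun (\<lambda>n. - a' n)"
  have V': "apply_bcontfun V' n = - a' n" for n
    unfolding V'_def
  proof (rule bfun_apply[where C = "\<bar>E\<bar> + c * norm V + c * d"])
    fix n
    have "\<bar>c * apply_bcontfun V n\<bar> \<le> c * norm V" using norm_bounded[of V n] c by (simp add: abs_mult)
    then show "norm (- a' n) \<le> \<bar>E\<bar> + c * norm V + c * d"
      using a'(3)[of n] unfolding a_def real_norm_def by linarith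
  qed
  have eq: "schrodinger c (V + w) u - E *\<^sub>R u = schrodinger 1 V' u" for u
  proof (rule ell2_eqI)
    fix n
    have "c * (apply_bcontfun V n + apply_bcontfun w n) = E - a' n"
      using c by (simp add: w a_def field_simps)
    then have "complex_of_real (c * (apply_bcontfun V n + apply_bcontfun w n)) = of_real E - of_real (a' n)" by simp
    then show "apply_ell2 (schrodinger c (V + w) u - E *\<^sub>R u) n = apply_ell2 (schrodinger 1 V' u) n"
      by (simp only: apply_ell2_simps apply_schrodinger plus_bcontfun.rep_eq V')
         (simp add: scaleR_conv_of_real algebra_simps)
  qed
  obtain g where "g > 0" "\<And>u. g * norm u \<le> norm (schrodinger 1 V' u)"
    using bounded_below_of_trace[of a' V' Q] V' a' by auto
  moreover have "norm w \<le> d" by (rule norm_bcontfun_le) (use wb in \<open>simp add: w\<close>)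
  ultimately show ?thesis using pw eq by (intro exI[of _ w]) auto
qed

section \<open>Confinement by nested gapped zones\<close>

text \<open>For \<open>z = cis (E * a)\<close> a function of \<open>H\<close> of modulus
  \<open>\<bar>cos (a * (H - E) / 2)\<bar>\<close>: it favours energies near \<open>E\<close>. If
  \<open>H\<close> has a gap there, it is a strict contraction.\<close>

definition half_op :: "(ell2 \<Rightarrow>\<^sub>L ell2) \<Rightarrow> real \<Rightarrow> complex \<Rightarrow> ell2 \<Rightarrow> ell2" where
  "half_op H a z u = (1/2) *\<^sub>R (u + cscale_op z (evolution H a u))"

lemma half_op_add: "half_op H a z (u + v) = half_op H a z u + half_op H a z v"
  by (simp add: half_op_def linear_add[OF evolution_linear] blinfun.bilinear_simps scaleR_add_right algebra_simps)

lemma norm_half_op_le: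
  assumes "hermitian_op H" "cmod z = 1" shows "norm (half_op H a z u) \<le> norm u"
  using norm_triangle_ineq[of u "cscale_op z (evolution H a u)"] assms
  by (simp add: half_op_def norm_cscale_op norm_evolution)

lemma norm_half_op_funpow_le:
  assumes "hermitian_op H" "cmod z = 1" shows "norm ((half_op H a z ^^ n) u) \<le> norm u"
  by (induction n) (auto intro: order_trans[OF norm_half_op_le[OF assms]])

text \<open>By the parallelogram law a large difference of two vectors of equal length forces a
  short mean.\<close>

lemma half_op_gap:
  assumes H: "hermitian_op H" and z: "cmod z = 1" and g: "0 \<le> g"
    and gap: "g * norm u \<le> norm (u - cscale_op z (evolution H a u))"
  shows "norm (half_op H a z u) \<le> sqrt (1 - g\<^sup>2 / 4) * norm u"
proof -
  define v where "v = cscale_op z (evolution H a u)"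
  have v: "norm v = norm u" by (simp add: v_def norm_cscale_op z norm_evolution[OF H])
  have par: "(norm (u + v))\<^sup>2 + (norm (u - v))\<^sup>2 = 2 * (norm u)\<^sup>2 + 2 * (norm v)\<^sup>2"
    by (simp add: power2_norm_eq_inner inner_add inner_diff inner_commute)
  have "(g * norm u)\<^sup>2 \<le> (norm (u - v))\<^sup>2"
    using gap g by (intro power_mono) (auto simp: v_def)
  then have "(norm (u + v))\<^sup>2 / 4 \<le> (1 - g\<^sup>2 / 4) * (norm u)\<^sup>2"
    using par v by (simp add: power_mult_distrib algebra_simps)
  moreover have "(norm (half_op H a z u))\<^sup>2 = (norm (u + v))\<^sup>2 / 4"
    by (simp add: half_op_def v_def[symmetric] power_divide)
  ultimately have "sqrt ((norm (half_op H a z u))\<^sup>2) \<le> sqrt ((1 - g\<^sup>2 / 4) * (norm u)\<^sup>2)"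
    by (simp del: real_sqrt_abs)
  then show ?thesis by (simp add: real_sqrt_mult)
qed

lemma hermitian_op_0: "hermitian_op 0"
  by (simp add: hermitian_op_def)

lemma evolution_zero_op [simp]: "evolution 0 t u = u"
proof -
  have "to_bop (cscale_op (- \<i>) o\<^sub>L 0) = 0"
    by (simp add: of_bop_inject[symmetric] zero_bop.rep_eq to_bop_inverse blinfun_eqI)
  then show ?thesis by (simp add: evolution_eq one_bop.rep_eq)
qed

lemma norm_evolution_diff:
  assumes H: "hermitian_op H" and t: "0 \<le> t"
  shows "norm (u - evolution H t u) \<le> t * norm (blinfun_apply H u)"
  using duhamel[OF H t, of "\<lambda>_. u" "\<lambda>_. cscale_op \<i> (blinfun_apply H u)" "norm (blinfun_apply H u)"]
  by (simp add: norm_cscale_op)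

text \<open>For short times \<open>U - 1\<close> is \<open>- \<i> * a * (H - E)\<close> up to second
  order, and \<open>8 * a * K \<le> 1\<close> keeps the second order term below half of the
  first.\<close>

lemma evolution_gap:
  assumes H: "hermitian_op H" and K: "norm H \<le> K" and E: "\<bar>E\<bar> \<le> 3 * K" and a: "0 < a" "8 * a * K \<le> 1"
    and gap: "\<And>u. g * norm u \<le> norm (blinfun_apply H u - E *\<^sub>R u)"
  shows "a * g / 2 * norm u \<le> norm (u - cscale_op (cis (E * a)) (evolution H a u))"
proof -
  define G where "G = H - E *\<^sub>R id_blinfun"
  have G: "hermitian_op G" unfolding G_def by (rule hermitian_shift[OF H])
  define h where "h = blinfun_apply G u"
  have h: "h = blinfun_apply H u - E *\<^sub>R u" by (simp add: h_def G_def blinfun.bilinear_simps)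
  have nG: "norm (blinfun_apply G v) \<le> 4 * K * norm v" for v
  proof -
    have "norm (blinfun_apply G v) \<le> norm (blinfun_apply H v) + \<bar>E\<bar> * norm v"
      using norm_triangle_ineq4[of "blinfun_apply H v" "E *\<^sub>R v"] by (simp add: G_def blinfun.bilinear_simps)
    also have "norm (blinfun_apply H v) \<le> K * norm v"
      by (meson K mult_right_mono norm_blinfun norm_ge_zero order_trans)
    also have "\<bar>E\<bar> * norm v \<le> 3 * K * norm v" using E by (intro mult_right_mono) auto
    finally show ?thesis by simp
  qed
  have "norm ((evolution G a u + a *\<^sub>R cscale_op \<i> h) - evolution 0 a (evolution G 0 u + 0 *\<^sub>R cscale_op \<i> h))
     \<le> a * (a * (4 * K * norm h))"
  proof (rule duhamel[OF hermitian_op_0, where r = "\<lambda>s. cscale_op \<i> (h - evolution G s h)"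
        and \<phi> = "\<lambda>s. evolution G s u + s *\<^sub>R cscale_op \<i> h"])
    fix s assume s: "0 \<le> s" "s \<le> a"
    have cm: "blinfun_apply G (evolution G s u) = evolution G s h"
      unfolding h_def by (rule commute_evolution[OF G]) (use G in \<open>auto simp: hermitian_op_def\<close>)
    have d1: "((\<lambda>s. s *\<^sub>R cscale_op \<i> h) has_vector_derivative cscale_op \<i> h) (at s within {0..a})"
      by (auto simp: has_vector_derivative_def intro!: derivative_eq_intros)
    show "((\<lambda>s. evolution G s u + s *\<^sub>R cscale_op \<i> h) has_vector_derivative
       - cscale_op \<i> (blinfun_apply 0 (evolution G s u + s *\<^sub>R cscale_op \<i> h))
       + cscale_op \<i> (h - evolution G s h)) (at s within {0..a})"
      using has_vector_derivative_add[OF has_vector_derivative_evolution d1, of G u]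
      by (simp add: cm blinfun.bilinear_simps)
    have "norm (h - evolution G s h) \<le> s * norm (blinfun_apply G h)" by (rule norm_evolution_diff[OF G s(1)])
    also have "\<dots> \<le> a * (4 * K * norm h)"
      using s nG[of h] by (intro mult_mono) auto
    finally show "norm (cscale_op \<i> (h - evolution G s h)) \<le> a * (4 * K * norm h)"
      by (simp add: norm_cscale_op)
  qed (use a in auto)
  then have 1: "norm (evolution G a u + a *\<^sub>R cscale_op \<i> h - u) \<le> a * (a * (4 * K * norm h))"
    by simp
  have "a * (a * (4 * K * norm h)) = (8 * a * K) * (a / 2 * norm h)" by simp
  also have "\<dots> \<le> 1 * (a / 2 * norm h)" by (rule mult_right_mono[OF a(2)]) (use a in simp)
  finally have 2: "norm (evolution G a u + a *\<^sub>R cscale_op \<i> h - u) \<le> a / 2 * norm h"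
    using 1 by simp
  have "a * norm h = norm (a *\<^sub>R cscale_op \<i> h)" using a by (simp add: norm_cscale_op)
  also have "\<dots> \<le> norm (evolution G a u + a *\<^sub>R cscale_op \<i> h - u) + norm (u - evolution G a u)"
    using norm_triangle_ineq[of "evolution G a u + a *\<^sub>R cscale_op \<i> h - u" "u - evolution G a u"] by simp
  finally have "a / 2 * norm h \<le> norm (u - evolution G a u)" using 2 by simp
  moreover have "a * g / 2 * norm u \<le> a / 2 * norm h"
    using mult_left_mono[OF gap[of u], of "a / 2"] a by (simp add: h mult_ac)
  ultimately have "a * g / 2 * norm u \<le> norm (u - evolution G a u)" by linarith
  moreover have "evolution G a u = cscale_op (cis (E * a)) (evolution H a u)"
    unfolding G_def by (rule evolution_shift[OF H]) (use a in simp)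
  ultimately show ?thesis by metis
qed

lemma sin_ge_5_6: assumes "0 \<le> x" "x \<le> 1" shows "5 / 6 * x \<le> sin (x::real)"
proof -
  have "\<bar>sin x - (\<Sum>m<3. sin_coeff m * x ^ m)\<bar> \<le> inverse (fact 3) * \<bar>x\<bar> ^ 3" by (rule Maclaurin_sin_bound)
  moreover have "(\<Sum>m<3. sin_coeff m * x ^ m) = x" by (simp add: sin_coeff_def eval_nat_numeral)
  ultimately have "\<bar>sin x - x\<bar> \<le> x ^ 3 / 6" using assms by (simp add: fact_numeral field_simps)
  moreover have "x ^ 3 \<le> x" using assms power_decreasing[of 1 3 x] by simp
  ultimately show ?thesis by linarith
qed

text \<open>A gap is needed only for \<open>\<bar>E\<bar> \<le> 3 * K\<close>, a compact range of
  energies. Beyond it the phase \<open>cis (E * a)\<close> alone moves \<open>u\<close> by at least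
  \<open>5 / 2 * K * a\<close>, more than twice what the evolution can undo.\<close>

lemma unit_gap:
  assumes H: "hermitian_op H" and K: "norm H \<le> K" "0 < K" and a: "0 < a" "8 * a * K \<le> 1" and E: "\<bar>E\<bar> * a \<le> pi"
    and gap: "\<bar>E\<bar> \<le> 3 * K \<Longrightarrow> \<forall>u. g * norm u \<le> norm (blinfun_apply H u - E *\<^sub>R u)"
  shows "min (a * g / 2) (a * K) * norm u \<le> norm (u - cscale_op (cis (E * a)) (evolution H a u))"
proof (cases "\<bar>E\<bar> \<le> 3 * K")
  case True
  have "a * g / 2 * norm u \<le> norm (u - cscale_op (cis (E * a)) (evolution H a u))"
    by (rule evolution_gap[OF H K(1) True a]) (use gap True in blast)
  then show ?thesis by (meson min.cobounded1 mult_right_mono norm_ge_zero order_trans)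
next
  case False
  define \<theta> where "\<theta> = \<bar>E\<bar> * a / 2"
  have x: "0 \<le> 3 * K * a / 2" "3 * K * a / 2 \<le> 1" using K a by (auto simp: mult_ac)
  have "3 * K * a / 2 \<le> \<theta>" using False a by (simp add: \<theta>_def mult_right_mono)
  then have "sin (3 * K * a / 2) \<le> sin \<theta>" using E x pi_ge_two by (intro sin_monotone_2pi_le) (auto simp: \<theta>_def)
  with sin_ge_5_6[OF x] have s: "5 / 4 * (K * a) \<le> sin \<theta>" by simp
  have "cmod (1 - cis (E * a)) = 2 * \<bar>sin (E * a / 2)\<bar>"
  proof -
    have "(cmod (1 - cis (E * a)))\<^sup>2 = (1 - cos (E * a))\<^sup>2 + (sin (E * a))\<^sup>2" by (simp add: cmod_power2)
    also have "\<dots> = 2 - 2 * cos (2 * (E * a / 2))" using sin_cos_squared_add[of "E * a"] by (simp add: power2_diff algebra_simps)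
    also have "\<dots> = (2 * \<bar>sin (E * a / 2)\<bar>)\<^sup>2" by (simp only: cos_double_sin) (simp add: power_mult_distrib)
    finally show ?thesis by (rule power2_eq_imp_eq) auto
  qed
  also have "\<bar>sin (E * a / 2)\<bar> = \<bar>sin \<theta>\<bar>" by (cases "E \<ge> 0") (auto simp: \<theta>_def)
  finally have c: "cmod (1 - cis (E * a)) \<ge> 5 / 2 * (K * a)" using s by simp
  have d: "norm (u - evolution H a u) \<le> a * K * norm u"
    using norm_evolution_diff[OF H, of a u] a norm_blinfun[of H u] K
    by (smt (verit, best) mult.assoc mult_left_mono mult_right_mono norm_ge_zero)
  have "u - cscale_op (cis (E * a)) u = (u - cscale_op (cis (E * a)) (evolution H a u))
      - cscale_op (cis (E * a)) (u - evolution H a u)"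
    by (simp add: blinfun.bilinear_simps)
  then have "norm (u - cscale_op (cis (E * a)) u) \<le> norm (u - cscale_op (cis (E * a)) (evolution H a u))
      + norm (u - evolution H a u)"
    by (metis norm_triangle_ineq4 norm_cscale_op norm_cis mult_1)
  moreover have "norm (u - cscale_op (cis (E * a)) u) = cmod (1 - cis (E * a)) * norm u"
  proof -
    have "u - cscale_op (cis (E * a)) u = cscale_op (1 - cis (E * a)) u"
      by (rule ell2_eqI) (simp add: algebra_simps)
    then show ?thesis by (simp add: norm_cscale_op)
  qed
  moreover have "5 / 2 * (K * a) * norm u \<le> cmod (1 - cis (E * a)) * norm u" by (rule mult_right_mono[OF c]) simp
  moreover have "5 / 2 * (K * a) * norm u = 5 / 2 * (a * K * norm u)" by simp
  moreover have "0 \<le> a * K * norm u" using a K by simp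
  ultimately have "a * K * norm u \<le> norm (u - cscale_op (cis (E * a)) (evolution H a u))"
    using d by linarith
  then show ?thesis by (meson min.cobounded2 mult_right_mono norm_ge_zero order_trans)
qed

text \<open>The two operators differ only off \<open>Z\<close>, and in such a short time a state
  starting deep inside \<open>Z\<close> hardly reaches the complement. The defect in
  \<open>duhamel\<close> is bounded by that small part.\<close>

lemma evolution_local:
  assumes K: "norm (schrodinger c V) \<le> K" "norm (schrodinger c W) \<le> K" and t: "0 \<le> t" "exp 1 * t * K \<le> 1"
    and eq: "\<And>n. n \<in> Z \<Longrightarrow> apply_bcontfun V n = apply_bcontfun W n"
    and u: "\<And>n m. n \<notin> Z \<Longrightarrow> \<bar>m - n\<bar> \<le> int r \<Longrightarrow> apply_ell2 u m = 0"
  shows "norm (evolution (schrodinger c V) t u - evolution (schrodinger c W) t u) \<le> 2 * exp (1 - real r) * norm u"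
proof -
  define r' where "r' s = cscale_op \<i> (schrodinger c V (evolution (schrodinger c W) s u)
       - schrodinger c W (evolution (schrodinger c W) s u))" for s
  have K0: "0 \<le> K" using K(1) norm_ge_zero order_trans by blast
  have b: "norm (r' s) \<le> 2 * K * (exp (1 - real r) * norm u)" if s: "0 \<le> s" "s \<le> t" for s
  proof -
    define p where "p = proj_op (- Z) (evolution (schrodinger c W) s u)"
    have "r' s = cscale_op \<i> (schrodinger c V p - schrodinger c W p)"
      by (rule ell2_eqI) (auto simp: r'_def p_def apply_schrodinger algebra_simps eq)
    then have "norm (r' s) \<le> norm (schrodinger c V p) + norm (schrodinger c W p)"
      by (simp add: norm_cscale_op norm_triangle_ineq4)
    also have "\<dots> \<le> K * norm p + K * norm p"
      by (intro add_mono; meson K mult_right_mono norm_blinfun norm_ge_zero order_trans)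
    finally have 1: "norm (r' s) \<le> K * norm p + K * norm p" .
    have "norm p \<le> exp (exp 1 * s * K - real r) * norm u"
      unfolding p_def by (rule finite_range[OF local_op_schrodinger K(2) s(1)]) (use u in auto)
    also have "\<dots> \<le> exp (1 - real r) * norm u"
    proof -
      have "exp 1 * s * K \<le> exp 1 * t * K" using s K0 by (intro mult_right_mono mult_left_mono) auto
      then have "exp 1 * s * K \<le> 1" using t(2) by linarith
      then show ?thesis by (intro mult_right_mono) auto
    qed
    finally have "norm (r' s) \<le> K * (exp (1 - real r) * norm u) + K * (exp (1 - real r) * norm u)"
      using 1 mult_left_mono[OF _ K0, of "norm p" "exp (1 - real r) * norm u"] by linarith
    then show ?thesis by (simp add: algebra_simps)
  qed
  have "norm (evolution (schrodinger c W) t u - evolution (schrodinger c V) t (evolution (schrodinger c W) 0 u))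
      \<le> t * (2 * K * (exp (1 - real r) * norm u))"
  proof (rule duhamel[OF hermitian_schrodinger t(1), where r = r' and \<phi> = "\<lambda>s. evolution (schrodinger c W) s u", rotated])
    fix s
    have "- cscale_op \<i> (schrodinger c W (evolution (schrodinger c W) s u))
       = - cscale_op \<i> (schrodinger c V (evolution (schrodinger c W) s u)) + r' s"
      by (simp add: r'_def blinfun.bilinear_simps)
    then show "((\<lambda>s. evolution (schrodinger c W) s u) has_vector_derivative
       - cscale_op \<i> (schrodinger c V (evolution (schrodinger c W) s u)) + r' s) (at s within {0..t})"
      using has_vector_derivative_evolution[of "schrodinger c W" u s "{0..t}"] by simp
  qed (use b in auto)
  also have "\<dots> = (t * K) * (2 * exp (1 - real r) * norm u)" by simp
  also have "\<dots> \<le> 1 * (2 * exp (1 - real r) * norm u)"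
  proof (rule mult_right_mono)
    have "1 * (t * K) \<le> exp 1 * (t * K)" using t(1) K0 by (intro mult_right_mono) auto
    then show "t * K \<le> 1" using t(2) by simp
  qed simp
  finally show ?thesis by (simp add: norm_minus_commute)
qed

lemma proj_op_shrink_bound:
  assumes H: "local_op H" "norm H \<le> K" and t: "0 \<le> t" "exp 1 * t * K \<le> 1" and z: "cmod z = 1"
    and S: "\<And>n m. n \<in> S \<Longrightarrow> \<bar>m - n\<bar> \<le> int r \<Longrightarrow> apply_ell2 u m = 0"
  shows "norm (proj_op S (half_op H t z u)) \<le> exp (1 - real r) * norm u"
proof -
  have "proj_op S u = 0" by (rule ell2_eqI) (use S in auto)
  then have "norm (proj_op S (half_op H t z u)) = norm (proj_op S (evolution H t u)) / 2"
    by (simp add: half_op_def blinfun.bilinear_simps proj_op_commute norm_cscale_op z)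
  also have "\<dots> \<le> exp (exp 1 * t * K - real r) * norm u / 2"
    by (intro divide_right_mono finite_range H t) (use S in auto)
  also have "\<dots> \<le> exp (exp 1 * t * K - real r) * norm u" by simp
  also have "\<dots> \<le> exp (1 - real r) * norm u" using t(2) by (intro mult_right_mono) auto
  finally show ?thesis .
qed

text \<open>The part of the state inside \<open>Z (Suc j)\<close> cannot leave \<open>Z 0\<close> in
  one step, so it evolves as under the gapped \<open>W\<close> and shrinks by
  \<open>\<theta>\<close>. The part outside would have to travel farther than \<open>r\<close> to
  reach the next zone. Each step thus costs a layer of width \<open>r\<close>.\<close>

lemma zone_decay:
  assumes K: "norm (schrodinger c V) \<le> K" "norm (schrodinger c W) \<le> K" and a: "0 \<le> a" "exp 1 * a * K \<le> 1"
    and z: "cmod z = 1"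
    and eq: "\<And>n. n \<in> Z 0 \<Longrightarrow> apply_bcontfun V n = apply_bcontfun W n"
    and Z: "\<And>j n m. n \<in> Z (Suc j) \<Longrightarrow> \<bar>m - n\<bar> \<le> int r \<Longrightarrow> m \<in> Z j"
    and \<theta>: "\<And>u. norm (half_op (schrodinger c W) a z u) \<le> \<theta> * norm u"
  shows "norm (proj_op (Z (Suc (Suc j))) ((half_op (schrodinger c V) a z ^^ (Suc j)) u))
     \<le> (\<theta> + exp (1 - real r)) * norm (proj_op (Z (Suc j)) ((half_op (schrodinger c V) a z ^^ j) u))
        + exp (1 - real r) * norm u"
proof -
  define x where "x = (half_op (schrodinger c V) a z ^^ j) u"
  define p where "p = proj_op (Z (Suc j)) x"
  define q where "q = proj_op (- Z (Suc j)) x"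
  have x: "x = p + q" by (rule ell2_eqI) (auto simp: p_def q_def)
  have nq: "norm q \<le> norm u"
    unfolding q_def x_def
    by (rule order_trans[OF norm_proj_op_le norm_half_op_funpow_le[OF hermitian_schrodinger z]])
  have Zmono: "m \<in> Z k" if "m \<in> Z (Suc k)" for m k using Z[OF that, of m] by simp
  have Z0: "m \<in> Z 0" if "m \<in> Z k" for m k using that by (induction k) (auto dest: Zmono)
  have "norm (proj_op (Z (Suc (Suc j))) (half_op (schrodinger c V) a z q)) \<le> exp (1 - real r) * norm q"
    by (rule proj_op_shrink_bound[OF local_op_schrodinger K(1) a z]) (use Z in \<open>auto simp: q_def\<close>)
  also have "\<dots> \<le> exp (1 - real r) * norm u" using nq by simp
  finally have 1: "norm (proj_op (Z (Suc (Suc j))) (half_op (schrodinger c V) a z q)) \<le> exp (1 - real r) * norm u" .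
  have "norm (evolution (schrodinger c V) a p - evolution (schrodinger c W) a p) \<le> 2 * exp (1 - real r) * norm p"
  proof (rule evolution_local[OF K a, where Z = "Z 0"])
    fix n m assume nm: "n \<notin> Z 0" "\<bar>m - n\<bar> \<le> int r"
    have "m \<notin> Z (Suc j)"
    proof
      assume "m \<in> Z (Suc j)"
      from Z[OF this, of n] nm(2) have "n \<in> Z j" by (simp add: abs_minus_commute)
      then show False using Z0 nm(1) by blast
    qed
    then show "apply_ell2 p m = 0" by (simp add: p_def)
  qed (use eq in auto)
  moreover have "half_op (schrodinger c V) a z p - half_op (schrodinger c W) a z p
      = (1/2) *\<^sub>R cscale_op z (evolution (schrodinger c V) a p - evolution (schrodinger c W) a p)"
    by (simp add: half_op_def blinfun.bilinear_simps scaleR_diff_right[symmetric] scaleR_add_right)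
  ultimately have "norm (half_op (schrodinger c V) a z p - half_op (schrodinger c W) a z p) \<le> exp (1 - real r) * norm p"
    by (simp add: norm_cscale_op z)
  then have "norm (half_op (schrodinger c V) a z p) \<le> (\<theta> + exp (1 - real r)) * norm p"
    using \<theta>[of p] norm_triangle_sub[of "half_op (schrodinger c V) a z p" "half_op (schrodinger c W) a z p"]
    by (simp add: algebra_simps)
  then have 2: "norm (proj_op (Z (Suc (Suc j))) (half_op (schrodinger c V) a z p)) \<le> (\<theta> + exp (1 - real r)) * norm p"
    by (rule order_trans[OF norm_proj_op_le])
  have "proj_op (Z (Suc (Suc j))) (half_op (schrodinger c V) a z x)
     = proj_op (Z (Suc (Suc j))) (half_op (schrodinger c V) a z p)
      + proj_op (Z (Suc (Suc j))) (half_op (schrodinger c V) a z q)"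
    by (simp add: x half_op_add blinfun.bilinear_simps)
  then have "norm (proj_op (Z (Suc (Suc j))) (half_op (schrodinger c V) a z x))
     \<le> norm (proj_op (Z (Suc (Suc j))) (half_op (schrodinger c V) a z p))
      + norm (proj_op (Z (Suc (Suc j))) (half_op (schrodinger c V) a z q))"
    by (metis norm_triangle_ineq)
  then have "norm (proj_op (Z (Suc (Suc j))) (half_op (schrodinger c V) a z x))
     \<le> (\<theta> + exp (1 - real r)) * norm p + exp (1 - real r) * norm u"
    using 1 2 by linarith
  then show ?thesis by (simp add: x_def p_def)
qed

text \<open>Each application moves the state by about \<open>r\<close> sites, up to
  \<open>exp (1 - r)\<close>, so the filtered unit vector still starts inside the barrier.\<close>

lemma spread_bound:
  assumes K: "norm (schrodinger c V) \<le> K" and a: "0 \<le> a" "exp 1 * a * K \<le> 1" and z: "cmod z = 1"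
  shows "norm (proj_op {n. \<bar>n\<bar> > int (j * r)} ((half_op (schrodinger c V) a z ^^ j) (ell2_delta 0)))
     \<le> real j * exp (1 - real r)"
proof (induction j)
  case 0
  have "proj_op {n. \<bar>n\<bar> > int (0 * r)} (ell2_delta 0) = 0"
    by (rule ell2_eqI) (simp add: ell2_delta.rep_eq)
  then show ?case by simp
next
  case (Suc j)
  define x where "x = (half_op (schrodinger c V) a z ^^ j) (ell2_delta 0)"
  define S where "S k = {n. \<bar>n\<bar> > int (k * r)}" for k :: nat
  define p where "p = proj_op (S j) x"
  define q where "q = proj_op (- S j) x"
  have x: "x = p + q" by (rule ell2_eqI) (auto simp: p_def q_def)
  have nq: "norm q \<le> 1"
    unfolding q_def x_def
    using order_trans[OF norm_proj_op_le norm_half_op_funpow_le[OF hermitian_schrodinger z]] norm_ell2_delta by metis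
  have "norm (proj_op (S (Suc j)) (half_op (schrodinger c V) a z q)) \<le> exp (1 - real r) * norm q"
    by (rule proj_op_shrink_bound[OF local_op_schrodinger K a z]) (auto simp: q_def S_def)
  also have "\<dots> \<le> exp (1 - real r)" using nq by simp
  finally have 1: "norm (proj_op (S (Suc j)) (half_op (schrodinger c V) a z q)) \<le> exp (1 - real r)" .
  have 2: "norm (proj_op (S (Suc j)) (half_op (schrodinger c V) a z p)) \<le> real j * exp (1 - real r)"
    using Suc.IH norm_proj_op_le[of "S (Suc j)" "half_op (schrodinger c V) a z p"]
      norm_half_op_le[OF hermitian_schrodinger z, of c V a p] unfolding p_def x_def S_def by linarith
  have "norm (proj_op (S (Suc j)) (half_op (schrodinger c V) a z x)) \<le> real (Suc j) * exp (1 - real r)"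
    unfolding x half_op_add blinfun.add_right
    by (rule order_trans[OF norm_triangle_ineq]) (use 1 2 in \<open>simp add: distrib_right\<close>)
  then show ?case unfolding x_def S_def by simp
qed

text \<open>Mass can leave the box \<open>\<bar>n\<bar> \<le> \<mu>\<close> only through the sites next to its boundary.\<close>

lemma flux_bound:
  assumes K: "norm (schrodinger c V) \<le> K" and t: "0 \<le> t" and \<mu>: "0 \<le> \<mu>"
    and \<sigma>: "\<And>s. norm (proj_op {n. \<bar>n\<bar> = \<mu> \<or> \<bar>n\<bar> = \<mu> + 1} (evolution (schrodinger c V) s \<phi>)) \<le> \<sigma>"
  shows "norm (proj_op {n. \<bar>n\<bar> > \<mu>} (evolution (schrodinger c V) t \<phi>))
     \<le> norm (proj_op {n. \<bar>n\<bar> > \<mu>} \<phi>) + t * (2 * K * \<sigma>)"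
proof -
  define H where "H = schrodinger c V"
  define P where "P = proj_op {n. \<bar>n\<bar> > \<mu>}"
  define Q where "Q = proj_op {n. \<bar>n\<bar> = \<mu> \<or> \<bar>n\<bar> = \<mu> + 1}"
  define cm where "cm u = blinfun_apply H (blinfun_apply P u) - blinfun_apply P (blinfun_apply H u)" for u
  have K0: "0 \<le> K" using K norm_ge_zero order_trans by blast
  \<comment> \<open>A bond crossing the cut joins a site with \<open>\<bar>n\<bar> = \<mu>\<close>
    to one with \<open>\<bar>n\<bar> = \<mu> + 1\<close>, so the commutator sees no other
    sites.\<close>
  have cm: "cm u = cm (blinfun_apply Q u)" for u
  proof -
    have "cm (u - blinfun_apply Q u) = 0"
    proof (rule ell2_eqI)
      fix n
      define w where "w = u - blinfun_apply Q u"
      have w: "apply_ell2 w m = 0" if "\<bar>m\<bar> = \<mu> \<or> \<bar>m\<bar> = \<mu> + 1" for m using that by (auto simp: w_def Q_def)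
      have "(\<bar>n\<bar> > \<mu>) = (\<bar>m\<bar> > \<mu>) \<or> apply_ell2 w m = 0" if "m = n + 1 \<or> m = n - 1" for m
        using that w[of m] \<mu> by (cases "\<bar>m\<bar> = \<mu> \<or> \<bar>m\<bar> = \<mu> + 1") auto
      from this[of "n + 1"] this[of "n - 1"]
      show "apply_ell2 (cm (u - blinfun_apply Q u)) n = apply_ell2 0 n"
        unfolding w_def[symmetric] by (auto simp: cm_def H_def P_def apply_schrodinger)
    qed
    then show ?thesis by (simp add: cm_def blinfun.bilinear_simps algebra_simps)
  qed
  have nH: "norm (blinfun_apply H v) \<le> K * norm v" for v
    unfolding H_def by (meson K mult_right_mono norm_blinfun norm_ge_zero order_trans)
  have ncm: "norm (cm u) \<le> 2 * K * norm (blinfun_apply Q u)" for u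
  proof -
    have "norm (cm (blinfun_apply Q u)) \<le> norm (blinfun_apply H (blinfun_apply P (blinfun_apply Q u)))
        + norm (blinfun_apply P (blinfun_apply H (blinfun_apply Q u)))" unfolding cm_def by (rule norm_triangle_ineq4)
    also have "\<dots> \<le> K * norm (blinfun_apply Q u) + K * norm (blinfun_apply Q u)"
    proof (rule add_mono)
      show "norm (blinfun_apply H (blinfun_apply P (blinfun_apply Q u))) \<le> K * norm (blinfun_apply Q u)"
        using nH[of "blinfun_apply P (blinfun_apply Q u)"] norm_proj_op_le[of "{n. \<bar>n\<bar> > \<mu>}" "blinfun_apply Q u"] K0
        unfolding P_def by (meson mult_left_mono order_trans)
      show "norm (blinfun_apply P (blinfun_apply H (blinfun_apply Q u))) \<le> K * norm (blinfun_apply Q u)"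
        using nH[of "blinfun_apply Q u"] unfolding P_def by (rule order_trans[OF norm_proj_op_le])
    qed
    finally show ?thesis using cm[of u] by simp
  qed
  have "norm (blinfun_apply P (evolution H t \<phi>) - evolution H t (blinfun_apply P (evolution H 0 \<phi>))) \<le> t * (2 * K * \<sigma>)"
  proof (rule duhamel[OF _ t, where r = "\<lambda>s. cscale_op \<i> (cm (evolution H s \<phi>))" and \<phi> = "\<lambda>s. blinfun_apply P (evolution H s \<phi>)"])
    show "hermitian_op H" unfolding H_def by (rule hermitian_schrodinger)
    fix s
    have "blinfun_apply P (- cscale_op \<i> (blinfun_apply H (evolution H s \<phi>)))
       = - cscale_op \<i> (blinfun_apply H (blinfun_apply P (evolution H s \<phi>))) + cscale_op \<i> (cm (evolution H s \<phi>))"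
      by (simp add: cm_def P_def blinfun.bilinear_simps proj_op_commute)
    then show "((\<lambda>s. blinfun_apply P (evolution H s \<phi>)) has_vector_derivative
       - cscale_op \<i> (blinfun_apply H (blinfun_apply P (evolution H s \<phi>))) + cscale_op \<i> (cm (evolution H s \<phi>))) (at s within {0..t})"
      using bounded_linear.has_vector_derivative[OF blinfun.bounded_linear_right has_vector_derivative_evolution, of P H \<phi> s "{0..t}"] by simp
    show "norm (cscale_op \<i> (cm (evolution H s \<phi>))) \<le> 2 * K * \<sigma>"
      using ncm[of "evolution H s \<phi>"] mult_left_mono[OF \<sigma>[of s], of "2 * K"] K0 unfolding Q_def H_def norm_cscale_op
      by simp
  qed
  moreover have "norm (evolution H t (blinfun_apply P \<phi>)) = norm (blinfun_apply P \<phi>)"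
    unfolding H_def by (rule norm_evolution[OF hermitian_schrodinger])
  ultimately show ?thesis
    using norm_triangle_sub[of "blinfun_apply P (evolution H t \<phi>)" "evolution H t (blinfun_apply P \<phi>)"]
    unfolding H_def P_def by simp
qed

section \<open>Resolving the propagator into energy filters\<close>

lemma evolution_cscale:
  "hermitian_op H \<Longrightarrow> evolution H t (cscale_op z u) = cscale_op z (evolution H t u)"
  by (rule commute_evolution[symmetric]) (auto simp: hermitian_op_cscale cscale_op_cscale_op mult.commute)

lemma half_op_evolution:
  assumes H: "hermitian_op H"
  shows "(half_op H a z ^^ n) (evolution H t u) = evolution H t ((half_op H a z ^^ n) u)"
proof (induction n)
  case (Suc n)
  have "evolution H a (evolution H t v) = evolution H t (evolution H a v)" for v
    by (simp add: evolution_plus[symmetric] add.commute)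
  then have "half_op H a z (evolution H t v) = evolution H t (half_op H a z v)" for v
    by (simp add: half_op_def linear_add[OF evolution_linear] linear_scale[OF evolution_linear] evolution_cscale[OF H])
  then show ?case using Suc by simp
qed simp

lemma half_op_funpow_expand:
  assumes H: "hermitian_op H"
  shows "(half_op H a z ^^ n) u
    = (1 / 2 ^ n) *\<^sub>R (\<Sum>i\<le>n. of_nat (n choose i) *\<^sub>R cscale_op (z ^ i) (evolution H (of_nat i * a) u))"
proof (induction n)
  case 0
  show ?case by simp
next
  case (Suc n)
  define e where "e i = cscale_op (z ^ i) (evolution H (of_nat i * a) u)" for i
  define L where "L v = cscale_op z (evolution H a v)" for v
  have L: "linear L" unfolding L_def
    by (intro linear_compose[OF evolution_linear, unfolded o_def] bounded_linear.linear blinfun.bounded_linear_right)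
  have Le: "L (e i) = e (Suc i)" for i
    by (simp add: L_def e_def evolution_cscale[OF H] evolution_plus[symmetric] cscale_op_cscale_op algebra_simps)
  have "(\<Sum>i\<le>Suc n. of_nat (Suc n choose i) *\<^sub>R e i)
      = e 0 + (\<Sum>i\<le>n. of_nat (n choose i) *\<^sub>R e (Suc i) + of_nat (n choose Suc i) *\<^sub>R e (Suc i))"
    by (subst sum.atMost_Suc_shift) (simp add: scaleR_add_left)
  also have "\<dots> = (e 0 + (\<Sum>i\<le>n. of_nat (n choose Suc i) *\<^sub>R e (Suc i))) + (\<Sum>i\<le>n. of_nat (n choose i) *\<^sub>R e (Suc i))"
    by (simp add: sum.distrib add_ac)
  also have "e 0 + (\<Sum>i\<le>n. of_nat (n choose Suc i) *\<^sub>R e (Suc i)) = (\<Sum>i\<le>Suc n. of_nat (n choose i) *\<^sub>R e i)"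
    by (subst sum.atMost_Suc_shift) simp
  also have "\<dots> = (\<Sum>i\<le>n. of_nat (n choose i) *\<^sub>R e i)" by simp
  also have "(\<Sum>i\<le>n. of_nat (n choose i) *\<^sub>R e (Suc i)) = L (\<Sum>i\<le>n. of_nat (n choose i) *\<^sub>R e i)"
    by (simp add: linear_sum[OF L] linear_scale[OF L] Le)
  finally have eq: "(\<Sum>i\<le>Suc n. of_nat (Suc n choose i) *\<^sub>R e i)
      = (\<Sum>i\<le>n. of_nat (n choose i) *\<^sub>R e i) + L (\<Sum>i\<le>n. of_nat (n choose i) *\<^sub>R e i)" .
  have "(half_op H a z ^^ Suc n) u = half_op H a z ((1 / 2 ^ n) *\<^sub>R (\<Sum>i\<le>n. of_nat (n choose i) *\<^sub>R e i))"
    using Suc by (simp add: e_def)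
  also have "\<dots> = (1 / 2 ^ Suc n) *\<^sub>R ((\<Sum>i\<le>n. of_nat (n choose i) *\<^sub>R e i) + L (\<Sum>i\<le>n. of_nat (n choose i) *\<^sub>R e i))"
    by (simp add: half_op_def L_def[symmetric] linear_scale[OF L] scaleR_add_right)
  finally have "(half_op H a z ^^ Suc n) u = (1 / 2 ^ Suc n) *\<^sub>R (\<Sum>i\<le>Suc n. of_nat (Suc n choose i) *\<^sub>R e i)"
    unfolding eq[symmetric] .
  then show ?case unfolding e_def .
qed

lemma sum_cis_roots:
  assumes k: "k \<noteq> 0" "\<bar>k\<bar> < int N"
  shows "(\<Sum>l<N. cis (2 * pi * real l * of_int k / real N)) = 0"
proof -
  define w where "w = cis (2 * pi * of_int k / real N)"
  have N: "real N > 0" using k by auto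
  have w: "w \<noteq> 1"
  proof
    assume "w = 1"
    then have "cos (2 * pi * of_int k / real N) = 1" by (metis Re_complex_of_real cis.simps(1) of_real_1 w_def)
    then obtain m :: int where m: "2 * pi * of_int k / real N = of_int m * 2 * pi" using cos_one_2pi_int by blast
    then have "of_int k = of_int m * real N" using N by (simp add: field_simps)
    then have "k = m * int N" by (metis of_int_eq_iff of_int_mult of_int_of_nat_eq)
    then show False using k by (cases "m = 0") (auto simp: abs_mult mult_less_cancel_right2)
  qed
  have "w ^ N = cis (2 * pi * of_int k)" unfolding w_def Complex.DeMoivre using N by simp
  also have "\<dots> = 1" by (rule cis_multiple_2pi) simp
  finally have wN: "w ^ N = 1" .
  have "(\<Sum>l<N. cis (2 * pi * real l * of_int k / real N)) = (\<Sum>l<N. w ^ l)"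
    by (intro sum.cong refl) (simp add: w_def Complex.DeMoivre mult_ac)
  then show ?thesis using geometric_sum[OF w, of N] wN by simp
qed

text \<open>A discrete partition of unity in energy: averaging \<open>((1 + z U)/2)\<^sup>n\<close> over the roots of unity \<open>z\<close>
  leaves a single power of \<open>U\<close>.\<close>

lemma evolution_partition:
  assumes H: "hermitian_op H" and j: "j \<le> n"
  shows "(\<Sum>l<Suc n. blinfun_apply (cscale_op (cis (- (2 * pi * real l * real j / real (Suc n)))))
            ((half_op H a (cis (2 * pi * real l / real (Suc n))) ^^ n) u))
     = (real (Suc n) * real (n choose j) / 2 ^ n) *\<^sub>R evolution H (real j * a) u" (is "?L = _")
proof -
  define N where "N = Suc n"
  define x where "x i = evolution H (real i * a) u" for i :: nat
  define s where "s i = (\<Sum>l<N. cis (2 * pi * real l * of_int (int i - int j) / real N))" for i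
  have s: "s i = (if i = j then of_nat N else 0)" if "i \<le> n" for i
  proof (cases "i = j")
    case False
    then show ?thesis using sum_cis_roots[of "int i - int j" N] that j by (simp add: s_def N_def)
  qed (simp add: s_def)
  have cs: "cscale_op (\<Sum>l\<in>A. f l) v = (\<Sum>l\<in>A. cscale_op (f l) v)" if "finite A" for f :: "nat \<Rightarrow> complex" and A v
    using that by induction (auto simp: cscale_op_add cscale_op_real[of 0, simplified])
  have "?L = (\<Sum>l<N. (1 / 2 ^ n) *\<^sub>R (\<Sum>i\<le>n. real (n choose i) *\<^sub>R cscale_op (cis (2 * pi * real l * of_int (int i - int j) / real N)) (x i)))"
  proof (intro sum.cong)
    fix l
    have ph: "cis (- (2 * pi * real l * real j / real N)) * cis (2 * pi * real l / real N) ^ i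
        = cis (2 * pi * real l * of_int (int i - int j) / real N)" for i
      unfolding Complex.DeMoivre cis_mult by (rule arg_cong[of _ _ cis]) (simp add: diff_divide_distrib algebra_simps)
    show "blinfun_apply (cscale_op (cis (- (2 * pi * real l * real j / real (Suc n)))))
            ((half_op H a (cis (2 * pi * real l / real (Suc n))) ^^ n) u)
      = (1 / 2 ^ n) *\<^sub>R (\<Sum>i\<le>n. real (n choose i) *\<^sub>R cscale_op (cis (2 * pi * real l * of_int (int i - int j) / real N)) (x i))"
      unfolding half_op_funpow_expand[OF H] N_def[symmetric] x_def[symmetric]
      by (simp only: blinfun.scaleR_right blinfun.sum_right cscale_op_cscale_op ph)
  qed (simp add: N_def)
  also have "\<dots> = (1 / 2 ^ n) *\<^sub>R (\<Sum>i\<le>n. real (n choose i) *\<^sub>R cscale_op (s i) (x i))"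
  proof -
    have "(\<Sum>l<N. (1 / 2 ^ n) *\<^sub>R (\<Sum>i\<le>n. real (n choose i) *\<^sub>R cscale_op (cis (2 * pi * real l * of_int (int i - int j) / real N)) (x i)))
       = (1 / 2 ^ n) *\<^sub>R (\<Sum>l<N. \<Sum>i\<le>n. real (n choose i) *\<^sub>R cscale_op (cis (2 * pi * real l * of_int (int i - int j) / real N)) (x i))"
      by (rule scaleR_sum_right[symmetric])
    also have "(\<Sum>l<N. \<Sum>i\<le>n. real (n choose i) *\<^sub>R cscale_op (cis (2 * pi * real l * of_int (int i - int j) / real N)) (x i))
       = (\<Sum>i\<le>n. \<Sum>l<N. real (n choose i) *\<^sub>R cscale_op (cis (2 * pi * real l * of_int (int i - int j) / real N)) (x i))"
      by (rule sum.swap)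
    also have "\<dots> = (\<Sum>i\<le>n. real (n choose i) *\<^sub>R cscale_op (s i) (x i))"
      unfolding s_def by (simp only: cs[OF finite_lessThan] scaleR_sum_right)
    finally show ?thesis .
  qed
  also have "(\<Sum>i\<le>n. real (n choose i) *\<^sub>R cscale_op (s i) (x i))
      = (\<Sum>i\<le>n. if i = j then (real (n choose j) * real N) *\<^sub>R x j else 0)"
    by (intro sum.cong refl) (auto simp: s cscale_op_real[of 0, simplified] cscale_op_real[of "real N", simplified])
  also have "\<dots> = (real (n choose j) * real N) *\<^sub>R x j" using j by (simp add: sum.delta)
  finally show ?thesis by (simp add: N_def x_def mult_ac)
qed

lemma recurrence_bound:
  fixes x :: "nat \<Rightarrow> real"
  assumes "\<And>i. x (Suc i) \<le> q * x i + e" and "x 0 \<le> 1" and q: "0 \<le> q" "q < 1" and e: "0 \<le> e"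
  shows "x n \<le> q ^ n + e / (1 - q)"
proof (induction n)
  case 0
  show ?case using assms by (simp add: add_increasing2)
next
  case (Suc n)
  have "x (Suc n) \<le> q * (q ^ n + e / (1 - q)) + e"
    using assms(1)[of n] mult_left_mono[OF Suc q(1)] by linarith
  also have "\<dots> = q ^ Suc n + e / (1 - q)" using q by (simp add: field_simps)
  finally show ?case .
qed

text \<open>The evolved state is a combination of \<open>n + 1\<close> filtered states, one per root
  of unity \<open>z\<close>. The barrier may depend on \<open>z\<close>: the component at energy
  \<open>E\<close> only needs a zone gapped at \<open>E\<close>. After \<open>n\<close> applications
  of the filter it is tiny at the centre \<open>\<mu>\<close> of this zone at all times, so no mass
  crosses it by \<open>flux_bound\<close>.\<close>

lemma confinement:
  assumes K: "norm (schrodinger c V) \<le> K" and a: "0 < a" "exp 1 * a * K \<le> 1" and n: "n = 2 * j" "0 < j"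
    and t: "real j * a \<le> t" and \<theta>: "0 \<le> \<theta>" "\<theta> + exp (1 - real r) < 1"
    and barrier: "\<And>z. cmod z = 1 \<Longrightarrow> \<exists>W \<mu>. norm (schrodinger c W) \<le> K \<and> (\<forall>u. norm (half_op (schrodinger c W) a z u) \<le> \<theta> * norm u)
       \<and> int (n * r) \<le> \<mu> \<and> \<mu> \<le> L \<and> (\<forall>x. \<bar>\<bar>x\<bar> - \<mu>\<bar> \<le> (int n + 1) * int r + 1 \<longrightarrow> apply_bcontfun V x = apply_bcontfun W x)"
  shows "norm (proj_op {x. \<bar>x\<bar> > L} (evolution (schrodinger c V) t (ell2_delta 0)))
     \<le> real (Suc n) * (real n * exp (1 - real r)
        + t * (2 * K * ((\<theta> + exp (1 - real r)) ^ n + exp (1 - real r) / (1 - (\<theta> + exp (1 - real r))))))"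
proof -
  define H where "H = schrodinger c V"
  have H: "hermitian_op H" unfolding H_def by (rule hermitian_schrodinger)
  define \<epsilon> where "\<epsilon> = exp (1 - real r)"
  define q where "q = \<theta> + \<epsilon>"
  define \<sigma> where "\<sigma> = q ^ n + \<epsilon> / (1 - q)"
  define d where "d = ell2_delta 0"
  have K0: "0 \<le> K" using K norm_ge_zero order_trans by blast
  have q: "0 \<le> q" "q < 1" using \<theta> by (auto simp: q_def \<epsilon>_def add_nonneg_nonneg)
  have \<sigma>0: "0 \<le> \<sigma>" using q by (simp add: \<sigma>_def \<epsilon>_def)
  define B where "B = real n * \<epsilon> + t * (2 * K * \<sigma>)"
  define s where "s = t - real j * a"
  have s: "0 \<le> s" "s \<le> t" using t a by (auto simp: s_def)
  have main: "norm (proj_op {x. \<bar>x\<bar> > L} (evolution H s ((half_op H a z ^^ n) d))) \<le> B" if z: "cmod z = 1" for z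
  proof -
    from barrier[OF z] obtain W \<mu> where W: "norm (schrodinger c W) \<le> K"
      "\<And>u. norm (half_op (schrodinger c W) a z u) \<le> \<theta> * norm u" "int (n * r) \<le> \<mu>" "\<mu> \<le> L"
      "\<And>x. \<bar>\<bar>x\<bar> - \<mu>\<bar> \<le> (int n + 1) * int r + 1 \<Longrightarrow> apply_bcontfun V x = apply_bcontfun W x" by blast
    \<comment> \<open>The zones around \<open>\<mu>\<close> shrink by \<open>r\<close> at each
      application; the last one, \<open>Z (Suc n)\<close>, has half-width 1 and still contains the
      two sites on either side of the cut.\<close>
    define Z where "Z i = {x. \<bar>\<bar>x\<bar> - \<mu>\<bar> \<le> (int n + 1 - int i) * int r + 1}" for i :: nat
    have Z: "m \<in> Z i" if "x \<in> Z (Suc i)" "\<bar>m - x\<bar> \<le> int r" for i x m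
    proof -
      have "\<bar>\<bar>m\<bar> - \<mu>\<bar> \<le> \<bar>\<bar>x\<bar> - \<mu>\<bar> + \<bar>m - x\<bar>" by linarith
      then show ?thesis using that by (simp add: Z_def algebra_simps)
    qed
    \<comment> \<open>The filter commutes with the evolution, so the decay can be applied to the
      state at an arbitrary time \<open>s'\<close>.\<close>
    have bd: "norm (proj_op {x. \<bar>x\<bar> = \<mu> \<or> \<bar>x\<bar> = \<mu> + 1} (evolution H s' ((half_op H a z ^^ n) d))) \<le> \<sigma>" for s'
    proof -
      define u where "u = evolution H s' d"
      have u: "norm u = 1" by (simp add: u_def norm_evolution[OF H] d_def)
      have "norm (proj_op (Z (Suc n)) ((half_op H a z ^^ n) u)) \<le> q ^ n + \<epsilon> / (1 - q)"
      proof (rule recurrence_bound[OF _ _ q, where x = "\<lambda>i. norm (proj_op (Z (Suc i)) ((half_op H a z ^^ i) u))"])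
        fix i
        show "norm (proj_op (Z (Suc (Suc i))) ((half_op H a z ^^ (Suc i)) u))
            \<le> q * norm (proj_op (Z (Suc i)) ((half_op H a z ^^ i) u)) + \<epsilon>"
          using zone_decay[OF K W(1) less_imp_le[OF a(1)] a(2) z _ _ W(2), where Z = Z and r = r and j = i and u = u] W(5) Z
          by (simp add: Z_def[of 0] q_def \<epsilon>_def H_def u)
        show "norm (proj_op (Z (Suc 0)) ((half_op H a z ^^ 0) u)) \<le> 1"
          using norm_proj_op_le[of "Z (Suc 0)" u] u by simp
      qed (simp add: \<epsilon>_def)
      moreover have "{x. \<bar>x\<bar> = \<mu> \<or> \<bar>x\<bar> = \<mu> + 1} \<subseteq> Z (Suc n)" by (auto simp: Z_def)
      ultimately show ?thesis
        using norm_proj_op_mono[of "{x. \<bar>x\<bar> = \<mu> \<or> \<bar>x\<bar> = \<mu> + 1}" "Z (Suc n)" "(half_op H a z ^^ n) u"]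
        by (simp add: \<sigma>_def u_def half_op_evolution[OF H])
    qed
    have \<mu>0: "0 \<le> \<mu>" using W(3) by (meson of_nat_0_le_iff order_trans)
    have sub: "{x. \<bar>x\<bar> > L} \<subseteq> {x. \<bar>x\<bar> > \<mu>}" "{x. \<bar>x\<bar> > \<mu>} \<subseteq> {x. \<bar>x\<bar> > int (n * r)}" using W by auto
    have "norm (proj_op {x. \<bar>x\<bar> > L} (evolution H s ((half_op H a z ^^ n) d)))
        \<le> norm (proj_op {x. \<bar>x\<bar> > \<mu>} (evolution H s ((half_op H a z ^^ n) d)))"
      by (rule norm_proj_op_mono[OF sub(1)])
    also have "\<dots> \<le> norm (proj_op {x. \<bar>x\<bar> > \<mu>} ((half_op H a z ^^ n) d)) + s * (2 * K * \<sigma>)"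
      unfolding H_def by (rule flux_bound[OF K s(1) \<mu>0]) (use bd in \<open>simp add: H_def\<close>)
    also have "norm (proj_op {x. \<bar>x\<bar> > \<mu>} ((half_op H a z ^^ n) d)) \<le> real n * \<epsilon>"
      using norm_proj_op_mono[OF sub(2)] spread_bound[OF K less_imp_le[OF a(1)] a(2) z, of n r]
      unfolding H_def d_def \<epsilon>_def by (rule order_trans)
    also have "s * (2 * K * \<sigma>) \<le> t * (2 * K * \<sigma>)" using s K0 \<sigma>0 by (intro mult_right_mono) auto
    finally show ?thesis by (simp add: B_def)
  qed
  have "evolution H t d = evolution H (real j * a) (evolution H s d)"
    by (simp add: evolution_plus[symmetric] s_def)
  define \<kappa> where "\<kappa> = real (Suc n) * real (n choose j) / 2 ^ n"
  \<comment> \<open>This is the reason for \<open>n = 2 * j\<close>: the central binomial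
    coefficient makes up for the factor \<open>2 ^ n\<close>.\<close>
  have \<kappa>: "1 \<le> \<kappa>"
  proof -
    have "4 ^ j / (2 * real j) \<le> real ((2 * j) choose j)" by (rule central_binomial_lower_bound[OF n(2)])
    then have "4 ^ j \<le> real (2 * j) * real ((2 * j) choose j)" using n by (simp add: field_simps)
    also have "\<dots> \<le> real (Suc n) * real (n choose j)" unfolding n by (intro mult_right_mono) auto
    finally have "4 ^ j \<le> real (Suc n) * real (n choose j)" .
    moreover have "2 ^ n = (4::real) ^ j" by (simp add: n power_mult)
    ultimately show ?thesis by (simp add: \<kappa>_def)
  qed
  have "\<kappa> *\<^sub>R evolution H t d = (\<Sum>l<Suc n. blinfun_apply (cscale_op (cis (- (2 * pi * real l * real j / real (Suc n)))))
            ((half_op H a (cis (2 * pi * real l / real (Suc n))) ^^ n) (evolution H s d)))"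
    using evolution_partition[OF H, of j n a "evolution H s d"] n
    by (simp only: \<kappa>_def) (simp add: evolution_plus[symmetric] s_def)
  then have "\<kappa> * norm (proj_op {x. \<bar>x\<bar> > L} (evolution H t d))
     = norm (\<Sum>l<Suc n. blinfun_apply (cscale_op (cis (- (2 * pi * real l * real j / real (Suc n)))))
         (proj_op {x. \<bar>x\<bar> > L} (evolution H s ((half_op H a (cis (2 * pi * real l / real (Suc n))) ^^ n) d))))"
    using \<kappa> by (simp only: half_op_evolution[OF H] proj_op_commute[symmetric] blinfun.sum_right[symmetric])
      (metis (no_types, lifting) abs_of_nonneg blinfun.scaleR_right norm_scaleR order_trans zero_le_one)
  also have "\<dots> \<le> (\<Sum>l<Suc n. B)"
    by (rule sum_norm_le) (simp add: norm_cscale_op main del: sum.lessThan_Suc)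
  also have "\<dots> = real (Suc n) * B" by simp
  finally have "\<kappa> * norm (proj_op {x. \<bar>x\<bar> > L} (evolution H t d)) \<le> real (Suc n) * B" .
  moreover have "norm (proj_op {x. \<bar>x\<bar> > L} (evolution H t d))
      \<le> \<kappa> * norm (proj_op {x. \<bar>x\<bar> > L} (evolution H t d))"
    using mult_right_mono[OF \<kappa>, of "norm (proj_op {x. \<bar>x\<bar> > L} (evolution H t d))"] by simp
  ultimately show ?thesis unfolding H_def d_def B_def \<sigma>_def q_def \<epsilon>_def by linarith
qed

section \<open>Finitely many gap-opening perturbations, placed in blocks\<close>

lemma schrodinger_diff_le:
  "norm (schrodinger c V u - schrodinger c' V' u) \<le> norm (c *\<^sub>R V - c' *\<^sub>R V') * norm u"
proof -
  have "schrodinger c V u - schrodinger c' V' u = mult_op (complexify (c *\<^sub>R V - c' *\<^sub>R V')) u"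
    by (rule ell2_eqI) (simp add: apply_schrodinger complexify.rep_eq minus_bcontfun.rep_eq scaleR_bcontfun.rep_eq algebra_simps)
  then show ?thesis using norm_mult_complexify by simp
qed

text \<open>Openness of spectral gaps and compactness give finitely many perturbations, one of which opens a
  gap at any prescribed energy.\<close>

lemma finite_gap_cover:
  fixes \<K> :: "(int \<Rightarrow>\<^sub>C real) set"
  assumes cpt: "compact \<K>" and per: "\<And>V. V \<in> \<K> \<Longrightarrow> periodic_seq V" and cm: "0 < cm" and d: "0 < d"
  shows "\<exists>F g. finite F \<and> 0 \<in> F \<and> 0 < g \<and> (\<forall>w\<in>F. periodic_seq w \<and> norm w \<le> d) \<and>
     (\<forall>V\<in>\<K>. \<forall>c\<in>{cm..cM}. \<forall>E\<in>{-E0..E0}. \<exists>w\<in>F. \<forall>u. g * norm u \<le> norm (schrodinger c (V + w) u - E *\<^sub>R u))"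
proof -
  define \<Omega> where "\<Omega> w g = {p :: (int \<Rightarrow>\<^sub>C real) \<times> real \<times> real. \<forall>u. g * norm u \<le>
      norm (schrodinger (fst (snd p)) (fst p + w) u - snd (snd p) *\<^sub>R u)}" for w g
  define S where "S = \<K> \<times> {cm..cM} \<times> {-E0..E0}"
  have S: "compact S" unfolding S_def by (intro compact_Times cpt compact_Icc)
  have ex: "\<exists>w g r. periodic_seq w \<and> norm w \<le> d \<and> 0 < g \<and> 0 < r \<and> ball p r \<subseteq> \<Omega> w g" if p: "p \<in> S" for p
  proof -
    obtain V c E where p': "p = (V, c, E)" "V \<in> \<K>" "cm \<le> c" using p by (cases p) (auto simp: S_def)
    have "0 < c" using p' cm by simp
    from gap_opening[OF per[OF p'(2)] this d, of E] obtain w g where w: "periodic_seq w" "norm w \<le> d" "0 < g"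
      "\<And>u. g * norm u \<le> norm (schrodinger c (V + w) u - E *\<^sub>R u)" by blast
    \<comment> \<open>Bounds the change of \<open>H - E\<close> when potential, coupling and energy
      vary. It is continuous and 0 at the given point, so half of the lower bound \<open>g\<close>
      persists nearby.\<close>
    define f where "f p = norm (fst (snd p) *\<^sub>R (fst p + w) - c *\<^sub>R (V + w)) + \<bar>snd (snd p) - E\<bar>"
      for p :: "(int \<Rightarrow>\<^sub>C real) \<times> real \<times> real"
    have "continuous (at p) f" unfolding f_def by (intro continuous_intros)
    moreover have "f p = 0" by (simp add: f_def p')
    ultimately obtain r where r: "0 < r" "\<And>p'. dist p' p < r \<Longrightarrow> \<bar>f p'\<bar> < g / 2"
      using w(3) unfolding continuous_at_eps_delta by (metis diff_zero dist_real_def half_gt_zero)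
    have "ball p r \<subseteq> \<Omega> w (g / 2)"
    proof
      fix x assume "x \<in> ball p r"
      obtain V' c' E' where x: "x = (V', c', E')" by (cases x) auto
      have fx: "norm (c' *\<^sub>R (V' + w) - c *\<^sub>R (V + w)) + \<bar>E' - E\<bar> < g / 2"
        using r(2)[of x] \<open>x \<in> ball p r\<close> by (simp add: f_def x dist_commute)
      have "g / 2 * norm u \<le> norm (schrodinger c' (V' + w) u - E' *\<^sub>R u)" for u
      proof -
        define A where "A = schrodinger c' (V' + w) u - schrodinger c (V + w) u"
        define X where "X = schrodinger c' (V' + w) u - E' *\<^sub>R u"
        have eq: "schrodinger c (V + w) u - E *\<^sub>R u = X - A + (E' - E) *\<^sub>R u"
          by (simp add: A_def X_def algebra_simps)
        have "norm (X - A + (E' - E) *\<^sub>R u) \<le> norm X + norm A + \<bar>E' - E\<bar> * norm u"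
          using norm_triangle_ineq[of "X - A" "(E' - E) *\<^sub>R u"] norm_triangle_ineq4[of X A] by simp
        moreover have "norm A \<le> norm (c' *\<^sub>R (V' + w) - c *\<^sub>R (V + w)) * norm u"
          unfolding A_def by (rule schrodinger_diff_le)
        moreover have "(norm (c' *\<^sub>R (V' + w) - c *\<^sub>R (V + w)) + \<bar>E' - E\<bar>) * norm u \<le> g / 2 * norm u"
          using fx by (intro mult_right_mono) auto
        ultimately have "g * norm u \<le> norm X + g / 2 * norm u"
          using w(4)[of u] unfolding eq by (simp add: distrib_right)
        then show ?thesis by (simp add: X_def)
      qed
      then show "x \<in> \<Omega> w (g / 2)" by (simp add: \<Omega>_def x)
    qed
    then show ?thesis using w r by (intro exI[of _ w] exI[of _ "g / 2"] exI[of _ r]) auto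
  qed
  then obtain W G R where WGR: "\<And>p. p \<in> S \<Longrightarrow> periodic_seq (W p) \<and> norm (W p) \<le> d \<and> 0 < G p \<and> 0 < R p \<and> ball p (R p) \<subseteq> \<Omega> (W p) (G p)"
    by metis
  have "S \<subseteq> (\<Union>p\<in>S. ball p (R p))" using WGR by force
  from compactE_image[OF S _ this] obtain C where C: "C \<subseteq> S" "finite C" "S \<subseteq> (\<Union>p\<in>C. ball p (R p))" by blast
  define g where "g = Min (insert 1 (G ` C))"
  have g: "0 < g" using WGR C by (auto simp: g_def)
  have gle: "g \<le> G p" if "p \<in> C" for p using that C by (simp add: g_def)
  show ?thesis
  proof (rule exI[of _ "insert 0 (W ` C)"], rule exI[of _ g], intro conjI ballI)
    show "finite (insert 0 (W ` C))" "0 \<in> insert 0 (W ` C)" "0 < g" using C g by auto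
    fix w assume "w \<in> insert 0 (W ` C)"
    moreover have "periodic_seq 0" by (auto simp: periodic_seq_def intro!: exI[of _ "1::int"])
    ultimately show "periodic_seq w" "norm w \<le> d" using WGR C d by auto
  next
    fix V c E assume "V \<in> \<K>" "c \<in> {cm..cM}" "E \<in> {-E0..E0}"
    then have "(V, c, E) \<in> S" by (simp add: S_def)
    then obtain p where p: "p \<in> C" "(V, c, E) \<in> ball p (R p)" using C by blast
    then have "(V, c, E) \<in> \<Omega> (W p) (G p)" using WGR C by blast
    then have "G p * norm u \<le> norm (schrodinger c (V + W p) u - E *\<^sub>R u)" for u by (simp add: \<Omega>_def)
    then have "g * norm u \<le> norm (schrodinger c (V + W p) u - E *\<^sub>R u)" for u
      by (meson gle[OF p(1)] mult_right_mono norm_ge_zero order_trans)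
    then show "\<exists>w\<in>insert 0 (W ` C). \<forall>u. g * norm u \<le> norm (schrodinger c (V + w) u - E *\<^sub>R u)"
      using p by blast
  qed
qed

text \<open>Block \<open>i\<close> fills
  \<open>(2 * i + 1) * R < \<bar>x\<bar> < (2 * i + 3) * R\<close> on both sides of the origin and
  carries \<open>ws ! i\<close> in its original position; its middle is the barrier site
  \<open>(2 * i + 2) * R\<close>. The pattern on \<open>{- L..L}\<close> is repeated with period
  \<open>2 * L + 1\<close>.\<close>

definition barrier_fun :: "(int \<Rightarrow>\<^sub>C real) list \<Rightarrow> int \<Rightarrow> int \<Rightarrow> real" where
  "barrier_fun ws R x = (let L = (2 * int (length ws) + 2) * R; y = (x + L) mod (2 * L + 1) - L; i = (\<bar>y\<bar> - R) div (2 * R) in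
     if 0 \<le> i \<and> i < int (length ws) then apply_bcontfun (ws ! nat i) y else 0)"

lemma barrier_fun_block:
  assumes i: "i < length ws" and x: "\<bar>\<bar>x\<bar> - (2 * int i + 2) * R\<bar> < R"
  shows "barrier_fun ws R x = apply_bcontfun (ws ! i) x"
proof -
  define m where "m = int (length ws)"
  define L where "L = (2 * m + 2) * R"
  have R: "0 < R" using x by linarith
  have im: "int i + 1 \<le> m" using i by (simp add: m_def)
  have up: "\<bar>x\<bar> < (2 * int i + 3) * R" and lo: "(2 * int i + 1) * R < \<bar>x\<bar>"
    using x by (auto simp: algebra_simps abs_less_iff)
  have "(2 * int i + 3) * R \<le> (2 * m + 2) * R" using R im by (intro mult_right_mono) auto
  then have xL: "\<bar>x\<bar> \<le> L" using up by (simp add: L_def)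
  have y: "(x + L) mod (2 * L + 1) - L = x" using xL by (simp add: mod_pos_pos_trivial)
  have "(\<bar>x\<bar> - R) div (2 * R) = int i"
    by (rule int_div_pos_eq[where r = "\<bar>x\<bar> - R - 2 * R * int i"]) (use up lo R in \<open>auto simp: algebra_simps\<close>)
  then show ?thesis using i y by (simp add: barrier_fun_def Let_def m_def[symmetric] L_def[symmetric]) (simp add: m_def)
qed

lemma eventually_square_le_exp:
  fixes A \<gamma> :: real assumes "0 < A" "0 < \<gamma>"
  shows "\<forall>\<^sub>F n::nat in at_top. A * (real n + 1)\<^sup>2 \<le> exp (\<gamma> * real n)"
  using assms by real_asymp

text \<open>The filters gain exponentially in their number \<open>n\<close>, while the barriers
  occupy a length of order \<open>n\<^sup>2\<close>. Hence \<open>t\<close> may be exponential in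
  \<open>n\<close>, and the barriers fit into any power \<open>t powr (1 / k)\<close>.\<close>

lemma confinement_parameters:
  fixes \<theta> K a :: real and m k :: nat
  assumes \<theta>: "0 \<le> \<theta>" "\<theta> < 1" and K: "0 \<le> K" and a: "0 < a" and k: "0 < k"
  shows "\<exists>j r t. 0 < j \<and> real j * a \<le> t \<and> real k \<le> t \<and> \<theta> + exp (1 - real r) < 1
    \<and> (2 * real m + 2) * (real ((2 * j + 2) * r) + 2) \<le> t powr (1 / real k)
    \<and> real (Suc (2 * j)) * (real (2 * j) * exp (1 - real r)
        + t * (2 * K * ((\<theta> + exp (1 - real r)) ^ (2 * j) + exp (1 - real r) / (1 - (\<theta> + exp (1 - real r)))))) \<le> t powr (- real k) / 2"
proof -
  define \<tau> where "\<tau> = (1 + \<theta>) / 2"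
  have \<tau>: "0 < \<tau>" "\<tau> < 1" using \<theta> by (auto simp: \<tau>_def)
  define b where "b = - ln \<tau>"
  have b: "0 < b" using \<tau> by (simp add: b_def)
  define \<rho> where "\<rho> = nat \<lceil>b\<rceil> + 1"
  have \<rho>: "b \<le> real \<rho>" unfolding \<rho>_def using b by linarith
  \<comment> \<open>Both errors are of order \<open>exp (- b * n)\<close>. With
    \<open>t = exp (\<beta> * n)\<close> this is \<open>t\<close> to the power
    \<open>- 2 * (k + 1)\<close>: the factor \<open>t\<close> of the flux is paid,
    \<open>t powr (- k)\<close> is reached, and a factor \<open>exp ((k + 1) * \<beta> * n)\<close>
    remains to absorb polynomials in \<open>n\<close>.\<close>
  define \<beta> where "\<beta> = b / (2 * (real k + 1))"
  have \<beta>: "0 < \<beta>" using b by (simp add: \<beta>_def)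
  define C where "C = 2 * K * (1 + 2 * exp 1 / (1 - \<theta>))"
  have C: "0 \<le> C" using K \<theta> by (simp add: C_def)
  have ev: "\<forall>\<^sub>F n::nat in at_top. (4 * exp 1 / (1 - \<theta>)) * (real n + 1)\<^sup>2 \<le> exp (b * real n)
     \<and> (a + real k) * (real n + 1)\<^sup>2 \<le> exp (\<beta> * real n)
     \<and> ((2 * real m + 2) * (real \<rho> + 2)) * (real n + 1)\<^sup>2 \<le> exp (\<beta> / real k * real n)
     \<and> (2 * (exp 1 + C)) * (real n + 1)\<^sup>2 \<le> exp ((real k + 1) * \<beta> * real n) \<and> 1 \<le> n"
    using \<theta> a b \<beta> C k by (intro eventually_conj eventually_square_le_exp eventually_ge_at_top)
      (auto intro!: mult_pos_pos divide_pos_pos add_pos_nonneg)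
  then obtain j0 where j0: "\<And>n. n \<ge> j0 \<Longrightarrow> (4 * exp 1 / (1 - \<theta>)) * (real n + 1)\<^sup>2 \<le> exp (b * real n)
     \<and> (a + real k) * (real n + 1)\<^sup>2 \<le> exp (\<beta> * real n)
     \<and> ((2 * real m + 2) * (real \<rho> + 2)) * (real n + 1)\<^sup>2 \<le> exp (\<beta> / real k * real n)
     \<and> (2 * (exp 1 + C)) * (real n + 1)\<^sup>2 \<le> exp ((real k + 1) * \<beta> * real n) \<and> 1 \<le> n"
    unfolding eventually_at_top_linorder by blast
  define j where "j = j0 + 1"
  define n where "n = 2 * j"
  have F: "(4 * exp 1 / (1 - \<theta>)) * (real n + 1)\<^sup>2 \<le> exp (b * real n)"
     "(a + real k) * (real n + 1)\<^sup>2 \<le> exp (\<beta> * real n)"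
     "((2 * real m + 2) * (real \<rho> + 2)) * (real n + 1)\<^sup>2 \<le> exp (\<beta> / real k * real n)"
     "(2 * (exp 1 + C)) * (real n + 1)\<^sup>2 \<le> exp ((real k + 1) * \<beta> * real n)" "1 \<le> n"
    using j0[of n] by (auto simp: n_def j_def)
  define r where "r = \<rho> * n"
  define t where "t = exp (\<beta> * real n)"
  define \<epsilon> where "\<epsilon> = exp (1 - real r)"
  define x where "x = exp (- (b * real n))"
  have n1: "1 \<le> (real n + 1)\<^sup>2" by (simp add: one_le_power)
  have \<epsilon>: "\<epsilon> \<le> exp 1 * x"
  proof -
    have "b * real n \<le> real r" using \<rho> by (simp add: r_def mult_right_mono)
    then show ?thesis by (simp add: \<epsilon>_def x_def exp_add[symmetric])
  qed
  have "4 * exp 1 / (1 - \<theta>) \<le> exp (b * real n)"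
    using mult_left_mono[OF n1, of "4 * exp 1 / (1 - \<theta>)"] F(1) \<theta> by simp
  then have "exp 1 * x \<le> (1 - \<theta>) / 4" using \<theta> by (simp add: x_def exp_minus field_simps)
  then have \<epsilon>\<theta>: "\<epsilon> \<le> (1 - \<theta>) / 4" using \<epsilon> by simp
  have \<epsilon>0: "0 < \<epsilon>" by (simp add: \<epsilon>_def)
  have q: "\<theta> + \<epsilon> \<le> \<tau>" "\<theta> + \<epsilon> < 1" "(1 - \<theta>) / 2 \<le> 1 - (\<theta> + \<epsilon>)" using \<epsilon>\<theta> \<theta> by (auto simp: \<tau>_def field_simps)
  have qn: "(\<theta> + \<epsilon>) ^ n \<le> x"
  proof -
    have "(\<theta> + \<epsilon>) ^ n \<le> \<tau> ^ n" using q \<theta> \<epsilon>0 by (intro power_mono) auto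
    also have "\<tau> ^ n = exp (real n * ln \<tau>)" using \<tau> by (simp add: exp_of_nat_mult)
    finally show ?thesis by (simp add: x_def b_def mult.commute)
  qed
  have \<epsilon>q: "\<epsilon> / (1 - (\<theta> + \<epsilon>)) \<le> 2 * exp 1 / (1 - \<theta>) * x"
  proof -
    have "\<epsilon> / (1 - (\<theta> + \<epsilon>)) \<le> (exp 1 * x) / ((1 - \<theta>) / 2)"
      using \<epsilon> q \<theta> \<epsilon>0 by (intro frac_le) auto
    then show ?thesis by (simp add: field_simps)
  qed
  have t1: "1 \<le> t" using \<beta> by (simp add: t_def)
  have ta: "(a + real k) * (real n + 1)\<^sup>2 \<le> t" using F(2) by (simp add: t_def)
  have nn: "real n \<le> (real n + 1)\<^sup>2" by (simp add: power2_eq_square algebra_simps)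
  have A1: "real j * a \<le> t"
  proof -
    have "real j * a \<le> real n * a" using a by (simp add: n_def)
    also have "\<dots> \<le> (real n + 1)\<^sup>2 * (a + real k)" using nn a by (intro mult_mono) auto
    finally show ?thesis using ta by (simp add: mult.commute)
  qed
  have A2: "real k \<le> t"
    using mult_mono[OF _ n1, of "real k" "a + real k"] a ta by simp
  have A3: "(2 * real m + 2) * (real ((2 * j + 2) * r) + 2) \<le> t powr (1 / real k)"
  proof -
    have "real n * (real n + 2) \<le> (real n + 1)\<^sup>2" by (simp add: power2_eq_square algebra_simps)
    then have "real \<rho> * (real n * (real n + 2)) + 2 * 1 \<le> real \<rho> * (real n + 1)\<^sup>2 + 2 * (real n + 1)\<^sup>2"
      by (intro add_mono mult_left_mono n1) auto
    then have "real ((2 * j + 2) * r) + 2 \<le> (real \<rho> + 2) * (real n + 1)\<^sup>2"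
      unfolding n_def[symmetric] r_def by (simp add: algebra_simps)
    then have "(2 * real m + 2) * (real ((2 * j + 2) * r) + 2) \<le> (2 * real m + 2) * ((real \<rho> + 2) * (real n + 1)\<^sup>2)"
      by (intro mult_left_mono) auto
    also have "\<dots> \<le> exp (\<beta> / real k * real n)" using F(3) by (simp add: mult.assoc)
    also have "\<dots> = t powr (1 / real k)" by (simp add: t_def powr_def)
    finally show ?thesis .
  qed
  have A4: "real (Suc (2 * j)) * (real (2 * j) * \<epsilon> + t * (2 * K * ((\<theta> + \<epsilon>) ^ (2 * j) + \<epsilon> / (1 - (\<theta> + \<epsilon>))))) \<le> t powr (- real k) / 2"
  proof -
    have x0: "0 < x" by (simp add: x_def)
    have "(\<theta> + \<epsilon>) ^ n + \<epsilon> / (1 - (\<theta> + \<epsilon>)) \<le> (1 + 2 * exp 1 / (1 - \<theta>)) * x"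
      using qn \<epsilon>q by (simp add: algebra_simps)
    then have "2 * K * ((\<theta> + \<epsilon>) ^ n + \<epsilon> / (1 - (\<theta> + \<epsilon>))) \<le> C * x"
      using mult_left_mono[of _ _ "2 * K"] K by (simp add: C_def mult.assoc)
    then have "t * (2 * K * ((\<theta> + \<epsilon>) ^ n + \<epsilon> / (1 - (\<theta> + \<epsilon>)))) \<le> t * (C * x)"
      using t1 by (intro mult_left_mono) auto
    moreover have "real n * \<epsilon> \<le> t * (real n * (exp 1 * x))"
    proof -
      have "1 * (real n * \<epsilon>) \<le> t * (real n * (exp 1 * x))"
        using t1 \<epsilon> \<epsilon>0 by (intro mult_mono mult_left_mono) auto
      then show ?thesis by simp
    qed
    ultimately have "real n * \<epsilon> + t * (2 * K * ((\<theta> + \<epsilon>) ^ n + \<epsilon> / (1 - (\<theta> + \<epsilon>)))) \<le> (t * x) * (real n * exp 1 + C)"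
      by (simp add: algebra_simps)
    also have "\<dots> \<le> (t * x) * ((exp 1 + C) * (real n + 1))"
      using t1 x0 C by (intro mult_left_mono) (auto simp: algebra_simps)
    finally have "real (Suc n) * (real n * \<epsilon> + t * (2 * K * ((\<theta> + \<epsilon>) ^ n + \<epsilon> / (1 - (\<theta> + \<epsilon>)))))
        \<le> real (Suc n) * ((t * x) * ((exp 1 + C) * (real n + 1)))"
      by (rule mult_left_mono) simp
    also have "\<dots> = (t * x) / 2 * ((2 * (exp 1 + C)) * (real n + 1)\<^sup>2)"
      by (simp add: power2_eq_square algebra_simps)
    also have "\<dots> \<le> (t * x) / 2 * exp ((real k + 1) * \<beta> * real n)"
      using F(4) t1 x0 by (intro mult_left_mono) auto
    also have "\<dots> = t powr (- real k) / 2"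
    proof -
      have "b = 2 * (real k + 1) * \<beta>" by (simp add: \<beta>_def)
      then show ?thesis by (simp add: t_def x_def powr_def exp_add[symmetric] algebra_simps)
    qed
    finally show ?thesis by (simp add: n_def)
  qed
  show ?thesis
    using A1 A2 A3 A4 q(2) unfolding \<epsilon>_def by (intro exI[of _ j] exI[of _ r] exI[of _ t]) (auto simp: j_def)
qed

lemma periodize:
  fixes f :: "int \<Rightarrow> real"
  assumes "\<And>n. \<bar>f n\<bar> \<le> B" "0 < q" "\<And>n. f (n + q) = f n"
  shows "periodic_seq (bfun f)" "\<And>n. apply_bcontfun (bfun f) n = f n" "norm (bfun f) \<le> B"
proof -
  show *: "apply_bcontfun (bfun f) n = f n" for n by (rule bfun_apply[where C = B]) (simp add: assms)
  show "periodic_seq (bfun f)" using assms by (auto simp: periodic_seq_def *)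
  show "norm (bfun f) \<le> B" by (rule norm_bcontfun_le) (simp add: * assms)
qed

text \<open>One perturbation and one time serve all potentials in the compact set and all couplings:
  the finite list of perturbations and the gap are uniform, hence so is \<open>\<theta>\<close>, and
  the number of filters, the range and the time depend only on \<open>\<theta>\<close> and on the
  length of the list.\<close>

theorem confinement_perturbation:
  fixes \<K> :: "(int \<Rightarrow>\<^sub>C real) set"
  assumes cpt: "compact \<K>" and per: "\<And>V. V \<in> \<K> \<Longrightarrow> periodic_seq V" and cm: "0 < cm" "cm \<le> cM" and d: "0 < d" and k: "0 < k"
  shows "\<exists>W t. periodic_seq W \<and> norm W \<le> d \<and> real k \<le> t \<and> (\<forall>V\<in>\<K>. \<forall>c\<in>{cm..cM}.
     norm (proj_op {x. real_of_int \<bar>x\<bar> > t powr (1 / real k)} (evolution (schrodinger c (V + W)) t (ell2_delta 0)))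
       \<le> t powr (- real k) / 2)"
proof -
  obtain B where B: "0 < B" "\<And>V. V \<in> \<K> \<Longrightarrow> norm V \<le> B"
    using compact_imp_bounded[OF cpt] unfolding bounded_pos by blast
  define K where "K = 2 + cM * (B + d)"
  have K: "0 < K" using cm B d by (simp add: K_def add_pos_pos)
  have nK: "norm (schrodinger c X) \<le> K" if "c \<in> {cm..cM}" "norm X \<le> B + d" for c X
  proof -
    have "\<bar>c\<bar> * norm X \<le> cM * (B + d)" using that cm by (intro mult_mono) auto
    then show ?thesis using norm_schrodinger_le[of c X] by (simp add: K_def)
  qed
  \<comment> \<open>Short enough both for \<open>unit_gap\<close>, which needs
    \<open>8 * a * K \<le> 1\<close>, and for the propagation bounds, which need
    \<open>exp 1 * a * K \<le> 1\<close>.\<close>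
  define a where "a = 1 / (8 * K)"
  have a: "0 < a" "8 * a * K \<le> 1" "a * K = 1 / 8" using K by (auto simp: a_def)
  have ea: "exp 1 * a * K \<le> 1" 
  proof -
    have "exp 1 * (a * K) \<le> 3 * (1 / 8)" unfolding a(3) using exp_le by (intro mult_right_mono) auto
    then show ?thesis by (simp only: mult.assoc)
  qed
  obtain F g where F: "finite F" "0 \<in> F" "0 < g" "\<And>w. w \<in> F \<Longrightarrow> periodic_seq w \<and> norm w \<le> d"
    "\<And>V c E. V \<in> \<K> \<Longrightarrow> c \<in> {cm..cM} \<Longrightarrow> E \<in> {-(3 * K)..3 * K} \<Longrightarrow>
       \<exists>w\<in>F. \<forall>u. g * norm u \<le> norm (schrodinger c (V + w) u - E *\<^sub>R u)"
    using finite_gap_cover[OF cpt per cm(1) d, of cM "3 * K"] by metis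
  obtain ws where ws: "set ws = F" using F(1) finite_list by blast
  define m where "m = length ws"
  define g' where "g' = min (a * g / 2) (a * K)"
  have g': "0 < g'" "g' \<le> 1 / 8" using a F(3) by (auto simp: g'_def)
  define \<theta> where "\<theta> = sqrt (1 - g'\<^sup>2 / 4)"
  have \<theta>: "0 \<le> \<theta>" "\<theta> < 1"
  proof -
    have "g'\<^sup>2 \<le> 1" using g' by (simp add: power_le_one)
    then show "0 \<le> \<theta>" "\<theta> < 1" using g' by (auto simp: \<theta>_def real_sqrt_lt_1_iff)
  qed
  obtain j r t where jrt: "0 < j" "real j * a \<le> t" "real k \<le> t" "\<theta> + exp (1 - real r) < 1"
    "(2 * real m + 2) * (real ((2 * j + 2) * r) + 2) \<le> t powr (1 / real k)"
    "real (Suc (2 * j)) * (real (2 * j) * exp (1 - real r)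
        + t * (2 * K * ((\<theta> + exp (1 - real r)) ^ (2 * j) + exp (1 - real r) / (1 - (\<theta> + exp (1 - real r)))))) \<le> t powr (- real k) / 2"
    using confinement_parameters[OF \<theta> less_imp_le[OF K] a(1) k, of m] by blast
  define n where "n = 2 * j"
  \<comment> \<open>Exceeds the half-width \<open>(n + 1) * r + 1\<close> of the zones, so every
    zone lies within its block, and also \<open>n * r\<close>, so the filtered unit vector starts
    inside the first barrier.\<close>
  define R where "R = (int n + 2) * int r + 2"
  have R: "0 < R" by (simp add: R_def add_nonneg_pos)
  define L where "L = (2 * int m + 2) * R"
  define f where "f = barrier_fun ws R"
  have fb: "\<bar>f x\<bar> \<le> d" for x
  proof -
    have "\<bar>apply_bcontfun (ws ! i) y\<bar> \<le> d" if "i < length ws" for i y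
      using F(4)[of "ws ! i"] ws that norm_bounded[of "ws ! i" y] nth_mem[OF that] by fastforce
    then show ?thesis using d by (auto simp: f_def barrier_fun_def Let_def)
  qed
  have L0: "0 \<le> L" using R by (simp add: L_def)
  have fper: "f (x + (2 * L + 1)) = f x" for x
  proof -
    have "(x + (2 * L + 1) + L) mod (2 * L + 1) = (x + L) mod (2 * L + 1)"
      by (metis add.assoc add.commute mod_add_self2)
    then show ?thesis unfolding f_def barrier_fun_def m_def[symmetric] L_def[symmetric] by simp
  qed
  define W where "W = bfun f"
  have W: "periodic_seq W" "\<And>x. apply_bcontfun W x = f x" "norm W \<le> d"
    unfolding W_def using periodize[of f d "2 * L + 1"] fb fper L0 by auto
  have Lt: "real_of_int L \<le> t powr (1 / real k)"
    using jrt(5) by (simp add: L_def R_def n_def algebra_simps)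
  show ?thesis
  proof (rule exI[of _ W], rule exI[of _ t], intro conjI ballI W(1) W(3) jrt(3))
    fix V c assume V: "V \<in> \<K>" and c: "c \<in> {cm..cM}"
    have nV: "norm (V + X) \<le> B + d" if "norm X \<le> d" for X
      using norm_triangle_ineq[of V X] B(2)[OF V] that by simp
    have "norm (proj_op {x. \<bar>x\<bar> > L} (evolution (schrodinger c (V + W)) t (ell2_delta 0)))
      \<le> real (Suc n) * (real n * exp (1 - real r)
        + t * (2 * K * ((\<theta> + exp (1 - real r)) ^ n + exp (1 - real r) / (1 - (\<theta> + exp (1 - real r))))))"
    proof (rule confinement[OF nK[OF c nV[OF W(3)]] a(1) ea n_def jrt(1) jrt(2) \<theta>(1) jrt(4)])
      fix z :: complex assume z: "cmod z = 1"
      \<comment> \<open>Every unimodular \<open>z\<close> is the phase \<open>cis (E * a)\<close> of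
        an energy with \<open>\<bar>E\<bar> * a \<le> \<pi>\<close>.\<close>
      define E where "E = Arg z / a"
      have Ea: "E * a = Arg z" using a by (simp add: E_def)
      have zE: "z = cis (E * a)" using z by (simp add: Ea) (metis Arg_eq cis_conv_exp mult_1 of_real_1 norm_zero zero_neq_one)
      have Epi: "\<bar>E\<bar> * a \<le> pi" using a mpi_less_Arg[of z] Arg_le_pi[of z] by (simp add: E_def abs_le_iff)
      have "\<exists>w\<in>F. \<bar>E\<bar> \<le> 3 * K \<longrightarrow> (\<forall>u. g * norm u \<le> norm (schrodinger c (V + w) u - E *\<^sub>R u))"
      proof (cases "\<bar>E\<bar> \<le> 3 * K")
        case True
        then show ?thesis using F(5)[OF V c, of E] by (auto simp: abs_le_iff)
      qed (use F(2) in auto)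
      then obtain i where i: "i < length ws"
        "\<bar>E\<bar> \<le> 3 * K \<Longrightarrow> \<forall>u. g * norm u \<le> norm (schrodinger c (V + ws ! i) u - E *\<^sub>R u)"
        by (metis in_set_conv_nth ws)
      have nw: "norm (schrodinger c (V + ws ! i)) \<le> K"
        using F(4)[of "ws ! i"] ws nth_mem[OF i(1)] by (intro nK[OF c] nV) auto
      show "\<exists>X \<mu>. norm (schrodinger c X) \<le> K \<and> (\<forall>u. norm (half_op (schrodinger c X) a z u) \<le> \<theta> * norm u)
       \<and> int (n * r) \<le> \<mu> \<and> \<mu> \<le> L \<and> (\<forall>x. \<bar>\<bar>x\<bar> - \<mu>\<bar> \<le> (int n + 1) * int r + 1 \<longrightarrow> apply_bcontfun (V + W) x = apply_bcontfun X x)"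
      proof (rule exI[of _ "V + ws ! i"], rule exI[of _ "(2 * int i + 2) * R"], intro conjI allI impI nw)
        fix u
        have "min (a * g / 2) (a * K) * norm u \<le> norm (u - cscale_op (cis (E * a)) (evolution (schrodinger c (V + ws ! i)) a u))"
          by (rule unit_gap[OF hermitian_schrodinger nw K a(1,2) Epi i(2)])
        then show "norm (half_op (schrodinger c (V + ws ! i)) a z u) \<le> \<theta> * norm u"
          unfolding \<theta>_def g'_def[symmetric] zE[symmetric] by (intro half_op_gap[OF hermitian_schrodinger z]) (use g' in auto)
      next
        have "int (n * r) \<le> R" by (simp add: R_def algebra_simps)
        also have "1 * R \<le> (2 * int i + 2) * R" using R by (intro mult_right_mono) auto
        then have "R \<le> (2 * int i + 2) * R" by simp
        finally show "int (n * r) \<le> (2 * int i + 2) * R" .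
        show "(2 * int i + 2) * R \<le> L" unfolding L_def using R i(1) by (intro mult_right_mono) (auto simp: m_def)
      next
        fix x assume "\<bar>\<bar>x\<bar> - (2 * int i + 2) * R\<bar> \<le> (int n + 1) * int r + 1"
        also have "\<dots> < R" by (simp add: R_def algebra_simps)
        finally have "barrier_fun ws R x = apply_bcontfun (ws ! i) x" by (rule barrier_fun_block[OF i(1)])
        then show "apply_bcontfun (V + W) x = apply_bcontfun (V + ws ! i) x" by (simp add: plus_bcontfun.rep_eq W f_def)
      qed
    qed
    also have "\<dots> \<le> t powr (- real k) / 2" using jrt(6) by (simp only: n_def)
    finally have "norm (proj_op {x. \<bar>x\<bar> > L} (evolution (schrodinger c (V + W)) t (ell2_delta 0))) \<le> t powr (- real k) / 2" .
    moreover have "{x. real_of_int \<bar>x\<bar> > t powr (1 / real k)} \<subseteq> {x. \<bar>x\<bar> > L}" using Lt by auto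
    ultimately show "norm (proj_op {x. real_of_int \<bar>x\<bar> > t powr (1 / real k)} (evolution (schrodinger c (V + W)) t (ell2_delta 0)))
       \<le> t powr (- real k) / 2"
      using norm_proj_op_mono order_trans by blast
  qed
qed

section \<open>Guarded regions\<close>

text \<open>One potential \<open>G\<close> has to guard for all \<open>V\<close> of period
  \<open>q\<close> and bounded norm at once, so every constant is chosen from \<open>q\<close>,
  \<open>B\<close> and the range of couplings alone: core length, gap, step height, cut-off length,
  then the wells one after another, since the room that class \<open>i\<close> needs depends on its
  distance from the origin.\<close>

lemma guard_exists:
  fixes q :: int and N :: nat
  assumes q: "0 < q" and cm: "0 < cm" "cm \<le> cM" and d0: "0 < d0" and B: "0 \<le> B"
  shows "\<exists>G \<kappa> P \<rho> w C. 0 < P \<and> 0 < \<rho> \<and> 0 < w \<and> 0 \<le> C \<and> norm G \<le> d0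
    \<and> (\<forall>n. apply_bcontfun G (n + P) = apply_bcontfun G n)
    \<and> (\<forall>n. \<kappa> (n + P) = \<kappa> n)
    \<and> (\<forall>V c i. (\<forall>n. apply_bcontfun V (n + q) = apply_bcontfun V n) \<longrightarrow> norm V \<le> B \<longrightarrow> c \<in> {cm..cM} \<longrightarrow> i \<le> N
        \<longrightarrow> guards w C (cball (V + G) \<rho>) c {n. \<kappa> n = (i :: nat)})"
proof -
  define d where "d = d0 / 2"
  have d: "0 < d" using d0 by (simp add: d_def)
  have cM: "0 < cM" using cm by simp
  define K where "K = 3 + cM * (B + d0)"
  have K1: "1 \<le> K" using cM B d0 by (simp add: K_def)
  \<comment> \<open>Makes the loss \<open>3 / l0\<close> of \<open>window_near_top\<close> at most
    \<open>c * d / 16\<close> for all couplings.\<close>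
  define l0 where "l0 = max 1 \<lceil>48 / (cm * d)\<rceil>"
  have l0: "1 \<le> l0" "3 / of_int l0 \<le> c * d / 16" if "cm \<le> c" for c
  proof -
    show "1 \<le> l0" by (simp add: l0_def)
    have "48 / (cm * d) \<le> of_int l0" unfolding l0_def by linarith
    then have "3 / of_int l0 \<le> cm * d / 16" using cm d \<open>1 \<le> l0\<close> by (simp add: field_simps)
    also have "\<dots> \<le> c * d / 16" using that d by (simp add: mult_right_mono)
    finally show "3 / of_int l0 \<le> c * d / 16" .
  qed
  define l where "l = l0 + q"
  have l1: "1 \<le> l" using l0(1)[of cm] q by (simp add: l_def)
  define g where "g = (1 / ((2 * K) ^ nat l * (4 * sqrt (of_int l))))\<^sup>2 / (4 * K)"
  have g: "0 < g" using K1 l1 by (simp add: g_def)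
  \<comment> \<open>All \<open>N + 1\<close> steps together stay below \<open>d / 16\<close> and,
    after multiplication by any coupling, below a quarter of the gap.\<close>
  define \<xi> where "\<xi> = min (d / (16 * (real N + 1))) (g / (4 * cM * (real N + 1)))"
  have \<xi>: "0 < \<xi>" using d g cM by (simp add: \<xi>_def)
  have \<xi>1: "(real N + 1) * \<xi> \<le> d / 16"
  proof -
    have "\<xi> \<le> d / (16 * (real N + 1))" by (simp add: \<xi>_def)
    then show ?thesis by (simp add: field_simps)
  qed
  have \<xi>2: "cM * ((real N + 1) * \<xi>) \<le> g / 4"
  proof -
    have "\<xi> \<le> g / (4 * cM * (real N + 1))" by (simp add: \<xi>_def)
    then have "\<xi> * (4 * cM * (real N + 1)) \<le> g" using cM by (subst (asm) pos_le_divide_eq) auto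
    then show ?thesis by (simp add: mult_ac)
  qed
  define D where "D = 8 / g + 16 / (cm * \<xi>) + 2 / (cm * d)"
  have Dp: "0 < D" using g cm \<xi> d by (simp add: D_def add_pos_pos)
  have Dc: "8 / g + 16 / (c * \<xi>) + 2 / (c * d) \<le> D" if "cm \<le> c" for c
  proof -
    have "16 / (c * \<xi>) \<le> 16 / (cm * \<xi>)" using that cm \<xi> by (intro divide_left_mono mult_right_mono) auto
    moreover have "2 / (c * d) \<le> 2 / (cm * d)" using that cm d by (intro divide_left_mono mult_right_mono) auto
    ultimately show ?thesis by (simp add: D_def)
  qed
  define L where "L = max (l + 1) \<lceil>60 * D\<rceil>"
  have Lb: "l + 1 \<le> L" "60 * D \<le> of_int L" unfolding L_def by (simp, linarith)
  have L1: "1 \<le> L" using Lb l1 by simp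
  define wf where "wf p = 1 / ((2 * K) ^ nat (p + l) * (2 * sqrt (2 * of_int (p + l + 1))))" for p :: int
  have wf: "0 < wf p" if "0 \<le> p" for p
    unfolding wf_def using K1 l1 that by (intro divide_pos_pos mult_pos_pos zero_less_power) auto
  \<comment> \<open>Number of dampings for a well at \<open>p\<close>: large against the inverse of
    the exponentially small overlap \<open>wf p\<close>.\<close>
  define mf where "mf p = nat \<lceil>(180 * D * K)\<^sup>2 / wf p\<rceil> + 1" for p
  have mf: "0 < mf p" "(180 * D * K)\<^sup>2 \<le> real (mf p) * wf p" if "0 \<le> p" for p
  proof -
    show "0 < mf p" by (simp add: mf_def)
    have "(180 * D * K)\<^sup>2 / wf p \<le> real (mf p)" unfolding mf_def by linarith
    then show "(180 * D * K)\<^sup>2 \<le> real (mf p) * wf p" using wf[OF that] by (simp add: field_simps)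
  qed
  have "\<exists>\<Lambda>. q dvd \<Lambda> \<and> 3 * L + 3 \<le> \<Lambda> \<and> X < of_int (\<Lambda> - l)" for X :: real
  proof -
    define k where "k = max (3 * L + 3) (\<lceil>X\<rceil> + l + 1)"
    have k: "0 \<le> k" "3 * L + 3 \<le> k" "X < of_int (k - l)" using L1 by (simp_all add: k_def) linarith
    have "k \<le> q * k" using k(1) q by (simp add: mult_le_cancel_right1)
    then have "real_of_int (k - l) \<le> of_int (q * k - l)" by linarith
    then have "q dvd q * k \<and> 3 * L + 3 \<le> q * k \<and> X < of_int (q * k - l)" using k \<open>k \<le> q * k\<close> by auto
    then show ?thesis by blast
  qed
  then obtain Lam :: "real \<Rightarrow> int" where Lam: "\<And>X. q dvd Lam X" "\<And>X. 3 * L + 3 \<le> Lam X" "\<And>X. X < real_of_int (Lam X - l)" by metis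
  \<comment> \<open>Free room beside a well at \<open>p\<close>: so long that \<open>mf p\<close>
    dampings spoil less than half of the admissible error \<open>K * wf p\<close>; the other half is
    left for the perturbation \<open>\<rho>\<close>.\<close>
  define \<Lambda> where "\<Lambda> p = Lam (max (16 * D) (real (mf p) * 8 / (K * wf p)))" for p
  have \<Lambda>: "q dvd \<Lambda> p" "3 * L + 3 \<le> \<Lambda> p" "16 * D < of_int (\<Lambda> p - l)" "real (mf p) * 8 / (K * wf p) < of_int (\<Lambda> p - l)" for p
    using Lam(1,2) Lam(3)[of "max (16 * D) (real (mf p) * 8 / (K * wf p))"] by (simp_all add: \<Lambda>_def)
  define A where "A = q * (3 * L + 4 + l)"
  have A: "q dvd A" "3 * L + 3 + l + q \<le> A"
  proof -
    have "q * 1 \<le> A - q * (3 * L + 3 + l)" by (simp add: A_def algebra_simps)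
    moreover have "1 * (3 * L + 3 + l) \<le> q * (3 * L + 3 + l)" using q L1 l1 by (intro mult_right_mono) auto
    ultimately show "3 * L + 3 + l + q \<le> A" by simp
  qed (simp add: A_def)
  \<comment> \<open>The next well lies beyond the room \<open>\<Lambda>\<close> of the present one;
    the extra \<open>A\<close> leaves space for the tile boundary and the margin
    \<open>3 * L + 3\<close>.\<close>
  define p where "p = rec_nat A (\<lambda>_ x. x + \<Lambda> x + A)"
  have p: "p 0 = A" "p (Suc i) = p i + \<Lambda> (p i) + A" for i by (simp_all add: p_def)
  have A0: "0 < A" using A L1 l1 q by simp
  have p_step: "p i \<le> p (Suc i)" for i using p(2)[of i] \<Lambda>(2)[of "p i"] A0 L1 by simp
  have p_mono: "i \<le> j \<Longrightarrow> p i \<le> p j" for i j by (rule lift_Suc_mono_le[of p]) (rule p_step)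
  have p0: "0 < p i" for i using p_mono[of 0 i] A0 p(1) by simp
  have p_dvd: "q dvd p i" for i by (induction i) (simp_all add: p A \<Lambda>)
  \<comment> \<open>The left end is \<open>- p (Suc N)\<close>, with one index beyond the last well,
    because the window of class \<open>N\<close> extends \<open>\<Lambda> (p N)\<close> to the left
    of the origin.\<close>
  define s where "s i = (case i of 0 \<Rightarrow> - p (Suc N) | Suc j \<Rightarrow> p j + \<Lambda> (p j) + q)" for i
  have s: "s 0 = - p (Suc N)" "s (Suc j) = p j + \<Lambda> (p j) + q" for j by (simp_all add: s_def)
  interpret tiling N p s L
  proof
    show "1 \<le> L" by (rule L1)
    show "s i + 3 * L + 3 \<le> p i" for i
    proof (cases i)
      case 0
      then show ?thesis using p0[of "Suc N"] A q l1 by (simp add: s p(1))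
    next
      case (Suc j)
      then show ?thesis using A l1 by (simp add: s p(2))
    qed
    show "p i + 3 * L + 3 \<le> s (Suc i)" for i using \<Lambda>(2)[of "p i"] q by (simp add: s)
  qed
  define Gf where "Gf n = real (cls n) * \<xi> + (if dd n \<le> l then d else 0)" for n
  have Gf: "norm (Gf n) \<le> d0" for n
  proof -
    have "real (cls n) * \<xi> \<le> (real N + 1) * \<xi>" using cls(1)[of n] \<xi> by (intro mult_right_mono) auto
    moreover have "0 \<le> real (cls n) * \<xi>" using \<xi> by simp
    ultimately show ?thesis using \<xi>1 d d0 unfolding Gf_def by (auto simp: d_def)
  qed
  define G where "G = bfun Gf"
  have G: "apply_bcontfun G n = Gf n" for n unfolding G_def using bfun_apply[of Gf d0, OF Gf] .
  define Uf where "Uf n = (if \<bar>n\<bar> \<le> l then d else 0)" for n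
  have Uf: "norm (Uf n) \<le> d0" for n using d0 d by (simp add: Uf_def d_def)
  define G' where "G' = bfun Uf"
  have G': "apply_bcontfun G' n = Uf n" for n unfolding G'_def using bfun_apply[of Uf d0, OF Uf] .
  define M where "M = (\<Sum>i\<le>N. real (mf (p i)))"
  have M: "real (mf (p i)) \<le> M" if "i \<le> N" for i unfolding M_def using that by (intro member_le_sum) auto
  \<comment> \<open>A positive number below all the overlaps \<open>wf (p i)\<close>.\<close>
  define w where "w = 1 / (\<Sum>i\<le>N. 1 / wf (p i))"
  have wp: "0 < wf (p i)" for i using wf[of "p i"] p0[of i] by simp
  have sp: "0 < (\<Sum>i\<le>N. 1 / wf (p i))" using wp by (intro sum_pos) auto
  have w: "0 < w" using sp by (simp add: w_def)
  have ww: "w \<le> wf (p i)" if "i \<le> N" for i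
  proof -
    have "1 / wf (p i) \<le> (\<Sum>i\<le>N. 1 / wf (p i))" using that wp by (intro member_le_sum) (auto intro: less_imp_le)
    then show ?thesis using sp wp[of i] by (simp add: w_def field_simps)
  qed
  have Mp: "0 < M" using M[of 0] mf(1)[of "p 0"] p0[of 0] by simp
  \<comment> \<open>The three bounds are the requirements of \<open>class_guards\<close> on the
    radius: on the norm of the shifted operators, on the leakage from the class, and on the overlap
    of all classes.\<close>
  define \<rho> where "\<rho> = min (K / cM) (min (1 / (30 * D * cM)) (K * w / (2 * M * cM)))"
  have \<rho>0: "0 < \<rho>" using K1 cM Dp w Mp by (simp add: \<rho>_def)
  have \<rho>M: "cM * \<rho> \<le> K" "30 * D * (cM * \<rho>) \<le> 1" "2 * M * (cM * \<rho>) \<le> K * w"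
  proof -
    have "\<rho> \<le> K / cM" "\<rho> \<le> 1 / (30 * D * cM)" "\<rho> \<le> K * w / (2 * M * cM)" by (auto simp: \<rho>_def)
    then show "cM * \<rho> \<le> K" "30 * D * (cM * \<rho>) \<le> 1" "2 * M * (cM * \<rho>) \<le> K * w"
      using cM Dp Mp by (simp_all add: field_simps)
  qed
  define C where "C = M * (2 * cM / (3 * K))"
  have main: "guards (w / 2) C (cball (V + G) \<rho>) c {n. cls n = i}"
    if V: "\<And>n. apply_bcontfun V (n + q) = apply_bcontfun V n" "norm V \<le> B" and c: "c \<in> {cm..cM}" and i: "i \<le> N" for V c i
  proof -
    have c0: "0 < c" "cm \<le> c" "c \<le> cM" using c cm by auto
    define U where "U = V + G'"
    define VG where "VG = V + G"
    have nW: "norm (V + W) \<le> B + d0" if "norm W \<le> d0" for W using norm_triangle_ineq[of V W] V(2) that by simp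
    have nG: "norm G \<le> d0" "norm G' \<le> d0"
      by (rule norm_bcontfun_le, simp only: G Gf) (rule norm_bcontfun_le, simp only: G' Uf)
    have sK: "norm (schrodinger c W) \<le> K" "\<bar>c * apply_bcontfun W n\<bar> \<le> K" if "norm W \<le> B + d0" for W n
    proof -
      have *: "\<bar>c\<bar> * norm W \<le> cM * (B + d0)" using c0 that by (intro mult_mono) auto
      show "norm (schrodinger c W) \<le> K" using norm_schrodinger_le[of c W] * by (simp add: K_def)
      have "\<bar>c * apply_bcontfun W n\<bar> \<le> \<bar>c\<bar> * norm W"
        unfolding abs_mult using norm_bounded[of W n] by (intro mult_left_mono) auto
      then show "\<bar>c * apply_bcontfun W n\<bar> \<le> K" using * by (simp add: K_def)
    qed
    have KU: "norm (schrodinger c U) \<le> K" "\<And>n. \<bar>c * apply_bcontfun U n\<bar> \<le> K"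
      and KVG: "norm (schrodinger c VG) \<le> K" "\<And>n. \<bar>c * apply_bcontfun VG n\<bar> \<le> K"
      unfolding U_def VG_def by (intro sK nW nG)+
    have KV: "norm (schrodinger c V) \<le> K" using sK(1)[of V] V(2) d0 by simp
    obtain \<nu> where \<nu>: "is_top (schrodinger c V) UNIV \<nu>" using ex_is_top[OF _ KV, of UNIV] by auto
    obtain E1 where E1: "is_top (schrodinger c U) {- 3 * L..3 * L} E1" "\<bar>E1\<bar> \<le> K"
      using ex_is_top[OF _ KU(1), of "{- 3 * L..3 * L}"] L1 by auto
    have "1 \<in> {- 3 * L..3 * L} - {0}" using L1 by auto
    then obtain E0 where E0: "is_top (schrodinger c U) ({- 3 * L..3 * L} - {0}) E0" "\<bar>E0\<bar> \<le> K"
      using ex_is_top[OF _ KU(1), of "{- 3 * L..3 * L} - {0}"] by blast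
    have Uap: "apply_bcontfun U n = apply_bcontfun V n + (if \<bar>n\<bar> \<le> l then d else 0)" for n
      by (simp add: U_def G' Uf_def)
    have VGap: "apply_bcontfun VG n = apply_bcontfun V n + (real (cls n) * \<xi> + (if dd n \<le> l then d else 0))" for n
      by (simp add: VG_def G Gf_def)
    have sub: "{- l - 1..l + 1} \<subseteq> {- 3 * L..3 * L}"
    proof -
      have "- 3 * L \<le> - l - 1" "l + 1 \<le> 3 * L" using Lb(1) L1 by linarith+
      then show ?thesis by (simp only: atLeastatMost_subset_iff) blast
    qed
    note gap = core_gap[OF V(1) q Uap c0(1) d \<nu> KU(1) K1 KU(2) l_def l0(1)[OF c0(2)] l0(2)[OF c0(2)] sub E1 E0]
    interpret gp: guard_potential N p s L q l d \<xi> c K g \<nu> E1 E0 V U VG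
    proof
      show "q dvd p i" for i by (rule p_dvd)
      show "q dvd P" unfolding P_def s using p_dvd \<Lambda>(1) by auto
      show "E0 + g \<le> E1" using gap(2) by (simp add: g_def)
      have "c * ((real N + 1) * \<xi>) \<le> cM * ((real N + 1) * \<xi>)" using c0 \<xi> by (intro mult_right_mono) auto
      then show "c * (real N + 1) * \<xi> \<le> g / 4" unfolding mult.assoc[of c] using \<xi>2 by (rule order_trans)
      have "real N * \<xi> \<le> d / 16" using \<xi>1 \<xi> by (simp add: algebra_simps)
      then have "c * (real N * \<xi>) \<le> c * (d / 16)" using c0 by (intro mult_left_mono) auto
      then show "c * (real N * \<xi>) \<le> c * d / 16" by simp
    qed (fact q V(1) l1 Lb(1) VGap Uap c0(1) d \<xi> K1 g \<nu> KU(1) KVG E1 E0(1) gap(1))+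
    define m where "m = mf (p i)"
    have pi: "0 \<le> p i" using p0[of i] by simp
    have c\<rho>: "c * \<rho> \<le> cM * \<rho>" "0 \<le> c * \<rho>" using c0 \<rho>0 by (auto intro: mult_right_mono)
    have gd: "guards (wf (p i) / 2) (real m * (2 * c / (3 * K))) (cball VG \<rho>) c {n. cls n = i}"
    proof (rule gp.class_guards[OF i _ _ _ _ Dc[OF c0(2)] Lb(2) \<Lambda>(3)[of "p i"] wf_def[of "p i"] mf(1)[OF pi, folded m_def] mf(2)[OF pi, folded m_def]])
      show "3 * L \<le> \<Lambda> (p i)" using \<Lambda>(2)[of "p i"] by simp
      show "s 0 \<le> - \<Lambda> (p i)" using p(2)[of i] p_mono[of "Suc i" "Suc N"] i pi A0 by (simp add: s)
      show "p i + \<Lambda> (p i) < s (Suc i)" using q by (simp add: s)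
      show "l \<le> p 0" using A L1 q by (simp add: p(1))
      show "0 \<le> \<rho>" using \<rho>0 by simp
      show "c * \<rho> \<le> K" using c\<rho> \<rho>M(1) by simp
      show "30 * D * (c * \<rho>) \<le> 1" by (rule order_trans[OF mult_left_mono[OF c\<rho>(1)] \<rho>M(2)]) (use Dp in simp)
      have \<Lambda>0: "0 < real_of_int (\<Lambda> (p i) - l)" using \<Lambda>(3)[of "p i"] Dp by linarith
      have "real m * (4 / of_int (\<Lambda> (p i) - l)) \<le> K * wf (p i) / 2"
        using \<Lambda>(4)[of "p i"] \<Lambda>0 K1 wp[of i] unfolding m_def[symmetric] by (simp add: field_simps)
      moreover have "real m * (c * \<rho>) \<le> K * wf (p i) / 2"
      proof -
        have "real m * (c * \<rho>) \<le> M * (cM * \<rho>)" unfolding m_def by (rule mult_mono[OF M[OF i] c\<rho>(1)]) (use c\<rho>(2) Mp in simp_all)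
        also have "\<dots> \<le> K * w / 2" using \<rho>M(3) by simp
        also have "\<dots> \<le> K * wf (p i) / 2" using ww[OF i] K1 by simp
        finally show ?thesis .
      qed
      ultimately show "real m * (4 / of_int (\<Lambda> (p i) - l) + c * \<rho>) \<le> K * wf (p i)" by (simp add: distrib_left)
    qed
    have mC: "real m * (2 * c / (3 * K)) \<le> C"
      unfolding C_def m_def using M[OF i] c0 K1 Mp by (intro mult_mono divide_right_mono) auto
    have "w / 2 \<le> wf (p i) / 2" using ww[OF i] by (rule divide_right_mono) simp
    from guards_mono[OF gd this mC subset_refl] show ?thesis by (simp only: VG_def)
  qed
  have C0: "0 \<le> C" using Mp cM K1 by (simp add: C_def)
  show ?thesis
  proof (rule exI[of _ G], rule exI[of _ cls], rule exI[of _ P], rule exI[of _ \<rho>], rule exI[of _ "w / 2"],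
      rule exI[of _ C], intro conjI)
    show "norm G \<le> d0" by (rule norm_bcontfun_le) (simp only: G Gf)
  qed (use P_pos \<rho>0 w C0 main in \<open>auto simp: G Gf_def cls_add_P dd_add_P\<close>)
qed

text \<open>On \<open>S\<close> the two potentials differ by the constant \<open>y\<close>, so a
  state living there evolves under the second one as under the first, up to the phase
  \<open>cis (- c * y * t)\<close>. The part off \<open>S\<close>, a tenth of the norm, sees a
  difference of at most \<open>2 * b\<close>, whence \<open>c * t * b / 5\<close>. Both evolutions
  nearly return to multiples of the same state, so the return phases are related.\<close>

lemma guarded_phases:
  assumes g: "guards w C Q c S" "0 < w" "0 \<le> C" and V: "V \<in> Q" "V' \<in> Q" and Y: "\<And>n. n \<in> S \<Longrightarrow> apply_bcontfun (V' - V) n = y"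
    and b: "norm (V' - V) \<le> b" "\<bar>y\<bar> \<le> b" and ct: "0 < c" "0 \<le> t"
    and rec: "norm (evolution (schrodinger c V) t (ell2_delta 0) - cscale_op z (ell2_delta 0)) \<le> \<eta>"
      "norm (evolution (schrodinger c V') t (ell2_delta 0) - cscale_op z' (ell2_delta 0)) \<le> \<eta>"
    and z': "cmod z' = 1"
  shows "cmod (cis (- c * y * t) * z - z') \<le> 2 * \<eta> / w + c * t * b / 5 + 2 * C * b / w"
proof -
  define H H' where "H = schrodinger c V" and "H' = schrodinger c V'"
  have herm: "hermitian_op H" "hermitian_op H'" by (simp_all add: H_def H'_def hermitian_schrodinger)
  have b0: "0 \<le> b" using b(2) by linarith
  have \<eta>0: "0 \<le> \<eta>" using rec(1) norm_ge_zero order_trans by blast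
  obtain f where f: "\<And>V. V \<in> Q \<Longrightarrow> w \<le> norm (f V)"
    "\<And>V t z. V \<in> Q \<Longrightarrow> norm (evolution (schrodinger c V) t (f V) - cscale_op z (f V))
         \<le> norm (evolution (schrodinger c V) t (ell2_delta 0) - cscale_op z (ell2_delta 0))"
    "\<And>V t. V \<in> Q \<Longrightarrow> 10 * norm (proj_op (- S) (evolution (schrodinger c V) t (f V))) \<le> norm (f V)"
    "\<And>V V'. V \<in> Q \<Longrightarrow> V' \<in> Q \<Longrightarrow> norm (f V - f V') \<le> C * norm (V - V')"
    using g(1) unfolding guards_def by blast
  define F where "F = norm (f V)"
  have F: "w \<le> F" "0 < F" using f(1)[OF V(1)] g(2) unfolding F_def by linarith+
  define E where "E = - c * y"
  define \<phi> where "\<phi> s = cscale_op (cis (E * s)) (evolution H s (f V))" for s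
  \<comment> \<open>The defect of the rotated solution; the constant shift cancels on
    \<open>S\<close>.\<close>
  define r where "r s = cscale_op \<i> (blinfun_apply H' (\<phi> s) - blinfun_apply H (\<phi> s) + E *\<^sub>R \<phi> s)" for s
  have "norm (\<phi> t - evolution H' t (\<phi> 0)) \<le> t * (c * b * F / 5)"
  proof (rule duhamel[OF herm(2) ct(2), where r = r])
    fix s
    have *: "cscale_op v (- cscale_op \<i> u) + cscale_op (\<i> * of_real E * v) u'
       = - cscale_op \<i> a + cscale_op \<i> (a - cscale_op v u + E *\<^sub>R cscale_op v u')" for v u u' a
      by (rule ell2_eqI) (simp add: algebra_simps scaleR_conv_of_real blinfun.bilinear_simps)
    show "(\<phi> has_vector_derivative - cscale_op \<i> (blinfun_apply H' (\<phi> s)) + r s) (at s within {0..t})"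
      unfolding r_def
      unfolding \<phi>_def hermitian_op_cscale[OF herm(1)] *[symmetric]
      by (rule bounded_bilinear.has_vector_derivative[OF bounded_bilinear_cscale_op cis_has_vector_derivative has_vector_derivative_evolution])
    have "norm (r s) = norm (blinfun_apply H' (\<phi> s) - blinfun_apply H (\<phi> s) + E *\<^sub>R \<phi> s)"
      by (simp add: r_def norm_cscale_op)
    also have "\<dots> \<le> norm ((2 * c * b) *\<^sub>R proj_op (- S) (\<phi> s))"
    proof (rule norm_ell2_mono)
      fix n
      have eq: "apply_ell2 (blinfun_apply H' (\<phi> s) - blinfun_apply H (\<phi> s) + E *\<^sub>R \<phi> s) n
        = of_real (c * (apply_bcontfun (V' - V) n - y)) * apply_ell2 (\<phi> s) n"
        by (simp add: H_def H'_def apply_schrodinger E_def scaleR_conv_of_real algebra_simps)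
      show "cmod (apply_ell2 (blinfun_apply H' (\<phi> s) - blinfun_apply H (\<phi> s) + E *\<^sub>R \<phi> s) n)
         \<le> cmod (apply_ell2 ((2 * c * b) *\<^sub>R proj_op (- S) (\<phi> s)) n)"
      proof (cases "n \<in> S")
        case True
        then show ?thesis unfolding eq by (simp add: Y[OF True] del: minus_bcontfun.rep_eq)
      next
        case False
        have "\<bar>apply_bcontfun (V' - V) n\<bar> \<le> b" using norm_bounded[of "V' - V" n] b(1) by (simp only: real_norm_def)
        then have "\<bar>apply_bcontfun (V' - V) n - y\<bar> \<le> 2 * b" using b(2) by linarith
        then have "\<bar>c * (apply_bcontfun (V' - V) n - y)\<bar> \<le> 2 * c * b"
          unfolding abs_mult using ct mult_left_mono[of "\<bar>apply_bcontfun (V' - V) n - y\<bar>" "2 * b" c] by simp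
        then have "\<bar>c * (apply_bcontfun (V' - V) n - y)\<bar> * cmod (apply_ell2 (\<phi> s) n) \<le> 2 * c * b * cmod (apply_ell2 (\<phi> s) n)"
          by (rule mult_right_mono) simp
        then show ?thesis unfolding eq norm_mult norm_of_real using False ct b0 by (simp add: norm_mult)
      qed
    qed
    also have "\<dots> = 2 * c * b * norm (proj_op (- S) (evolution H s (f V)))"
      using ct b0 by (simp add: \<phi>_def proj_op_commute norm_cscale_op)
    also have "\<dots> \<le> 2 * c * b * (F / 10)"
      using f(3)[OF V(1), of s] ct b0 by (intro mult_left_mono) (auto simp: H_def F_def)
    finally show "norm (r s) \<le> c * b * F / 5" by (simp add: mult_ac)
  qed
  then have d: "norm (\<phi> t - evolution H' t (f V)) \<le> c * t * b / 5 * F" by (simp add: \<phi>_def mult_ac)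
  have 1: "norm (\<phi> t - cscale_op (cis (E * t) * z) (f V)) \<le> \<eta>"
  proof -
    have "\<phi> t - cscale_op (cis (E * t) * z) (f V)
      = cscale_op (cis (E * t)) (evolution H t (f V) - cscale_op z (f V))"
      by (simp add: \<phi>_def cscale_op_cscale_op blinfun.diff_right)
    then show ?thesis using f(2)[OF V(1), of t z] rec(1) by (simp add: norm_cscale_op H_def)
  qed
  have ff: "norm (f V - f V') \<le> C * b"
    using f(4)[OF V] mult_left_mono[OF b(1) g(3)] by (simp add: norm_minus_commute)
  \<comment> \<open>The return of the second evolution is known for its own guarded state
    \<open>f V'\<close>; exchanging it for \<open>f V\<close> costs \<open>C * b\<close>
    twice.\<close>
  have 2: "norm (evolution H' t (f V) - cscale_op z' (f V)) \<le> \<eta> + 2 * C * b"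
  proof -
    have "evolution H' t (f V) - cscale_op z' (f V)
      = (evolution H' t (f V') - cscale_op z' (f V')) + evolution H' t (f V - f V') + cscale_op z' (f V' - f V)"
      by (simp add: blinfun.diff_right linear_diff[OF evolution_linear])
    also have "norm \<dots> \<le> \<eta> + C * b + C * b"
    proof (intro order_trans[OF norm_triangle_ineq add_mono])
      show "norm (evolution H' t (f V') - cscale_op z' (f V')) \<le> \<eta>"
        using f(2)[OF V(2), of t z'] rec(2) by (simp add: H'_def)
      show "norm (evolution H' t (f V - f V')) \<le> C * b" using ff by (simp add: norm_evolution[OF herm(2)])
      show "norm (cscale_op z' (f V' - f V)) \<le> C * b" using ff z' by (simp add: norm_cscale_op norm_minus_commute)
    qed
    finally show ?thesis by simp
  qed
  have "cscale_op (cis (E * t) * z - z') (f V)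
    = - (\<phi> t - cscale_op (cis (E * t) * z) (f V)) + ((\<phi> t - evolution H' t (f V)) + (evolution H' t (f V) - cscale_op z' (f V)))"
    by (rule ell2_eqI) (simp add: algebra_simps)
  then have "norm (cscale_op (cis (E * t) * z - z') (f V)) \<le> \<eta> + (c * t * b / 5 * F + (\<eta> + 2 * C * b))"
  proof (simp only:, intro order_trans[OF norm_triangle_ineq add_mono])
    show "norm (- (\<phi> t - cscale_op (cis (E * t) * z) (f V))) \<le> \<eta>" using 1 by (simp only: norm_minus_cancel)
  qed (use 2 d in auto)
  then have "cmod (cis (E * t) * z - z') * F \<le> c * t * b / 5 * F + (2 * \<eta> + 2 * C * b)" by (simp add: norm_cscale_op F_def)
  moreover have "2 * \<eta> + 2 * C * b \<le> (2 * \<eta> + 2 * C * b) / w * F"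
  proof -
    have "(2 * \<eta> + 2 * C * b) * w \<le> (2 * \<eta> + 2 * C * b) * F" using F(1) \<eta>0 g(3) b0 by (intro mult_left_mono) auto
    then show ?thesis using g(2) by (simp add: field_simps)
  qed
  ultimately have "cmod (cis (E * t) * z - z') * F \<le> (c * t * b / 5 + (2 * \<eta> + 2 * C * b) / w) * F" by (simp add: distrib_right)
  then have "cmod (cis (E * t) * z - z') \<le> c * t * b / 5 + (2 * \<eta> + 2 * C * b) / w" using F(2) by (rule mult_right_le_imp_le)
  then show ?thesis by (simp add: E_def add_divide_distrib)
qed

text \<open>The phase is left free, as moments do not see it.\<close>

definition recurrent :: "(int \<Rightarrow>\<^sub>C real) \<Rightarrow> real \<Rightarrow> real \<Rightarrow> real \<Rightarrow> bool" where
  "recurrent V c t \<eta> \<longleftrightarrow> (\<exists>z. cmod z = 1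
     \<and> norm (evolution (schrodinger c V) t (ell2_delta 0) - cscale_op z (ell2_delta 0)) \<le> \<eta>)"

text \<open>Class \<open>S\<^sub>0\<close> is not shifted and serves as a reference: there the
  return phases nearly agree. On \<open>S\<close> they differ by \<open>cis (- c * y * t)\<close>,
  which must therefore be close to 1. As \<open>c * t * \<bar>y\<bar> \<le> 1\<close> excludes a
  full turn, \<open>y\<close> is small.\<close>

lemma guard_injective:
  assumes g: "guards w C Q c S\<^sub>0" "guards w C Q c S" "0 < w" "0 \<le> C" and V: "V \<in> Q" "V' \<in> Q"
    and Y: "\<And>n. n \<in> S\<^sub>0 \<Longrightarrow> apply_bcontfun (V' - V) n = 0" "\<And>n. n \<in> S \<Longrightarrow> apply_bcontfun (V' - V) n = y" "norm (V' - V) \<le> \<bar>y\<bar>"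
    and ct: "0 < c" "0 \<le> t" "40 * C \<le> c * t * w" "c * t * \<bar>y\<bar> \<le> 1"
    and rec: "recurrent V c t \<eta>" "recurrent V' c t \<eta>"
  shows "c * t * \<bar>y\<bar> \<le> 12 * \<eta> / w"
proof -
  obtain z z' where z: "cmod z = 1" "cmod z' = 1"
    and r: "norm (evolution (schrodinger c V) t (ell2_delta 0) - cscale_op z (ell2_delta 0)) \<le> \<eta>"
      "norm (evolution (schrodinger c V') t (ell2_delta 0) - cscale_op z' (ell2_delta 0)) \<le> \<eta>"
    using rec unfolding recurrent_def by blast
  define X where "X = 2 * \<eta> / w + c * t * \<bar>y\<bar> / 5 + 2 * C * \<bar>y\<bar> / w"
  have 1: "cmod (z - z') \<le> X"
    using guarded_phases[OF g(1,3,4) V Y(1) Y(3) _ ct(1,2) r z(2)] by (simp add: X_def)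
  have 2: "cmod (cis (- c * y * t) * z - z') \<le> X"
    using guarded_phases[OF g(2,3,4) V Y(2) Y(3) _ ct(1,2) r z(2)] by (simp add: X_def)
  have "cmod ((cis (- c * y * t) - 1) * z) \<le> 2 * X"
    using norm_triangle_ineq4[of "cis (- c * y * t) * z - z'" "z - z'"] 1 2 by (simp add: algebra_simps)
  then have "cmod (cis (- c * y * t) - 1) \<le> 2 * X" using z by (simp add: norm_mult)
  moreover have "\<bar>sin (c * t * \<bar>y\<bar>)\<bar> \<le> cmod (cis (- c * y * t) - 1)"
  proof -
    have "\<bar>sin (c * t * \<bar>y\<bar>)\<bar> = \<bar>Im (cis (- c * y * t) - 1)\<bar>" by (simp add: abs_if mult_ac)
    then show ?thesis using abs_Im_le_cmod by metis
  qed
  moreover have x0: "0 \<le> c * t * \<bar>y\<bar>" using ct by simp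
  then have "5 / 6 * (c * t * \<bar>y\<bar>) \<le> sin (c * t * \<bar>y\<bar>)" using ct(4) by (intro sin_ge_5_6)
  ultimately have m: "5 / 6 * (c * t * \<bar>y\<bar>) \<le> 2 * X" by linarith
  \<comment> \<open>The condition on \<open>t\<close> makes the Lipschitz term at most
    \<open>c * t * \<bar>y\<bar> / 20\<close>. Then \<open>2 * X\<close> is at most
    \<open>4 * \<eta> / w\<close> plus half of \<open>c * t * \<bar>y\<bar>\<close>, against
    \<open>5 / 6\<close> of it on the left; the difference of a third gives the factor 12.\<close>
  have "40 * C * \<bar>y\<bar> \<le> c * t * w * \<bar>y\<bar>" by (rule mult_right_mono[OF ct(3)]) simp
  then have "40 * (C * \<bar>y\<bar> / w) \<le> c * t * \<bar>y\<bar>" using g(3) by (simp add: field_simps)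
  then show ?thesis using m unfolding X_def by simp
qed

section \<open>Counting returning parameters\<close>

definition grid :: "nat \<Rightarrow> nat \<Rightarrow> (nat \<Rightarrow> nat) set" where
  "grid N n = {1..N} \<rightarrow>\<^sub>E {..<n}"

text \<open>Class 0 is never shifted, being the phase reference of
  \<open>guard_injective\<close>.\<close>

definition block :: "(int \<Rightarrow> nat) \<Rightarrow> nat \<Rightarrow> real \<Rightarrow> nat \<Rightarrow> (nat \<Rightarrow> nat) \<Rightarrow> (int \<Rightarrow>\<^sub>C real)" where
  "block \<kappa> N a n k = bfun (\<lambda>m. if \<kappa> m \<in> {1..N} then a * real (k (\<kappa> m)) / real n else 0)"

lemma finite_grid: "finite (grid N n)" by (simp add: grid_def finite_PiE)

lemma card_grid: "card (grid N n) = n ^ N" by (simp add: grid_def card_PiE)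

lemma grid_less: "k \<in> grid N n \<Longrightarrow> i \<in> {1..N} \<Longrightarrow> k i < n" by (auto simp: grid_def PiE_def)

lemma block:
  assumes k: "k \<in> grid N n" and a: "0 \<le> a"
  shows block_apply: "apply_bcontfun (block \<kappa> N a n k) m = (if \<kappa> m \<in> {1..N} then a * real (k (\<kappa> m)) / real n else 0)"
    and norm_block_le: "norm (block \<kappa> N a n k) \<le> a"
proof -
  define f where "f m = (if \<kappa> m \<in> {1..N} then a * real (k (\<kappa> m)) / real n else 0)" for m
  have f: "norm (f m) \<le> a" for m
  proof (cases "\<kappa> m \<in> {1..N}")
    case True
    then have "k (\<kappa> m) < n" by (rule grid_less[OF k])
    then have "real (k (\<kappa> m)) \<le> real n" "0 < real n" by simp_all
    then have "a * real (k (\<kappa> m)) / real n \<le> a" using a by (simp add: field_simps mult_left_mono)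
    then show ?thesis using True a by (simp add: f_def)
  next
    case False
    then show ?thesis using a unfolding f_def by (simp only: if_False norm_zero)
  qed
  have *: "apply_bcontfun (block \<kappa> N a n k) m = f m" for m
    unfolding block_def f_def[symmetric] using bfun_apply[of f a, OF f] .
  show "apply_bcontfun (block \<kappa> N a n k) m = (if \<kappa> m \<in> {1..N} then a * real (k (\<kappa> m)) / real n else 0)" using * by (simp add: f_def)
  show "norm (block \<kappa> N a n k) \<le> a" by (rule norm_bcontfun_le) (simp only: * f)
qed

text \<open>The grid is cut into cells of side \<open>D + 1\<close>; within a cell the members of
  \<open>X\<close> lie in a cube of side \<open>2 * d + 1\<close> around any one of them.\<close>

lemma card_cells_le:
  fixes X :: "(nat \<Rightarrow> nat) set"
  assumes X: "X \<subseteq> grid N n"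
    and d: "\<And>k k' i. k \<in> X \<Longrightarrow> k' \<in> X \<Longrightarrow> (\<And>i. i \<in> {1..N} \<Longrightarrow> k i div (D + 1) = k' i div (D + 1)) \<Longrightarrow> i \<in> {1..N} \<Longrightarrow> k' i \<le> k i + d"
  shows "card X \<le> ((n div (D + 1) + 1) * (2 * d + 1)) ^ N"
proof -
  define cell where "cell k = restrict (\<lambda>i. k i div (D + 1)) {1..N}" for k :: "nat \<Rightarrow> nat"
  have fX: "finite X" using X finite_grid finite_subset by blast
  have im: "cell ` X \<subseteq> grid N (n div (D + 1) + 1)"
  proof
    fix y assume "y \<in> cell ` X"
    then obtain k where k: "k \<in> X" "y = cell k" by blast
    have "k i div (D + 1) \<le> n div (D + 1)" if "i \<in> {1..N}" for i
      using grid_less[OF subsetD[OF X k(1)] that] by (intro div_le_mono) simp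
    then show "y \<in> grid N (n div (D + 1) + 1)" unfolding k(2) cell_def grid_def by (auto simp: less_Suc_eq_le)
  qed
  have fib: "card {k \<in> X. cell k = y} \<le> (2 * d + 1) ^ N" for y
  proof (cases "{k \<in> X. cell k = y} = {}")
    case False
    then obtain k0 where k0: "k0 \<in> X" "cell k0 = y" by blast
    have "{k \<in> X. cell k = y} \<subseteq> (\<Pi>\<^sub>E i\<in>{1..N}. {k0 i - d..k0 i + d})"
    proof
      fix k assume "k \<in> {k \<in> X. cell k = y}"
      then have k: "k \<in> X" "cell k = cell k0" using k0 by auto
      have cell_eq: "k i div (D + 1) = k0 i div (D + 1)" if "i \<in> {1..N}" for i
        using fun_cong[OF k(2), of i] that by (simp add: cell_def)
      have "k i \<in> {k0 i - d..k0 i + d}" if "i \<in> {1..N}" for i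
        using d[OF k0(1) k(1) cell_eq[symmetric] that] d[OF k(1) k0(1) cell_eq that] by auto
      moreover have "k \<in> extensional {1..N}" using X k(1) by (auto simp: grid_def PiE_def)
      ultimately show "k \<in> (\<Pi>\<^sub>E i\<in>{1..N}. {k0 i - d..k0 i + d})" by (intro PiE_I) (auto simp: extensional_def)
    qed
    then have "card {k \<in> X. cell k = y} \<le> card (\<Pi>\<^sub>E i\<in>{1..N}. {k0 i - d..k0 i + d})" by (intro card_mono) (auto intro: finite_PiE)
    also have "\<dots> = (\<Prod>i\<in>{1..N}. card {k0 i - d..k0 i + d})" by (simp add: card_PiE)
    also have "\<dots> \<le> (\<Prod>i\<in>{1..N}. 2 * d + 1)" by (intro prod_mono) auto
    finally show ?thesis by simp
  next
    case True
    show ?thesis unfolding True by simp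
  qed
  have "card X = card (\<Union>y\<in>cell ` X. {k \<in> X. cell k = y})" by (rule arg_cong[where f = card]) auto
  also have "\<dots> \<le> (\<Sum>y\<in>cell ` X. card {k \<in> X. cell k = y})" by (rule card_UN_le) (use fX in simp)
  also have "\<dots> \<le> (\<Sum>y\<in>cell ` X. (2 * d + 1) ^ N)" by (rule sum_mono) (rule fib)
  also have "\<dots> = card (cell ` X) * (2 * d + 1) ^ N" by simp
  also have "\<dots> \<le> (n div (D + 1) + 1) ^ N * (2 * d + 1) ^ N"
    using card_mono[OF finite_grid im] by (intro mult_right_mono) (simp_all only: card_grid)
  finally show ?thesis by (simp only: power_mult_distrib)
qed

lemma evolution_perturbation:
  assumes H: "hermitian_op H" "hermitian_op H'" and t: "0 \<le> t" and e: "\<And>v. norm (blinfun_apply H v - blinfun_apply H' v) \<le> e * norm v"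
  shows "norm (evolution H t u - evolution H' t u) \<le> t * e * norm u"
proof -
  have "norm (evolution H t u - evolution H' t (evolution H 0 u)) \<le> t * (e * norm u)"
  proof (rule duhamel[OF H(2) t, where r = "\<lambda>s. cscale_op \<i> (blinfun_apply H' (evolution H s u) - blinfun_apply H (evolution H s u))"])
    fix s
    show "((\<lambda>s. evolution H s u) has_vector_derivative - cscale_op \<i> (blinfun_apply H' (evolution H s u))
       + cscale_op \<i> (blinfun_apply H' (evolution H s u) - blinfun_apply H (evolution H s u))) (at s within {0..t})"
      using has_vector_derivative_evolution[of H u s "{0..t}"] by (simp add: blinfun.diff_right)
    show "norm (cscale_op \<i> (blinfun_apply H' (evolution H s u) - blinfun_apply H (evolution H s u))) \<le> e * norm u"
      using e[of "evolution H s u"] by (simp add: norm_cscale_op norm_evolution[OF H(1)] norm_minus_commute)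
  qed
  then show ?thesis by simp
qed

lemma recurrent_perturbation:
  assumes "recurrent V c t \<eta>"
    and "norm (evolution (schrodinger c V) t (ell2_delta 0) - evolution (schrodinger c' V') t' (ell2_delta 0)) \<le> \<delta>"
  shows "recurrent V' c' t' (\<eta> + \<delta>)"
proof -
  obtain z where z: "cmod z = 1" "norm (evolution (schrodinger c V) t (ell2_delta 0) - cscale_op z (ell2_delta 0)) \<le> \<eta>"
    using assms(1) unfolding recurrent_def by blast
  have "norm (evolution (schrodinger c' V') t' (ell2_delta 0) - cscale_op z (ell2_delta 0)) \<le> \<eta> + \<delta>"
    using norm_triangle_ineq4[of "evolution (schrodinger c V) t (ell2_delta 0) - cscale_op z (ell2_delta 0)"
        "evolution (schrodinger c V) t (ell2_delta 0) - evolution (schrodinger c' V') t' (ell2_delta 0)"] z(2) assms(2) by simp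
  then show ?thesis unfolding recurrent_def using z(1) by blast
qed

lemma recurrent_mono: "recurrent V c t \<eta> \<Longrightarrow> \<eta> \<le> \<eta>' \<Longrightarrow> recurrent V c t \<eta>'"
  unfolding recurrent_def using order_trans by blast

text \<open>With \<open>R = a * c * t\<close> there are about \<open>R\<close> turns of phase per
  parameter, hence at most \<open>2 * R\<close> cells per direction in which no phase wraps around.
  By \<open>guard_injective\<close> a cell contains at most about \<open>3 * x\<close> returning
  values per direction. The product \<open>2 * R * (3 * x)\<close> no longer involves
  \<open>t\<close>: the returning fraction per direction is \<open>72 * \<eta> / w\<close>.\<close>

lemma count_recurrent_at:
  fixes N n :: nat
  assumes g: "\<And>i. i \<le> N \<Longrightarrow> guards w C Q c {m. \<kappa> m = i}" "0 < w" "0 \<le> C" and Q: "\<And>k. k \<in> grid N n \<Longrightarrow> Z + block \<kappa> N a n k \<in> Q"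
    and ct: "0 < c" "0 < t" "40 * C \<le> c * t * w" and a: "0 < a" "1 \<le> a * c * t" and n: "w * (a * c * t) \<le> 12 * \<eta> * real n" and \<eta>: "0 < \<eta>"
  shows "real (card {k \<in> grid N n. recurrent (Z + block \<kappa> N a n k) c t \<eta>}) \<le> (72 * \<eta> / w) ^ N * real n ^ N"
proof -
  define X where "X = {k \<in> grid N n. recurrent (Z + block \<kappa> N a n k) c t \<eta>}"
  define R where "R = a * c * t"
  define x where "x = 12 * \<eta> * real n / (w * R)"
  have R: "1 \<le> R" using a by (simp add: R_def)
  have x: "1 \<le> x" using n R g(2) by (simp add: x_def R_def[symmetric])
  have n0: "0 < real n"
  proof (rule ccontr)
    assume "\<not> 0 < real n"
    then show False using x by (simp add: x_def)
  qed
  \<comment> \<open>Within a cell the phases differ by at most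
    \<open>R * D / n \<le> 1\<close>.\<close>
  define D where "D = nat \<lfloor>real n / R\<rfloor>"
  define d where "d = nat \<lfloor>x\<rfloor>"
  have D: "real D \<le> real n / R" "real n / R \<le> real (D + 1)" using R by (simp_all add: D_def) linarith
  have d: "real d \<le> x" using x by (simp add: d_def)
  have "card X \<le> ((n div (D + 1) + 1) * (2 * d + 1)) ^ N"
  proof (rule card_cells_le)
    show "X \<subseteq> grid N n" by (auto simp: X_def)
    fix k k' i assume k: "k \<in> X" "k' \<in> X" and cell: "\<And>i. i \<in> {1..N} \<Longrightarrow> k i div (D + 1) = k' i div (D + 1)" and i: "i \<in> {1..N}"
    have kg: "k \<in> grid N n" "k' \<in> grid N n" using k by (auto simp: X_def)
    define e where "e i = \<bar>real (k' i) - real (k i)\<bar>" for i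
    \<comment> \<open>\<open>guard_injective\<close> needs a class whose shift dominates the whole
      difference of the potentials, so the coordinate of largest difference is used; bounding it
      bounds all others.\<close>
    obtain j where j: "j \<in> {1..N}" "\<And>i. i \<in> {1..N} \<Longrightarrow> e i \<le> e j"
    proof -
      have ne: "e ` {1..N} \<noteq> {}" using i by blast
      then have "Max (e ` {1..N}) \<in> e ` {1..N}" by (intro Max_in) auto
      then obtain j where "j \<in> {1..N}" "e j = Max (e ` {1..N})" by auto
      then show ?thesis by (intro that[of j]) auto
    qed
    have eD: "e j \<le> real D"
    proof -
      define q where "q = k j div (D + 1)"
      have "k j = q * (D + 1) + k j mod (D + 1)" "k' j = q * (D + 1) + k' j mod (D + 1)"
        using div_mult_mod_eq[of "k j" "D + 1"] div_mult_mod_eq[of "k' j" "D + 1"] by (simp_all only: q_def cell[OF j(1)])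
      moreover have "k j mod (D + 1) \<le> D" "k' j mod (D + 1) \<le> D" by (simp_all add: less_Suc_eq_le[symmetric])
      ultimately show ?thesis unfolding e_def by linarith
    qed
    define y where "y = a * (real (k' j) - real (k j)) / real n"
    have ay: "\<bar>y\<bar> = a * e j / real n" using a n0 by (simp add: y_def e_def abs_mult)
    define V V' where "V = Z + block \<kappa> N a n k" and "V' = Z + block \<kappa> N a n k'"
    have a0: "0 \<le> a" using a by simp
    have Y: "apply_bcontfun (V' - V) m = (if \<kappa> m \<in> {1..N} then a * (real (k' (\<kappa> m)) - real (k (\<kappa> m))) / real n else 0)" for m
      by (simp add: V_def V'_def block_apply[OF kg(1) a0] block_apply[OF kg(2) a0] diff_divide_distrib right_diff_distrib)
    have "c * t * \<bar>y\<bar> \<le> 12 * \<eta> / w"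
    proof (rule guard_injective[OF g(1)[of 0] g(1)[of j] g(2,3)])
      show "V \<in> Q" "V' \<in> Q" unfolding V_def V'_def by (intro Q kg)+
      show "apply_bcontfun (V' - V) m = 0" if "m \<in> {m. \<kappa> m = 0}" for m using that unfolding Y by simp
      show "apply_bcontfun (V' - V) m = y" if "m \<in> {m. \<kappa> m = j}" for m using that j(1) unfolding Y by (simp add: y_def)
      show "norm (V' - V) \<le> \<bar>y\<bar>"
      proof (rule norm_bcontfun_le)
        fix m
        show "norm (apply_bcontfun (V' - V) m) \<le> \<bar>y\<bar>"
        proof (cases "\<kappa> m \<in> {1..N}")
          case True
          have "norm (apply_bcontfun (V' - V) m) = a * e (\<kappa> m) / real n" unfolding Y using True a n0 by (simp add: e_def abs_mult)
          also have "\<dots> \<le> a * e j / real n" using j(2)[OF True] a by (intro divide_right_mono mult_left_mono) auto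
          finally show ?thesis by (simp only: ay)
        next
          case False
          then show ?thesis unfolding Y by (simp only: if_False norm_zero abs_ge_zero)
        qed
      qed
      show "0 \<le> t" using ct by simp
      have "e j \<le> real n / R" using eD D by linarith
      then have "R * e j \<le> real n" using R by (simp add: field_simps)
      moreover have "c * t * \<bar>y\<bar> = R * e j / real n" by (simp add: ay R_def)
      ultimately show "c * t * \<bar>y\<bar> \<le> 1" using n0 by simp
      show "recurrent V c t \<eta>" "recurrent V' c t \<eta>" using k by (auto simp: X_def V_def V'_def)
    qed (use ct j in auto)
    moreover have "c * t * \<bar>y\<bar> = R * e j / real n" by (simp add: ay R_def)
    ultimately have "R * e j / real n \<le> 12 * \<eta> / w" by simp
    then have "e j \<le> x" using n0 R g(2) by (simp add: x_def field_simps)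
    then have "e i \<le> x" using j(2)[OF i] by simp
    then have "real (k' i) - real (k i) \<le> x" unfolding e_def by linarith
    then show "k' i \<le> k i + d" using x unfolding d_def by linarith
  qed
  then have "real (card X) \<le> real (((n div (D + 1) + 1) * (2 * d + 1)) ^ N)" by (simp only: of_nat_le_iff)
  also have "\<dots> = (real (n div (D + 1) + 1) * real (2 * d + 1)) ^ N" by (simp only: of_nat_power of_nat_mult)
  also have "\<dots> \<le> (72 * \<eta> / w * real n) ^ N"
  proof (rule power_mono)
    have "real (n div (D + 1)) \<le> real n / real (D + 1)" by (rule of_nat_div_le_of_nat)
    also have "\<dots> \<le> R" using D(2) R by (simp add: field_simps)
    finally have 1: "real (n div (D + 1) + 1) \<le> 2 * R" using R by simp
    have 2: "real (2 * d + 1) \<le> 3 * x" using d x by simp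
    have "real (n div (D + 1) + 1) * real (2 * d + 1) \<le> 2 * R * (3 * x)" by (rule mult_mono[OF 1 2]) (use R in simp_all)
    also have "\<dots> = 72 * \<eta> / w * real n" using R by (simp add: x_def)
    finally show "real (n div (D + 1) + 1) * real (2 * d + 1) \<le> 72 * \<eta> / w * real n" .
  qed simp
  finally show ?thesis by (simp only: X_def power_mult_distrib)
qed

lemma sum_inverse_square_le: "2 \<le> T \<Longrightarrow> (\<Sum>s\<in>{T..S}. 1 / (real s)\<^sup>2) \<le> 1 / (real T - 1)"
proof -
  assume T: "2 \<le> T"
  have "(\<Sum>s\<in>{T..S}. 1 / (real s)\<^sup>2) \<le> 1 / (real T - 1) - 1 / real S" if "T \<le> S" for S
    using that
  proof (induction S rule: dec_induct)
    case base
    have "1 / (real T)\<^sup>2 \<le> 1 / (real T * (real T - 1))" using T by (intro divide_left_mono) (auto simp: power2_eq_square)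
    also have "\<dots> = 1 / (real T - 1) - 1 / real T" using T by (simp add: field_simps)
    finally show ?case by simp
  next
    case (step S)
    have "1 / (real (Suc S))\<^sup>2 \<le> 1 / (real S * real (Suc S))" using T step by (intro divide_left_mono) (auto simp: power2_eq_square)
    also have "\<dots> = 1 / real S - 1 / real (Suc S)" using T step by (simp add: field_simps)
    finally show ?case using step by simp
  qed
  moreover have "0 \<le> 1 / real S" by simp
  ultimately have "(\<Sum>s\<in>{T..S}. 1 / (real s)\<^sup>2) \<le> 1 / (real T - 1)" if "T \<le> S" using that by (smt (verit))
  moreover have "(\<Sum>s\<in>{T..S}. 1 / (real s)\<^sup>2) \<le> 1 / (real T - 1)" if "\<not> T \<le> S" using that T by simp
  ultimately show ?thesis by blast
qed

text \<open>For times between \<open>s\<close> and \<open>s + 1\<close> a net of order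
  \<open>s\<close> times and \<open>s\<^sup>2\<close> couplings suffices, and each net point
  excludes a fraction of order \<open>1 / s ^ 5\<close> of the parameters. The sum over
  \<open>s\<close> of \<open>1 / s\<^sup>2\<close> has a small tail. The starting time
  \<open>T\<close> depends only on the constants of the guards; the end time \<open>T1\<close>
  enters only through the fineness \<open>n0\<close> of the grid.\<close>

lemma count_recurrent:
  assumes w: "0 < w" and C: "0 \<le> C" and cm: "0 < cm" "cm \<le> cM" and a: "0 < a" and B: "0 \<le> B" and \<epsilon>: "0 < \<epsilon>" "\<epsilon> \<le> 1" "5 \<le> \<epsilon> * real N"
  shows "\<exists>T::real. \<forall>T1. \<exists>n0. \<forall>n\<ge>n0. \<forall>\<kappa> Q Z. (\<forall>i\<le>N. \<forall>c\<in>{cm..cM}. guards w C Q c {m. \<kappa> m = i}) \<longrightarrow> (\<forall>V\<in>Q. norm V \<le> B)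
     \<longrightarrow> (\<forall>k\<in>grid N n. Z + block \<kappa> N a n k \<in> Q)
     \<longrightarrow> real (card {k \<in> grid N n. \<exists>t\<in>{T..T1}. \<exists>c\<in>{cm..cM}. recurrent (Z + block \<kappa> N a n k) c t (2 * t powr - \<epsilon>)}) \<le> real n ^ N / 16"
proof -
  define K where "K = 2 + cM * B"
  have cM: "0 < cM" using cm by simp
  have K: "0 < K" using cM B by (simp add: K_def add_pos_nonneg)
  \<comment> \<open>Fineness of the net: \<open>K\<close> bounds the speed of the state in time, and
    \<open>2 * B\<close> the effect of the coupling at times up to \<open>2 * s\<close>; rounding
    then moves the state by at most \<open>1 / s\<close>.\<close>
  define M where "M = nat \<lceil>K + 2 * B\<rceil> + 1"
  have M: "K + 2 * B \<le> real M" "1 \<le> M" by (simp_all add: M_def) linarith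
  define q where "q = 2 * real M * ((cM - cm) * real M + 1) * (216 / w) ^ N"
  have q: "0 \<le> q" using cm w by (simp add: q_def)
  define T where "T = nat \<lceil>max (16 * q) (max (40 * C / (cm * w)) (1 / (a * cm)))\<rceil> + 2"
  have T: "2 \<le> T" "16 * q \<le> real T - 1" "40 * C / (cm * w) \<le> real T" "1 / (a * cm) \<le> real T"
    unfolding T_def by (simp_all) linarith+
  show ?thesis
  proof (intro exI[of _ "real T"] allI)
    fix T1 :: real
    define n0 where "n0 = nat \<lceil>w * (a * cM * (\<bar>T1\<bar> + 2)) * (\<bar>T1\<bar> + 2)\<rceil> + 1"
    show "\<exists>n0. \<forall>n\<ge>n0. \<forall>\<kappa> Q Z. (\<forall>i\<le>N. \<forall>c\<in>{cm..cM}. guards w C Q c {m. \<kappa> m = i}) \<longrightarrow> (\<forall>V\<in>Q. norm V \<le> B)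
     \<longrightarrow> (\<forall>k\<in>grid N n. Z + block \<kappa> N a n k \<in> Q)
     \<longrightarrow> real (card {k \<in> grid N n. \<exists>t\<in>{real T..T1}. \<exists>c\<in>{cm..cM}. recurrent (Z + block \<kappa> N a n k) c t (2 * t powr - \<epsilon>)}) \<le> real n ^ N / 16"
    proof (intro exI[of _ n0] allI impI)
      fix n \<kappa> Q Z
      assume n: "n0 \<le> n" and g: "\<forall>i\<le>N. \<forall>c\<in>{cm..cM}. guards w C Q c {m. \<kappa> m = i}" and QB: "\<forall>V\<in>Q. norm V \<le> B"
        and QZ: "\<forall>k\<in>grid N n. Z + block \<kappa> N a n k \<in> Q"
      have nn: "w * (a * cM * (\<bar>T1\<bar> + 2)) * (\<bar>T1\<bar> + 2) \<le> real n" "0 < n" using n by (simp_all add: n0_def) linarith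
      \<comment> \<open>Times are \<open>1 / (M * s)\<close> apart, but couplings
        \<open>1 / (M * s\<^sup>2)\<close>, because an error in the coupling is multiplied by the
        time.\<close>
      define tt where "tt s i = real s + real i / (real M * real s)" for s i :: nat
      define cc where "cc s l = cm + real l / (real M * (real s)\<^sup>2)" for s l :: nat
      define Ls where "Ls s = nat \<lfloor>(cM - cm) * (real M * (real s)\<^sup>2)\<rfloor>" for s :: nat
      define E where "E s i l = {k \<in> grid N n. recurrent (Z + block \<kappa> N a n k) (cc s l) (tt s i) (3 * real s powr - \<epsilon>)}" for s i l
      define S1 where "S1 = nat \<lfloor>T1\<rfloor>"
      have ccr: "cc s l \<in> {cm..cM}" if "l \<le> Ls s" "1 \<le> s" for s l
      proof -
        have Ms: "0 < real M * (real s)\<^sup>2" using M that by simp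
        have "0 \<le> (cM - cm) * (real M * (real s)\<^sup>2)" using cm by simp
        then have "real l \<le> (cM - cm) * (real M * (real s)\<^sup>2)" using that unfolding Ls_def by linarith
        then have "real l / (real M * (real s)\<^sup>2) \<le> cM - cm" by (subst pos_divide_le_eq[OF Ms])
        then show ?thesis by (simp add: cc_def)
      qed
      have cover: "{k \<in> grid N n. \<exists>t\<in>{real T..T1}. \<exists>c\<in>{cm..cM}. recurrent (Z + block \<kappa> N a n k) c t (2 * t powr - \<epsilon>)}
         \<subseteq> (\<Union>s\<in>{T..S1}. \<Union>i\<in>{..M * s}. \<Union>l\<in>{..Ls s}. E s i l)"
      proof
        fix k assume "k \<in> {k \<in> grid N n. \<exists>t\<in>{real T..T1}. \<exists>c\<in>{cm..cM}. recurrent (Z + block \<kappa> N a n k) c t (2 * t powr - \<epsilon>)}"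
        then obtain t c where k: "k \<in> grid N n" and t: "real T \<le> t" "t \<le> T1" and c: "cm \<le> c" "c \<le> cM"
          and rec: "recurrent (Z + block \<kappa> N a n k) c t (2 * t powr - \<epsilon>)" by auto
        define V where "V = Z + block \<kappa> N a n k"
        define s where "s = nat \<lfloor>t\<rfloor>"
        have s: "T \<le> s" "s \<le> S1" "real s \<le> t" "t \<le> real s + 1" using t T(1) unfolding s_def S1_def by linarith+
        have s1: "1 \<le> s" "1 \<le> real s" using s T by simp_all
        define i where "i = nat \<lfloor>(t - real s) * (real M * real s)\<rfloor>"
        define l where "l = nat \<lfloor>(c - cm) * (real M * (real s)\<^sup>2)\<rfloor>"
        have Ms: "0 < real M * real s" "0 < real M * (real s)\<^sup>2" using M s1 by simp_all
        have p0: "0 \<le> (t - real s) * (real M * real s)" "0 \<le> (c - cm) * (real M * (real s)\<^sup>2)" using s c by simp_all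
        have i: "real i \<le> (t - real s) * (real M * real s)" "(t - real s) * (real M * real s) \<le> real i + 1"
          using p0 unfolding i_def by linarith+
        have l: "real l \<le> (c - cm) * (real M * (real s)\<^sup>2)" "(c - cm) * (real M * (real s)\<^sup>2) \<le> real l + 1"
          using p0 unfolding l_def by linarith+
        have iM: "i \<le> M * s"
        proof -
          have "(t - real s) * (real M * real s) \<le> 1 * (real M * real s)" using s Ms by (intro mult_right_mono) auto
          then have "real i \<le> real (M * s)" using i by simp
          then show ?thesis by (simp only: of_nat_le_iff)
        qed
        have lL: "l \<le> Ls s" unfolding l_def Ls_def using c Ms by (intro nat_mono floor_mono mult_right_mono) auto
        have frac: "y / m \<le> x" "x - y / m \<le> 1 / m" if "y \<le> x * m" "x * m \<le> y + 1" "0 < m" for x y m :: real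
        proof -
          show "y / m \<le> x" using that by (simp add: pos_divide_le_eq)
          have "x \<le> (y + 1) / m" using that by (simp add: pos_le_divide_eq)
          then show "x - y / m \<le> 1 / m" by (simp add: add_divide_distrib)
        qed
        have dt: "0 \<le> t - tt s i" "t - tt s i \<le> 1 / (real M * real s)"
          using frac[OF i Ms(1)] by (simp_all add: tt_def)
        have dc: "0 \<le> c - cc s l" "c - cc s l \<le> 1 / (real M * (real s)\<^sup>2)"
          using frac[OF l Ms(2)] by (simp_all add: cc_def)
        have c': "cc s l \<in> {cm..cM}" by (rule ccr[OF lL s1(1)])
        have VB: "norm V \<le> B" using QB QZ k by (simp add: V_def)
        have HK: "norm (schrodinger c V) \<le> K"
        proof -
          have "\<bar>c\<bar> * norm V \<le> cM * B" using VB c cm cM by (intro mult_mono) auto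
          then show ?thesis using norm_schrodinger_le[of c V] by (simp add: K_def)
        qed
        define \<psi> where "\<psi> = evolution (schrodinger c V) (tt s i) (ell2_delta 0)"
        have t'0: "0 \<le> tt s i" by (simp add: tt_def)
        have "norm (evolution (schrodinger c V) t (ell2_delta 0) - \<psi>) \<le> (t - tt s i) * K"
        proof -
          have "evolution (schrodinger c V) t (ell2_delta 0) = evolution (schrodinger c V) (t - tt s i) \<psi>"
            using evolution_plus[of "schrodinger c V" "t - tt s i" "tt s i"] by (simp add: \<psi>_def)
          then have "norm (evolution (schrodinger c V) t (ell2_delta 0) - \<psi>) \<le> (t - tt s i) * norm (schrodinger c V \<psi>)"
            using norm_evolution_diff[OF hermitian_schrodinger dt(1), of \<psi> c V] by (simp add: norm_minus_commute)
          also have "\<dots> \<le> (t - tt s i) * (K * norm \<psi>)" by (intro mult_left_mono norm_blinfun_le HK dt)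
          finally show ?thesis by (simp add: \<psi>_def norm_evolution[OF hermitian_schrodinger])
        qed
        moreover have "(t - tt s i) * K \<le> K / (real M * real s)" using mult_right_mono[OF dt(2), of K] K by simp
        moreover have "norm (\<psi> - evolution (schrodinger (cc s l) V) (tt s i) (ell2_delta 0)) \<le> tt s i * ((c - cc s l) * B) * norm (ell2_delta 0)"
          unfolding \<psi>_def
        proof (rule evolution_perturbation[OF hermitian_schrodinger hermitian_schrodinger t'0])
          fix v :: ell2
          have "norm (c *\<^sub>R V - cc s l *\<^sub>R V) = (c - cc s l) * norm V" using dc by (simp add: scaleR_diff_left[symmetric])
          also have "\<dots> \<le> (c - cc s l) * B" by (intro mult_left_mono VB dc)
          finally have "norm (c *\<^sub>R V - cc s l *\<^sub>R V) * norm v \<le> (c - cc s l) * B * norm v" by (rule mult_right_mono) simp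
          then show "norm (schrodinger c V v - schrodinger (cc s l) V v) \<le> (c - cc s l) * B * norm v"
            by (rule order_trans[OF schrodinger_diff_le])
        qed
        moreover have "tt s i * ((c - cc s l) * B) \<le> 2 * B / (real M * real s)"
        proof -
          have "tt s i * ((c - cc s l) * B) \<le> (2 * real s) * (1 / (real M * (real s)\<^sup>2) * B)"
            using dt s s1 dc B by (intro mult_mono mult_right_mono) auto
          also have "\<dots> = 2 * B / (real M * real s)" using s1 by (simp add: power2_eq_square)
          finally show ?thesis .
        qed
        ultimately have "norm (evolution (schrodinger c V) t (ell2_delta 0) - evolution (schrodinger (cc s l) V) (tt s i) (ell2_delta 0))
            \<le> K / (real M * real s) + 2 * B / (real M * real s)"
          using norm_triangle_ineq[of "evolution (schrodinger c V) t (ell2_delta 0) - \<psi>" "\<psi> - evolution (schrodinger (cc s l) V) (tt s i) (ell2_delta 0)"]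
          by simp
        also have "\<dots> = (K + 2 * B) / (real M * real s)" by (simp add: add_divide_distrib)
        also have "\<dots> \<le> real M / (real M * real s)" using M Ms by (intro divide_right_mono) auto
        also have "\<dots> = real s powr (- 1)" using M s1 by (simp add: powr_minus_divide)
        also have "\<dots> \<le> real s powr - \<epsilon>" using s1 \<epsilon> by (intro powr_mono) auto
        finally have "recurrent V (cc s l) (tt s i) (2 * t powr - \<epsilon> + real s powr - \<epsilon>)"
          by (rule recurrent_perturbation[OF rec[folded V_def]])
        moreover have "t powr - \<epsilon> \<le> real s powr - \<epsilon>" using s s1 \<epsilon> by (intro powr_mono2') auto
        ultimately have "recurrent V (cc s l) (tt s i) (3 * real s powr - \<epsilon>)" by (rule_tac recurrent_mono) auto
        then have "k \<in> E s i l" using k by (simp add: E_def V_def)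
        then show "k \<in> (\<Union>s\<in>{T..S1}. \<Union>i\<in>{..M * s}. \<Union>l\<in>{..Ls s}. E s i l)"
          using s iM lL by (intro UN_I[of s] UN_I[of i] UN_I[of l]) auto
      qed
      have cardE: "real (card (E s i l)) \<le> (216 / w) ^ N * real n ^ N / (real s) ^ 5"
        if s: "s \<in> {T..S1}" and i: "i \<le> M * s" and l: "l \<le> Ls s" for s i l
      proof -
        have s1: "1 \<le> s" "1 \<le> real s" using s T by simp_all
        have Ms: "0 < real M * real s" using M s1 by simp
        have "real i \<le> real (M * s)" using i by (simp only: of_nat_le_iff)
        then have "real i / (real M * real s) \<le> 1" using Ms by simp
        then have t': "real s \<le> tt s i" "tt s i \<le> real s + 1" by (simp_all add: tt_def)
        have c': "cm \<le> cc s l" "cc s l \<le> cM" using ccr[OF l s1(1)] by auto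
        have sT: "real s \<le> \<bar>T1\<bar>" "real T \<le> real s" using s by (auto simp: S1_def) linarith
        have ct: "cm * real T \<le> cc s l * tt s i" using c' t' sT cm by (intro mult_mono) auto
        have "real (card (E s i l)) \<le> (72 * (3 * real s powr - \<epsilon>) / w) ^ N * real n ^ N"
          unfolding E_def
        proof (rule count_recurrent_at[where C = C and Q = Q])
          show "guards w C Q (cc s l) {m. \<kappa> m = i}" if "i \<le> N" for i using g that c' by auto
          show "0 < cc s l" "0 < tt s i" using c' cm t' s1 by linarith+
          have "40 * C \<le> cm * real T * w" using T(3) cm w by (simp add: field_simps)
          also have "\<dots> \<le> cc s l * tt s i * w" by (rule mult_right_mono[OF ct]) (use w in simp)
          finally show "40 * C \<le> cc s l * tt s i * w" .
          have "1 \<le> a * (cm * real T)" using T(4) cm a by (simp add: field_simps)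
          also have "\<dots> \<le> a * (cc s l * tt s i)" by (rule mult_left_mono[OF ct]) (use a in simp)
          finally show "1 \<le> a * cc s l * tt s i" by (simp add: mult.assoc)
          define b where "b = \<bar>T1\<bar> + 2"
          have b: "1 \<le> b" "real s \<le> b" "tt s i \<le> b" using sT t' by (simp_all add: b_def)
          have "a * cc s l * tt s i \<le> a * cM * b" using c' a b t' s1 cm by (intro mult_mono) auto
          then have "w * (a * cc s l * tt s i) \<le> w * (a * cM * b)" using w by (intro mult_left_mono) auto
          also have "\<dots> \<le> real n / b" using nn(1) b(1) unfolding b_def[symmetric] by (simp add: field_simps)
          also have "\<dots> \<le> real n * real s powr - \<epsilon>"
          proof -
            have "1 / b \<le> 1 / real s" using b s1 by (intro divide_left_mono) auto
            also have "\<dots> = real s powr (- 1)" using s1 by (simp add: powr_minus_divide)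
            also have "\<dots> \<le> real s powr - \<epsilon>" using s1 \<epsilon> by (intro powr_mono) auto
            finally have "1 / b \<le> real s powr - \<epsilon>" .
            then have "real n * (1 / b) \<le> real n * real s powr - \<epsilon>" by (rule mult_left_mono) simp
            then show ?thesis by simp
          qed
          also have "\<dots> \<le> 12 * (3 * real s powr - \<epsilon>) * real n" by simp
          finally show "w * (a * cc s l * tt s i) \<le> 12 * (3 * real s powr - \<epsilon>) * real n" .
          show "0 < 3 * real s powr - \<epsilon>" using s1 by simp
        qed (use w C a QZ in auto)
        also have "(72 * (3 * real s powr - \<epsilon>) / w) ^ N = (216 / w) ^ N * (real s powr - \<epsilon>) ^ N"
          by (simp add: power_mult_distrib power_divide)
        also have "(real s powr - \<epsilon>) ^ N = real s powr (- (\<epsilon> * real N))" using s1 by (simp add: powr_realpow[symmetric] powr_powr)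
        also have "(216 / w) ^ N * real s powr (- (\<epsilon> * real N)) * real n ^ N \<le> (216 / w) ^ N * (1 / (real s) ^ 5) * real n ^ N"
        proof (intro mult_right_mono mult_left_mono)
          \<comment> \<open>Here 5 enters: three powers of \<open>s\<close> are used up by the net,
            two remain for summation.\<close>
          have "real s powr (- (\<epsilon> * real N)) \<le> real s powr (- 5)" using s1 \<epsilon> by (intro powr_mono) auto
          also have "\<dots> = 1 / real s ^ 5" using s1 by (simp add: powr_minus_divide powr_numeral)
          finally show "real s powr (- (\<epsilon> * real N)) \<le> 1 / (real s) ^ 5" .
        qed (use w in simp_all)
        finally show ?thesis by simp
      qed
      have "real (card {k \<in> grid N n. \<exists>t\<in>{real T..T1}. \<exists>c\<in>{cm..cM}. recurrent (Z + block \<kappa> N a n k) c t (2 * t powr - \<epsilon>)})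
          \<le> real (card (\<Union>s\<in>{T..S1}. \<Union>i\<in>{..M * s}. \<Union>l\<in>{..Ls s}. E s i l))"
      proof -
        have "finite (\<Union>s\<in>{T..S1}. \<Union>i\<in>{..M * s}. \<Union>l\<in>{..Ls s}. E s i l)" by (auto simp: E_def finite_grid)
        then show ?thesis using card_mono[OF _ cover] by (simp only: of_nat_le_iff)
      qed
      also have "\<dots> \<le> (\<Sum>s\<in>{T..S1}. \<Sum>i\<in>{..M * s}. \<Sum>l\<in>{..Ls s}. real (card (E s i l)))"
      proof -
        have "card (\<Union>s\<in>{T..S1}. \<Union>i\<in>{..M * s}. \<Union>l\<in>{..Ls s}. E s i l) \<le> (\<Sum>s\<in>{T..S1}. \<Sum>i\<in>{..M * s}. \<Sum>l\<in>{..Ls s}. card (E s i l))"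
          by (rule order_trans[OF card_UN_le], simp, rule sum_mono, rule order_trans[OF card_UN_le], simp, rule sum_mono, rule card_UN_le, simp)
        then have "real (card (\<Union>s\<in>{T..S1}. \<Union>i\<in>{..M * s}. \<Union>l\<in>{..Ls s}. E s i l)) \<le> real (\<Sum>s\<in>{T..S1}. \<Sum>i\<in>{..M * s}. \<Sum>l\<in>{..Ls s}. card (E s i l))"
          by (simp only: of_nat_le_iff)
        then show ?thesis by (simp only: of_nat_sum)
      qed
      also have "\<dots> \<le> (\<Sum>s\<in>{T..S1}. q * real n ^ N * (1 / (real s)\<^sup>2))"
      proof (rule sum_mono)
        fix s assume s: "s \<in> {T..S1}"
        have s1: "1 \<le> s" "1 \<le> real s" using s T by simp_all
        define Y where "Y = (216 / w) ^ N * real n ^ N / (real s) ^ 5"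
        have Y0: "0 \<le> Y" using w by (simp add: Y_def)
        have "(\<Sum>i\<in>{..M * s}. \<Sum>l\<in>{..Ls s}. real (card (E s i l))) \<le> (\<Sum>i\<in>{..M * s}. \<Sum>l\<in>{..Ls s}. Y)"
          by (intro sum_mono) (use cardE[OF s] in \<open>auto simp: Y_def\<close>)
        also have "\<dots> = (real M * real s + 1) * ((real (Ls s) + 1) * Y)" by (simp add: algebra_simps)
        also have "\<dots> \<le> (2 * real M * real s) * ((((cM - cm) * real M + 1) * (real s)\<^sup>2) * Y)"
        proof (intro mult_mono mult_right_mono Y0)
          have "1 * 1 \<le> real M * real s" using M s1 by (intro mult_mono) auto
          then show "real M * real s + 1 \<le> 2 * real M * real s" by simp
          have "real (Ls s) \<le> (cM - cm) * (real M * (real s)\<^sup>2)" unfolding Ls_def using cm by simp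
          moreover have "1 \<le> (real s)\<^sup>2" using s1 by simp
          ultimately show "real (Ls s) + 1 \<le> ((cM - cm) * real M + 1) * (real s)\<^sup>2" by (simp add: algebra_simps)
        qed (use Y0 cm in \<open>auto intro!: mult_nonneg_nonneg add_nonneg_nonneg\<close>)
        also have "\<dots> = q * real n ^ N * (1 / (real s)\<^sup>2)"
          using s1 by (simp add: Y_def q_def eval_nat_numeral)
        finally show "(\<Sum>i\<in>{..M * s}. \<Sum>l\<in>{..Ls s}. real (card (E s i l))) \<le> q * real n ^ N * (1 / (real s)\<^sup>2)" .
      qed
      also have "\<dots> = q * real n ^ N * (\<Sum>s\<in>{T..S1}. 1 / (real s)\<^sup>2)" by (simp only: sum_distrib_left)
      also have "\<dots> \<le> q * real n ^ N * (1 / (real T - 1))"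
        by (rule mult_left_mono[OF sum_inverse_square_le[OF T(1)]]) (use q in simp)
      also have "\<dots> \<le> real n ^ N / 16"
      proof -
        have "q * (1 / (real T - 1)) \<le> 1 / 16" using T by (simp add: field_simps)
        then have "q * (1 / (real T - 1)) * real n ^ N \<le> 1 / 16 * real n ^ N" by (rule mult_right_mono) simp
        then show ?thesis by (simp add: mult_ac)
      qed
      finally show "real (card {k \<in> grid N n. \<exists>t\<in>{real T..T1}. \<exists>c\<in>{cm..cM}. recurrent (Z + block \<kappa> N a n k) c t (2 * t powr - \<epsilon>)}) \<le> real n ^ N / 16" .
    qed
  qed
qed

section \<open>The inductive construction\<close>

lemma bounded_linear_eval: "bounded_linear (\<lambda>f :: int \<Rightarrow>\<^sub>C real. apply_bcontfun f n)"
proof (rule bounded_linear_intro[where K = 1])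
  show "norm (apply_bcontfun f n) \<le> norm f * 1" for f :: "int \<Rightarrow>\<^sub>C real" using norm_bounded[of f n] by simp
qed (simp_all add: plus_bcontfun.rep_eq scaleR_bcontfun.rep_eq)

text \<open>The library has this only for a metric domain, and \<open>int\<close> is not an instance of that class.\<close>

lemma Cauchy_bcontfun_convergent:
  fixes f :: "nat \<Rightarrow> (int \<Rightarrow>\<^sub>C real)"
  assumes "Cauchy f"
  obtains l where "f \<longlonglongrightarrow> l"
proof -
  have "uniformly_Cauchy_on UNIV (\<lambda>n x. apply_bcontfun (f n) x)"
    using assms unfolding Cauchy_def uniformly_Cauchy_on_def by (metis dist_fun_lt_imp_dist_val_lt)
  then obtain g where g: "uniform_limit UNIV (\<lambda>n x. apply_bcontfun (f n) x) g sequentially"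
    using Cauchy_uniformly_convergent unfolding uniformly_convergent_on_def by blast
  from uniform_limit_bcontfunE[OF g sequentially_bot] show ?thesis using that by metis
qed

text \<open>A bounded closed set in a space of dimension \<open>P\<close>; rounding the values to
  multiples of \<open>e / 2\<close> on one period gives the finite net.\<close>

lemma compact_periodic:
  fixes P :: int
  assumes P: "0 < P"
  shows "compact {f :: int \<Rightarrow>\<^sub>C real. (\<forall>n. apply_bcontfun f (n + P) = apply_bcontfun f n) \<and> norm f \<le> B}" (is "compact ?S")
  unfolding compact_eq_totally_bounded
proof (intro conjI allI impI)
  have "closed ?S"
    by (intro closed_Collect_conj closed_Collect_all closed_Collect_eq closed_Collect_le
        linear_continuous_on bounded_linear_eval continuous_intros)
  show "complete ?S"
  proof (rule completeI)
    fix f :: "nat \<Rightarrow> (int \<Rightarrow>\<^sub>C real)"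
    assume f: "\<forall>n. f n \<in> ?S" "Cauchy f"
    obtain l where l: "f \<longlonglongrightarrow> l" using Cauchy_bcontfun_convergent[OF f(2)] .
    then have "l \<in> ?S" using closed_sequentially[OF \<open>closed ?S\<close>] f(1) by blast
    then show "\<exists>l\<in>?S. f \<longlonglongrightarrow> l" using l by blast
  qed
  fix e :: real assume e: "0 < e"
  define M where "M = \<lceil>2 * B / e\<rceil> + 1"
  define A where "A = {0..<P} \<rightarrow>\<^sub>E {- M..M}"
  define net where "net h = bfun (\<lambda>n. e / 2 * real_of_int (h (n mod P)))" for h :: "int \<Rightarrow> int"
  have net: "apply_bcontfun (net h) n = e / 2 * real_of_int (h (n mod P))" if "h \<in> A" for h n
    unfolding net_def
  proof (rule bfun_apply[where C = "e / 2 * real_of_int M"])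
    fix n
    have "n mod P \<in> {0..<P}" using P by simp
    then have "h (n mod P) \<in> {- M..M}" using that unfolding A_def by (rule PiE_mem[rotated])
    then have "\<bar>real_of_int (h (n mod P))\<bar> \<le> real_of_int M" by auto
    then show "norm (e / 2 * real_of_int (h (n mod P))) \<le> e / 2 * real_of_int M" using e by (simp add: abs_mult)
  qed
  show "\<exists>k. finite k \<and> ?S \<subseteq> (\<Union>x\<in>k. ball x e)"
  proof (intro exI[of _ "net ` A"] conjI subsetI)
    show "finite (net ` A)" unfolding A_def by (intro finite_imageI finite_PiE) auto
    fix f assume "f \<in> ?S"
    then have f: "\<And>n. apply_bcontfun f (n + P) = apply_bcontfun f n" "norm f \<le> B" by auto
    define h where "h = restrict (\<lambda>n. \<lfloor>apply_bcontfun f n / (e / 2)\<rfloor>) {0..<P}"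
    have fB: "\<bar>apply_bcontfun f n / (e / 2)\<bar> \<le> 2 * B / e" for n
    proof -
      have "\<bar>apply_bcontfun f n\<bar> \<le> B" using norm_bounded[of f n] f(2) by simp
      then show ?thesis using e by (simp add: abs_mult divide_right_mono)
    qed
    have hA: "h \<in> A"
      unfolding A_def h_def
    proof (intro restrict_PiE_iff[THEN iffD2] ballI)
      fix n
      show "\<lfloor>apply_bcontfun f n / (e / 2)\<rfloor> \<in> {- M..M}" 
      proof -
        have fl: "\<lfloor>y\<rfloor> \<in> {- (\<lceil>b\<rceil> + 1)..\<lceil>b\<rceil> + 1}" if "\<bar>y\<bar> \<le> b" for y b :: real
          using that unfolding atLeastAtMost_iff by linarith
        show ?thesis unfolding M_def by (rule fl[OF fB])
      qed
    qed
    have "norm (net h - f) \<le> e / 2"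
    proof (rule norm_bcontfun_le)
      fix n
      have "n mod P \<in> {0..<P}" using P by simp
      moreover have "apply_bcontfun f (n mod P) = apply_bcontfun f n"
        using int_periodic_mult[of "apply_bcontfun f" P "n mod P" "n div P", OF f(1)] by (simp add: mod_div_decomp add.commute)
      ultimately have h: "h (n mod P) = \<lfloor>apply_bcontfun f n / (e / 2)\<rfloor>" by (simp add: h_def)
      define y where "y = apply_bcontfun f n / (e / 2)"
      have y: "apply_bcontfun f n = e / 2 * y" using e by (simp add: y_def)
      have "apply_bcontfun (net h - f) n = e / 2 * (of_int \<lfloor>y\<rfloor> - y)"
        unfolding minus_bcontfun.rep_eq net[OF hA] h y_def[symmetric] y by (simp add: right_diff_distrib)
      then have "norm (apply_bcontfun (net h - f) n) = e / 2 * \<bar>of_int \<lfloor>y\<rfloor> - y\<bar>"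
        using e by (simp only: real_norm_def abs_mult)
      also have "\<dots> \<le> e / 2 * 1" using e by (intro mult_left_mono) linarith+
      finally show "norm (apply_bcontfun (net h - f) n) \<le> e / 2" by simp
    qed
    then have "f \<in> ball (net h) e" using e by (simp add: dist_norm)
    then show "f \<in> (\<Union>x\<in>net ` A. ball x e)" using hA by blast
  qed
qed

text \<open>Double counting. At least three quarters of \<open>A\<close> avoid \<open>X\<close>; if
  each of them were bad for more than a quarter of \<open>B\<close>, then more than
  \<open>3 / 16\<close> of all pairs would be bad, but at most \<open>1 / 16\<close> are.\<close>

lemma ex_good_choice:
  assumes fin: "finite A" "finite B" and A: "A \<noteq> {}" and X: "real (card {a \<in> A. X a}) \<le> real (card A) / 4"
    and R: "\<And>b. b \<in> B \<Longrightarrow> real (card {a \<in> A. R a b}) \<le> real (card A) / 16"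
  shows "\<exists>a\<in>A. \<not> X a \<and> real (card {b \<in> B. R a b}) \<le> real (card B) / 4"
proof (rule ccontr)
  assume neg: "\<not> ?thesis"
  have cA: "0 < real (card A)" using A fin by (simp add: card_gt_0_iff)
  have c: "card {b \<in> B. R a b} = (\<Sum>b\<in>B. if R a b then 1 else 0)" "card {a \<in> A. R a b} = (\<Sum>a\<in>A. if R a b then 1 else 0)" for a b
    using fin by (simp_all add: sum.If_cases Int_def)
  have split: "real (card {a \<in> A. \<not> X a}) = real (card A) - real (card {a \<in> A. X a})"
  proof -
    have "card A = card {a \<in> A. X a} + card {a \<in> A. \<not> X a}"
      using fin by (subst card_Un_disjoint[symmetric]) (auto intro: arg_cong[where f = card])
    then show ?thesis by simp
  qed
  have ex: "\<exists>a\<in>A. \<not> X a"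
  proof (rule ccontr)
    assume "\<not> ?thesis"
    then have "{a \<in> A. X a} = A" by blast
    then show False using X cA by simp
  qed
  have cB: "0 < real (card B)"
  proof -
    obtain a where a: "a \<in> A" "\<not> X a" using ex by blast
    then have "real (card B) / 4 < real (card {b \<in> B. R a b})" using neg by force
    moreover have "card {b \<in> B. R a b} \<le> card B" using fin by (intro card_mono) auto
    ultimately show ?thesis by linarith
  qed
  have "real (card {a \<in> A. \<not> X a}) * (real (card B) / 4) = (\<Sum>a\<in>{a \<in> A. \<not> X a}. real (card B) / 4)" by simp
  also have "\<dots> \<le> (\<Sum>a\<in>{a \<in> A. \<not> X a}. real (card {b \<in> B. R a b}))" using neg by (intro sum_mono) force
  also have "\<dots> \<le> (\<Sum>a\<in>A. real (card {b \<in> B. R a b}))" using fin by (intro sum_mono2) auto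
  also have "\<dots> = real (\<Sum>a\<in>A. \<Sum>b\<in>B. if R a b then 1 else 0)" by (simp only: c of_nat_sum)
  also have "(\<Sum>a\<in>A. \<Sum>b\<in>B. if R a b then 1 else (0 :: nat)) = (\<Sum>b\<in>B. \<Sum>a\<in>A. if R a b then 1 else 0)" by (rule sum.swap)
  also have "real \<dots> = (\<Sum>b\<in>B. real (card {a \<in> A. R a b}))" by (simp only: c of_nat_sum)
  also have "\<dots> \<le> (\<Sum>b\<in>B. real (card A) / 16)" by (intro sum_mono R)
  also have "\<dots> = real (card B) * (real (card A) / 16)" by simp
  finally have "real (card {a \<in> A. \<not> X a}) * (real (card B) / 4) \<le> real (card B) * (real (card A) / 16)" .
  moreover have "3 / 4 * real (card A) * (real (card B) / 4) \<le> real (card {a \<in> A. \<not> X a}) * (real (card B) / 4)"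
    using split X by (intro mult_right_mono) auto
  ultimately have "real (card B) * real (card A) * (3 / 16 - 1 / 16) \<le> 0" by (simp add: algebra_simps)
  then show False using cA cB by (simp add: mult_le_0_iff)
qed

text \<open>The interval from \<open>1 / j\<close> to \<open>j\<close>, written without division so
  that it is empty for \<open>j = 0\<close>; these sets exhaust the positive couplings.\<close>

definition couplings :: "nat \<Rightarrow> real set" where
  "couplings j = {c. 1 \<le> c * real j \<and> c \<le> real j}"

text \<open>The factor 2 is a reserve: the limit potential is shown not to return within the
  distance without this factor.\<close>

definition returning :: "nat \<Rightarrow> real \<Rightarrow> real \<Rightarrow> (int \<Rightarrow>\<^sub>C real) set" where
  "returning j T T' = {V. \<exists>t\<in>{T..T'}. \<exists>c\<in>couplings j. recurrent V c t (2 * t powr - (1 / real j))}"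

text \<open>Stage \<open>j\<close> of the construction: a family \<open>F n k\<close> of periodic candidates, \<open>n\<close> being the fineness of
  the parameter grid. Up to any perturbation of size \<open>r\<close> few candidates return after time \<open>T\<close>, and
  few are excluded by the set \<open>A\<close> inherited from the previous stage.\<close>

definition stage :: "nat \<Rightarrow> (nat \<Rightarrow> (nat \<Rightarrow> nat) \<Rightarrow> (int \<Rightarrow>\<^sub>C real)) \<Rightarrow> real \<Rightarrow> real \<Rightarrow> (int \<Rightarrow>\<^sub>C real) set \<Rightarrow> bool" where
  "stage j F r T A \<longleftrightarrow> 0 < r
    \<and> (\<exists>P B. 0 < P \<and> (\<forall>n>0. \<forall>k\<in>grid (5 * j) n. (\<forall>m. apply_bcontfun (F n k) (m + P) = apply_bcontfun (F n k) m) \<and> norm (F n k) \<le> B))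
    \<and> (\<forall>T'. \<exists>n0. \<forall>n\<ge>n0. \<forall>Z. norm Z \<le> r \<longrightarrow> real (card {k \<in> grid (5 * j) n. F n k + Z \<in> returning j T T'}) \<le> real n ^ (5 * j) / 16)
    \<and> infinite {n. real (card {k \<in> grid (5 * j) n. F n k \<in> A}) \<le> real n ^ (5 * j) / 4}"

text \<open>The power \<open>- j\<close> outweighs the factor \<open>t powr p\<close> of the
  ballistic region in the moment, as soon as \<open>p \<le> j\<close>.\<close>

definition confined :: "nat \<Rightarrow> real \<Rightarrow> (int \<Rightarrow>\<^sub>C real) \<Rightarrow> bool" where
  "confined j t V \<longleftrightarrow> (\<forall>c\<in>couplings j.
     norm (proj_op {x. real_of_int \<bar>x\<bar> > t powr (1 / real j)} (evolution (schrodinger c V) t (ell2_delta 0))) \<le> t powr (- real j))"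

text \<open>There are no couplings for \<open>j = 0\<close>, so nothing returns; the family is
  constant.\<close>

lemma stage_0:
  assumes V: "periodic_seq V" and r: "0 < r"
  shows "stage 0 (\<lambda>_ _. V) r 1 {}"
proof -
  obtain P where P: "0 < P" "\<And>m. apply_bcontfun V (m + P) = apply_bcontfun V m" using V unfolding periodic_seq_def by blast
  have "returning 0 1 T' = {}" for T' by (simp add: returning_def couplings_def)
  then show ?thesis unfolding stage_def using r P by (auto intro!: exI[of _ P] exI[of _ "norm V"])
qed

text \<open>What follows must not depend on choices still open. Guards and their threshold
  \<open>T'\<close> are found for all candidates at once through their common period and bound;
  \<open>T'\<close> then tells how fine the old grid must be, and the confining \<open>W\<close> is
  found for a compact set containing all continuations. Only then is the old parameter
  \<open>k\<close> fixed, so that few of the new parameters return between \<open>T\<close> and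
  \<open>T'\<close>. These few form the exclusion set handed on to the next stage.\<close>

lemma next_stage:
  assumes st: "stage j F r T A"
  shows "\<exists>F' r' T' V t. stage (Suc j) F' r' T' (returning j T T') \<and> V \<notin> A \<and> periodic_seq V
    \<and> (\<exists>n>0. \<exists>k\<in>grid (5 * j) n. V = F n k) \<and> (\<forall>n>0. \<forall>k\<in>grid (5 * Suc j) n. norm (F' n k - V) \<le> r / 2)
    \<and> r' \<le> r / 2 \<and> T \<le> T' \<and> real (Suc j) \<le> T' \<and> r' * real (Suc j) * T'\<^sup>2 \<le> 1 \<and> real (Suc j) \<le> t
    \<and> (\<forall>n>0. \<forall>k\<in>grid (5 * Suc j) n. \<forall>X. norm (X - F' n k) \<le> r' \<longrightarrow> confined (Suc j) t X)"
proof -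
  define N where "N = 5 * j"
  define J where "J = Suc j"
  define N' where "N' = 5 * J"
  note st' = st[unfolded stage_def, folded N_def]
  have r: "0 < r" by (rule st'[THEN conjunct1])
  obtain P B where PB: "0 < P" "\<forall>n>0. \<forall>k\<in>grid N n. (\<forall>m. apply_bcontfun (F n k) (m + P) = apply_bcontfun (F n k) m) \<and> norm (F n k) \<le> B"
    using st'[THEN conjunct2, THEN conjunct1] by (elim exE conjE)
  have P: "0 < P" "\<And>n k m. 0 < n \<Longrightarrow> k \<in> grid N n \<Longrightarrow> apply_bcontfun (F n k) (m + P) = apply_bcontfun (F n k) m"
    and B': "\<And>n k. 0 < n \<Longrightarrow> k \<in> grid N n \<Longrightarrow> norm (F n k) \<le> B"
    using PB by simp_all
  note cnt = st'[THEN conjunct2, THEN conjunct2, THEN conjunct1, rule_format]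
  note inf = st'[THEN conjunct2, THEN conjunct2, THEN conjunct2]
  have B: "0 \<le> B"
  proof -
    have "grid N 1 \<noteq> {}" using card_grid[of N 1] by auto
    then obtain k where "k \<in> grid N 1" by blast
    then show ?thesis using B'[of 1 k] norm_ge_zero order_trans by (metis zero_less_one)
  qed
  define cm cM where "cm = 1 / real J" and "cM = real J"
  have J1: "1 \<le> real J" by (simp add: J_def)
  have cm: "0 < cm" "cm \<le> cM"
  proof -
    show "0 < cm" using J1 by (simp add: cm_def)
    have "cm \<le> 1" using J1 by (simp add: cm_def)
    then show "cm \<le> cM" using J1 by (simp add: cM_def)
  qed
  have coup: "couplings J = {cm..cM}" using J1 by (auto simp: couplings_def cm_def cM_def pos_divide_le_eq)
  have r8: "0 < r / 8" using r by simp
  from guard_exists[OF P(1) cm r8 B, of N'] obtain G \<kappa> P' \<rho> w C where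
    gx: "0 < P' \<and> 0 < \<rho> \<and> 0 < w \<and> 0 \<le> C \<and> norm G \<le> r / 8
      \<and> (\<forall>n. apply_bcontfun G (n + P') = apply_bcontfun G n) \<and> (\<forall>n. \<kappa> (n + P') = \<kappa> n)
      \<and> (\<forall>V c i. (\<forall>n. apply_bcontfun V (n + P) = apply_bcontfun V n) \<longrightarrow> norm V \<le> B \<longrightarrow> c \<in> {cm..cM} \<longrightarrow> i \<le> N'
        \<longrightarrow> guards w C (cball (V + G) \<rho>) c {n. \<kappa> n = i})"
    by (elim exE)
  have G: "0 < P'" "0 < \<rho>" "0 < w" "0 \<le> C" "norm G \<le> r / 8"
      "\<And>n. apply_bcontfun G (n + P') = apply_bcontfun G n" "\<And>n. \<kappa> (n + P') = \<kappa> n"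
    using gx by (elim conjE, simp)+
  have gd: "guards w C (cball (V + G) \<rho>) c {n. \<kappa> n = i}"
    if "\<And>n. apply_bcontfun V (n + P) = apply_bcontfun V n" "norm V \<le> B" "c \<in> {cm..cM}" "i \<le> N'" for V c i
    using gx that by (elim conjE) simp
  \<comment> \<open>The guards, \<open>W\<close> and the block together stay below
    \<open>r / 2\<close>; the quarters of \<open>\<rho>\<close> keep \<open>W\<close>, the block and
    a later perturbation inside the guarded ball.\<close>
  define a where "a = min (r / 8) (\<rho> / 4)"
  have a: "0 < a" "a \<le> r / 8" "a \<le> \<rho> / 4" using r G by (auto simp: a_def)
  define \<epsilon> where "\<epsilon> = 1 / real J"
  \<comment> \<open>Taking \<open>5 * J\<close> parameters against the exponent \<open>1 / J\<close>
    gives exactly the product required by \<open>count_recurrent\<close>.\<close>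
  have \<epsilon>: "0 < \<epsilon>" "\<epsilon> \<le> 1" "5 \<le> \<epsilon> * real N'" using J1 by (simp_all add: \<epsilon>_def N'_def)
  define BQ where "BQ = B + r + \<rho>"
  have BQ: "0 \<le> BQ" using B r G by (simp add: BQ_def)
  obtain T0 where T0: "\<And>T1. \<exists>n0. \<forall>n\<ge>n0. \<forall>\<kappa> Q Z. (\<forall>i\<le>N'. \<forall>c\<in>{cm..cM}. guards w C Q c {m. \<kappa> m = i}) \<longrightarrow> (\<forall>V\<in>Q. norm V \<le> BQ)
     \<longrightarrow> (\<forall>k\<in>grid N' n. Z + block \<kappa> N' a n k \<in> Q)
     \<longrightarrow> real (card {k \<in> grid N' n. \<exists>t\<in>{T0..T1}. \<exists>c\<in>{cm..cM}. recurrent (Z + block \<kappa> N' a n k) c t (2 * t powr - \<epsilon>)}) \<le> real n ^ N' / 16"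
    using count_recurrent[OF G(3,4) cm a(1) BQ \<epsilon>] by (elim exE) (rule that, elim allE)
  \<comment> \<open>The new block takes effect at \<open>T0\<close>. Up to \<open>T'\<close> the old
    block is responsible, under the perturbation by guards, confinement and new block, which is at
    most \<open>r\<close>.\<close>
  define T' where "T' = max T0 (max T (real J))"
  have T': "T0 \<le> T'" "T \<le> T'" "real J \<le> T'" by (auto simp: T'_def)
  obtain n0 where n0: "\<And>n Z. n0 \<le> n \<Longrightarrow> norm Z \<le> r \<Longrightarrow> real (card {k \<in> grid N n. F n k + Z \<in> returning j T T'}) \<le> real n ^ N / 16"
    using cnt[of T'] by blast
  obtain n where n: "Suc n0 \<le> n" "real (card {k \<in> grid N n. F n k \<in> A}) \<le> real n ^ N / 4"
    using inf unfolding infinite_nat_iff_unbounded_le by blast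
  have n1: "0 < n" "n0 \<le> n" using n by simp_all
  define PP where "PP = P * P'"
  have PP: "0 < PP" using P G by (simp add: PP_def)
  define \<K> where "\<K> = {f :: int \<Rightarrow>\<^sub>C real. (\<forall>m. apply_bcontfun f (m + PP) = apply_bcontfun f m) \<and> norm f \<le> B + r}"
  have per\<K>: "periodic_seq V" if "V \<in> \<K>" for V using that PP by (auto simp: \<K>_def periodic_seq_def)
  have J0: "0 < J" by (simp add: J_def)
  obtain W t where W: "periodic_seq W" "norm W \<le> a" "real J \<le> t"
    and conf: "\<And>V c. V \<in> \<K> \<Longrightarrow> c \<in> {cm..cM} \<Longrightarrow>
       norm (proj_op {x. real_of_int \<bar>x\<bar> > t powr (1 / real J)} (evolution (schrodinger c (V + W)) t (ell2_delta 0))) \<le> t powr (- real J) / 2"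
    using confinement_perturbation[OF compact_periodic[OF PP, of "B + r", folded \<K>_def] per\<K> cm a(1) J0] by blast
  have t0: "0 < t" using W(3) J0 by linarith
  define F' where "F' k n' k' = F n k + G + W + block \<kappa> N' a n' k'" for k n' k'
  have bl: "norm (block \<kappa> N' a n' k') \<le> a" if "k' \<in> grid N' n'" for n' k' using norm_block_le[OF that] a by simp
  define R where "R k n' k' \<longleftrightarrow> F' k n' k' \<in> returning j T T'" for k n' k'
  \<comment> \<open>For each fineness \<open>n'\<close> of the new grid some old parameter is not
    excluded and leaves at least three quarters of the new ones free of return before
    \<open>T'\<close>.\<close>
  have good: "\<exists>k\<in>grid N n. F n k \<notin> A \<and> real (card {k' \<in> grid N' n'. R k n' k'}) \<le> real n' ^ N' / 4" for n'
  proof -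
    have "\<exists>k\<in>grid N n. F n k \<notin> A \<and> real (card {k' \<in> grid N' n'. R k n' k'}) \<le> real (card (grid N' n')) / 4"
    proof (rule ex_good_choice[OF finite_grid finite_grid])
      have "card (grid N n) \<noteq> 0" using n1 by (simp add: card_grid)
      then show "grid N n \<noteq> {}" by auto
      show "real (card {k \<in> grid N n. F n k \<in> A}) \<le> real (card (grid N n)) / 4" using n(2) by (simp add: card_grid)
      fix k' assume k': "k' \<in> grid N' n'"
      have "norm (G + W + block \<kappa> N' a n' k') \<le> r / 8 + a + a"
        by (intro order_trans[OF norm_triangle_ineq] add_mono G(5) W(2) bl k')
      then have "norm (G + W + block \<kappa> N' a n' k') \<le> r" using a r by linarith
      from n0[OF n1(2) this] show "real (card {k \<in> grid N n. R k n' k'}) \<le> real (card (grid N n)) / 16"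
        by (simp add: R_def F'_def card_grid add.assoc)
    qed
    then show ?thesis by (simp add: card_grid)
  qed
  \<comment> \<open>The good \<open>k\<close> may vary with \<open>n'\<close>, but there are
    finitely many; one of them is good for infinitely many \<open>n'\<close>, which is all that
    \<open>stage\<close> demands.\<close>
  obtain k where k: "k \<in> grid N n" "infinite {n' \<in> UNIV. F n k \<notin> A \<and> real (card {k' \<in> grid N' n'. R k n' k'}) \<le> real n' ^ N' / 4}"
    using pigeonhole_infinite_rel[of "UNIV :: nat set" "grid N n"
        "\<lambda>n' k. F n k \<notin> A \<and> real (card {k' \<in> grid N' n'. R k n' k'}) \<le> real n' ^ N' / 4"] good finite_grid by auto
  define V where "V = F n k"
  have VA: "V \<notin> A"
  proof
    assume "V \<in> A"
    then show False using k(2) by (simp add: V_def)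
  qed
  have Vp: "\<And>m. apply_bcontfun V (m + P) = apply_bcontfun V m" "norm V \<le> B"
    using P(2)[OF n1(1) k(1)] B'[OF n1(1) k(1)] by (simp_all add: V_def)
  have VPP: "apply_bcontfun V (m + PP) = apply_bcontfun V m" for m
    using int_periodic_mult[of "apply_bcontfun V" P m P', OF Vp(1)] by (simp add: PP_def mult.commute)
  have GPP: "apply_bcontfun G (m + PP) = apply_bcontfun G m" "\<kappa> (m + PP) = \<kappa> m" for m
    using int_periodic_mult[of "apply_bcontfun G" P' m P, OF G(6)] int_periodic_mult[of \<kappa> P' m P, OF G(7)] by (simp_all add: PP_def)
  have a0: "0 \<le> a" using a by simp
  have F\<K>: "V + G + block \<kappa> N' a n' k' \<in> \<K>" if k': "k' \<in> grid N' n'" for n' k'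
  proof -
    have "norm (V + G + block \<kappa> N' a n' k') \<le> B + r / 8 + a"
      by (intro order_trans[OF norm_triangle_ineq] add_mono G(5) Vp(2) bl k')
    then have "norm (V + G + block \<kappa> N' a n' k') \<le> B + r" using a r by linarith
    then show ?thesis by (simp add: \<K>_def plus_bcontfun.rep_eq VPP GPP block_apply[OF k' a0])
  qed
  \<comment> \<open>Halving gives convergence; \<open>\<rho> / 4\<close> keeps later perturbations
    within the guards; the third bound lets non-return up to \<open>T'\<close> pass to the limit;
    the last changes the state at time \<open>t\<close> by at most \<open>t powr (- J) / 2\<close>,
    the half left over by \<open>confinement_perturbation\<close>.\<close>
  define r' where "r' = min (min (r / 2) (\<rho> / 4)) (min (1 / (real J * T'\<^sup>2)) (t powr (- real J) / (2 * real J * t)))"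
  have T'0: "0 < T'" using T' J0 by linarith
  have r': "0 < r'" "r' \<le> r / 2" "r' \<le> \<rho> / 4" "r' \<le> 1 / (real J * T'\<^sup>2)" "r' \<le> t powr (- real J) / (2 * real J * t)"
    using r G T'0 t0 J0 by (auto simp: r'_def)
  define Fn where "Fn = F' k"
  have Fn: "Fn n' k' = V + G + W + block \<kappa> N' a n' k'" for n' k' by (simp add: Fn_def F'_def V_def)
  have "stage J Fn r' T' (returning j T T')"
    unfolding stage_def N'_def[symmetric]
  proof (intro conjI allI)
    obtain q where q: "0 < q" "\<And>m. apply_bcontfun W (m + q) = apply_bcontfun W m" using W(1) unfolding periodic_seq_def by blast
    show "\<exists>P B. 0 < P \<and> (\<forall>n>0. \<forall>k\<in>grid N' n. (\<forall>m. apply_bcontfun (Fn n k) (m + P) = apply_bcontfun (Fn n k) m) \<and> norm (Fn n k) \<le> B)"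
    proof (intro exI[of _ "PP * q"] exI[of _ "B + r + a"] conjI allI impI ballI)
      show "0 < PP * q" using PP q by simp
      fix n' k' assume k': "k' \<in> grid N' n'"
      define X where "X = V + G + block \<kappa> N' a n' k'"
      have X: "apply_bcontfun X (m + PP) = apply_bcontfun X m" "norm X \<le> B + r" for m using F\<K>[OF k'] by (auto simp: X_def \<K>_def)
      have FX: "Fn n' k' = X + W" by (simp add: Fn X_def)
      show "norm (Fn n' k') \<le> B + r + a" unfolding FX by (intro order_trans[OF norm_triangle_ineq] add_mono X W)
      show "apply_bcontfun (Fn n' k') (m + PP * q) = apply_bcontfun (Fn n' k') m" for m
        using int_periodic_mult[of "apply_bcontfun X" PP m q, OF X(1)] int_periodic_mult[of "apply_bcontfun W" q m PP, OF q(2)]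
        by (simp add: FX plus_bcontfun.rep_eq mult.commute)
    qed
    show "\<exists>n0. \<forall>n\<ge>n0. \<forall>Z. norm Z \<le> r' \<longrightarrow> real (card {k \<in> grid N' n. Fn n k + Z \<in> returning J T' T1}) \<le> real n ^ N' / 16" for T1
    proof -
      obtain m0 where m0: "\<And>n Z. m0 \<le> n \<Longrightarrow> \<forall>i\<le>N'. \<forall>c\<in>{cm..cM}. guards w C (cball (V + G) \<rho>) c {m. \<kappa> m = i} \<Longrightarrow> \<forall>V\<in>cball (V + G) \<rho>. norm V \<le> BQ
          \<Longrightarrow> \<forall>k\<in>grid N' n. Z + block \<kappa> N' a n k \<in> cball (V + G) \<rho>
          \<Longrightarrow> real (card {k \<in> grid N' n. \<exists>t\<in>{T0..T1}. \<exists>c\<in>{cm..cM}. recurrent (Z + block \<kappa> N' a n k) c t (2 * t powr - \<epsilon>)}) \<le> real n ^ N' / 16"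
        using T0[of T1] by blast
      show ?thesis
      proof (intro exI[of _ m0] allI impI)
        fix n' and Z :: "int \<Rightarrow>\<^sub>C real" assume n': "m0 \<le> n'" and Z: "norm Z \<le> r'"
        define Z' where "Z' = V + G + W + Z"
        have eq: "Fn n' k' + Z = Z' + block \<kappa> N' a n' k'" for k' by (simp add: Fn Z'_def)
        have "real (card {k \<in> grid N' n'. \<exists>t\<in>{T0..T1}. \<exists>c\<in>{cm..cM}. recurrent (Z' + block \<kappa> N' a n' k) c t (2 * t powr - \<epsilon>)}) \<le> real n' ^ N' / 16"
        proof (rule m0[OF n'])
          show "\<forall>i\<le>N'. \<forall>c\<in>{cm..cM}. guards w C (cball (V + G) \<rho>) c {m. \<kappa> m = i}" using gd[OF Vp] by blast
          show "\<forall>X\<in>cball (V + G) \<rho>. norm X \<le> BQ"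
          proof
            fix X assume "X \<in> cball (V + G) \<rho>"
            then have "norm (X - (V + G)) \<le> \<rho>" by (simp add: dist_norm norm_minus_commute)
            moreover have "norm (V + G) \<le> B + r / 8" by (intro order_trans[OF norm_triangle_ineq] add_mono Vp G)
            ultimately show "norm X \<le> BQ" using norm_triangle_sub[of X "V + G"] r by (simp add: BQ_def)
          qed
          show "\<forall>k\<in>grid N' n'. Z' + block \<kappa> N' a n' k \<in> cball (V + G) \<rho>"
          proof
            fix k' assume k': "k' \<in> grid N' n'"
            have "norm (W + Z + block \<kappa> N' a n' k') \<le> a + r' + a"
              by (intro order_trans[OF norm_triangle_ineq] add_mono W Z bl k')
            moreover have "Z' + block \<kappa> N' a n' k' - (V + G) = W + Z + block \<kappa> N' a n' k'" by (simp add: Z'_def)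
            ultimately have "norm (Z' + block \<kappa> N' a n' k' - (V + G)) \<le> a + r' + a" by (simp only:)
            then have "dist (Z' + block \<kappa> N' a n' k') (V + G) \<le> \<rho>" using a r'(3) unfolding dist_norm by linarith
            then show "Z' + block \<kappa> N' a n' k' \<in> cball (V + G) \<rho>" unfolding mem_cball by (simp only: dist_commute)
          qed
        qed
        moreover have "{k \<in> grid N' n'. Fn n' k + Z \<in> returning J T' T1}
           \<subseteq> {k \<in> grid N' n'. \<exists>t\<in>{T0..T1}. \<exists>c\<in>{cm..cM}. recurrent (Z' + block \<kappa> N' a n' k) c t (2 * t powr - \<epsilon>)}"
          unfolding eq returning_def coup \<epsilon>_def using T'(1) by force
        then have "card {k \<in> grid N' n'. Fn n' k + Z \<in> returning J T' T1}
           \<le> card {k \<in> grid N' n'. \<exists>t\<in>{T0..T1}. \<exists>c\<in>{cm..cM}. recurrent (Z' + block \<kappa> N' a n' k) c t (2 * t powr - \<epsilon>)}"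
          by (rule card_mono[rotated]) (simp add: finite_grid)
        ultimately show "real (card {k \<in> grid N' n'. Fn n' k + Z \<in> returning J T' T1}) \<le> real n' ^ N' / 16" by linarith
      qed
    qed
    show "infinite {n'. real (card {k' \<in> grid N' n'. Fn n' k' \<in> returning j T T'}) \<le> real n' ^ N' / 4}"
    proof (rule infinite_super[OF _ k(2)])
      show "{n' \<in> UNIV. F n k \<notin> A \<and> real (card {k' \<in> grid N' n'. R k n' k'}) \<le> real n' ^ N' / 4}
         \<subseteq> {n'. real (card {k' \<in> grid N' n'. Fn n' k' \<in> returning j T T'}) \<le> real n' ^ N' / 4}"
        by (auto simp: R_def Fn_def)
    qed
  qed (rule r')
  moreover have "periodic_seq V" using Vp(1) P(1) by (auto simp: periodic_seq_def)
  moreover have "norm (Fn n' k' - V) \<le> r / 2" if "k' \<in> grid N' n'" for n' k'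
  proof -
    have "norm (G + W + block \<kappa> N' a n' k') \<le> r / 8 + a + a"
      by (intro order_trans[OF norm_triangle_ineq] add_mono G(5) W(2) bl that)
    then show ?thesis using a r by (simp add: Fn)
  qed
  moreover have "r' * real J * T'\<^sup>2 \<le> 1" using r'(4) J0 T'0 by (simp add: field_simps)
  moreover have "confined J t X" if k': "k' \<in> grid N' n'" and X: "norm (X - Fn n' k') \<le> r'" for n' k' X
    unfolding confined_def coup
  proof
    fix c assume c: "c \<in> {cm..cM}"
    define S where "S = {x. real_of_int \<bar>x\<bar> > t powr (1 / real J)}"
    define \<psi> where "\<psi> Y = evolution (schrodinger c Y) t (ell2_delta 0)" for Y
    have Fe: "Fn n' k' = V + G + block \<kappa> N' a n' k' + W" by (simp add: Fn)
    have 1: "norm (proj_op S (\<psi> (Fn n' k'))) \<le> t powr (- real J) / 2"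
      unfolding S_def \<psi>_def Fe by (rule conf[OF F\<K>[OF k'] c])
    have c0: "0 < c" "c \<le> real J" using c cm by (auto simp: cM_def)
    have "norm (\<psi> X - \<psi> (Fn n' k')) \<le> t * (c * r') * norm (ell2_delta 0)"
      unfolding \<psi>_def
    proof (rule evolution_perturbation[OF hermitian_schrodinger hermitian_schrodinger])
      show "norm (schrodinger c X v - schrodinger c (Fn n' k') v) \<le> c * r' * norm v" for v
        by (rule order_trans[OF norm_schrodinger_diff], intro mult_right_mono mult_mono) (use X c0 in auto)
    qed (use t0 in simp)
    also have "\<dots> \<le> t * (real J * (t powr (- real J) / (2 * real J * t)))"
      unfolding norm_ell2_delta mult_1_right by (intro mult_left_mono mult_mono c0 r') (use c0 r' t0 in auto)
    also have "\<dots> = t powr (- real J) / 2" using t0 J0 by simp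
    finally have 2: "norm (proj_op S (\<psi> X - \<psi> (Fn n' k'))) \<le> t powr (- real J) / 2"
      by (rule order_trans[OF norm_proj_op_le])
    have "proj_op S (\<psi> X) = proj_op S (\<psi> (Fn n' k')) + proj_op S (\<psi> X - \<psi> (Fn n' k'))"
      by (simp add: blinfun.diff_right)
    then have "norm (proj_op S (\<psi> X)) \<le> t powr (- real J) / 2 + t powr (- real J) / 2"
      using norm_triangle_ineq[of "proj_op S (\<psi> (Fn n' k'))" "proj_op S (\<psi> X - \<psi> (Fn n' k'))"] 1 2 by simp
    then show "norm (proj_op {x. real_of_int \<bar>x\<bar> > t powr (1 / real J)} (evolution (schrodinger c X) t (ell2_delta 0))) \<le> t powr (- real J)"
      by (simp add: S_def \<psi>_def)
  qed
  ultimately show ?thesis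
    using VA r'(2) T' W(3) n1 k(1) unfolding J_def[symmetric] N'_def[symmetric] N_def[symmetric] V_def[symmetric]
    by (intro exI[of _ Fn] exI[of _ r'] exI[of _ T'] exI[of _ V] exI[of _ t]) (auto simp: V_def)
qed

text \<open>The fixed members \<open>V j\<close> of the stages converge, and the limit stays within
  \<open>r j\<close> of each of them. That is close enough to inherit non-return between consecutive
  thresholds and confinement at the selected times.\<close>

lemma slow_potential_exists:
  assumes V0: "periodic_seq V0" and e: "0 < e"
  shows "\<exists>V T t. limit_periodic V \<and> norm (V - V0) \<le> e \<and> (\<forall>j. real j \<le> T j \<and> T j \<le> T (Suc j))
    \<and> (\<forall>j c s. c \<in> couplings j \<longrightarrow> T j \<le> s \<longrightarrow> s \<le> T (Suc j) \<longrightarrow> \<not> recurrent V c s (s powr - (1 / real j)))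
    \<and> (\<forall>j. real (Suc j) \<le> t j \<and> confined (Suc j) (t j) V)"
proof -
  define P where "P j \<sigma> \<longleftrightarrow> (case \<sigma> of (F, r, T, A) \<Rightarrow> stage j F r T A \<and> (j = 0 \<longrightarrow> F = (\<lambda>_ _. V0) \<and> r = e \<and> T = 1))" for j \<sigma>
  define Q where "Q j \<sigma> \<sigma>' \<longleftrightarrow> (case \<sigma> of (F, r, T, A) \<Rightarrow> case \<sigma>' of (F', r', T', A') \<Rightarrow> A' = returning j T T' \<and> (\<exists>V t. V \<notin> A \<and> periodic_seq V
    \<and> (\<exists>n>0. \<exists>k\<in>grid (5 * j) n. V = F n k) \<and> (\<forall>n>0. \<forall>k\<in>grid (5 * Suc j) n. norm (F' n k - V) \<le> r / 2)
    \<and> r' \<le> r / 2 \<and> T \<le> T' \<and> real (Suc j) \<le> T' \<and> r' * real (Suc j) * T'\<^sup>2 \<le> 1 \<and> real (Suc j) \<le> t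
    \<and> (\<forall>n>0. \<forall>k\<in>grid (5 * Suc j) n. \<forall>X. norm (X - F' n k) \<le> r' \<longrightarrow> confined (Suc j) t X)))" for j \<sigma> \<sigma>'
  have "\<exists>\<sigma>. \<forall>j. P j (\<sigma> j) \<and> Q j (\<sigma> j) (\<sigma> (Suc j))"
  proof (rule dependent_nat_choice)
    show "\<exists>\<sigma>. P 0 \<sigma>"
      by (rule exI[of _ "(\<lambda>_ _. V0, e, 1, {})"]) (simp add: P_def stage_0[OF V0 e])
    fix \<sigma> j assume *: "P j \<sigma>"
    obtain F r T A where \<sigma>: "\<sigma> = (F, r, T, A)" by (cases \<sigma>)
    have "stage j F r T A" using * by (simp add: P_def \<sigma>)
    from next_stage[OF this] obtain F' r' T' V t where n: "stage (Suc j) F' r' T' (returning j T T') \<and> V \<notin> A \<and> periodic_seq V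
    \<and> (\<exists>n>0. \<exists>k\<in>grid (5 * j) n. V = F n k) \<and> (\<forall>n>0. \<forall>k\<in>grid (5 * Suc j) n. norm (F' n k - V) \<le> r / 2)
    \<and> r' \<le> r / 2 \<and> T \<le> T' \<and> real (Suc j) \<le> T' \<and> r' * real (Suc j) * T'\<^sup>2 \<le> 1 \<and> real (Suc j) \<le> t
    \<and> (\<forall>n>0. \<forall>k\<in>grid (5 * Suc j) n. \<forall>X. norm (X - F' n k) \<le> r' \<longrightarrow> confined (Suc j) t X)" by (elim exE)
    show "\<exists>\<sigma>'. P (Suc j) \<sigma>' \<and> Q j \<sigma> \<sigma>'"
    proof (intro exI[of _ "(F', r', T', returning j T T')"] conjI)
      show "P (Suc j) (F', r', T', returning j T T')" using n by (simp add: P_def)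
      show "Q j \<sigma> (F', r', T', returning j T T')"
        unfolding Q_def \<sigma> prod.case
        by (rule conjI[OF refl], rule exI[of _ V], rule exI[of _ t], rule n[THEN conjunct2])
    qed
  qed
  then obtain \<sigma> where \<sigma>: "\<And>j. P j (\<sigma> j)" "\<And>j. Q j (\<sigma> j) (\<sigma> (Suc j))" by blast
  define F r T A where "F j = fst (\<sigma> j)" and "r j = fst (snd (\<sigma> j))" and "T j = fst (snd (snd (\<sigma> j)))" and "A j = snd (snd (snd (\<sigma> j)))" for j
  have \<sigma>_eq: "\<sigma> j = (F j, r j, T j, A j)" for j by (simp add: F_def r_def T_def A_def)
  have st: "stage j (F j) (r j) (T j) (A j)" and st0: "F 0 = (\<lambda>_ _. V0)" "r 0 = e" "T 0 = 1" for j
    using \<sigma>(1)[of j] \<sigma>(1)[of 0] by (simp_all add: P_def \<sigma>_eq)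
  have r0: "0 < r j" for j using st[of j] unfolding stage_def by (rule conjunct1)
  note Q = \<sigma>(2)[unfolded \<sigma>_eq Q_def prod.case]
  have A: "A (Suc j) = returning j (T j) (T (Suc j))" for j using Q[of j] by (rule conjunct1)
  obtain V t where Vt: "\<And>j. V j \<notin> A j \<and> periodic_seq (V j)
    \<and> (\<exists>n>0. \<exists>k\<in>grid (5 * j) n. V j = F j n k) \<and> (\<forall>n>0. \<forall>k\<in>grid (5 * Suc j) n. norm (F (Suc j) n k - V j) \<le> r j / 2)
    \<and> r (Suc j) \<le> r j / 2 \<and> T j \<le> T (Suc j) \<and> real (Suc j) \<le> T (Suc j) \<and> r (Suc j) * real (Suc j) * (T (Suc j))\<^sup>2 \<le> 1 \<and> real (Suc j) \<le> t j
    \<and> (\<forall>n>0. \<forall>k\<in>grid (5 * Suc j) n. \<forall>X. norm (X - F (Suc j) n k) \<le> r (Suc j) \<longrightarrow> confined (Suc j) (t j) X)"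
    using Q[THEN conjunct2] by metis
  have VA: "V j \<notin> A j" and Vper: "periodic_seq (V j)" and VF: "\<exists>n>0. \<exists>k\<in>grid (5 * j) n. V j = F j n k"
    and FV: "\<And>n k. 0 < n \<Longrightarrow> k \<in> grid (5 * Suc j) n \<Longrightarrow> norm (F (Suc j) n k - V j) \<le> r j / 2"
    and rS: "r (Suc j) \<le> r j / 2" and TS: "T j \<le> T (Suc j)" "real (Suc j) \<le> T (Suc j)" "r (Suc j) * real (Suc j) * (T (Suc j))\<^sup>2 \<le> 1"
    and tj: "real (Suc j) \<le> t j"
    and cf: "\<And>n k X. 0 < n \<Longrightarrow> k \<in> grid (5 * Suc j) n \<Longrightarrow> norm (X - F (Suc j) n k) \<le> r (Suc j) \<Longrightarrow> confined (Suc j) (t j) X" for j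
    using Vt[of j] by (elim conjE; simp)+
  have VS: "norm (V (Suc j) - V j) \<le> r j / 2" for j
  proof -
    obtain n k where "n > 0" "k \<in> grid (5 * Suc j) n" "V (Suc j) = F (Suc j) n k" using VF[of "Suc j"] by blast
    then show ?thesis using FV by simp
  qed
  \<comment> \<open>A step of length at most \<open>r j / 2\<close> is covered by the decrease of
    the radius from \<open>r j\<close> to at most its half.\<close>
  have near: "norm (V (j + m) - V j) \<le> r j - r (j + m)" for j m
  proof (induction m)
    case (Suc m)
    have "norm (V (j + Suc m) - V j) \<le> norm (V (Suc (j + m)) - V (j + m)) + norm (V (j + m) - V j)"
      using norm_triangle_ineq[of "V (Suc (j + m)) - V (j + m)" "V (j + m) - V j"] by simp
    then show ?case using VS[of "j + m"] Suc.IH rS[of "j + m"] by simp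
  qed simp
  have near': "norm (V m - V j) \<le> r j" if "j \<le> m" for j m
    using near[of j "m - j"] r0[of m] that by simp
  have rpow: "r j \<le> e * (1 / 2) ^ j" for j
  proof (induction j)
    case (Suc j)
    then show ?case using rS[of j] by simp
  qed (simp add: st0)
  have "(\<lambda>j. e * (1 / 2) ^ j) \<longlonglongrightarrow> e * 0" by (intro tendsto_mult_left LIMSEQ_realpow_zero) auto
  then have rlim: "r \<longlonglongrightarrow> 0"
    by (intro tendsto_sandwich[of "\<lambda>_. 0" r sequentially "\<lambda>j. e * (1 / 2) ^ j" 0] always_eventually allI)
      (auto simp: rpow[simplified] intro: less_imp_le r0)
  have "Cauchy V"
  proof (rule CauchyI')
    fix \<epsilon> :: real assume "0 < \<epsilon>"
    then have "\<forall>\<^sub>F j in sequentially. r j < \<epsilon>" using rlim order_tendstoD(2) by blast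
    then obtain M where M: "\<And>j. M \<le> j \<Longrightarrow> r j < \<epsilon>" unfolding eventually_sequentially by blast
    have "dist (V m) (V n) < \<epsilon>" if "M \<le> m" "m < n" for m n
      using near'[of m n] M[OF that(1)] that by (simp add: dist_norm norm_minus_commute)
    then show "\<exists>M. \<forall>m\<ge>M. \<forall>n>m. dist (V m) (V n) < \<epsilon>" by blast
  qed
  then obtain W where W: "V \<longlonglongrightarrow> W" using Cauchy_bcontfun_convergent by blast
  have WV: "norm (W - V j) \<le> r j" for j
  proof (rule tendsto_upperbound)
    show "(\<lambda>m. norm (V m - V j)) \<longlonglongrightarrow> norm (W - V j)" by (intro tendsto_intros W)
    show "\<forall>\<^sub>F m in sequentially. norm (V m - V j) \<le> r j" using eventually_ge_at_top[of j] by eventually_elim (rule near')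
  qed simp
  show ?thesis
  proof (rule exI[of _ W], rule exI[of _ T], rule exI[of _ t], intro conjI allI impI)
    show "limit_periodic W" unfolding limit_periodic_def using Vper W by blast
    have "V 0 = V0" using VF[of 0] by (auto simp: st0)
    then show "norm (W - V0) \<le> e" using WV[of 0] st0 by simp
    show "real j \<le> T j" for j using TS(2)[of "j - 1"] st0 by (cases j) auto
    show "T j \<le> T (Suc j)" for j by (rule TS(1))
    show "real (Suc j) \<le> t j" for j by (rule tj)
    show "confined (Suc j) (t j) W" for j
    proof -
      obtain n k where "n > 0" "k \<in> grid (5 * Suc j) n" "V (Suc j) = F (Suc j) n k" using VF[of "Suc j"] by blast
      then show ?thesis using cf WV[of "Suc j"] by simp
    qed
    fix j c s assume c: "c \<in> couplings j" and s: "T j \<le> s" "s \<le> T (Suc j)"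
    have cj: "1 \<le> c * real j" "c \<le> real j" using c by (auto simp: couplings_def)
    have j: "1 \<le> real j" using cj by (cases j) auto
    have c0: "0 < c" using cj(1) j by (metis less_le_trans mult_nonpos_nonneg not_less of_nat_0_le_iff zero_less_one)
    have "1 \<le> T j" using TS(2)[of "j - 1"] j by (cases j) auto
    then have s1: "1 \<le> s" using s by simp
    show "\<not> recurrent W c s (s powr - (1 / real j))"
    proof
      assume rec: "recurrent W c s (s powr - (1 / real j))"
      have "norm (evolution (schrodinger c W) s (ell2_delta 0) - evolution (schrodinger c (V (Suc j))) s (ell2_delta 0))
          \<le> s * (c * r (Suc j)) * norm (ell2_delta 0)"
      proof (rule evolution_perturbation[OF hermitian_schrodinger hermitian_schrodinger])
        show "norm (schrodinger c W v - schrodinger c (V (Suc j)) v) \<le> c * r (Suc j) * norm v" for v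
          by (rule order_trans[OF norm_schrodinger_diff], intro mult_right_mono mult_mono) (use WV c0 in auto)
      qed (use s1 in simp)
      \<comment> \<open>The square of the threshold in the bound on the radius pays for the factor
        \<open>s\<close> and still leaves \<open>1 / s\<close>.\<close>
      also have "\<dots> \<le> s powr - 1"
      proof -
        have "s * (s * (c * r (Suc j))) \<le> T (Suc j) * (T (Suc j) * (real (Suc j) * r (Suc j)))"
          using s s1 c0 cj less_imp_le[OF r0[of "Suc j"]] by (intro mult_mono mult_nonneg_nonneg) auto
        also have "\<dots> \<le> 1" using TS(3)[of j] by (simp add: power2_eq_square mult_ac)
        finally have "s * (c * r (Suc j)) \<le> 1 / s" using s1 by (simp add: field_simps)
        then show ?thesis using s1 by (simp add: powr_minus_divide)
      qed
      also have "\<dots> \<le> s powr - (1 / real j)" using s1 j by (intro powr_mono) (auto simp: divide_simps)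
      finally have "recurrent (V (Suc j)) c s (s powr - (1 / real j) + s powr - (1 / real j))" by (rule recurrent_perturbation[OF rec])
      then have "V (Suc j) \<in> A (Suc j)" unfolding A returning_def using c s by auto
      then show False using VA by blast
    qed
  qed
qed

section \<open>Moments from non-return and confinement\<close>

lemma inner_cscale_delta: "cscale_op z (ell2_delta 0) \<bullet> u = z \<bullet> apply_ell2 u 0"
  by (subst inner_finite_supp[of "{0}"]) (auto simp: supp_in_def ell2_delta.rep_eq)

text \<open>Mass away from the origin counts with weight at least 1. If no phase brings the state
  within \<open>\<eta>\<close> of the unit vector at 0, then the modulus at 0 is at most
  \<open>1 - \<eta>\<^sup>2 / 2\<close>, and the remaining mass is at least
  \<open>\<eta>\<^sup>2 / 2\<close>.\<close>

lemma moment_lower_bound: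
  assumes p: "0 < p" and nr: "\<not> recurrent V c t \<eta>" and \<eta>: "0 \<le> \<eta>"
  shows "\<eta>\<^sup>2 / 2 \<le> position_moment p (evolution (schrodinger c V) t (ell2_delta 0))"
proof -
  define \<psi> where "\<psi> = evolution (schrodinger c V) t (ell2_delta 0)"
  have n\<psi>: "norm \<psi> = 1" by (simp add: \<psi>_def norm_evolution[OF hermitian_schrodinger])
  define a where "a = apply_ell2 \<psi> 0"
  have sq: "(norm (\<psi> - cscale_op z (ell2_delta 0)))\<^sup>2 = 1 - 2 * (z \<bullet> a) + (cmod z)\<^sup>2" for z
  proof -
    have "cscale_op z (ell2_delta 0) \<bullet> \<psi> = z \<bullet> a" by (simp add: inner_cscale_delta a_def)
    moreover have "\<psi> \<bullet> \<psi> = 1" using n\<psi> by (simp add: power2_norm_eq_inner[symmetric])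
    moreover have "cscale_op z (ell2_delta 0) \<bullet> cscale_op z (ell2_delta 0) = (cmod z)\<^sup>2"
      unfolding power2_norm_eq_inner[symmetric] norm_cscale_op by simp
    ultimately show ?thesis
      unfolding power2_norm_eq_inner[of "\<psi> - cscale_op z (ell2_delta 0)"]
      by (simp add: inner_diff_left inner_diff_right inner_commute[of \<psi> "cscale_op z (ell2_delta 0)"])
  qed
  have a1: "cmod a \<le> 1" using cmod_le_norm_ell2[of \<psi> 0] n\<psi> by (simp add: a_def)
  have "\<eta>\<^sup>2 < 2 - 2 * cmod a"
  proof -
    \<comment> \<open>The best phase; any phase will do if the amplitude at 0 vanishes.\<close>
    define z where "z = (if a = 0 then 1 else (1 / cmod a) *\<^sub>R a)"
    have z: "cmod z = 1" "z \<bullet> a = cmod a" by (auto simp: z_def power2_norm_eq_inner[symmetric] power2_eq_square)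
    then have "\<eta> < norm (\<psi> - cscale_op z (ell2_delta 0))"
      using nr unfolding recurrent_def \<psi>_def[symmetric] by force
    then have "\<eta>\<^sup>2 < (norm (\<psi> - cscale_op z (ell2_delta 0)))\<^sup>2" using \<eta> by (intro power_strict_mono) auto
    then show ?thesis unfolding sq z by simp
  qed
  then have "\<eta>\<^sup>2 / 2 \<le> 1 - cmod a" by simp
  also have "\<dots> \<le> 1 - (cmod a)\<^sup>2" using a1 by (simp add: power2_eq_square mult_left_le_one_le)
  also have "\<dots> = (norm (\<psi> - cscale_op a (ell2_delta 0)))\<^sup>2" unfolding sq by (simp add: power2_norm_eq_inner)
  also have "\<dots> \<le> position_moment p \<psi>"
    unfolding norm_ell2_power2 position_moment_def
  proof (rule infsum_mono[OF ell2_summable])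
    show "(\<lambda>n. \<bar>real_of_int n\<bar> powr p * (cmod (apply_ell2 \<psi> n))\<^sup>2) summable_on UNIV"
      unfolding \<psi>_def by (rule summable_position_moment[OF p])
    fix n :: int
    show "(cmod (apply_ell2 (\<psi> - cscale_op a (ell2_delta 0)) n))\<^sup>2 \<le> \<bar>real_of_int n\<bar> powr p * (cmod (apply_ell2 \<psi> n))\<^sup>2"
    proof (cases "n = 0")
      case False
      then have "1 \<le> \<bar>real_of_int n\<bar>" by linarith
      then have "1 \<le> \<bar>real_of_int n\<bar> powr p" using p by (intro ge_one_powr_ge_zero) auto
      then have "1 * (cmod (apply_ell2 \<psi> n))\<^sup>2 \<le> \<bar>real_of_int n\<bar> powr p * (cmod (apply_ell2 \<psi> n))\<^sup>2" by (rule mult_right_mono) simp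
      then show ?thesis using False by (simp add: ell2_delta.rep_eq)
    qed (simp add: ell2_delta.rep_eq a_def)
  qed
  finally show ?thesis by (simp add: \<psi>_def)
qed

lemma summable_powr_exp: "(\<lambda>n::int. \<bar>real_of_int n\<bar> powr p * exp (- \<bar>real_of_int n\<bar>)) summable_on UNIV" if "0 < p"
proof -
  define g where "g x = x powr p * exp (- x)" for x :: real
  have "summable (\<lambda>n::nat. g (real n))" unfolding g_def
  proof (rule summable_comparison_test_bigo)
    show "summable (\<lambda>n. norm (exp (- (1 / 2)) ^ n :: real))" by (simp add: summable_geometric)
    show "(\<lambda>n::nat. real n powr p * exp (- real n)) \<in> O(\<lambda>n. exp (- (1 / 2)) ^ n)" using that by real_asymp
  qed
  then have nat: "(\<lambda>n::nat. g (real n)) summable_on UNIV" by (intro norm_summable_imp_summable_on) (simp add: g_def)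
  have "(\<lambda>n::int. g \<bar>real_of_int n\<bar>) summable_on (range int \<union> range (\<lambda>n. - int n))"
    by (intro summable_on_union) (subst summable_on_reindex, use nat in \<open>auto simp: o_def inj_on_def\<close>)+
  moreover have "range int \<union> range (\<lambda>n. - int n) = UNIV" by (auto simp: image_iff) (metis int_cases2)
  ultimately show ?thesis by (simp add: g_def)
qed

text \<open>The constant does not depend on \<open>j\<close> or \<open>t\<close>. Confinement
  handles sites up to the ballistic distance, and finite propagation speed those beyond.\<close>

lemma moment_upper_bound:
  assumes p: "0 < p" and c: "0 < c"
  shows "\<exists>C\<ge>1. \<forall>j t. confined j t V \<longrightarrow> c \<in> couplings j \<longrightarrow> p \<le> real j \<longrightarrow> 1 \<le> t
    \<longrightarrow> position_moment p (evolution (schrodinger c V) t (ell2_delta 0)) \<le> C * t powr (p / real j)"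
proof -
  define K where "K = 2 + c * norm V"
  have K: "2 \<le> K" "norm (schrodinger c V) \<le> K" using c norm_schrodinger_le[of c V] by (simp_all add: K_def)
  \<comment> \<open>Beyond \<open>D * t\<close> the propagation bound
    \<open>exp 1 * t * K - (\<bar>n\<bar> - 1)\<close> is at most
    \<open>- \<bar>n\<bar> / 2\<close>; the second half of \<open>D\<close> absorbs the 1, as
    \<open>t \<ge> 1\<close>.\<close>
  define D where "D = 2 * (exp 1 * K + 1)"
  have D: "1 \<le> D" using K by (simp add: D_def)
  define g where "g n = \<bar>real_of_int n\<bar> powr p * exp (- \<bar>real_of_int n\<bar>)" for n :: int
  have g: "g summable_on UNIV" unfolding g_def by (rule summable_powr_exp[OF p])
  define C where "C = 1 + D powr p + infsum g UNIV"
  have C1: "1 \<le> C" unfolding C_def by (simp add: infsum_nonneg g_def)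
  show ?thesis
  proof (intro exI[of _ C] conjI C1 allI impI)
    fix j t assume cf: "confined j t V" and cj: "c \<in> couplings j" and pj: "p \<le> real j" and t: "1 \<le> t"
    have j0: "0 < real j" using p pj by simp
    define \<psi> where "\<psi> = evolution (schrodinger c V) t (ell2_delta 0)"
    have n\<psi>: "norm \<psi> = 1" by (simp add: \<psi>_def norm_evolution[OF hermitian_schrodinger])
    define S where "S = {x. real_of_int \<bar>x\<bar> > t powr (1 / real j)}"
    define \<phi> where "\<phi> = proj_op S \<psi>"
    have \<phi>: "norm \<phi> \<le> t powr (- real j)" using cf cj unfolding confined_def \<phi>_def S_def \<psi>_def by blast
    have far: "(cmod (apply_ell2 \<psi> n))\<^sup>2 \<le> exp (- \<bar>real_of_int n\<bar>)" if n: "D * t < \<bar>real_of_int n\<bar>" for n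
    proof -
      have t0: "0 \<le> t" using t by simp
      have "1 * 1 \<le> D * t" by (rule mult_mono) (use D t in auto)
      then have n1: "1 \<le> \<bar>n\<bar>" using n by linarith
      define r where "r = nat (\<bar>n\<bar> - 1)"
      have r: "int r = \<bar>n\<bar> - 1" "real r = \<bar>real_of_int n\<bar> - 1" using n1 by (simp_all add: r_def)
      have "norm (proj_op {n} \<psi>) \<le> exp (exp 1 * t * K - real r) * norm (ell2_delta 0)"
        unfolding \<psi>_def
        by (rule finite_range[OF local_op_schrodinger K(2) t0]) (use r(1) n1 in \<open>auto simp: ell2_delta.rep_eq\<close>)
      moreover have "cmod (apply_ell2 \<psi> n) \<le> norm (proj_op {n} \<psi>)"
        using cmod_le_norm_ell2[of "proj_op {n} \<psi>" n] by simp
      ultimately have "cmod (apply_ell2 \<psi> n) \<le> exp (exp 1 * t * K - real r)" by simp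
      also have "\<dots> \<le> exp (- \<bar>real_of_int n\<bar> / 2)"
      proof -
        have "D * t = 2 * (exp 1 * t * K) + 2 * t" by (simp add: D_def algebra_simps)
        then have "exp 1 * t * K - real r \<le> - \<bar>real_of_int n\<bar> / 2" using n r(2) t by linarith
        then show ?thesis by simp
      qed
      finally have "(cmod (apply_ell2 \<psi> n))\<^sup>2 \<le> (exp (- \<bar>real_of_int n\<bar> / 2))\<^sup>2" by (intro power_mono) auto
      also have "\<dots> = exp (- \<bar>real_of_int n\<bar>)" by (simp add: exp_double[symmetric])
      finally show ?thesis .
    qed
    have "position_moment p \<psi> \<le> (\<Sum>\<^sub>\<infinity>n. t powr (p / real j) * (cmod (apply_ell2 \<psi> n))\<^sup>2 + (D * t) powr p * (cmod (apply_ell2 \<phi> n))\<^sup>2 + g n)"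
      unfolding position_moment_def
    proof (rule infsum_mono)
      show "(\<lambda>n. \<bar>real_of_int n\<bar> powr p * (cmod (apply_ell2 \<psi> n))\<^sup>2) summable_on UNIV"
        unfolding \<psi>_def by (rule summable_position_moment[OF p])
      show "(\<lambda>n. t powr (p / real j) * (cmod (apply_ell2 \<psi> n))\<^sup>2 + (D * t) powr p * (cmod (apply_ell2 \<phi> n))\<^sup>2 + g n) summable_on UNIV"
        by (intro summable_on_add summable_on_cmult_right ell2_summable g)
      fix n :: int
      define x where "x = \<bar>real_of_int n\<bar> powr p * (cmod (apply_ell2 \<psi> n))\<^sup>2"
      have nn: "0 \<le> t powr (p / real j) * (cmod (apply_ell2 \<psi> n))\<^sup>2" "0 \<le> (D * t) powr p * (cmod (apply_ell2 \<phi> n))\<^sup>2" "0 \<le> g n"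
        by (simp_all add: g_def)
      \<comment> \<open>Confined region, ballistic region with little mass, and exponentially small
        tail.\<close>
      consider "\<bar>real_of_int n\<bar> \<le> t powr (1 / real j)" | "n \<in> S" "\<bar>real_of_int n\<bar> \<le> D * t" | "D * t < \<bar>real_of_int n\<bar>"
        by (force simp: S_def)
      then have "x \<le> t powr (p / real j) * (cmod (apply_ell2 \<psi> n))\<^sup>2 \<or> x \<le> (D * t) powr p * (cmod (apply_ell2 \<phi> n))\<^sup>2 \<or> x \<le> g n"
      proof cases
        case 1
        then have "\<bar>real_of_int n\<bar> powr p \<le> (t powr (1 / real j)) powr p" using p by (intro powr_mono2) auto
        then have "\<bar>real_of_int n\<bar> powr p \<le> t powr (p / real j)" by (simp add: powr_powr)
        then show ?thesis unfolding x_def by (intro disjI1 mult_right_mono) auto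
      next
        case 2
        then have "\<bar>real_of_int n\<bar> powr p \<le> (D * t) powr p" using p by (intro powr_mono2) auto
        moreover have "apply_ell2 \<phi> n = apply_ell2 \<psi> n" using 2 by (simp add: \<phi>_def)
        ultimately show ?thesis unfolding x_def by (intro disjI2 disjI1) (simp add: mult_right_mono)
      next
        case 3
        then show ?thesis unfolding x_def g_def by (intro disjI2 mult_left_mono far) auto
      qed
      then show "\<bar>real_of_int n\<bar> powr p * (cmod (apply_ell2 \<psi> n))\<^sup>2
        \<le> t powr (p / real j) * (cmod (apply_ell2 \<psi> n))\<^sup>2 + (D * t) powr p * (cmod (apply_ell2 \<phi> n))\<^sup>2 + g n"
        unfolding x_def[symmetric] using nn by linarith
    qed
    also have "\<dots> = t powr (p / real j) * (norm \<psi>)\<^sup>2 + (D * t) powr p * (norm \<phi>)\<^sup>2 + infsum g UNIV"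
      unfolding norm_ell2_power2
      by (subst infsum_add, intro summable_on_add summable_on_cmult_right ell2_summable, rule g,
          subst infsum_add, (intro summable_on_cmult_right ell2_summable)+)
        (simp add: infsum_cmult_right ell2_summable)
    also have "\<dots> \<le> t powr (p / real j) + D powr p + infsum g UNIV"
    proof -
      have "(norm \<phi>)\<^sup>2 \<le> (t powr (- real j))\<^sup>2" using \<phi> by (intro power_mono) auto
      also have "\<dots> = t powr (- (2 * real j))" using t by (simp add: power2_eq_square powr_add[symmetric])
      finally have "(D * t) powr p * (norm \<phi>)\<^sup>2 \<le> (D * t) powr p * t powr (- (2 * real j))" by (rule mult_left_mono) simp
      also have "\<dots> = D powr p * t powr (p - 2 * real j)" using D t by (simp add: powr_mult powr_add[symmetric])
      also have "\<dots> \<le> D powr p * t powr 0" using t pj j0 by (intro mult_left_mono powr_mono) auto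
      finally show ?thesis using t n\<psi> by simp
    qed
    also have "\<dots> \<le> C * t powr (p / real j)"
    proof -
      have "1 \<le> t powr (p / real j)" using t p by (intro ge_one_powr_ge_zero) auto
      then have "(D powr p + infsum g UNIV) * 1 \<le> (D powr p + infsum g UNIV) * t powr (p / real j)"
        by (intro mult_left_mono) (auto intro!: add_nonneg_nonneg infsum_nonneg simp: g_def)
      then show ?thesis by (simp add: C_def algebra_simps)
    qed
    finally show "position_moment p (evolution (schrodinger c V) t (ell2_delta 0)) \<le> C * t powr (p / real j)" by (simp add: \<psi>_def)
  qed
qed

section \<open>Transport exponents\<close>

text \<open>Every large time lies between two consecutive thresholds with index at least
  \<open>j0\<close>, so the moment is at least of order \<open>t powr (- 2 / j0)\<close>.\<close>

lemma transport_exponent_nonneg: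
  assumes p: "0 < p" and c: "0 < c" and T: "\<And>j. real j \<le> T j" "\<And>j. T j \<le> T (Suc j)"
    and nr: "\<And>j s. c \<in> couplings j \<Longrightarrow> T j \<le> s \<Longrightarrow> s \<le> T (Suc j) \<Longrightarrow> \<not> recurrent V c s (s powr - (1 / real j))"
  shows "0 \<le> transport_exponent_minus (schrodinger c V) (ell2_delta 0) p"
  unfolding transport_exponent_minus_def le_Liminf_iff
proof (intro allI impI)
  fix y :: ereal assume "y < 0"
  then obtain z where z: "y < ereal z" "ereal z < ereal 0" using ereal_dense2[of y 0] by (auto simp: zero_ereal_def)
  define \<delta> where "\<delta> = - z"
  have \<delta>: "0 < \<delta>" using z by (simp add: \<delta>_def)
  \<comment> \<open>From \<open>j0\<close> on the coupling is admissible, and the exponent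
    \<open>2 / j0\<close> uses at most half of \<open>p * \<delta>\<close>; the constant
    \<open>ln 2\<close> will use a quarter by the choice of \<open>t0\<close>.\<close>
  obtain j0 :: nat where j0': "max (max c (1 / c)) (max 1 (4 / (p * \<delta>))) \<le> real j0" using real_arch_simple by blast
  have j0: "c \<le> real j0" "1 \<le> c * real j0" "1 \<le> real j0" "4 / (p * \<delta>) \<le> real j0"
    using j0' c by (auto simp: pos_divide_le_eq mult.commute)
  define t0 where "t0 = max (T j0) (exp (4 * ln 2 / (p * \<delta>) + 1))"
  have "y < ereal (ln (position_moment p (evolution (schrodinger c V) t (ell2_delta 0))) / (p * ln t))" if t: "t0 \<le> t" for t
  proof -
    have tT: "T j0 \<le> t" and te: "exp (4 * ln 2 / (p * \<delta>) + 1) \<le> t" using t by (simp_all add: t0_def)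
    have t1: "1 \<le> t" using T(1)[of j0] j0 tT by linarith
    have lnt: "4 * ln 2 / (p * \<delta>) + 1 \<le> ln t" using te t1 by (simp add: ln_ge_iff)
    have ln0: "0 < 4 * ln 2 / (p * \<delta>)" using p \<delta> by simp
    then have lt: "0 < ln t" "4 * ln 2 / (p * \<delta>) \<le> ln t" using lnt by linarith+
    obtain m0 :: nat where "t < real m0" using reals_Archimedean2 by blast
    then have ex: "t < T m0" using T(1)[of m0] by linarith
    \<comment> \<open>The thresholds are unbounded because \<open>j \<le> T j\<close>; the
      predecessor of the first one beyond \<open>t\<close> begins the interval containing
      \<open>t\<close>.\<close>
    define m where "m = (LEAST m. t < T m)"
    have m1: "t < T m" unfolding m_def by (rule LeastI[of "\<lambda>m. t < T m", OF ex])
    have m2: "T i \<le> t" if "i < m" for i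
      using not_less_Least[OF that[unfolded m_def]] by (simp only: not_less)
    have "j0 < m"
    proof (rule ccontr)
      assume "\<not> j0 < m"
      then have "m \<le> j0" by simp
      then have "T m \<le> T j0" by (rule lift_Suc_mono_le[of T, rotated]) (rule T(2))
      then show False using m1 tT by linarith
    qed
    then obtain j where j: "m = Suc j" "j0 \<le> j" by (cases m) auto
    have jr: "real j0 \<le> real j" using j by simp
    have cj: "c \<in> couplings j"
    proof -
      have "c * real j0 \<le> c * real j" using jr c by (intro mult_left_mono) auto
      then show ?thesis using j0 jr by (simp add: couplings_def)
    qed
    have "\<not> recurrent V c t (t powr - (1 / real j))" using nr[OF cj m2] m1 j by auto
    then have "(t powr - (1 / real j))\<^sup>2 / 2 \<le> position_moment p (evolution (schrodinger c V) t (ell2_delta 0))"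
      by (intro moment_lower_bound p) auto
    moreover have "t powr (- (2 / real j0)) \<le> (t powr - (1 / real j))\<^sup>2"
    proof -
      have "2 / real j \<le> 2 / real j0" using jr j0 by (intro divide_left_mono) auto
      then have "t powr (- (2 / real j0)) \<le> t powr (- (2 / real j))" using t1 by (intro powr_mono) auto
      also have "\<dots> = (t powr - (1 / real j))\<^sup>2" using t1 by (simp add: power2_eq_square powr_add[symmetric])
      finally show ?thesis .
    qed
    ultimately have lb: "t powr (- (2 / real j0)) / 2 \<le> position_moment p (evolution (schrodinger c V) t (ell2_delta 0))" by linarith
    have pos: "0 < t powr (- (2 / real j0)) / 2" using t1 by simp
    have "ln (t powr (- (2 / real j0)) / 2) \<le> ln (position_moment p (evolution (schrodinger c V) t (ell2_delta 0)))"
      using lb pos by (intro ln_mono) auto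
    moreover have "ln (t powr (- (2 / real j0)) / 2) = - (2 / real j0) * ln t - ln 2" using t1 by (simp add: ln_div ln_powr)
    moreover have "- \<delta> * (p * ln t) < - (2 / real j0) * ln t - ln 2"
    proof -
      have "2 / real j0 \<le> p * \<delta> / 2" using j0 p \<delta> by (simp add: field_simps)
      then have "2 / real j0 * ln t \<le> p * \<delta> / 2 * ln t" using lt by (intro mult_right_mono) auto
      moreover have "ln 2 \<le> p * \<delta> / 4 * ln t" using lt(2) p \<delta> by (simp add: field_simps)
      moreover have "0 < p * \<delta> * ln t" using p \<delta> lt by simp
      ultimately show ?thesis by (simp add: algebra_simps)
    qed
    ultimately have "- \<delta> * (p * ln t) < ln (position_moment p (evolution (schrodinger c V) t (ell2_delta 0)))" by linarith
    moreover have "0 < p * ln t" using p lt by simp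
    ultimately have "- \<delta> < ln (position_moment p (evolution (schrodinger c V) t (ell2_delta 0))) / (p * ln t)" by (simp only: pos_less_divide_eq)
    then have "ereal z < ereal (ln (position_moment p (evolution (schrodinger c V) t (ell2_delta 0))) / (p * ln t))" by (simp add: \<delta>_def)
    then show ?thesis by (rule less_trans[OF z(1)])
  qed
  then show "\<forall>\<^sub>F t in at_top. y < ereal (ln (position_moment p (evolution (schrodinger c V) t (ell2_delta 0))) / (p * ln t))"
    unfolding eventually_at_top_linorder by blast
qed

text \<open>For a lower limit the times \<open>t j\<close> suffice, at which the moment is at most
  \<open>C * t powr (p / j)\<close> with \<open>C\<close> fixed.\<close>

lemma transport_exponent_nonpos:
  assumes p: "0 < p" and c: "0 < c" and t: "\<And>j. real (Suc j) \<le> t j" "\<And>j. confined (Suc j) (t j) V"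
  shows "transport_exponent_minus (schrodinger c V) (ell2_delta 0) p \<le> 0"
proof (rule ccontr)
  define m where "m s = position_moment p (evolution (schrodinger c V) s (ell2_delta 0))" for s
  assume "\<not> ?thesis"
  then have "ereal 0 < Liminf at_top (\<lambda>s. ereal (ln (m s) / (p * ln s)))"
    unfolding transport_exponent_minus_def m_def by (simp add: not_le zero_ereal_def)
  then obtain \<delta> where \<delta>: "ereal 0 < ereal \<delta>" "ereal \<delta> < Liminf at_top (\<lambda>s. ereal (ln (m s) / (p * ln s)))"
    using ereal_dense2 by blast
  have \<delta>0: "0 < \<delta>" using \<delta>(1) by simp
  obtain S where S: "\<And>s. S \<le> s \<Longrightarrow> \<delta> < ln (m s) / (p * ln s)"
    using less_LiminfD[OF \<delta>(2)] unfolding eventually_at_top_linorder by auto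
  obtain C where C: "1 \<le> C" "\<And>j s. confined j s V \<Longrightarrow> c \<in> couplings j \<Longrightarrow> p \<le> real j \<Longrightarrow> 1 \<le> s \<Longrightarrow> m s \<le> C * s powr (p / real j)"
    using moment_upper_bound[OF p c, of V] unfolding m_def by blast
  \<comment> \<open>Large enough for the coupling and \<open>p\<close> to be admissible, for the
    time to exceed \<open>S\<close>, and for the exponent \<open>1 / J\<close> and the constant
    \<open>C\<close> to use half of \<open>\<delta>\<close> each.\<close>
  define b where "b = max (max c (1 / c)) (max (max p S) (max (2 / \<delta>) (exp (2 * ln C / (p * \<delta>) + 1))))"
  obtain j :: nat where "b \<le> real j" using real_arch_simple by blast
  define J where "J = Suc j"
  have J: "c \<le> real J" "1 / c \<le> real J" "p \<le> real J" "S \<le> real J" "2 / \<delta> \<le> real J" "exp (2 * ln C / (p * \<delta>) + 1) \<le> real J"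
    using \<open>b \<le> real j\<close> by (auto simp: b_def J_def)
  define s where "s = t j"
  have s: "real J \<le> s" "confined J s V" using t[of j] by (simp_all add: s_def J_def)
  have J1: "1 \<le> real J" by (simp add: J_def)
  have s1: "1 \<le> s" using s J1 by linarith
  have cJ: "c \<in> couplings J" using J c by (auto simp: couplings_def pos_divide_le_eq mult.commute)
  have lC: "0 \<le> ln C" using C by simp
  have "exp (2 * ln C / (p * \<delta>) + 1) \<le> s" using J s by linarith
  then have "2 * ln C / (p * \<delta>) + 1 \<le> ln s" using s1 by (simp add: ln_ge_iff)
  moreover have "0 \<le> 2 * ln C / (p * \<delta>)" using lC p \<delta>0 by simp
  ultimately have ls: "0 < ln s" "2 * ln C / (p * \<delta>) \<le> ln s" by linarith+
  have pl: "0 < p * ln s" using p ls by simp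
  have "\<delta> < ln (m s) / (p * ln s)" using S J s by force
  then have low: "\<delta> * (p * ln s) < ln (m s)" using pl by (simp only: pos_less_divide_eq)
  have mpos: "0 < m s"
  proof (rule ccontr)
    assume "\<not> 0 < m s"
    moreover have "0 \<le> m s" unfolding m_def position_moment_def by (intro infsum_nonneg) auto
    ultimately have "m s = 0" by simp
    then show False using low mult_pos_pos[OF \<delta>0 pl] by simp
  qed
  have "ln (m s) \<le> ln (C * s powr (p / real J))" using C(2)[OF s(2) cJ J(3) s1] mpos by (intro ln_mono) auto
  also have "\<dots> = ln C + p / real J * ln s" using C(1) s1 by (simp add: ln_mult ln_powr)
  also have "\<dots> \<le> \<delta> * (p * ln s)"
  proof -
    have "1 / real J \<le> \<delta> / 2" using J(5) J1 \<delta>0 by (simp add: field_simps)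
    then have "1 / real J * (p * ln s) \<le> \<delta> / 2 * (p * ln s)" using pl by (intro mult_right_mono) auto
    then have "p / real J * ln s \<le> \<delta> * (p * ln s) / 2" by simp
    moreover have "ln C \<le> \<delta> * (p * ln s) / 2" using ls(2) p \<delta>0 by (simp add: field_simps)
    ultimately show ?thesis by linarith
  qed
  finally show False using low by simp
qed

theorem theorem4p4:
  shows "\<exists>D :: (int \<Rightarrow>\<^sub>C real) set.
           D \<subseteq> {V. limit_periodic V} \<and>
           {V. limit_periodic V} \<subseteq> closure D \<and>
           (\<forall>V\<in>D. \<forall>p > (0::real). \<forall>c > (0::real).
              transport_exponent_minus (schrodinger c V) (ell2_delta 0) p = 0)"
proof -
  define D where "D = {V. limit_periodic V \<and> (\<forall>p > (0::real). \<forall>c > (0::real). transport_exponent_minus (schrodinger c V) (ell2_delta 0) p = 0)}"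
  have dense: "\<exists>W\<in>D. dist W V < e" if V: "limit_periodic V" and e: "0 < e" for V e
  proof -
    obtain X where X: "\<And>k. periodic_seq (X k)" "X \<longlonglongrightarrow> V" using V unfolding limit_periodic_def by blast
    obtain k where k: "dist (X k) V < e / 2" using metric_LIMSEQ_D[OF X(2), of "e / 2"] e by auto
    have e3: "0 < e / 3" using e by simp
    obtain W T t where W: "limit_periodic W" "norm (W - X k) \<le> e / 3" "\<And>j. real j \<le> T j \<and> T j \<le> T (Suc j)"
      "\<And>j c s. c \<in> couplings j \<Longrightarrow> T j \<le> s \<Longrightarrow> s \<le> T (Suc j) \<Longrightarrow> \<not> recurrent W c s (s powr - (1 / real j))"
      "\<And>j. real (Suc j) \<le> t j \<and> confined (Suc j) (t j) W"
      using slow_potential_exists[OF X(1)[of k] e3] by blast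
    have "transport_exponent_minus (schrodinger c W) (ell2_delta 0) p = 0" if "0 < p" "0 < c" for p c
      using transport_exponent_nonneg[OF that, of T W] transport_exponent_nonpos[OF that, of t W] W(3,4,5) by (intro antisym) auto
    then have "W \<in> D" using W(1) by (simp add: D_def)
    moreover have "dist W V \<le> dist W (X k) + dist (X k) V" by (rule dist_triangle)
    then have "dist W V < e" using W(2) k e by (simp add: dist_norm)
    ultimately show ?thesis by blast
  qed
  show ?thesis
  proof (intro exI[of _ D] conjI)
    show "{V. limit_periodic V} \<subseteq> closure D" using dense by (auto simp: closure_approachable)
  qed (auto simp: D_def)
qed

end
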